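(* Let $d\ge 2$, let $R:\mathbb{R}_+\to(0,\infty)$ be a non-decreasing concave function with $R(r)=o(r)$ as $r\to\infty$, and let $\varepsilon:\mathbb{R}_+\to(0,1)$ be a non-increasing function. Let $\ker_d(t)=\log t$ if $d=2$ and $\ker_d(t)=-t^{-(d-2)}$ if $d\ge 3$, and put $$\varphi(t)=\varphi_{\varepsilon,R}(t):=\frac{1}{R(t)\sqrt{-\ker_d(\varepsilon(t))}}.$$ For a subharmonic function $u$ on $\mathbb{R}^d$ let $Z_u:=\{x\in\mathbb{R}^d: u(x)\le 0\}$ be its zero set and $M_u(\rho):=\max_{|x|\le\rho}u(x)$. (A) Assume that $\limsup_{t\to\infty}\frac{1}{t\,\varphi(t)}<1$. Let $u$ be a subharmonic function on $\mathbb{R}^d$ such that its zero set $Z_u$ is $(\varepsilon,R)$-recurrent and there exists $x_0\in\mathbb{R}^d$ with $u(x_0)\ge 1$. Then $$\liminf_{\rho\to\infty}\frac{\log M_u(\rho)}{\int_1^\rho\varphi(t)\,dt}>0.$$ (B) If $\frac{d}{dt}\left(\frac{1}{\varphi(t)}\right)$ is bounded, then there exists a subharmonic function $u$ on $\mathbb{R}^d$ whose zero set $Z_u$ is $(\varepsilon,R)$-recurrent, with $u(0)\ge 1$ and $$\limsup_{\rho\to\infty}\frac{\log M_u(\rho)}{\int_1^\rho\varphi(t)\,dt}<\infty.$$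
   Context: $|\cdot|$ is the Euclidean norm on $\mathbb{R}^d$, and $B(x,r)=\{y\in\mathbb{R}^d:|y-x|<r\}$. Capacity: $\mathcal{C}_d(A)$ denotes the capacity of $A$ (logarithmic capacity if $d=2$, Newtonian capacity if $d\ge 3$), normalized so that the capacity of a ball equals its radius. Explicitly, for compact $K\subset\mathbb{R}^d$ let $V(K)=\sup_\mu\iint\ker_d(|x-y|)\,d\mu(x)\,d\mu(y)$, the supremum being over Borel probability measures $\mu$ on $K$; then $\mathcal{C}_2(K)=e^{V(K)}$ and $\mathcal{C}_d(K)=(-V(K))^{-1/(d-2)}$ for $d\ge3$ (equal to $0$ if $V(K)=-\infty$ or $K=\emptyset$). For a bounded Borel set $A$, $\mathcal{C}_d(A)$ is the supremum of $\mathcal{C}_d(K)$ over compact $K\subset A$. Recurrent sets: a closed set $E\subset\mathbb{R}^d$ is $(\varepsilon,R)$-recurrent if for every $x\in\mathbb{R}^d$, $$\mathcal{C}_d\big(B(x,R(|x|))\cap E\big)>R(|x|)\,\varepsilon(|x|).$$ *)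

theory Defs
  imports "HOL-Probability.Probability" "HOL-Library.Landau_Symbols"
begin

text \<open>
  The Lebesgue integral of an extended-real function, which may be \<open>-\<infinity>\<close>. It is only used for
  functions bounded above and finite measures, where the positive part has a finite integral
  and the difference is never \<open>\<infinity> - \<infinity>\<close>.
\<close>

definition ext_integral :: "'a measure \<Rightarrow> ('a \<Rightarrow> ereal) \<Rightarrow> ereal" where
  "ext_integral M f =
     enn2ereal (\<integral>\<^sup>+x. e2ennreal (f x) \<partial>M) - enn2ereal (\<integral>\<^sup>+x. e2ennreal (- f x) \<partial>M)"

text \<open>
  The value at \<open>0\<close> is \<open>-\<infinity>\<close>, as needed on the diagonal in the energy integral; the
  library's \<open>ln 0 = 0\<close> and \<open>1 / 0 = 0\<close> would be wrong there.
\<close>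

definition cap_kernel :: "nat \<Rightarrow> real \<Rightarrow> ereal" where
  "cap_kernel d t =
     (if t \<le> 0 then -\<infinity>
      else if d = 2 then ereal (ln t)
      else ereal (- (1 / t ^ (d - 2))))"

definition energy :: "'a::euclidean_space measure \<Rightarrow> ereal" where
  "energy \<mu> = ext_integral \<mu> (\<lambda>y. ext_integral \<mu> (\<lambda>x. cap_kernel DIM('a) (norm (x - y))))"

text \<open>A Borel probability measure on \<open>K\<close> is a Borel probability measure of the whole space
  that is concentrated on \<open>K\<close>. The supremum is \<open>-\<infinity>\<close> for \<open>K = {}\<close>.\<close>

definition max_energy :: "'a::euclidean_space set \<Rightarrow> ereal" where
  "max_energy K =
     (SUP \<mu>\<in>{\<mu>. prob_space \<mu> \<and> sets \<mu> = sets borel \<and> emeasure \<mu> K = 1}. energy \<mu>)"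

definition compact_capacity :: "'a::euclidean_space set \<Rightarrow> real" where
  "compact_capacity K =
     (if max_energy K = -\<infinity> then 0
      else if DIM('a) = 2 then exp (real_of_ereal (max_energy K))
      else (- real_of_ereal (max_energy K)) powr (- (1 / (real DIM('a) - 2))))"

definition capacity :: "'a::euclidean_space set \<Rightarrow> real" where
  "capacity A = (SUP K\<in>{K. compact K \<and> K \<subseteq> A}. compact_capacity K)"

definition recurrent ::
  "(real \<Rightarrow> real) \<Rightarrow> (real \<Rightarrow> real) \<Rightarrow> 'a::euclidean_space set \<Rightarrow> bool" where
  "recurrent \<epsilon> R E \<longleftrightarrow>
     closed E \<and> (\<forall>x. capacity (ball x (R (norm x)) \<inter> E) > R (norm x) * \<epsilon> (norm x))"

text \<open>
  Subharmonic on the whole space: values in \<open>[-\<infinity>, \<infinity>)\<close>, upper semicontinuous, and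
  satisfying the sub-mean-value inequality on every ball.
\<close>

definition subharmonic :: "('a::euclidean_space \<Rightarrow> ereal) \<Rightarrow> bool" where
  "subharmonic u \<longleftrightarrow>
     (\<forall>x. u x < \<infinity>) \<and>
     (\<forall>c. open {x. u x < c}) \<and>
     (\<forall>x r. 0 < r \<longrightarrow>
        u x \<le> ext_integral (restrict_space lborel (ball x r)) u / ereal (measure lborel (ball x r)))"

definition zero_set :: "('a \<Rightarrow> ereal) \<Rightarrow> 'a set" where
  "zero_set u = {x. u x \<le> 0}"

text \<open>For upper semicontinuous \<open>u\<close> the supremum is attained when \<open>\<rho> \<ge> 0\<close>.\<close>

definition max_on_ball :: "('a::euclidean_space \<Rightarrow> ereal) \<Rightarrow> real \<Rightarrow> ereal" where
  "max_on_ball u \<rho> = (SUP x\<in>cball 0 \<rho>. u x)"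

definition phi :: "nat \<Rightarrow> (real \<Rightarrow> real) \<Rightarrow> (real \<Rightarrow> real) \<Rightarrow> real \<Rightarrow> real" where
  "phi d \<epsilon> R t = 1 / (R t * sqrt (- real_of_ereal (cap_kernel d (\<epsilon> t))))"

text \<open>If \<open>u\<close> is subharmonic and \<open>u x \<ge> 1\<close>, then \<open>max_on_ball u \<rho>\<close> lies in \<open>[1, \<infinity>)\<close> for
  \<open>\<rho> \<ge> norm x\<close>, so there the conversion to a real number and \<open>ln\<close> are harmless.\<close>

definition growth_ratio ::
  "(real \<Rightarrow> real) \<Rightarrow> (real \<Rightarrow> real) \<Rightarrow> ('a::euclidean_space \<Rightarrow> ereal) \<Rightarrow> real \<Rightarrow> real" where
  "growth_ratio \<epsilon> R u \<rho> =
     ln (real_of_ereal (max_on_ball u \<rho>)) / integral {1..\<rho>} (phi DIM('a) \<epsilon> R)"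

end

theory Submission imports Defs begin

text \<open>
  Lower bound: a set of capacity at least \<open>R \<epsilon>\<close> carries a probability measure of energy at least
  \<open>ker (\<epsilon> R)\<close>. Sum truncated potentials of such measures, placed on the zero set in every cell of a
  maximal \<open>R\<close>-separated net; their positive Laplacian pays for a concave paraboloid of width
  \<open>S \<approx> R sqrt (- ker \<epsilon>) = 1 / \<phi>\<close>. This sum plus the paraboloid is a barrier for \<open>u\<close>, and the comparison
  principle gives \<open>M (r - S r) \<le> (1 - \<delta>) * M r\<close>. Iterating yields \<open>log M \<ge> c * \<integral> \<phi>\<close>.

  Upper bound: let \<open>g\<close> be comparable to \<open>1 / \<phi>\<close> plus a small multiple of \<open>R\<close>, and \<open>h = exp \<integral> 1 / g\<close>. Subtract
  truncated kernels centred at a maximal separated net from \<open>h\<close>, so small that \<open>h\<close> stays subharmonic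
  and so large that the cube of the positive part vanishes near every net point. If \<open>\<epsilon>\<close> is small, one
  such hole has enough capacity. Otherwise the holes have radius proportional to the mesh, and for a
  fine mesh they have nearly the capacity of the full ball.
\<close>

section \<open>The sub-mean-value property for functions with bounded Hessian\<close>

text \<open>Both halves balance the same two quantities. A potential attached to one cell has
  Laplacian of order \<open>1 / R\<^sup>2\<close> and height of order
  \<open>ke = - ker \<epsilon>\<close>. In the lower bound the heights may use only a fixed fraction
  of \<open>M\<close>, so the potentials get weight \<open>M / ke\<close> and can pay for a
  paraboloid of curvature \<open>M / (R\<^sup>2 * ke)\<close>; this removes a fixed fraction of
  \<open>M\<close> exactly when its width is about \<open>R * sqrt ke\<close>. In the upper bound
  the Laplacian of \<open>h\<close>, at least \<open>h / (4 * g\<^sup>2)\<close>, pays for kernels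
  of weight \<open>(ell / g)\<^sup>2 * h\<close>, which reach the height \<open>h\<close> where the
  kernel is of order \<open>(g / ell)\<^sup>2\<close>; with \<open>g\<close> about
  \<open>R * sqrt ke\<close> that is a hole of relative size \<epsilon>. A multiple of
  \<open>R\<close> is added to \<open>g\<close> because \<open>g\<close> must dominate the mesh:
  otherwise \<open>h\<close> would vary too much within a cell. Recurrence asks for a capacity
  strictly above \<open>R * \<epsilon>\<close>, and \<epsilon> may be close to 1, where the
  constants lost with a single hole are fatal; hence the second regime, which compares with the full
  ball.\<close>

lemma directional_difference_quotient:
  fixes F :: "'a::real_normed_vector \<Rightarrow> real"
  assumes "(F has_derivative F') (at y)"
  shows "(\<lambda>n. real (Suc n) * (F (y + (1 / real (Suc n)) *\<^sub>R b) - F y)) \<longlonglongrightarrow> F' b"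
proof -
  have "((\<lambda>s. F (y + s *\<^sub>R b)) has_derivative (\<lambda>s. F' (s *\<^sub>R b))) (at 0)"
  proof -
    have "((\<lambda>s. y + s *\<^sub>R b) has_derivative (\<lambda>s. s *\<^sub>R b)) (at 0)"
      by (auto intro!: derivative_eq_intros)
    from has_derivative_compose[OF this, of F F'] assms show ?thesis by simp
  qed
  then have "((\<lambda>s. F (y + s *\<^sub>R b)) has_real_derivative F' b) (at 0)"
  proof -
    have "(\<lambda>s. F' (s *\<^sub>R b)) = (*) (F' b)"
      using linear_cmul[OF has_derivative_linear[OF assms]] by (auto simp: fun_eq_iff mult.commute)
    then show ?thesis using \<open>((\<lambda>s. F (y + s *\<^sub>R b)) has_derivative (\<lambda>s. F' (s *\<^sub>R b))) (at 0)\<close>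
      by (simp add: has_field_derivative_def)
  qed
  then have "(\<lambda>h. (F (y + h *\<^sub>R b) - F y) / h) \<midarrow>0\<rightarrow> F' b"
    by (simp add: DERIV_def)
  then have "(\<lambda>n. (F (y + (1 / real (Suc n)) *\<^sub>R b) - F y) / (1 / real (Suc n))) \<longlonglongrightarrow> F' b"
    by (rule filterlim_compose)
       (intro filterlim_atI, use LIMSEQ_Suc[OF lim_1_over_n] in auto)
  then show ?thesis by (simp add: mult.commute)
qed

lemma integral_lborel_translation:
  fixes F :: "'a::euclidean_space \<Rightarrow> real"
  assumes [measurable]: "F \<in> borel_measurable borel"
  shows "(\<integral>x. F (x + a) \<partial>lborel) = (\<integral>x. F x \<partial>lborel)"
proof -
  have "(\<integral>x. F x \<partial>lborel) = (\<integral>x. F x \<partial>(distr lborel borel ((+) a)))"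
    by (simp add: lborel_distr_plus)
  also have "\<dots> = (\<integral>x. F (a + x) \<partial>lborel)"
    by (subst integral_distr) auto
  finally show ?thesis by (simp add: add.commute)
qed

lemma integral_lborel_affine:
  fixes f :: "'a::euclidean_space \<Rightarrow> real"
  assumes [measurable]: "f \<in> borel_measurable borel" and c: "c > 0"
  shows "(\<integral>x. f x \<partial>lborel) = c ^ DIM('a) * (\<integral>y. f (x + c *\<^sub>R y) \<partial>lborel)"
proof -
  have "(\<integral>x. f x \<partial>lborel) = (\<integral>y. f y \<partial>(density (distr lborel borel (\<lambda>y. x + c *\<^sub>R y)) (\<lambda>_. \<bar>c\<bar> ^ DIM('a))))"
    using lborel_affine[of c x] c by simp
  also have "\<dots> = (\<integral>y. c ^ DIM('a) * f y \<partial>(distr lborel borel (\<lambda>y. x + c *\<^sub>R y)))"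
    using c by (subst integral_density) (auto simp: ennreal_power)
  also have "\<dots> = c ^ DIM('a) * (\<integral>y. f (x + c *\<^sub>R y) \<partial>lborel)"
    by (subst integral_distr) auto
  finally show ?thesis .
qed

text \<open>Difference quotients integrate to zero by translation invariance; the Lipschitz bound
  and the compact support dominate them, so the limit integrates to zero as well. \<open>D\<close>
  need not be measurable, so the measurable limit \<open>D'\<close> is returned in its
  place.\<close>

lemma integral_directional_derivative_eq_0:
  fixes F D :: "'a::euclidean_space \<Rightarrow> real"
  assumes Lip: "\<And>x y. \<bar>F x - F y\<bar> \<le> L * norm (x - y)"
    and supp: "\<And>x. x \<notin> ball 0 1 \<Longrightarrow> F x = 0"
    and D: "AE x in lborel. (\<lambda>n. real (Suc n) * (F (x + (1 / real (Suc n)) *\<^sub>R b) - F x)) \<longlonglongrightarrow> D x"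
  obtains D' where "integrable lborel D'" "integral\<^sup>L lborel D' = 0" "AE x in lborel. D' x = D x"
proof -
  have L: "L \<ge> 0"
  proof -
    obtain i :: 'a where "i \<in> Basis" using nonempty_Basis by blast
    then show ?thesis using order_trans[OF abs_ge_zero Lip[of i 0]] by simp
  qed
  have cont: "continuous_on UNIV F"
  proof (rule lipschitz_on_continuous_on)
    show "L-lipschitz_on UNIV F"
      using Lip L by (auto simp: lipschitz_on_def dist_norm)
  qed
  have [measurable]: "F \<in> borel_measurable borel"
    by (rule borel_measurable_continuous_onI[OF cont])
  define Q where "Q n x = real (Suc n) * (F (x + (1 / real (Suc n)) *\<^sub>R b) - F x)" for n x
  have [measurable]: "Q n \<in> borel_measurable borel" for n
    unfolding Q_def by measurable
  define D' where "D' x = lim (\<lambda>n. Q n x)" for x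
  have D'm: "D' \<in> borel_measurable lborel"
    unfolding D'_def using borel_measurable_lim_metric[of Q lborel] by simp
  have AEeq: "AE x in lborel. D' x = D x"
    using D by eventually_elim (auto simp: D'_def Q_def intro: limI)
  \<comment> \<open>The increments are at most \<open>norm b\<close> long, so every
    \<open>Q n\<close> vanishes outside this ball.\<close>
  define w where "w x = L * norm b * indicator (cball 0 (1 + norm b)) x" for x :: 'a
  have wint: "integrable lborel w"
    unfolding w_def using emeasure_lborel_cball_finite[of "0::'a" "1 + norm b"]
    by (intro integrable_mult_right integrable_real_indicator) auto
  have Qb: "norm (Q n x) \<le> w x" for n x
  proof (cases "x \<in> cball 0 (1 + norm b)")
    case True
    define e where "e = (1 / real (Suc n)) *\<^sub>R b"
    have e: "real (Suc n) * norm e = norm b" by (simp add: e_def)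
    have "\<bar>F (x + e) - F x\<bar> \<le> L * norm e"
      using Lip[of "x + e" x] by (simp only: add_diff_cancel_left')
    then have "real (Suc n) * \<bar>F (x + e) - F x\<bar> \<le> real (Suc n) * (L * norm e)"
      by (rule mult_left_mono) simp
    also have "\<dots> = L * norm b" using e by (metis mult.left_commute)
    finally show ?thesis using True unfolding Q_def w_def e_def[symmetric]
      by (simp only: abs_mult real_norm_def indicator_simps abs_of_nat mult_1_right)
  next
    case False
    then have x: "norm x > 1 + norm b" by simp
    have "norm ((1 / real (Suc n)) *\<^sub>R b) = norm b / real (Suc n)" by simp
    also have "\<dots> \<le> norm b / 1" by (rule divide_left_mono) auto
    finally have "norm ((1 / real (Suc n)) *\<^sub>R b) \<le> norm b" by simp
    then have "norm (x + (1 / real (Suc n)) *\<^sub>R b) \<ge> 1"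
      using x norm_triangle_ineq2[of x "- ((1 / real (Suc n)) *\<^sub>R b)"] by simp
    moreover have "norm x \<ge> 1" using x by (smt (verit) norm_ge_zero)
    ultimately have "Q n x = 0" by (simp add: Q_def supp)
    then show ?thesis using False by (simp add: w_def)
  qed
  have lim: "AE x in lborel. (\<lambda>n. Q n x) \<longlonglongrightarrow> D' x"
    using D AEeq by eventually_elim (auto simp: Q_def)
  have int: "integrable lborel D'"
    by (rule integrable_dominated_convergence[OF _ _ wint lim]) (use Qb D'm in auto)
  have "(\<lambda>n. integral\<^sup>L lborel (Q n)) \<longlonglongrightarrow> integral\<^sup>L lborel D'"
    by (rule integral_dominated_convergence[OF _ _ wint lim]) (use Qb D'm in auto)
  moreover have "integral\<^sup>L lborel (Q n) = 0" for n
  proof -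
    obtain B where B: "\<And>x. x \<in> cball 0 1 \<Longrightarrow> \<bar>F x\<bar> \<le> B"
      using compact_imp_bounded[OF compact_continuous_image[OF continuous_on_subset[OF cont] compact_cball[of 0 1]]]
      by (force simp: bounded_iff)
    have F: "integrable lborel F"
    proof (rule Bochner_Integration.integrable_bound)
      show "integrable lborel (\<lambda>x::'a. B * indicator (cball 0 1) x :: real)"
        using emeasure_lborel_cball_finite[of "0::'a" 1]
        by (intro integrable_mult_right integrable_real_indicator) auto
      show "AE x in lborel. norm (F x) \<le> norm (B * indicator (cball 0 1) x)"
      proof (rule AE_I2)
        fix x show "norm (F x) \<le> norm (B * indicator (cball 0 1) x)"
          using B[of x] supp[of x] by (cases "x \<in> cball 0 1") auto
      qed
    qed simp
    have F': "integrable lborel (\<lambda>x. F (x + a))" for a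
    proof -
      have "integrable (distr lborel borel ((+) a)) F" using F by (simp add: lborel_distr_plus)
      then have "integrable lborel (\<lambda>x. F (a + x))" by (subst (asm) integrable_distr_eq) auto
      then show ?thesis by (simp add: add.commute)
    qed
    show ?thesis
      unfolding Q_def using F F' integral_lborel_translation[of F "(1 / real (Suc n)) *\<^sub>R b"]
      by (simp del: of_nat_Suc)
  qed
  ultimately have "integral\<^sup>L lborel D' = 0"
    by (simp add: LIMSEQ_const_iff)
  then show ?thesis using that int AEeq by blast
qed


lemma borel_measurable_indicator_times:
  fixes f :: "'a::euclidean_space \<Rightarrow> real"
  assumes "A \<in> sets borel" "continuous_on A f"
  shows "(\<lambda>x. indicator A x * f x) \<in> borel_measurable borel"
  using borel_measurable_continuous_on_indicator[OF assms] by simp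

text \<open>The Hessian \<open>H\<close> is only assumed to exist and to be bounded, not to be continuous.\<close>

locale subharmonic_C2_ball =
  fixes f :: "'a::euclidean_space \<Rightarrow> real" and g :: "'a \<Rightarrow> 'a" and H :: "'a \<Rightarrow> 'a \<Rightarrow> 'a"
    and x :: 'a and r' C :: real
  assumes grad: "y \<in> ball x r' \<Longrightarrow> (f has_derivative (\<lambda>v. g y \<bullet> v)) (at y)"
    and hess: "y \<in> ball x r' \<Longrightarrow> (g has_derivative H y) (at y)"
    and bound: "y \<in> ball x r' \<Longrightarrow> norm (H y v) \<le> C * norm v"
    and trace: "y \<in> ball x r' \<Longrightarrow> (\<Sum>b\<in>Basis. H y b \<bullet> b) \<ge> 0"
    and r'_pos: "r' > 0"
begin

lemma C_nonneg: "C \<ge> 0"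
proof -
  obtain i :: 'a where "i \<in> Basis" using nonempty_Basis by blast
  then show ?thesis using order_trans[OF norm_ge_zero bound[of x i]] r'_pos by simp
qed

lemma grad_lipschitz:
  assumes "y \<in> ball x r'" "z \<in> ball x r'"
  shows "norm (g y - g z) \<le> C * norm (y - z)"
proof (rule differentiable_bound[OF convex_ball _ _ assms])
  fix w assume w: "w \<in> ball x r'"
  show "(g has_derivative H w) (at w within ball x r')"
    using hess[OF w] by (rule has_derivative_at_withinI)
  show "onorm (H w) \<le> C"
    using bound[OF w] by (intro onorm_bound C_nonneg) auto
qed

definition "G = norm (g x) + C * r'"

lemma grad_bound:
  assumes "y \<in> ball x r'"
  shows "norm (g y) \<le> G"
proof -
  have "norm (g y - g x) \<le> C * norm (y - x)" using grad_lipschitz assms r'_pos by simp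
  also have "\<dots> \<le> C * r'" using assms C_nonneg by (intro mult_left_mono) (auto simp: dist_norm norm_minus_commute)
  finally show ?thesis using norm_triangle_ineq2[of "g y" "g x"] by (simp add: G_def)
qed

lemma G_nonneg: "G \<ge> 0" using grad_bound[of x] r'_pos order_trans[OF norm_ge_zero] by auto

lemma f_lipschitz:
  assumes "y \<in> ball x r'" "z \<in> ball x r'"
  shows "\<bar>f y - f z\<bar> \<le> G * norm (y - z)"
proof -
  have "norm (f y - f z) \<le> G * norm (y - z)"
  proof (rule differentiable_bound[OF convex_ball _ _ assms])
    fix w assume w: "w \<in> ball x r'"
    show "(f has_derivative (\<lambda>v. g w \<bullet> v)) (at w within ball x r')"
      using grad[OF w] by (rule has_derivative_at_withinI)
    have "norm (g w \<bullet> v) \<le> G * norm v" for v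
      using Cauchy_Schwarz_ineq2[of "g w" v] mult_right_mono[OF grad_bound[OF w] norm_ge_zero[of v]] by simp
    then show "onorm (\<lambda>v. g w \<bullet> v) \<le> G"
      by (intro onorm_bound G_nonneg)
  qed
  then show ?thesis by simp
qed

lemma continuous_f: "continuous_on (ball x r') f"
  using grad by (intro continuous_at_imp_continuous_on ballI has_derivative_continuous)

lemma continuous_g: "continuous_on (ball x r') g"
  using hess by (intro continuous_at_imp_continuous_on ballI has_derivative_continuous)

lemma scaled_mem:
  assumes "y \<in> ball 0 1" "\<bar>t\<bar> < r'"
  shows "x + t *\<^sub>R y \<in> ball x r'"
proof -
  have "norm (t *\<^sub>R y) \<le> \<bar>t\<bar> * 1" using assms by (simp add: mult_left_le)
  then show ?thesis using assms by (simp add: dist_norm)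
qed

text \<open>The divergence theorem without a boundary term: the field
  \<open>(1 - y \<bullet> y) * g (x + t y)\<close>, extended by zero, vanishes on the unit sphere,
  so its divergence integrates to zero. That divergence is \<open>- 2 * (g \<bullet> y)\<close> plus
  \<open>(1 - y \<bullet> y) * t\<close> times the trace of the Hessian, and the second part is
  nonnegative.\<close>

lemma mean_derivative_nonneg:
  assumes t: "0 \<le> t" "t < r'"
  shows "(\<integral>y. indicator (ball 0 1) y * (g (x + t *\<^sub>R y) \<bullet> y) \<partial>lborel) \<ge> 0"
proof -
  define F where "F b y = (if y \<in> ball 0 1 then (1 - y \<bullet> y) * (g (x + t *\<^sub>R y) \<bullet> b) else 0)" for b y
  define D where "D b y = (if y \<in> ball 0 1 then - 2 * (y \<bullet> b) * (g (x + t *\<^sub>R y) \<bullet> b)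
       + (1 - y \<bullet> y) * t * (H (x + t *\<^sub>R y) b \<bullet> b) else 0)" for b y
  have mem: "x + t *\<^sub>R y \<in> ball x r'" if "y \<in> ball 0 1" for y
    using scaled_mem[OF that, of t] t by simp
  have gb: "\<bar>g z \<bullet> b\<bar> \<le> G" if "z \<in> ball x r'" "b \<in> Basis" for z b
    using Basis_le_norm[OF that(2), of "g z"] grad_bound[OF that(1)] by linarith
  have sq: "\<bar>y \<bullet> y - z \<bullet> z\<bar> \<le> 2 * norm (y - z)" if "norm y \<le> 1" "norm z \<le> 1" for y z :: 'a
  proof -
    have "y \<bullet> y - z \<bullet> z = (y + z) \<bullet> (y - z)" by (simp add: inner_simps inner_commute)
    then have "\<bar>y \<bullet> y - z \<bullet> z\<bar> \<le> norm (y + z) * norm (y - z)" by (simp add: Cauchy_Schwarz_ineq2)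
    also have "\<dots> \<le> 2 * norm (y - z)" using norm_triangle_ineq[of y z] that by (intro mult_right_mono) auto
    finally show ?thesis .
  qed
  \<comment> \<open>For a pair on two sides of the sphere the weight helps:
    \<open>1 - y \<bullet> y\<close> is at most twice the distance from \<open>y\<close> to the
    sphere.\<close>
  have Fout: "\<bar>F b y\<bar> \<le> (2 * G + C * t) * norm (y - z)"
    if "b \<in> Basis" "y \<in> ball 0 1" "z \<notin> ball 0 1" for b y z
  proof -
    have y: "norm y < 1" and z: "norm z \<ge> 1" using that by auto
    have yy: "y \<bullet> y = norm y * norm y" by (simp add: power2_norm_eq_inner[symmetric] power2_eq_square)
    have "1 - y \<bullet> y = (1 - norm y) * (1 + norm y)" unfolding yy by algebra
    also have "\<dots> \<le> (1 - norm y) * 2" using y by (intro mult_left_mono) auto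
    also have "\<dots> \<le> norm (y - z) * 2" using z norm_triangle_ineq3[of z y]
      by (simp add: norm_minus_commute)
    finally have 1: "1 - y \<bullet> y \<le> 2 * norm (y - z)" by simp
    have 0: "0 \<le> 1 - y \<bullet> y" unfolding yy using y by (simp add: mult_le_one)
    have "\<bar>F b y\<bar> = (1 - y \<bullet> y) * \<bar>g (x + t *\<^sub>R y) \<bullet> b\<bar>" using that 0 by (simp add: F_def abs_mult)
    also have "\<dots> \<le> (2 * norm (y - z)) * G" using 1 0 gb[OF mem that(1)] that by (intro mult_mono) auto
    also have "\<dots> \<le> (2 * G + C * t) * norm (y - z)"
      using C_nonneg t by (simp add: algebra_simps)
    finally show ?thesis .
  qed
  have Lip: "\<bar>F b y - F b z\<bar> \<le> (2 * G + C * t) * norm (y - z)" if b: "b \<in> Basis" for b y z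
  proof -
    consider "y \<in> ball 0 1" "z \<in> ball 0 1" | "y \<in> ball 0 1" "z \<notin> ball 0 1"
      | "y \<notin> ball 0 1" "z \<in> ball 0 1" | "y \<notin> ball 0 1" "z \<notin> ball 0 1" by blast
    then show ?thesis
    proof cases
      case 1
      have y: "norm y \<le> 1" "norm z \<le> 1" using 1 by auto
      have yy: "0 \<le> 1 - y \<bullet> y" "1 - y \<bullet> y \<le> 1"
        using y by (auto simp: power2_norm_eq_inner[symmetric] power_le_one)
      let ?a = "g (x + t *\<^sub>R y) \<bullet> b" and ?c = "g (x + t *\<^sub>R z) \<bullet> b"
      have ac: "\<bar>?a - ?c\<bar> \<le> C * t * norm (y - z)"
      proof -
        have "\<bar>?a - ?c\<bar> \<le> norm (g (x + t *\<^sub>R y) - g (x + t *\<^sub>R z))"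
          using Basis_le_norm[OF b] by (simp add: inner_diff_left[symmetric])
        also have "\<dots> \<le> C * norm (x + t *\<^sub>R y - (x + t *\<^sub>R z))"
          using grad_lipschitz mem 1 by blast
        also have "x + t *\<^sub>R y - (x + t *\<^sub>R z) = t *\<^sub>R (y - z)" by (simp add: algebra_simps)
        finally show ?thesis using t by simp
      qed
      have "F b y - F b z = (1 - y \<bullet> y) * (?a - ?c) - (y \<bullet> y - z \<bullet> z) * ?c"
        using 1 by (simp add: F_def algebra_simps)
      then have "\<bar>F b y - F b z\<bar> \<le> (1 - y \<bullet> y) * \<bar>?a - ?c\<bar> + \<bar>y \<bullet> y - z \<bullet> z\<bar> * \<bar>?c\<bar>"
        using yy abs_triangle_ineq4[of "(1 - y \<bullet> y) * (?a - ?c)" "(y \<bullet> y - z \<bullet> z) * ?c"] by (simp add: abs_mult)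
      also have "\<dots> \<le> 1 * (C * t * norm (y - z)) + (2 * norm (y - z)) * G"
        using yy ac sq[OF y] gb[OF mem b] 1 by (intro add_mono mult_mono) auto
      finally show ?thesis by (simp add: algebra_simps)
    next
      case 2 then show ?thesis using Fout[OF b 2] by (simp add: F_def)
    next
      case 3 then show ?thesis using Fout[OF b 3(2,1)] by (simp add: F_def norm_minus_commute)
    next
      case 4 then show ?thesis using C_nonneg G_nonneg t by (simp add: F_def)
    qed
  qed
  have lim: "AE y in lborel. (\<lambda>n. real (Suc n) * (F b (y + (1 / real (Suc n)) *\<^sub>R b) - F b y)) \<longlonglongrightarrow> D b y"
    if b: "b \<in> Basis" for b
  proof -
    \<comment> \<open>\<open>F b\<close> may fail to be differentiable on the unit sphere, which is
      a null set.\<close>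
    have "AE y in lborel. y \<notin> sphere (0::'a) 1"
      using negligible_sphere[of "0::'a" 1]
      by (intro AE_not_in) (simp add: negligible_iff_null_sets null_sets_completion_iff)
    then show ?thesis
    proof eventually_elim
      case (elim y)
      show ?case
      proof (cases "y \<in> ball 0 1")
        case True
        have "((\<lambda>w. x + t *\<^sub>R w) has_derivative (\<lambda>v. t *\<^sub>R v)) (at y)"
          by (auto intro!: derivative_eq_intros)
        from has_derivative_compose[OF this hess[OF mem[OF True]]]
        have "((\<lambda>w. g (x + t *\<^sub>R w)) has_derivative (\<lambda>v. H (x + t *\<^sub>R y) (t *\<^sub>R v))) (at y)" .
        then have "((\<lambda>w. (1 - w \<bullet> w) * (g (x + t *\<^sub>R w) \<bullet> b)) has_derivative
          (\<lambda>v. (1 - y \<bullet> y) * (H (x + t *\<^sub>R y) (t *\<^sub>R v) \<bullet> b) + (- (y \<bullet> v + v \<bullet> y)) * (g (x + t *\<^sub>R y) \<bullet> b))) (at y)"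
          by (auto intro!: derivative_eq_intros)
        then have "(F b has_derivative
          (\<lambda>v. (1 - y \<bullet> y) * (H (x + t *\<^sub>R y) (t *\<^sub>R v) \<bullet> b) + (- (y \<bullet> v + v \<bullet> y)) * (g (x + t *\<^sub>R y) \<bullet> b))) (at y)"
          by (rule has_derivative_transform_within_open[OF _ open_ball True]) (simp add: F_def)
        from directional_difference_quotient[OF this, of b]
        show ?thesis using True linear_cmul[OF has_derivative_linear[OF hess[OF mem[OF True]]], of t b]
          by (simp add: D_def inner_commute algebra_simps)
      next
        case False
        then have y: "y \<in> - cball 0 1" using elim by auto
        have "((\<lambda>_. 0::real) has_derivative (\<lambda>_. 0)) (at y)" by simp
        then have "(F b has_derivative (\<lambda>v. 0)) (at y)"
          by (rule has_derivative_transform_within_open[OF _ _ y]) (auto simp: F_def)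
        from directional_difference_quotient[OF this, of b] show ?thesis using False by (simp add: D_def)
      qed
    qed
  qed
  have "\<exists>D'. \<forall>b\<in>Basis. integrable lborel (D' b) \<and> integral\<^sup>L lborel (D' b) = 0 \<and> (AE y in lborel. D' b y = D b y)"
  proof (rule bchoice, intro ballI)
    fix b :: 'a assume b: "b \<in> Basis"
    show "\<exists>D'. integrable lborel D' \<and> integral\<^sup>L lborel D' = 0 \<and> (AE y in lborel. D' y = D b y)"
      by (rule integral_directional_derivative_eq_0[OF Lip[OF b] _ lim[OF b]]) (auto simp: F_def)
  qed
  then obtain D' where D': "\<And>b. b \<in> Basis \<Longrightarrow> integrable lborel (D' b)"
    "\<And>b. b \<in> Basis \<Longrightarrow> integral\<^sup>L lborel (D' b) = 0"
    "\<And>b. b \<in> Basis \<Longrightarrow> AE y in lborel. D' b y = D b y" by blast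
  have AE: "AE y in lborel. \<forall>b\<in>Basis. D' b y = D b y"
    using D'(3) by (simp add: AE_finite_all)
  define m where "m y = indicator (ball 0 1) y * (g (x + t *\<^sub>R y) \<bullet> y)" for y
  have "(\<integral>y. (\<Sum>b\<in>Basis. D' b y) \<partial>lborel) \<ge> (\<integral>y. - 2 * m y \<partial>lborel)"
  proof (rule integral_mono_AE)
    show "integrable lborel (\<lambda>y. \<Sum>b\<in>Basis. D' b y)" using D' by auto
    have "continuous_on (ball 0 1) (\<lambda>y. g (x + t *\<^sub>R y) \<bullet> y)"
      by (intro continuous_intros continuous_on_compose2[OF continuous_g]) (use mem in auto)
    then have [measurable]: "m \<in> borel_measurable borel"
      unfolding m_def by (intro borel_measurable_indicator_times) auto
    have "integrable lborel m"
    proof (rule Bochner_Integration.integrable_bound)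
      show "integrable lborel (\<lambda>y::'a. G * indicator (ball 0 1) y :: real)"
        using emeasure_lborel_ball_finite[of "0::'a" 1]
        by (intro integrable_mult_right integrable_real_indicator) auto
      show "AE y in lborel. norm (m y) \<le> norm (G * indicator (ball 0 1) y)"
      proof (rule AE_I2)
        fix y
        show "norm (m y) \<le> norm (G * indicator (ball 0 1) y)"
        proof (cases "y \<in> ball 0 1")
          case True
          have "\<bar>g (x + t *\<^sub>R y) \<bullet> y\<bar> \<le> norm (g (x + t *\<^sub>R y)) * norm y" by (rule Cauchy_Schwarz_ineq2)
          also have "\<dots> \<le> G * 1" using grad_bound[OF mem[OF True]] True G_nonneg by (intro mult_mono) auto
          finally show ?thesis using True G_nonneg by (simp add: m_def)
        qed (simp add: m_def)
      qed
    qed simp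
    then show "integrable lborel (\<lambda>y. - 2 * m y)" by simp
    show "AE y in lborel. - 2 * m y \<le> (\<Sum>b\<in>Basis. D' b y)"
      using AE
    proof eventually_elim
      case (elim y)
      then have eq: "(\<Sum>b\<in>Basis. D' b y) = (\<Sum>b\<in>Basis. D b y)" by simp
      show ?case
      proof (cases "y \<in> ball 0 1")
        case True
        have "y \<bullet> y \<le> 1" using True by (auto simp: power2_norm_eq_inner[symmetric] power_le_one)
        moreover have "(\<Sum>b\<in>Basis. D b y) = - 2 * (\<Sum>b\<in>Basis. (g (x + t *\<^sub>R y) \<bullet> b) * (y \<bullet> b))
           + (1 - y \<bullet> y) * t * (\<Sum>b\<in>Basis. H (x + t *\<^sub>R y) b \<bullet> b)"
          using True by (simp add: D_def sum.distrib sum_distrib_left algebra_simps sum_subtractf sum_negf)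
        ultimately show ?thesis
          unfolding eq using True trace[OF mem[OF True]] t by (simp add: m_def euclidean_inner[symmetric])
      qed (simp add: m_def eq D_def)
    qed
  qed
  also have "(\<integral>y. (\<Sum>b\<in>Basis. D' b y) \<partial>lborel) = 0"
    using D' by (simp add: Bochner_Integration.integral_sum)
  finally show ?thesis unfolding m_def by simp
qed

lemma spherical_mean_has_derivative:
  assumes t: "\<bar>t\<bar> < r'"
  shows "((\<lambda>t. \<integral>y. indicator (ball 0 1) y * f (x + t *\<^sub>R y) \<partial>lborel) has_real_derivative
     (\<integral>y. indicator (ball 0 1) y * (g (x + t *\<^sub>R y) \<bullet> y) \<partial>lborel)) (at t)"
proof -
  define w where "w t y = indicator (ball 0 1) y * f (x + t *\<^sub>R y)" for t y
  define w' where "w' y = indicator (ball 0 1) y * (g (x + t *\<^sub>R y) \<bullet> y)" for y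
  have wm: "w t \<in> borel_measurable borel" and wi: "integrable lborel (w t)" if t: "\<bar>t\<bar> < r'" for t
  proof -
    have "continuous_on (ball 0 1) (\<lambda>y. f (x + t *\<^sub>R y))"
      by (intro continuous_intros continuous_on_compose2[OF continuous_f]) (use scaled_mem t in auto)
    then show m: "w t \<in> borel_measurable borel"
      unfolding w_def by (intro borel_measurable_indicator_times) auto
    show "integrable lborel (w t)"
    proof (rule Bochner_Integration.integrable_bound)
      show "integrable lborel (\<lambda>y::'a. (\<bar>f x\<bar> + G * r') * indicator (ball 0 1) y :: real)"
        using emeasure_lborel_ball_finite[of "0::'a" 1]
        by (intro integrable_mult_right integrable_real_indicator) auto
      show "AE y in lborel. norm (w t y) \<le> norm ((\<bar>f x\<bar> + G * r') * indicator (ball 0 1) y)"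
      proof (rule AE_I2)
        fix y
        show "norm (w t y) \<le> norm ((\<bar>f x\<bar> + G * r') * indicator (ball 0 1) y)"
        proof (cases "y \<in> ball 0 1")
          case True
          have mem: "x + t *\<^sub>R y \<in> ball x r'" by (rule scaled_mem[OF True t])
          then have "\<bar>f (x + t *\<^sub>R y) - f x\<bar> \<le> G * norm (x + t *\<^sub>R y - x)"
            using r'_pos by (intro f_lipschitz) auto
          also have "\<dots> \<le> G * r'" using mem G_nonneg by (intro mult_left_mono) (auto simp: dist_norm)
          finally show ?thesis using True G_nonneg r'_pos by (simp add: w_def)
        qed (simp add: w_def)
      qed
    qed (use m in simp)
  qed
  \<comment> \<open>The limit is taken along arbitrary sequences, as dominated convergence requires;
    the interval is open, so restricting to it does not change the limit.\<close>
  have "((\<lambda>s. (integral\<^sup>L lborel (w s) - integral\<^sup>L lborel (w t)) / (s - t)) \<longlongrightarrow> integral\<^sup>L lborel w') (at t within {-r'<..<r'})"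
    unfolding tendsto_at_iff_sequentially
  proof (intro allI impI)
    fix X assume X: "\<forall>i. X i \<in> {- r'<..<r'} - {t}" and lim: "X \<longlonglongrightarrow> t"
    have Xi: "\<bar>X i\<bar> < r'" "X i \<noteq> t" for i using X[rule_format, of i] by auto
    define q where "q n y = (w (X n) y - w t y) / (X n - t)" for n y
    have "(\<lambda>n. integral\<^sup>L lborel (q n)) \<longlonglongrightarrow> integral\<^sup>L lborel w'"
    proof (rule integral_dominated_convergence[where w = "\<lambda>y. G * indicator (ball 0 1) y"])
      have "continuous_on (ball 0 1) (\<lambda>y. g (x + t *\<^sub>R y) \<bullet> y)"
        by (intro continuous_intros continuous_on_compose2[OF continuous_g]) (use scaled_mem t in auto)
      then show "w' \<in> borel_measurable lborel"
        unfolding w'_def using borel_measurable_indicator_times[of "ball 0 1"] by simp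
      show "q n \<in> borel_measurable lborel" for n
        unfolding q_def using wm[OF Xi(1)] wm[OF t] by (simp add: borel_measurable_divide)
      show "integrable lborel (\<lambda>y::'a. G * indicator (ball 0 1) y :: real)"
        using emeasure_lborel_ball_finite[of "0::'a" 1]
        by (intro integrable_mult_right integrable_real_indicator) auto
      show "AE y in lborel. (\<lambda>n. q n y) \<longlonglongrightarrow> w' y"
      proof (rule AE_I2)
        fix y
        show "(\<lambda>n. q n y) \<longlonglongrightarrow> w' y"
        proof (cases "y \<in> ball 0 1")
          case True
          have "((\<lambda>s. x + s *\<^sub>R y) has_derivative (\<lambda>s. s *\<^sub>R y)) (at t)"
            by (auto intro!: derivative_eq_intros)
          from has_derivative_compose[OF this grad[OF scaled_mem[OF True t]]]
          have "((\<lambda>s. f (x + s *\<^sub>R y)) has_derivative (\<lambda>s. g (x + t *\<^sub>R y) \<bullet> s *\<^sub>R y)) (at t)" .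
          moreover have "(\<lambda>s. g (x + t *\<^sub>R y) \<bullet> s *\<^sub>R y) = (*) (g (x + t *\<^sub>R y) \<bullet> y)"
            by (auto simp: fun_eq_iff mult.commute)
          ultimately have "((\<lambda>s. f (x + s *\<^sub>R y)) has_real_derivative (g (x + t *\<^sub>R y) \<bullet> y)) (at t)"
            by (simp add: has_field_derivative_def)
          then have "((\<lambda>s. (f (x + s *\<^sub>R y) - f (x + t *\<^sub>R y)) / (s - t)) \<longlongrightarrow> g (x + t *\<^sub>R y) \<bullet> y) (at t)"
            by (simp add: has_field_derivative_iff)
          then have "(\<lambda>n. (f (x + X n *\<^sub>R y) - f (x + t *\<^sub>R y)) / (X n - t)) \<longlonglongrightarrow> g (x + t *\<^sub>R y) \<bullet> y"
            by (rule filterlim_compose) (use lim Xi in \<open>auto intro!: filterlim_atI\<close>)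
          then show ?thesis using True by (simp add: q_def w_def w'_def)
        qed (simp add: q_def w_def w'_def)
      qed
      show "AE y in lborel. norm (q n y) \<le> G * indicator (ball 0 1) y" for n
      proof (rule AE_I2)
        fix y
        show "norm (q n y) \<le> G * indicator (ball 0 1) y"
        proof (cases "y \<in> ball 0 1")
          case True
          have "\<bar>f (x + X n *\<^sub>R y) - f (x + t *\<^sub>R y)\<bar> \<le> G * norm (x + X n *\<^sub>R y - (x + t *\<^sub>R y))"
            by (rule f_lipschitz[OF scaled_mem[OF True Xi(1)] scaled_mem[OF True t]])
          also have "x + X n *\<^sub>R y - (x + t *\<^sub>R y) = (X n - t) *\<^sub>R y" by (simp add: algebra_simps)
          also have "G * norm ((X n - t) *\<^sub>R y) \<le> G * \<bar>X n - t\<bar>"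
            using True G_nonneg by (intro mult_left_mono) (auto simp: mult_left_le)
          finally show ?thesis using True Xi(2)[of n] by (simp add: q_def w_def divide_le_eq)
        qed (simp add: q_def w_def)
      qed
    qed
    moreover have "integral\<^sup>L lborel (q n) = (integral\<^sup>L lborel (w (X n)) - integral\<^sup>L lborel (w t)) / (X n - t)" for n
      unfolding q_def using wi[OF Xi(1)] wi[OF t] by simp
    ultimately show "((\<lambda>s. (integral\<^sup>L lborel (w s) - integral\<^sup>L lborel (w t)) / (s - t)) \<circ> X) \<longlonglongrightarrow> integral\<^sup>L lborel w'"
      by (simp add: o_def)
  qed
  moreover have "at t within {-r'<..<r'} = at t" using t by (intro at_within_open) auto
  ultimately show ?thesis by (simp add: has_field_derivative_iff w_def[abs_def] w'_def[abs_def])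
qed

lemma sub_mean_value:
  assumes r: "0 < r" "r < r'"
  shows "f x * measure lborel (ball x r) \<le> (\<integral>y. indicator (ball x r) y * f y \<partial>lborel)"
proof -
  define m where "m t = (\<integral>y. indicator (ball 0 1) y * f (x + t *\<^sub>R y) \<partial>lborel)" for t :: real
  have "m 0 \<le> m r"
  proof (rule DERIV_nonneg_imp_nondecreasing[OF less_imp_le[OF r(1)]])
    fix t assume t: "0 \<le> t" "t \<le> r"
    show "\<exists>y. (m has_real_derivative y) (at t) \<and> 0 \<le> y"
      using spherical_mean_has_derivative[of t] mean_derivative_nonneg[of t] t r unfolding m_def by force
  qed
  moreover have "m 0 = measure lborel (ball (0::'a) 1) * f x" by (simp add: m_def)
  moreover have "(\<integral>y. indicator (ball x r) y * f y \<partial>lborel) = r ^ DIM('a) * m r"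
  proof -
    have "continuous_on (ball x r) f" by (rule continuous_on_subset[OF continuous_f]) (use r in auto)
    then have "(\<lambda>y. indicator (ball x r) y * f y) \<in> borel_measurable borel"
      by (intro borel_measurable_indicator_times) auto
    from integral_lborel_affine[OF this r(1), of x]
    have "(\<integral>y. indicator (ball x r) y * f y \<partial>lborel)
      = r ^ DIM('a) * (\<integral>y. indicator (ball x r) (x + r *\<^sub>R y) * f (x + r *\<^sub>R y) \<partial>lborel)" .
    moreover have "indicator (ball x r) (x + r *\<^sub>R y) = (indicator (ball 0 1) y :: real)" for y
      using r by (auto simp: indicator_def dist_norm)
    ultimately show ?thesis by (simp add: m_def)
  qed
  moreover have "measure lborel (ball x r) = r ^ DIM('a) * measure lborel (ball (0::'a) 1)"
    using content_ball[of r x] content_ball[of 1 "0::'a"] r by simp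
  ultimately show ?thesis using r by (simp add: mult.assoc mult.left_commute mult_left_mono mult.commute[of _ "f x"])
qed

end

section \<open>The truncated fundamental solution\<close>

text \<open>Radial functions are written through the squared distance, which is smooth even at the
  centre; \<open>p1\<close> and \<open>p2\<close> below are derivatives with respect to that
  square.\<close>

lemma radial_has_derivative:
  fixes c y :: "'a::euclidean_space"
  assumes "(p has_real_derivative p1) (at ((y - c) \<bullet> (y - c)))"
  shows "((\<lambda>x. p ((x - c) \<bullet> (x - c))) has_derivative (\<lambda>v. ((2 * p1) *\<^sub>R (y - c)) \<bullet> v)) (at y)"
proof -
  have "((\<lambda>x. (x - c) \<bullet> (x - c)) has_derivative (\<lambda>v. 2 * ((y - c) \<bullet> v))) (at y)"
    by (auto intro!: derivative_eq_intros simp: inner_commute)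
  from has_derivative_compose[OF this assms[unfolded has_field_derivative_def]] show ?thesis
    by (simp add: mult.assoc mult.left_commute)
qed

lemma radial_gradient_has_derivative:
  fixes c y :: "'a::euclidean_space"
  assumes "(p1 has_real_derivative p2) (at ((y - c) \<bullet> (y - c)))"
  shows "((\<lambda>x. (2 * p1 ((x - c) \<bullet> (x - c))) *\<^sub>R (x - c)) has_derivative
    (\<lambda>v. (4 * p2 * ((y - c) \<bullet> v)) *\<^sub>R (y - c) + (2 * p1 ((y - c) \<bullet> (y - c))) *\<^sub>R v)) (at y)"
proof -
  from radial_has_derivative[OF assms]
  have "((\<lambda>x. p1 ((x - c) \<bullet> (x - c))) has_derivative (\<lambda>v. ((2 * p2) *\<^sub>R (y - c)) \<bullet> v)) (at y)" .
  then show ?thesis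
    by (auto intro!: derivative_eq_intros simp: algebra_simps)
qed

text \<open>This is the Laplacian of \<open>p (w \<bullet> w)\<close> when \<open>p1\<close> and
  \<open>p2\<close> are the first two derivatives of \<open>p\<close>.\<close>

lemma radial_hessian_trace:
  fixes w :: "'a::euclidean_space"
  shows "(\<Sum>b\<in>Basis. ((4 * p2 * (w \<bullet> b)) *\<^sub>R w + (2 * p1) *\<^sub>R b) \<bullet> b) = 4 * p2 * (w \<bullet> w) + 2 * real DIM('a) * p1"
proof -
  have "(\<Sum>b\<in>Basis. ((4 * p2 * (w \<bullet> b)) *\<^sub>R w + (2 * p1) *\<^sub>R b) \<bullet> b)
    = (\<Sum>b\<in>Basis. 4 * p2 * ((w \<bullet> b) * (w \<bullet> b)) + 2 * p1)"
    by (rule sum.cong) (auto simp: inner_simps)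
  also have "\<dots> = 4 * p2 * (w \<bullet> w) + 2 * real DIM('a) * p1"
    by (simp add: sum.distrib sum_distrib_left[symmetric] euclidean_inner[of w w])
  finally show ?thesis .
qed

lemma radial_hessian_bound:
  fixes w :: "'a::euclidean_space"
  shows "norm ((4 * p2 * (w \<bullet> v)) *\<^sub>R w + (2 * p1) *\<^sub>R v) \<le> (4 * \<bar>p2\<bar> * (w \<bullet> w) + 2 * \<bar>p1\<bar>) * norm v"
proof -
  have "norm ((4 * p2 * (w \<bullet> v)) *\<^sub>R w) = 4 * \<bar>p2\<bar> * (\<bar>w \<bullet> v\<bar> * norm w)" by (simp add: abs_mult)
  also have "\<dots> \<le> 4 * \<bar>p2\<bar> * ((norm w * norm v) * norm w)"
    by (intro mult_left_mono mult_right_mono Cauchy_Schwarz_ineq2) auto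
  also have "\<dots> = 4 * \<bar>p2\<bar> * (w \<bullet> w) * norm v"
    by (simp add: power2_norm_eq_inner[symmetric] power2_eq_square)
  finally have "norm ((4 * p2 * (w \<bullet> v)) *\<^sub>R w) \<le> 4 * \<bar>p2\<bar> * (w \<bullet> w) * norm v" .
  moreover have "norm ((2 * p1) *\<^sub>R v) = 2 * \<bar>p1\<bar> * norm v" by (simp add: abs_mult)
  ultimately show ?thesis
    using norm_triangle_ineq[of "(4 * p2 * (w \<bullet> v)) *\<^sub>R w" "(2 * p1) *\<^sub>R v"] unfolding distrib_right by linarith
qed

text \<open>The negated kernel as a real function. It is nonnegative on (0, 1], the range to which
  distances are rescaled.\<close>

definition kr :: "nat \<Rightarrow> real \<Rightarrow> real" where
  "kr d t = (if d = 2 then - ln t else 1 / t ^ (d - 2))"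

lemma cap_kernel_eq: "t > 0 \<Longrightarrow> cap_kernel d t = ereal (- kr d t)"
  by (simp add: cap_kernel_def kr_def)

text \<open>The fundamental solution in terms of the squared distance, normalised so that its
  derivative is \<open>- (s powr (- (d / 2)))\<close> in every dimension; \<open>ckap\<close>
  converts between this normalisation and that of \<open>kr\<close>.\<close>

definition kap :: "nat \<Rightarrow> real \<Rightarrow> real" where
  "kap d s = (if d = 2 then - ln s else s powr (1 - real d / 2) / (real d / 2 - 1))"

definition ckap :: "nat \<Rightarrow> real" where
  "ckap d = (if d = 2 then 2 else 2 / (real d - 2))"

lemma ckap_pos: "d \<ge> 2 \<Longrightarrow> ckap d > 0"
  by (auto simp: ckap_def)

lemma kap_power2: "d \<ge> 2 \<Longrightarrow> t > 0 \<Longrightarrow> kap d (t\<^sup>2) = ckap d * kr d t"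
proof (cases "d = 2")
  case True then show "t > 0 \<Longrightarrow> ?thesis" by (simp add: kap_def ckap_def kr_def ln_realpow)
next
  case False
  assume d: "d \<ge> 2" and t: "t > 0"
  have "(t\<^sup>2) powr (1 - real d / 2) = (t powr 2) powr (1 - real d / 2)" using t by simp
  also have "\<dots> = t powr (- real (d - 2))" using d by (simp add: powr_powr algebra_simps of_nat_diff)
  also have "\<dots> = 1 / t ^ (d - 2)" using t by (simp add: powr_minus_divide powr_realpow)
  finally show ?thesis using False d by (simp add: kap_def ckap_def kr_def field_simps)
qed

lemma kr_antimono: "0 < s \<Longrightarrow> s \<le> t \<Longrightarrow> kr d t \<le> kr d s"
  by (auto simp: kr_def intro!: divide_left_mono power_mono)

lemma kr_strict_antimono: "d \<ge> 2 \<Longrightarrow> 0 < s \<Longrightarrow> s < t \<Longrightarrow> kr d t < kr d s"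
  by (auto simp: kr_def intro!: divide_strict_left_mono power_strict_mono)

lemma kr_pos: "d \<ge> 2 \<Longrightarrow> 0 < t \<Longrightarrow> t < 1 \<Longrightarrow> kr d t > 0"
  by (auto simp: kr_def)

lemma kr_nonneg: "0 < t \<Longrightarrow> t \<le> 1 \<Longrightarrow> kr d t \<ge> 0"
  by (auto simp: kr_def)

lemma kap_has_derivative:
  assumes "d \<ge> 2" "s > 0"
  shows "(kap d has_real_derivative - (s powr (- (real d / 2)))) (at s)"
proof (cases "d = 2")
  case True
  have "((\<lambda>s. - ln s) has_real_derivative - (1 / s)) (at s)"
    using assms by (auto intro!: derivative_eq_intros)
  moreover have "kap d = (\<lambda>s. - ln s)" using True by (auto simp: kap_def)
  ultimately show ?thesis using True assms by (simp add: powr_minus_divide)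
next
  case False
  then have n: "real d / 2 - 1 \<noteq> 0" by auto
  have "((\<lambda>s. s powr (1 - real d / 2) / (real d / 2 - 1)) has_real_derivative
     ((1 - real d / 2) * s powr (1 - real d / 2 - 1)) / (real d / 2 - 1)) (at s)"
    using assms by (intro DERIV_cdivide has_real_derivative_powr) auto
  moreover have "kap d = (\<lambda>s. s powr (1 - real d / 2) / (real d / 2 - 1))" using False by (auto simp: kap_def)
  moreover have "((1 - real d / 2) * s powr (1 - real d / 2 - 1)) / (real d / 2 - 1) = - (s powr (- (real d / 2)))"
    using n by (simp add: field_simps)
  ultimately show ?thesis by simp
qed

lemma kap_deriv_has_derivative:
  assumes "s > 0"
  shows "((\<lambda>s. - (s powr (- (real d / 2)))) has_real_derivative (real d / 2) * s powr (- (real d / 2) - 1)) (at s)"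
proof -
  have "((\<lambda>s. s powr (- (real d / 2))) has_real_derivative (- (real d / 2)) * s powr (- (real d / 2) - 1)) (at s)"
    using assms by (rule has_real_derivative_powr)
  from DERIV_minus[OF this] show ?thesis by simp
qed

lemma powr_mult_self: "s > 0 \<Longrightarrow> s * s powr (a - 1) = s powr (a::real)"
  by (metis less_eq_real_def mult.commute order_less_irrefl powr_mult_base diff_add_cancel add.commute)

text \<open>Harmonicity of the fundamental solution away from its pole, in the form of
  \<open>radial_hessian_trace\<close>.\<close>

lemma kap_laplacian:
  assumes "s > 0"
  shows "4 * ((real d / 2) * s powr (- (real d / 2) - 1)) * s + 2 * real d * (- (s powr (- (real d / 2)))) = 0"
  using powr_mult_self[OF assms, of "- (real d / 2)"] by (simp add: algebra_simps)

text \<open>The quadratic correction makes the truncation of the fundamental solution at \<open>s = 1\<close> (where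
  \<open>s\<close> is the squared distance) of class \<open>C\<^sup>2\<close>; it costs a bounded positive Laplacian.\<close>

definition prof :: "nat \<Rightarrow> real \<Rightarrow> real" where
  "prof d s = (if s < 1 then kap d s - kap d 1 + (1 + real d / 2) * (s - 1) - (real d / 4) * (s\<^sup>2 - 1) else 0)"

definition prof1 :: "nat \<Rightarrow> real \<Rightarrow> real" where
  "prof1 d s = (if s < 1 then - (s powr (- (real d / 2))) + (1 + real d / 2) - (real d / 2) * s else 0)"

definition prof2 :: "nat \<Rightarrow> real \<Rightarrow> real" where
  "prof2 d s = (if s < 1 then (real d / 2) * (s powr (- (real d / 2) - 1) - 1) else 0)"

text \<open>For gluing: a function equal to \<open>e\<close> on one side of \<open>a\<close> and to
  0 on the other inherits a vanishing derivative at \<open>a\<close>.\<close>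

lemma has_real_derivative_0_dominated:
  fixes e F :: "real \<Rightarrow> real"
  assumes "(e has_real_derivative 0) (at a)" "e a = 0" "F a = 0" "\<And>s. \<bar>F s\<bar> \<le> \<bar>e s\<bar>"
  shows "(F has_real_derivative 0) (at a)"
proof -
  have "((\<lambda>s. e s / (s - a)) \<longlongrightarrow> 0) (at a)" using assms by (simp add: has_field_derivative_iff)
  then have "((\<lambda>s. F s / (s - a)) \<longlongrightarrow> 0) (at a)"
    by (rule tendsto_0_le[where K = 1]) (use assms in \<open>auto simp: divide_right_mono abs_divide intro!: always_eventually\<close>)
  then show ?thesis using assms by (simp add: has_field_derivative_iff)
qed

lemma prof_has_derivative:
  assumes d: "d \<ge> 2" and s: "s > 0"
  shows "(prof d has_real_derivative prof1 d s) (at s)"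
proof -
  define e where "e s = kap d s - kap d 1 + (1 + real d / 2) * (s - 1) - (real d / 4) * (s\<^sup>2 - 1)" for s
  have e: "(e has_real_derivative - (s powr (- (real d / 2))) + (1 + real d / 2) - (real d / 2) * s) (at s)" if "s > 0" for s
    unfolding e_def using d that by (auto intro!: derivative_eq_intros kap_has_derivative)
  consider "s < 1" | "s = 1" | "s > 1" by linarith
  then show ?thesis
  proof cases
    case 1
    have "(prof d has_real_derivative - (s powr (- (real d / 2))) + (1 + real d / 2) - (real d / 2) * s) (at s)"
      by (rule has_field_derivative_transform_within_open[OF e[OF s], of "{..<1}"]) (use 1 in \<open>auto simp: prof_def e_def\<close>)
    then show ?thesis using 1 by (simp add: prof1_def)
  next
    case 2
    have "(prof d has_real_derivative 0) (at 1)"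
      by (rule has_real_derivative_0_dominated[of e]) (use e[of 1] in \<open>auto simp: prof_def e_def\<close>)
    then show ?thesis using 2 by (simp add: prof1_def)
  next
    case 3
    have "((\<lambda>_. 0::real) has_real_derivative 0) (at s)" by simp
    then have "(prof d has_real_derivative 0) (at s)"
      by (rule has_field_derivative_transform_within_open[of _ _ _ "{1<..}"]) (use 3 in \<open>auto simp: prof_def\<close>)
    then show ?thesis using 3 by (simp add: prof1_def)
  qed
qed

lemma prof1_has_derivative:
  assumes s: "s > 0"
  shows "(prof1 d has_real_derivative prof2 d s) (at s)"
proof -
  define e where "e s = - (s powr (- (real d / 2))) + (1 + real d / 2) - (real d / 2) * s" for s
  have e: "(e has_real_derivative (real d / 2) * (s powr (- (real d / 2) - 1) - 1)) (at s)" if "s > 0" for s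
  proof -
    have "(e has_real_derivative (real d / 2) * s powr (- (real d / 2) - 1) + 0 - real d / 2 * 1) (at s)"
      unfolding e_def[abs_def]
      by (intro DERIV_diff DERIV_add kap_deriv_has_derivative that DERIV_const DERIV_cmult DERIV_ident)
    then show ?thesis by (simp add: algebra_simps)
  qed
  consider "s < 1" | "s = 1" | "s > 1" by linarith
  then show ?thesis
  proof cases
    case 1
    have "(prof1 d has_real_derivative (real d / 2) * (s powr (- (real d / 2) - 1) - 1)) (at s)"
      by (rule has_field_derivative_transform_within_open[OF e[OF s], of "{..<1}"]) (use 1 in \<open>auto simp: prof1_def e_def\<close>)
    then show ?thesis using 1 by (simp add: prof2_def)
  next
    case 2
    have "(prof1 d has_real_derivative 0) (at 1)"
      by (rule has_real_derivative_0_dominated[of e]) (use e[of 1] in \<open>auto simp: prof1_def e_def\<close>)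
    then show ?thesis using 2 by (simp add: prof2_def)
  next
    case 3
    have "((\<lambda>_. 0::real) has_real_derivative 0) (at s)" by simp
    then have "(prof1 d has_real_derivative 0) (at s)"
      by (rule has_field_derivative_transform_within_open[of _ _ _ "{1<..}"]) (use 3 in \<open>auto simp: prof1_def\<close>)
    then show ?thesis using 3 by (simp add: prof2_def)
  qed
qed

lemma prof2_nonneg:
  assumes "s > 0" shows "prof2 d s \<ge> 0"
proof (cases "s < 1")
  case True
  have "s powr (- (real d / 2) - 1) \<ge> s powr 0" using True assms by (intro powr_mono') auto
  then show ?thesis using True assms by (simp add: prof2_def)
qed (simp add: prof2_def)

lemma prof1_nonpos:
  assumes "s > 0" shows "prof1 d s \<le> 0"
proof (cases "s < 1")
  case True
  have "prof1 d s \<le> prof1 d 1"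
  proof (rule DERIV_nonneg_imp_nondecreasing[of s 1 "prof1 d"])
    show "\<exists>y. (prof1 d has_real_derivative y) (at x) \<and> 0 \<le> y" if "s \<le> x" "x \<le> 1" for x
      using prof1_has_derivative[of x d] prof2_nonneg[of x d] that assms by force
  qed (use True in simp)
  then show ?thesis by (simp add: prof1_def)
qed (simp add: prof1_def)

lemma prof_antimono:
  assumes "d \<ge> 2" "0 < s" "s \<le> t" shows "prof d t \<le> prof d s"
proof (rule DERIV_nonpos_imp_nonincreasing[OF assms(3)])
  show "\<exists>y. (prof d has_real_derivative y) (at x) \<and> y \<le> 0" if "s \<le> x" "x \<le> t" for x
    using prof_has_derivative[of d x] prof1_nonpos[of x d] that assms by force
qed

lemma prof_nonneg: "d \<ge> 2 \<Longrightarrow> 0 < s \<Longrightarrow> prof d s \<ge> 0"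
  using prof_antimono[of d s "max s 1"] by (simp add: prof_def)

text \<open>The fundamental solution is harmonic, so only the quadratic correction contributes. Away
  from the pole the Laplacian is bounded below while \<open>s\<close> stays away from 1, which
  drives the lower growth bound, and it never exceeds \<open>2 * d + d\<^sup>2\<close>, which drives
  the construction of holes.\<close>

lemma prof_laplacian:
  assumes "s > 0"
  shows "4 * prof2 d s * s + 2 * real d * prof1 d s = (2 * real d + (real d)\<^sup>2) * max 0 (1 - s)"
  using powr_mult_self[OF assms, of "- (real d / 2)"]
  by (cases "s < 1") (auto simp: prof1_def prof2_def algebra_simps power2_eq_square)

lemma kap_1: "d \<ge> 2 \<Longrightarrow> kap d 1 \<ge> 0"
  by (auto simp: kap_def)

lemma prof_le_kap:
  assumes "d \<ge> 2" "0 < s" "s < 1" shows "prof d s \<le> kap d s"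
proof -
  have "(1 + real d / 2) * (s - 1) - (real d / 4) * (s\<^sup>2 - 1) = (s - 1) * (1 + real d / 2 - (real d / 4) * (s + 1))"
    by (simp add: power2_eq_square algebra_simps)
  also have "(real d / 4) * (s + 1) \<le> (real d / 4) * 2" using assms by (intro mult_left_mono) auto
  then have "(s - 1) * (1 + real d / 2 - (real d / 4) * (s + 1)) \<le> 0"
    using assms by (intro mult_nonpos_nonneg) linarith+
  finally show ?thesis using kap_1[OF assms(1)] assms by (simp add: prof_def)
qed

lemma prof_ge_kap:
  assumes "0 < s" "s < 1" shows "prof d s \<ge> kap d s - kap d 1 - (1 + real d / 2)"
proof -
  have "(1 + real d / 2) * (s - 1) \<ge> (1 + real d / 2) * (-1)" using assms by (intro mult_left_mono) auto
  moreover have "(real d / 4) * (s\<^sup>2 - 1) \<le> 0"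
    using assms by (intro mult_nonneg_nonpos) (auto simp: power_le_one)
  ultimately show ?thesis using assms by (simp add: prof_def)
qed

text \<open>Two distances occur because the potential at a point will be estimated by the potential
  at another, nearest point of the support.\<close>

lemma prof_le_kr:
  assumes "d \<ge> 2" "0 < t" "t \<le> T" "T \<le> 1" shows "prof d (T\<^sup>2) \<le> ckap d * kr d t"
proof (cases "T < 1")
  case True
  have "prof d (T\<^sup>2) \<le> prof d (t\<^sup>2)" using assms by (intro prof_antimono power_mono) auto
  also have "\<dots> \<le> kap d (t\<^sup>2)" using assms True by (intro prof_le_kap) (auto simp: power_less_one_iff)
  finally show ?thesis using assms by (simp add: kap_power2)
next
  case False
  then show ?thesis using assms ckap_pos[of d] kr_nonneg[of t d] by (simp add: prof_def)
qed

section \<open>Comparison and maximum principles\<close>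

lemma ext_integral_mono:
  assumes "\<And>x. x \<in> space M \<Longrightarrow> f x \<le> g x"
  shows "ext_integral M f \<le> ext_integral M g"
  unfolding ext_integral_def less_eq_ennreal.rep_eq[symmetric]
  by (intro ereal_minus_mono less_eq_ennreal.rep_eq[THEN iffD1] nn_integral_mono e2ennreal_mono) (use assms in auto)

lemma ext_integral_real:
  assumes "integrable M f"
  shows "ext_integral M (\<lambda>x. ereal (f x)) = ereal (integral\<^sup>L M f)"
proof -
  obtain r where r: "r \<ge> 0" "(\<integral>\<^sup>+x. ennreal (f x) \<partial>M) = ennreal r" 
    using assms unfolding real_integrable_def by (cases "\<integral>\<^sup>+x. ennreal (f x) \<partial>M") auto
  obtain q where q: "q \<ge> 0" "(\<integral>\<^sup>+x. ennreal (- f x) \<partial>M) = ennreal q"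
    using assms unfolding real_integrable_def by (cases "\<integral>\<^sup>+x. ennreal (- f x) \<partial>M") auto
  have "integral\<^sup>L M f = r - q"
    using r q assms by (simp add: real_lebesgue_integral_def)
  then show ?thesis using r q by (simp add: ext_integral_def)
qed

lemma ext_integral_ball_real:
  fixes f :: "'a::euclidean_space \<Rightarrow> real"
  assumes "integrable lborel (\<lambda>z. indicator (ball y r) z * f z)"
  shows "ext_integral (restrict_space lborel (ball y r)) (\<lambda>x. ereal (f x))
     = ereal (\<integral>z. indicator (ball y r) z * f z \<partial>lborel)"
proof -
  have "integrable (restrict_space lborel (ball y r)) f"
    using assms by (subst integrable_restrict_space) auto
  then show ?thesis by (simp add: ext_integral_real integral_restrict_space)
qed

lemma subharmonic_less_top: "subharmonic u \<Longrightarrow> u x < \<infinity>"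
  by (simp add: subharmonic_def)

lemma subharmonic_open: "subharmonic u \<Longrightarrow> open {x. u x < c}"
  by (simp add: subharmonic_def)

lemma subharmonic_bounded_above:
  fixes u :: "'a::euclidean_space \<Rightarrow> ereal"
  assumes "subharmonic u" "compact C"
  obtains B :: real where "\<And>x. x \<in> C \<Longrightarrow> u x \<le> ereal B"
proof -
  have "C \<subseteq> (\<Union>n::nat. {x. u x < ereal (real n)})"
  proof
    fix x
    have "u x < \<infinity>" by (rule subharmonic_less_top[OF assms(1)])
    then obtain n :: nat where "u x < ereal (real n)" using less_PInf_Ex_of_nat[of "u x"] by auto
    then show "x \<in> (\<Union>n::nat. {x. u x < ereal (real n)})" by auto
  qed
  then obtain N where N: "finite N" "C \<subseteq> (\<Union>n\<in>N. {x. u x < ereal (real n)})"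
    by (rule compactE_image[OF assms(2), of UNIV "\<lambda>n::nat. {x. u x < ereal (real n)}", rotated])
       (auto intro: subharmonic_open[OF assms(1)])
  show ?thesis
  proof
    fix x assume "x \<in> C"
    then obtain n where n: "n \<in> N" "u x < ereal (real n)" using N by auto
    have "real n \<le> real (Max N)" using n N by simp
    then show "u x \<le> ereal (real (Max N))" using n(2) by (meson ereal_less_eq(3) less_imp_le order_trans)
  qed
qed

text \<open>Where \<open>u - b\<close> is largest and positive, the sub-mean-value property of
  \<open>u\<close> contradicts the strict super-mean-value property of \<open>b\<close> on one ball.
  The latter is demanded only where \<open>u\<close> exceeds \<open>b\<close>, so \<open>b\<close>
  may jump down on a set where \<open>u\<close> is already known to be small.\<close>

lemma comparison_principle:
  fixes u :: "'a::euclidean_space \<Rightarrow> ereal" and b :: "'a \<Rightarrow> real"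
  assumes u: "subharmonic u" and C: "compact C"
    and lsc: "\<And>y c. y \<in> C \<Longrightarrow> c < b y \<Longrightarrow> \<exists>U. open U \<and> y \<in> U \<and> (\<forall>z\<in>U \<inter> C. c < b z)"
    and alt: "\<And>y. y \<in> C \<Longrightarrow> u y > ereal (b y) \<Longrightarrow> \<exists>r>0. ball y r \<subseteq> C
       \<and> integrable lborel (\<lambda>z. indicator (ball y r) z * b z)
       \<and> (\<integral>z. indicator (ball y r) z * b z \<partial>lborel) < b y * measure lborel (ball y r)"
    and x: "x \<in> C"
  shows "u x \<le> ereal (b x)"
proof (rule ccontr)
  assume "\<not> u x \<le> ereal (b x)"
  define w where "w y = u y - ereal (b y)" for y
  define m where "m = (SUP y\<in>C. w y)"
  \<comment> \<open>An upper semicontinuous function attains its supremum on a compact set: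
    otherwise finitely many neighbourhoods, each with a bound below \<open>m\<close>, would cover
    \<open>C\<close>.\<close>
  have "\<exists>y\<in>C. w y = m"
  proof (rule ccontr)
    assume "\<not> (\<exists>y\<in>C. w y = m)"
    then have lt: "w y < m" if "y \<in> C" for y
      using SUP_upper[OF that, of w] that unfolding m_def by (metis order_le_less)
    have "\<exists>c U. c < m \<and> open U \<and> y \<in> U \<and> (\<forall>z\<in>U \<inter> C. w z \<le> c)" if y: "y \<in> C" for y
    proof -
      obtain c where c: "w y < ereal c" "ereal c < m" using ereal_dense2[OF lt[OF y]] by auto
      have "u y < ereal (c + b y)" using c(1) by (cases "u y") (auto simp: w_def)
      then obtain e where e: "u y < ereal e" "e < c + b y" using ereal_dense2 by (metis ereal_less(2) less_ereal.simps(1))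
      then obtain U where U: "open U" "y \<in> U" "\<And>z. z \<in> U \<inter> C \<Longrightarrow> e - c < b z"
        using lsc[OF y, of "e - c"] by auto
      have "w z \<le> ereal c" if z: "z \<in> (U \<inter> {x. u x < ereal e}) \<inter> C" for z
      proof -
        have "u z < ereal e" "e - c < b z" using z U by auto
        then show ?thesis by (cases "u z") (auto simp: w_def)
      qed
      then show ?thesis using c(2) U e subharmonic_open[OF u, of "ereal e"]
        by (intro exI[of _ "ereal c"] exI[of _ "U \<inter> {x. u x < ereal e}"]) auto
    qed
    then obtain c U where cU: "\<And>y. y \<in> C \<Longrightarrow> c y < m" "\<And>y. y \<in> C \<Longrightarrow> open (U y)"
      "\<And>y. y \<in> C \<Longrightarrow> y \<in> U y" "\<And>y z. y \<in> C \<Longrightarrow> z \<in> U y \<inter> C \<Longrightarrow> w z \<le> c y" by metis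
    obtain F where F: "F \<subseteq> C" "finite F" "C \<subseteq> (\<Union>y\<in>F. U y)"
      by (rule compactE_image[OF C, of C U]) (use cU in auto)
    have ne: "F \<noteq> {}" using F x by auto
    have "m \<le> Max (c ` F)"
      unfolding m_def
    proof (rule SUP_least)
      fix z assume z: "z \<in> C"
      then obtain y where y: "y \<in> F" "z \<in> U y" using F by auto
      then have "w z \<le> c y" using cU(4)[of y z] z F by auto
      also have "c y \<le> Max (c ` F)" using F y by simp
      finally show "w z \<le> Max (c ` F)" .
    qed
    moreover have "Max (c ` F) < m" using F ne cU(1) by (subst Max_less_iff) auto
    ultimately show False by simp
  qed
  then obtain y where y: "y \<in> C" "w y = m" by auto
  have "ereal (b x) < u x" using \<open>\<not> u x \<le> ereal (b x)\<close> by simp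
  then have "0 < w x" by (cases "u x") (auto simp: w_def)
  also have "w x \<le> m" unfolding m_def using x by (rule SUP_upper)
  finally have m: "0 < m" .
  have ub: "u y > ereal (b y)" using m y by (cases "u y") (auto simp: w_def)
  moreover have "u y < \<infinity>" by (rule subharmonic_less_top[OF u])
  ultimately obtain uy where uy: "u y = ereal uy" by (cases "u y") auto
  have m_eq: "m = ereal (uy - b y)" using y uy by (simp add: w_def)
  obtain r where r: "r > 0" "ball y r \<subseteq> C" "integrable lborel (\<lambda>z. indicator (ball y r) z * b z)"
    "(\<integral>z. indicator (ball y r) z * b z \<partial>lborel) < b y * measure lborel (ball y r)"
    using alt[OF y(1) ub] by auto
  let ?V = "measure lborel (ball y r)"
  have V: "?V > 0" using r content_ball_gt_0_iff[of y r] by simp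
  have int_c: "integrable lborel (\<lambda>z. indicator (ball y r) z * (uy - b y))"
    using emeasure_lborel_ball_finite[of y r]
    by (intro integrable_mult_left integrable_real_indicator) auto
  have int: "integrable lborel (\<lambda>z. indicator (ball y r) z * (b z + (uy - b y)))"
    using Bochner_Integration.integrable_add[OF r(3) int_c] by (simp add: distrib_left)
  have "u y \<le> ext_integral (restrict_space lborel (ball y r)) u / ereal ?V"
    using u r(1) unfolding subharmonic_def by blast
  also have "\<dots> \<le> ext_integral (restrict_space lborel (ball y r)) (\<lambda>z. ereal (b z + (uy - b y))) / ereal ?V"
  proof (rule ereal_divide_right_mono)
    show "ext_integral (restrict_space lborel (ball y r)) u \<le> ext_integral (restrict_space lborel (ball y r)) (\<lambda>z. ereal (b z + (uy - b y)))"
    proof (rule ext_integral_mono)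
      fix z assume "z \<in> space (restrict_space lborel (ball y r))"
      then have "z \<in> C" using r(2) by (auto simp: space_restrict_space)
      then have "w z \<le> ereal (uy - b y)" unfolding m_eq[symmetric] m_def by (rule SUP_upper)
      then show "u z \<le> ereal (b z + (uy - b y))" by (cases "u z") (auto simp: w_def)
    qed
  qed (use V in simp)
  also have "\<dots> = ereal ((\<integral>z. indicator (ball y r) z * (b z + (uy - b y)) \<partial>lborel) / ?V)"
    using ext_integral_ball_real[OF int] V by simp
  finally have "uy \<le> (\<integral>z. indicator (ball y r) z * (b z + (uy - b y)) \<partial>lborel) / ?V" using uy by simp
  then have "uy * ?V \<le> (\<integral>z. indicator (ball y r) z * (b z + (uy - b y)) \<partial>lborel)"
    using V by (simp add: field_simps)
  also have "\<dots> = (\<integral>z. indicator (ball y r) z * b z \<partial>lborel) + (\<integral>z. indicator (ball y r) z * (uy - b y) \<partial>lborel)"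
    unfolding distrib_left by (rule Bochner_Integration.integral_add[OF r(3) int_c])
  also have "\<dots> = (\<integral>z. indicator (ball y r) z * b z \<partial>lborel) + ?V * (uy - b y)" by simp
  also have "\<dots> < b y * ?V + ?V * (uy - b y)" using r(4) by simp
  finally show False by (simp add: algebra_simps)
qed

lemma mean_square_distance_pos:
  fixes y :: "'a::euclidean_space"
  assumes "r > 0"
  shows "integrable lborel (\<lambda>z. indicator (ball y r) z * ((z - y) \<bullet> (z - y)))"
    "(\<integral>z. indicator (ball y r) z * ((z - y) \<bullet> (z - y)) \<partial>lborel) > 0"
proof -
  have m: "(\<lambda>z. indicator (ball y r) z * ((z - y) \<bullet> (z - y))) \<in> borel_measurable borel"
    by (intro borel_measurable_indicator_times continuous_intros) auto
  have int: "integrable lborel (\<lambda>z. indicator (ball y s) z * c :: real)" for s c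
    using emeasure_lborel_ball_finite[of y s] by (intro integrable_mult_left integrable_real_indicator) auto
  show i: "integrable lborel (\<lambda>z. indicator (ball y r) z * ((z - y) \<bullet> (z - y)))"
  proof (rule Bochner_Integration.integrable_bound[OF int[of r "r * r"]])
    show "AE x in lborel. norm (indicator (ball y r) x * ((x - y) \<bullet> (x - y))) \<le> norm (indicator (ball y r) x * (r * r))"
    proof (rule AE_I2)
      fix x
      show "norm (indicator (ball y r) x * ((x - y) \<bullet> (x - y))) \<le> norm (indicator (ball y r) x * (r * r))"
      proof (cases "x \<in> ball y r")
        case True
        then have "norm (x - y) * norm (x - y) \<le> r * r"
          using assms by (intro mult_mono) (auto simp: dist_norm norm_minus_commute)
        then show ?thesis using True by (simp add: power2_norm_eq_inner[symmetric] power2_eq_square)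
      qed simp
    qed
  qed (use m in simp)
  \<comment> \<open>Outside the ball of half the radius the integrand is at least
    \<open>(r/2)\<^sup>2\<close>.\<close>
  have "0 < (r/2) * (r/2) * (measure lborel (ball y r) - measure lborel (ball y (r/2)))"
  proof -
    have "measure lborel (ball y (r/2)) = (r/2) ^ DIM('a) * unit_ball_vol (real DIM('a))"
      "measure lborel (ball y r) = r ^ DIM('a) * unit_ball_vol (real DIM('a))"
      using assms by (simp_all add: content_ball mult.commute)
    moreover have "(r/2) ^ DIM('a) < r ^ DIM('a)" using assms by (intro power_strict_mono) auto
    moreover have "unit_ball_vol (real DIM('a)) > 0" by simp
    ultimately show ?thesis using assms by simp
  qed
  also have "\<dots> = (\<integral>z. indicator (ball y r) z * ((r/2) * (r/2)) - indicator (ball y (r/2)) z * ((r/2) * (r/2)) \<partial>lborel)"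
    by (subst Bochner_Integration.integral_diff[OF int int]) (simp add: algebra_simps)
  also have "\<dots> \<le> (\<integral>z. indicator (ball y r) z * ((z - y) \<bullet> (z - y)) \<partial>lborel)"
  proof (rule integral_mono[OF _ i])
    show "integrable lborel (\<lambda>z. indicator (ball y r) z * ((r/2) * (r/2)) - indicator (ball y (r/2)) z * ((r/2) * (r/2)))"
      by (rule Bochner_Integration.integrable_diff[OF int int])
    fix z
    have "(z - y) \<bullet> (z - y) = norm (z - y) * norm (z - y)" by (simp add: power2_norm_eq_inner[symmetric] power2_eq_square)
    moreover have "norm (z - y) * norm (z - y) \<ge> r/2 * (r/2)" if "norm (z - y) \<ge> r/2"
      using that assms by (intro mult_mono) auto
    ultimately show "indicator (ball y r) z * ((r/2) * (r/2)) - indicator (ball y (r/2)) z * ((r/2) * (r/2))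
      \<le> indicator (ball y r) z * ((z - y) \<bullet> (z - y))"
      using assms by (auto simp: indicator_def dist_norm norm_minus_commute)
  qed
  finally show "(\<integral>z. indicator (ball y r) z * ((z - y) \<bullet> (z - y)) \<partial>lborel) > 0" .
qed

lemma mean_square_norm:
  fixes x0 y :: "'a::euclidean_space"
  assumes "r > 0"
  shows "integrable lborel (\<lambda>z. indicator (ball y r) z * ((z - x0) \<bullet> (z - x0)))"
    "(\<integral>z. indicator (ball y r) z * ((z - x0) \<bullet> (z - x0)) \<partial>lborel)
      = ((y - x0) \<bullet> (y - x0)) * measure lborel (ball y r) + (\<integral>z. indicator (ball y r) z * ((z - y) \<bullet> (z - y)) \<partial>lborel)"
proof -
  let ?l = "\<lambda>z. 2 * ((z - y) \<bullet> (y - x0)) + (y - x0) \<bullet> (y - x0)"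
  \<comment> \<open>The affine part \<open>?l\<close> is harmonic; the sub-mean-value inequality for
    \<open>c = 1\<close> and \<open>c = -1\<close> gives equality.\<close>
  have lin: "(\<integral>z. indicator (ball y r) z * (c * ?l z) \<partial>lborel) \<ge> c * ((y - x0) \<bullet> (y - x0)) * measure lborel (ball y r)" for c
  proof -
    interpret subharmonic_C2_ball "\<lambda>z. c * ?l z" "\<lambda>_. (2 * c) *\<^sub>R (y - x0)" "\<lambda>_ _. 0" y "2 * r" 0
      by unfold_locales (use assms in \<open>auto intro!: derivative_eq_intros simp: algebra_simps inner_commute\<close>)
    show ?thesis using sub_mean_value[of r] assms by simp
  qed
  have int: "integrable lborel (\<lambda>z. indicator (ball y r) z * ?l z)"
  proof (rule Bochner_Integration.integrable_bound)
    show "integrable lborel (\<lambda>z. indicator (ball y r) z * (2 * (r * norm (y - x0)) + norm (y - x0) * norm (y - x0)))"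
      using emeasure_lborel_ball_finite[of y r] by (intro integrable_mult_left integrable_real_indicator) auto
    show "(\<lambda>z. indicator (ball y r) z * ?l z) \<in> borel_measurable lborel"
      using borel_measurable_indicator_times[of "ball y r" ?l] by (simp add: continuous_intros)
    show "AE z in lborel. norm (indicator (ball y r) z * ?l z) \<le> norm (indicator (ball y r) z * (2 * (r * norm (y - x0)) + norm (y - x0) * norm (y - x0)))"
    proof (rule AE_I2)
      fix z
      show "norm (indicator (ball y r) z * ?l z) \<le> norm (indicator (ball y r) z * (2 * (r * norm (y - x0)) + norm (y - x0) * norm (y - x0)))"
      proof (cases "z \<in> ball y r")
        case True
        have "\<bar>(z - y) \<bullet> (y - x0)\<bar> \<le> norm (z - y) * norm (y - x0)" by (rule Cauchy_Schwarz_ineq2)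
        also have "\<dots> \<le> r * norm (y - x0)" using True by (intro mult_right_mono) (auto simp: dist_norm norm_minus_commute)
        finally have 1: "\<bar>(z - y) \<bullet> (y - x0)\<bar> \<le> r * norm (y - x0)" .
        have 2: "(y - x0) \<bullet> (y - x0) = norm (y - x0) * norm (y - x0)" by (simp add: power2_norm_eq_inner[symmetric] power2_eq_square)
        show ?thesis using True 1 assms unfolding 2 by (simp add: abs_le_iff) (smt (verit) mult_nonneg_nonneg norm_ge_zero)
      qed simp
    qed
  qed
  have eq: "indicator (ball y r) z * ((z - x0) \<bullet> (z - x0)) = indicator (ball y r) z * ?l z + indicator (ball y r) z * ((z - y) \<bullet> (z - y))" for z
    by (simp add: inner_simps inner_commute algebra_simps)
  note i = mean_square_distance_pos(1)[OF assms, of y]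
  show "integrable lborel (\<lambda>z. indicator (ball y r) z * ((z - x0) \<bullet> (z - x0)))"
    unfolding eq using int i by (rule Bochner_Integration.integrable_add)
  have "(\<integral>z. indicator (ball y r) z * ?l z \<partial>lborel) = ((y - x0) \<bullet> (y - x0)) * measure lborel (ball y r)"
  proof -
    have "(\<integral>z. indicator (ball y r) z * (-1 * ?l z) \<partial>lborel) = - (\<integral>z. indicator (ball y r) z * ?l z \<partial>lborel)"
      unfolding integral_minus[symmetric] by (rule Bochner_Integration.integral_cong) (simp_all add: algebra_simps)
    then show ?thesis using lin[of 1] lin[of "-1"] by simp
  qed
  then show "(\<integral>z. indicator (ball y r) z * ((z - x0) \<bullet> (z - x0)) \<partial>lborel)
      = ((y - x0) \<bullet> (y - x0)) * measure lborel (ball y r) + (\<integral>z. indicator (ball y r) z * ((z - y) \<bullet> (z - y)) \<partial>lborel)"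
    unfolding eq by (simp add: Bochner_Integration.integral_add[OF int i])
qed

lemma subharmonic_maximum_principle:
  fixes u :: "'a::euclidean_space \<Rightarrow> ereal"
  assumes u: "subharmonic u" and \<rho>: "\<rho> > 0" and m: "\<And>x. norm x = \<rho> \<Longrightarrow> u x \<le> ereal m" and x: "norm x \<le> \<rho>"
  shows "u x \<le> ereal m"
proof -
  \<comment> \<open>A slightly concave paraboloid supplies the strict inequality that
    \<open>comparison_principle\<close> asks for; its height \<eta> is arbitrary.\<close>
  have "u x \<le> ereal (m + \<eta>)" if \<eta>: "\<eta> > 0" for \<eta>
  proof -
    define k where "k = \<eta> / \<rho>\<^sup>2"
    have k: "k > 0" using \<eta> \<rho> by (simp add: k_def)
    define b where "b x = m + k * (\<rho>\<^sup>2 - (x - 0) \<bullet> (x - 0))" for x :: 'a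
    have "u x \<le> ereal (b x)"
    proof (rule comparison_principle[OF u compact_cball[of 0 \<rho>]])
      fix y :: 'a and c :: real assume "c < b y"
      moreover have "continuous_on UNIV b" unfolding b_def by (intro continuous_intros)
      ultimately have "open (b -` {c<..})" "y \<in> b -` {c<..}" by (auto intro: open_vimage)
      then show "\<exists>U. open U \<and> y \<in> U \<and> (\<forall>z\<in>U \<inter> cball 0 \<rho>. c < b z)" by blast
    next
      fix y :: 'a assume y: "y \<in> cball 0 \<rho>" "ereal (b y) < u y"
      have "norm y \<noteq> \<rho>"
      proof
        assume *: "norm y = \<rho>"
        then have "b y = m" by (simp add: b_def power2_norm_eq_inner[symmetric])
        then show False using m[OF *] y by simp
      qed
      then have ny: "norm y < \<rho>" using y by simp
      define r where "r = \<rho> - norm y"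
      have r: "r > 0" "ball y r \<subseteq> cball 0 \<rho>"
        using ny unfolding r_def by (auto simp: dist_norm) (smt (verit) norm_triangle_ineq3)
      note sq = mean_square_norm[OF r(1), of y 0] and pos = mean_square_distance_pos[OF r(1), of y]
      have ic: "integrable lborel (\<lambda>z. indicator (ball y r) z * (m + k * \<rho>\<^sup>2))"
        using emeasure_lborel_ball_finite[of y r] by (intro integrable_mult_left integrable_real_indicator) auto
      have isq: "integrable lborel (\<lambda>z. k * (indicator (ball y r) z * ((z - 0) \<bullet> (z - 0))))" using sq(1) by (rule integrable_mult_right)
      have eq: "indicator (ball y r) z * b z = indicator (ball y r) z * (m + k * \<rho>\<^sup>2) - k * (indicator (ball y r) z * ((z - 0) \<bullet> (z - 0)))" for z
        by (simp add: b_def algebra_simps)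
      have "integrable lborel (\<lambda>z. indicator (ball y r) z * b z)"
        unfolding eq using ic isq by (rule Bochner_Integration.integrable_diff)
      moreover have "(\<integral>z. indicator (ball y r) z * b z \<partial>lborel) < b y * measure lborel (ball y r)"
      proof -
        have "(\<integral>z. indicator (ball y r) z * b z \<partial>lborel) = (\<integral>z. indicator (ball y r) z * (m + k * \<rho>\<^sup>2) \<partial>lborel)
          - k * (((y - 0) \<bullet> (y - 0)) * measure lborel (ball y r) + (\<integral>z. indicator (ball y r) z * ((z - y) \<bullet> (z - y)) \<partial>lborel))"
          unfolding eq Bochner_Integration.integral_diff[OF ic isq] integral_mult_right_zero sq(2) by (rule refl)
        moreover
        have "(\<integral>z. indicator (ball y r) z * (m + k * \<rho>\<^sup>2) \<partial>lborel) = (m + k * \<rho>\<^sup>2) * measure lborel (ball y r)"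
          by (subst integral_mult_left_zero) simp
        moreover have "b y * measure lborel (ball y r)
           = (m + k * \<rho>\<^sup>2) * measure lborel (ball y r) - k * (((y - 0) \<bullet> (y - 0)) * measure lborel (ball y r))"
          by (simp add: b_def algebra_simps)
        ultimately show ?thesis using mult_pos_pos[OF k pos(2)] unfolding distrib_left[of k] by linarith
      qed
      ultimately show "\<exists>r>0. ball y r \<subseteq> cball 0 \<rho> \<and> integrable lborel (\<lambda>z. indicator (ball y r) z * b z)
        \<and> (\<integral>z. indicator (ball y r) z * b z \<partial>lborel) < b y * measure lborel (ball y r)" using r by blast
    qed (use x in auto)
    also have "b x \<le> m + \<eta>"
    proof -
      have "k * (\<rho>\<^sup>2 - x \<bullet> x) \<le> k * \<rho>\<^sup>2" using k by (intro mult_left_mono) auto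
      also have "\<dots> = \<eta>" using \<rho> by (simp add: k_def)
      finally show ?thesis by (simp add: b_def)
    qed
    finally show ?thesis by simp
  qed
  then have "\<And>e::real. 0 < e \<Longrightarrow> u x \<le> ereal m + ereal e" by simp
  then show ?thesis by (blast intro: ereal_le_epsilon2)
qed

text \<open>A locally bounded Hessian with nonnegative trace suffices, so the local representations of \<open>f\<close>
  need not be patched by hand.\<close>

lemma subharmonic_local_C2:
  fixes f :: "'a::euclidean_space \<Rightarrow> real"
  assumes loc: "\<And>x. \<exists>r>0. \<exists>g H C. subharmonic_C2_ball f g H x r C"
  shows "subharmonic (\<lambda>x. ereal (f x))"
proof -
  obtain \<rho> g H C where L: "\<And>x. \<rho> x > 0" "\<And>x. subharmonic_C2_ball f (g x) (H x) x (\<rho> x) (C x)" using loc by metis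
  have cont: "continuous_on UNIV f"
    unfolding continuous_on_eq_continuous_within
    using subharmonic_C2_ball.grad[OF L(2)] L(1) has_derivative_continuous centre_in_ball by (metis UNIV_I)
  \<comment> \<open>Derivatives are unique, so the local gradients and Hessians agree on overlaps
    and form global fields. Only the Hessian bounds differ from ball to ball, and a finite cover
    makes them uniform on a given ball.\<close>
  define G where "G y = g y y" for y
  have fG: "(f has_derivative (\<lambda>v. G y \<bullet> v)) (at y)" for y
    using subharmonic_C2_ball.grad[OF L(2), of y y] L(1) by (simp add: G_def)
  have gG: "g x y = G y" if "y \<in> ball x (\<rho> x)" for x y
  proof -
    have "(\<lambda>v. g x y \<bullet> v) = (\<lambda>v. G y \<bullet> v)"
      by (rule has_derivative_unique[OF subharmonic_C2_ball.grad[OF L(2) that] fG])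
    then have "g x y \<bullet> v = G y \<bullet> v" for v by (rule fun_cong)
    then show ?thesis using vector_eq_rdot[of "g x y" "G y"] by (simp add: inner_commute)
  qed
  have GH: "(G has_derivative H x y) (at y)" if "y \<in> ball x (\<rho> x)" for x y
    by (rule has_derivative_transform_within_open[OF subharmonic_C2_ball.hess[OF L(2) that] open_ball that]) (rule gG)
  have HH: "H x y = H y y" if "y \<in> ball x (\<rho> x)" for x y
    by (rule has_derivative_unique[OF GH[OF that] GH]) (use L(1) in auto)
  show ?thesis
    unfolding subharmonic_def
  proof (intro conjI allI impI)
    show "open {x. ereal (f x) < c}" for c
    proof (cases c)
      case (real r)
      then have "{x. ereal (f x) < c} = f -` {..<r}" by auto
      then show ?thesis using open_vimage[OF open_lessThan cont] by simp
    qed auto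
    fix x :: 'a and r :: real assume r: "0 < r"
    obtain F where F: "finite F" "cball x (r + 1) \<subseteq> (\<Union>z\<in>F. ball z (\<rho> z))"
    proof (rule compactE_image[OF compact_cball[of x "r + 1"], of UNIV "\<lambda>z. ball z (\<rho> z)"])
      show "cball x (r + 1) \<subseteq> (\<Union>z\<in>UNIV. ball z (\<rho> z))"
      proof
        fix z show "z \<in> (\<Union>z\<in>UNIV. ball z (\<rho> z))" using L(1)[of z] by (intro UN_I[of z]) auto
      qed
    qed auto
    define K where "K = Max (insert 0 (C ` F))"
    interpret subharmonic_C2_ball f G "\<lambda>y. H y y" x "r + 1" K
    proof
      fix y v assume "y \<in> ball x (r + 1)"
      then obtain z where z: "z \<in> F" "y \<in> ball z (\<rho> z)" using F by force
      have "norm (H z y v) \<le> C z * norm v" by (rule subharmonic_C2_ball.bound[OF L(2) z(2)])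
      also have "\<dots> \<le> K * norm v" using F z by (intro mult_right_mono) (auto simp: K_def)
      finally show "norm (H y y v) \<le> K * norm v" using HH[OF z(2)] by simp
    next
      show "(\<Sum>b\<in>Basis. H y y b \<bullet> b) \<ge> 0" for y
        using subharmonic_C2_ball.trace[OF L(2), of y y] L(1) by simp
    qed (use fG GH L(1) r in auto)
    let ?V = "measure lborel (ball x r)"
    have V: "?V > 0" using r content_ball_gt_0_iff[of x r] by simp
    obtain B where B: "\<And>z. z \<in> cball x r \<Longrightarrow> \<bar>f z\<bar> \<le> B"
      using compact_imp_bounded[OF compact_continuous_image[OF continuous_on_subset[OF cont] compact_cball[of x r]]]
      by (force simp: bounded_iff)
    have int: "integrable lborel (\<lambda>z. indicator (ball x r) z * f z)"
    proof (rule Bochner_Integration.integrable_bound)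
      show "integrable lborel (\<lambda>z. indicator (ball x r) z * B)"
        using emeasure_lborel_ball_finite[of x r] by (intro integrable_mult_left integrable_real_indicator) auto
      show "(\<lambda>z. indicator (ball x r) z * f z) \<in> borel_measurable lborel"
        using borel_measurable_indicator_times[of "ball x r" f] continuous_on_subset[OF cont] by simp
      show "AE z in lborel. norm (indicator (ball x r) z * f z) \<le> norm (indicator (ball x r) z * B)"
      proof (rule AE_I2)
        fix z show "norm (indicator (ball x r) z * f z) \<le> norm (indicator (ball x r) z * B)"
          using B[of z] by (cases "z \<in> ball x r") auto
      qed
    qed
    have "f x * ?V \<le> (\<integral>z. indicator (ball x r) z * f z \<partial>lborel)" using sub_mean_value[of r] r by simp
    then show "ereal (f x) \<le> ext_integral (restrict_space lborel (ball x r)) (\<lambda>x. ereal (f x)) / ereal ?V"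
      unfolding ext_integral_ball_real[OF int] using V by (simp add: field_simps)
  qed auto
qed

section \<open>Capacity and rescaled energies\<close>

text \<open>Turns the difference of two integrals into a single nonnegative integral, so that
  energies can be handled in \<open>ennreal\<close>, with Tonelli and Fatou at hand.\<close>

lemma ext_integral_bounded_above:
  assumes M: "prob_space M" and f[measurable]: "f \<in> borel_measurable M" and le: "AE x in M. f x \<le> ereal A"
  shows "ereal A - ext_integral M f = enn2ereal (\<integral>\<^sup>+x. e2ennreal (ereal A - f x) \<partial>M)"
proof -
  interpret prob_space M by (rule M)
  define J P N where "J = (\<integral>\<^sup>+x. e2ennreal (ereal A - f x) \<partial>M)"
    and "P = (\<integral>\<^sup>+x. e2ennreal (f x) \<partial>M)" and "N = (\<integral>\<^sup>+x. e2ennreal (- f x) \<partial>M)"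
  \<comment> \<open>The pointwise identity behind this splits \<open>A\<close> and \<open>f\<close>
    into positive and negative parts and moves each part to the side where it is added. It also
    holds where \<open>f\<close> is -\<infinity>.\<close>
  have "(\<integral>\<^sup>+x. (e2ennreal (ereal A - f x) + e2ennreal (f x)) + ennreal (- A) \<partial>M)
      = (\<integral>\<^sup>+x. e2ennreal (- f x) + ennreal A \<partial>M)"
  proof (rule nn_integral_cong_AE)
    show "AE x in M. (e2ennreal (ereal A - f x) + e2ennreal (f x)) + ennreal (- A) = e2ennreal (- f x) + ennreal A"
      using le
    proof eventually_elim
      case (elim x)
      show ?case
      proof (cases "f x")
        case (real r)
        have "ennreal (A - r) + ennreal r + ennreal (- A) = ennreal (- r) + ennreal A"
        proof -
          have *: "ennreal a = ennreal (max 0 a)" for a by (simp add: max_def ennreal_neg)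
          have "ennreal (max 0 (A - r)) + ennreal (max 0 r) + ennreal (max 0 (- A))
              = ennreal (max 0 (A - r) + max 0 r + max 0 (- A))" by simp
          also have "max 0 (A - r) + max 0 r + max 0 (- A) = max 0 (- r) + max 0 A"
            using elim real by (auto simp: max_def)
          also have "ennreal (max 0 (- r) + max 0 A) = ennreal (max 0 (- r)) + ennreal (max 0 A)" by simp
          finally show ?thesis unfolding *[symmetric] .
        qed
        then show ?thesis using real by simp
      next
        case MInf
        then show ?thesis by simp
      qed (use elim in simp)
    qed
  qed
  then have eq: "J + P + ennreal (- A) = N + ennreal A"
    unfolding J_def P_def N_def by (simp add: nn_integral_add emeasure_space_1)
  have "P \<le> (\<integral>\<^sup>+x. ennreal A \<partial>M)"
    unfolding P_def
  proof (rule nn_integral_mono_AE)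
    show "AE x in M. e2ennreal (f x) \<le> ennreal A"
      using le by eventually_elim (metis e2ennreal_ereal e2ennreal_mono)
  qed
  also have "\<dots> < \<top>" by (simp add: emeasure_space_1)
  finally have P: "P < \<top>" .
  have fin: "N = \<top> \<longleftrightarrow> J = \<top>"
    using eq P by (metis ennreal_add_eq_top ennreal_neq_top order_less_irrefl)
  show ?thesis
    unfolding ext_integral_def J_def[symmetric] P_def[symmetric] N_def[symmetric]
  proof (cases "N = \<top>")
    case True
    then show "ereal A - (enn2ereal P - enn2ereal N) = enn2ereal J"
      using fin P by (cases P) auto
  next
    case False
    then obtain n j p where r: "N = ennreal n" "n \<ge> 0" "J = ennreal j" "j \<ge> 0" "P = ennreal p" "p \<ge> 0"
      using fin P by (cases N; cases J; cases P) auto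
    have *: "ennreal a = ennreal (max 0 a)" for a by (simp add: max_def ennreal_neg)
    have "j + p + max 0 (- A) = n + max 0 A"
    proof -
      have "ennreal (j + p + max 0 (- A)) = ennreal j + ennreal p + ennreal (- A)"
        using r *[of "- A"] by simp
      also have "\<dots> = ennreal n + ennreal A" using eq r by simp
      also have "\<dots> = ennreal (n + max 0 A)" using r *[of A] by simp
      finally show ?thesis using r by (subst (asm) ennreal_inj) auto
    qed
    then show "ereal A - (enn2ereal P - enn2ereal N) = enn2ereal J"
      using r by (auto simp: max_def split: if_splits)
  qed
qed

text \<open>The negated kernel with negative values clipped to 0 and the value \<infinity> on the
  diagonal. Clipping loses nothing for arguments up to 1, which is why distances are always divided
  by a bound on the diameter first.\<close>

definition kk :: "nat \<Rightarrow> real \<Rightarrow> ennreal" where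
  "kk d t = e2ennreal (- cap_kernel d t)"

lemma kk_pos: "t > 0 \<Longrightarrow> kk d t = ennreal (kr d t)"
  by (simp add: kk_def cap_kernel_eq)

lemma kk_0 [simp]: "kk d 0 = \<top>"
  by (simp add: kk_def cap_kernel_def)

lemma kk_antimono: "0 \<le> s \<Longrightarrow> s \<le> t \<Longrightarrow> kk d t \<le> kk d s"
  using kr_antimono[of s t d] by (cases "s = 0") (auto simp: kk_pos ennreal_leI)

lemma cap_kernel_measurable [measurable]: "cap_kernel d \<in> borel_measurable borel"
  unfolding cap_kernel_def by measurable

lemma kk_measurable [measurable]: "kk d \<in> borel_measurable borel"
  unfolding kk_def by measurable

text \<open>Rescaling is additive for the logarithmic and multiplicative for the Newtonian kernel; the
  constants \<open>scA\<close> and \<open>scB\<close> treat both cases at once.\<close>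

definition scA :: "nat \<Rightarrow> real \<Rightarrow> real" where "scA d L = (if d = 2 then ln L else 0)"
definition scB :: "nat \<Rightarrow> real \<Rightarrow> real" where "scB d L = (if d = 2 then 1 else L ^ (d - 2))"

lemma kr_scale: "L > 0 \<Longrightarrow> t > 0 \<Longrightarrow> kr d (t / L) = scB d L * (scA d L + kr d t)"
  by (auto simp: kr_def scA_def scB_def ln_div power_divide)

lemma scB_pos: "L > 0 \<Longrightarrow> scB d L > 0" by (auto simp: scB_def)

lemma kk_scale: 
  assumes "L > 0" "t \<ge> 0"
  shows "kk d (t / L) = ennreal (scB d L) * e2ennreal (ereal (scA d L) - cap_kernel d t)"
proof (cases "t = 0")
  case True
  then show ?thesis using scB_pos[OF assms(1), of d]
    by (simp add: cap_kernel_def ennreal_mult_top)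
next
  case False
  then show ?thesis using assms scB_pos[OF assms(1), of d]
    by (simp add: kk_pos cap_kernel_eq kr_scale ennreal_mult')
qed

lemma cap_kernel_le_scA: "0 \<le> t \<Longrightarrow> t \<le> L \<Longrightarrow> L > 0 \<Longrightarrow> cap_kernel d t \<le> ereal (scA d L)"
  by (auto simp: cap_kernel_def scA_def)

definition borel_prob_on :: "'a::euclidean_space set \<Rightarrow> 'a measure \<Rightarrow> bool" where
  "borel_prob_on K \<mu> \<longleftrightarrow> prob_space \<mu> \<and> sets \<mu> = sets borel \<and> emeasure \<mu> K = 1"

definition kk_energy :: "real \<Rightarrow> 'a::euclidean_space measure \<Rightarrow> ennreal" where
  "kk_energy L \<mu> = (\<integral>\<^sup>+y. \<integral>\<^sup>+x. kk DIM('a) (norm (x - y) / L) \<partial>\<mu> \<partial>\<mu>)"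

lemma borel_prob_on_AE:
  assumes "borel_prob_on K \<mu>" "closed K"
  shows "AE x in \<mu>. x \<in> K"
proof -
  interpret prob_space \<mu> using assms by (simp add: borel_prob_on_def)
  have "K \<in> sets \<mu>" using assms by (simp add: borel_prob_on_def borel_closed)
  then show ?thesis using assms by (intro AE_prob_1) (simp add: borel_prob_on_def measure_def)
qed

text \<open>Both energies are expressed through \<open>J\<close>, which is infinite exactly when the
  energy is -\<infinity>; no subtraction of infinities occurs.\<close>

lemma energy_kk_energy:
  fixes \<mu> :: "'a::euclidean_space measure"
  assumes \<mu>: "borel_prob_on K \<mu>" and K: "closed K" and L: "L > 0"
    and diam: "\<And>x y. x \<in> K \<Longrightarrow> y \<in> K \<Longrightarrow> norm (x - y) \<le> L"
  obtains J where "ereal (scA DIM('a) L) - energy \<mu> = enn2ereal J" "kk_energy L \<mu> = ennreal (scB DIM('a) L) * J"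
proof -
  interpret prob_space \<mu> using \<mu> by (simp add: borel_prob_on_def)
  have sets[measurable_cong, simp]: "sets \<mu> = sets borel" using \<mu> by (simp add: borel_prob_on_def)
  let ?d = "DIM('a)"
  let ?A = "ereal (scA ?d L)"
  have AEK: "AE x in \<mu>. x \<in> K" by (rule borel_prob_on_AE[OF \<mu> K])
  define G where "G y = ext_integral \<mu> (\<lambda>x. cap_kernel ?d (norm (x - y)))" for y
  define p where "p y = (\<integral>\<^sup>+x. e2ennreal (?A - cap_kernel ?d (norm (x - y))) \<partial>\<mu>)" for y
  have Gp: "?A - G y = enn2ereal (p y)" if y: "y \<in> K" for y
    unfolding G_def p_def
  proof (rule ext_integral_bounded_above)
    show "AE x in \<mu>. cap_kernel ?d (norm (x - y)) \<le> ?A"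
      using AEK by eventually_elim (use diam y L in \<open>auto intro: cap_kernel_le_scA\<close>)
  qed (auto intro: prob_space_axioms)
  have GA: "G y \<le> ?A" if "y \<in> K" for y
  proof -
    have "0 \<le> ?A - G y" using Gp[OF that] by simp
    then show ?thesis by (cases "G y") auto
  qed
  have Gm: "G \<in> borel_measurable \<mu>"
    unfolding G_def ext_integral_def by measurable
  have "?A - ext_integral \<mu> G = enn2ereal (\<integral>\<^sup>+y. e2ennreal (?A - G y) \<partial>\<mu>)"
    by (rule ext_integral_bounded_above[OF prob_space_axioms Gm]) (use AEK in eventually_elim, rule GA)
  also have "(\<integral>\<^sup>+y. e2ennreal (?A - G y) \<partial>\<mu>) = (\<integral>\<^sup>+y. p y \<partial>\<mu>)"
    by (rule nn_integral_cong_AE, use AEK in eventually_elim) (simp add: Gp)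
  finally have 1: "?A - energy \<mu> = enn2ereal (\<integral>\<^sup>+y. p y \<partial>\<mu>)"
    unfolding energy_def G_def .
  have "kk_energy L \<mu> = (\<integral>\<^sup>+y. \<integral>\<^sup>+x. ennreal (scB ?d L) * e2ennreal (?A - cap_kernel ?d (norm (x - y))) \<partial>\<mu> \<partial>\<mu>)"
    unfolding kk_energy_def using L by (simp add: kk_scale)
  also have "\<dots> = (\<integral>\<^sup>+y. ennreal (scB ?d L) * p y \<partial>\<mu>)"
    unfolding p_def by (intro nn_integral_cong nn_integral_cmult) measurable
  also have "\<dots> = ennreal (scB ?d L) * (\<integral>\<^sup>+y. p y \<partial>\<mu>)"
    unfolding p_def by (intro nn_integral_cmult) measurable
  finally show ?thesis using 1 that by blast
qed

text \<open>The bridge between the definition of capacity and nonnegative energies: both strict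
  inequalities compare \<open>J\<close> with the same number.\<close>

lemma energy_gt_iff:
  fixes \<mu> :: "'a::euclidean_space measure"
  assumes \<mu>: "borel_prob_on K \<mu>" and K: "closed K" and L: "L > 0"
    and diam: "\<And>x y. x \<in> K \<Longrightarrow> y \<in> K \<Longrightarrow> norm (x - y) \<le> L" and c: "c > 0"
  shows "energy \<mu> > ereal (- kr DIM('a) c) \<longleftrightarrow> kk_energy L \<mu> < ennreal (kr DIM('a) (c / L))"
proof -
  obtain J where J: "ereal (scA DIM('a) L) - energy \<mu> = enn2ereal J" "kk_energy L \<mu> = ennreal (scB DIM('a) L) * J"
    by (rule energy_kk_energy[OF \<mu> K L diam])
  let ?A = "scA DIM('a) L" and ?B = "scB DIM('a) L" and ?k = "kr DIM('a) c"
  have B: "?B > 0" by (rule scB_pos[OF L])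
  show ?thesis
  proof (cases J)
    case (real j)
    then have e: "energy \<mu> = ereal (?A - j)" using J(1) by (cases "energy \<mu>") auto
    have "kk_energy L \<mu> = ennreal (?B * j)" using J(2) real B by (simp add: ennreal_mult')
    then have "kk_energy L \<mu> < ennreal (kr DIM('a) (c / L)) \<longleftrightarrow> ?B * j < ?B * (?A + ?k)"
      using kr_scale[OF L c, of "DIM('a)"] B real by (simp add: ennreal_less_iff)
    also have "\<dots> \<longleftrightarrow> j < ?A + ?k" using B by simp
    finally show ?thesis using e by auto
  next
    case top
    then have "energy \<mu> = -\<infinity>" using J(1) by (cases "energy \<mu>") auto
    moreover have "kk_energy L \<mu> = \<top>" using J(2) top B by (simp add: ennreal_mult_top)
    ultimately show ?thesis by simp
  qed
qed

lemma max_energy_borel_prob_on: "max_energy K = (SUP \<mu>\<in>{\<mu>. borel_prob_on K \<mu>}. energy \<mu>)"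
  by (simp add: max_energy_def borel_prob_on_def)

lemma powr_minus_inverse_exponent:
  assumes "r > 0" "d \<ge> 3"
  shows "(1 / r ^ (d - 2)) powr (- (1 / (real d - 2))) = r"
proof -
  have "1 / r ^ (d - 2) = r powr (- real (d - 2))" using assms by (simp only: powr_minus_divide powr_realpow)
  then have "(1 / r ^ (d - 2)) powr (- (1 / (real d - 2))) = r powr (- real (d - 2) * - (1 / (real d - 2)))"
    by (simp add: powr_powr)
  also have "- real (d - 2) * - (1 / (real d - 2)) = 1" using assms by (simp add: of_nat_diff field_simps)
  finally show ?thesis using assms by simp
qed

lemma compact_capacity_gt_imp:
  fixes K :: "'a::euclidean_space set"
  assumes d: "DIM('a) \<ge> 2" and c: "c > 0" and cap: "compact_capacity K > c"
  obtains \<mu> where "borel_prob_on K \<mu>" "energy \<mu> > ereal (- kr DIM('a) c)"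
proof -
  let ?d = "DIM('a)"
  have "max_energy K > ereal (- kr ?d c)"
  proof (rule ccontr)
    assume "\<not> ?thesis"
    then have le: "max_energy K \<le> ereal (- kr ?d c)" by simp
    have "compact_capacity K \<le> c"
    proof (cases "max_energy K")
      case (real v)
      then have v: "v \<le> - kr ?d c" using le by simp
      show ?thesis
      proof (cases "?d = 2")
        case True
        then have "exp v \<le> exp (ln c)" using v by (simp add: kr_def)
        then show ?thesis using True real c by (simp add: compact_capacity_def)
      next
        case False
        then have 1: "1 / c ^ (?d - 2) \<le> - v" using v by (simp add: kr_def)
        have "(- v) powr (- (1 / (real ?d - 2))) \<le> (1 / c ^ (?d - 2)) powr (- (1 / (real ?d - 2)))"
          using c 1 d False by (intro powr_mono2') auto
        also have "\<dots> = c" using False d c by (intro powr_minus_inverse_exponent) auto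
        finally show ?thesis using False real by (simp add: compact_capacity_def)
      qed
    qed (use le c in \<open>auto simp: compact_capacity_def\<close>)
    then show False using cap by simp
  qed
  then show ?thesis using that unfolding max_energy_borel_prob_on less_SUP_iff by auto
qed

section \<open>Capacity versus diameter, and passing between capacities and measures\<close>

lemma max_energy_le_diam:
  fixes K :: "'a::euclidean_space set"
  assumes K: "closed K" and L: "L > 0" and diam: "\<And>x y. x \<in> K \<Longrightarrow> y \<in> K \<Longrightarrow> norm (x - y) \<le> L"
  shows "max_energy K \<le> ereal (- kr DIM('a) L)"
  unfolding max_energy_borel_prob_on
proof (rule SUP_least, rule ccontr)
  fix \<mu> :: "'a measure" assume "\<mu> \<in> {\<mu>. borel_prob_on K \<mu>}" and "\<not> energy \<mu> \<le> ereal (- kr DIM('a) L)"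
  then have \<mu>: "borel_prob_on K \<mu>" and e: "energy \<mu> > ereal (- kr DIM('a) L)" by auto
  interpret prob_space \<mu> using \<mu> by (simp add: borel_prob_on_def)
  have "kk_energy L \<mu> < ennreal (kr DIM('a) 1)"
    using e energy_gt_iff[OF \<mu> K L diam L] L by simp
  moreover have "ennreal (kr DIM('a) 1) \<le> kk_energy L \<mu>"
  proof -
    have AEK: "AE x in \<mu>. x \<in> K" by (rule borel_prob_on_AE[OF \<mu> K])
    have "ennreal (kr DIM('a) 1) = (\<integral>\<^sup>+y. \<integral>\<^sup>+x. ennreal (kr DIM('a) 1) \<partial>\<mu> \<partial>\<mu>)"
      by (simp add: emeasure_space_1)
    also have "\<dots> \<le> kk_energy L \<mu>"
      unfolding kk_energy_def
    proof (rule nn_integral_mono_AE, use AEK in eventually_elim)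
      fix y assume y: "y \<in> K"
      show "(\<integral>\<^sup>+x. ennreal (kr DIM('a) 1) \<partial>\<mu>) \<le> (\<integral>\<^sup>+x. kk DIM('a) (norm (x - y) / L) \<partial>\<mu>)"
      proof (rule nn_integral_mono_AE, use AEK in eventually_elim)
        fix x assume x: "x \<in> K"
        show "ennreal (kr DIM('a) 1) \<le> kk DIM('a) (norm (x - y) / L)"
          using kk_antimono[of "norm (x - y) / L" 1 "DIM('a)"] diam[OF x y] L by (simp add: kk_pos)
      qed
    qed
    finally show ?thesis .
  qed
  ultimately show False by simp
qed

text \<open>A crude bound, but it makes the real supremum in \<open>capacity\<close> one over a
  bounded set.\<close>

lemma compact_capacity_le_diam:
  fixes K :: "'a::euclidean_space set"
  assumes d: "DIM('a) \<ge> 2" and K: "closed K" and L: "L > 0" and diam: "\<And>x y. x \<in> K \<Longrightarrow> y \<in> K \<Longrightarrow> norm (x - y) \<le> L"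
  shows "compact_capacity K \<le> L"
proof (rule ccontr)
  assume "\<not> compact_capacity K \<le> L"
  then obtain \<mu> where "borel_prob_on K \<mu>" "energy \<mu> > ereal (- kr DIM('a) L)"
    using compact_capacity_gt_imp[OF d L, of K] by auto
  then have "max_energy K > ereal (- kr DIM('a) L)"
    unfolding max_energy_borel_prob_on by (auto simp: less_SUP_iff)
  then show False using max_energy_le_diam[OF K L diam] by simp
qed

lemma compact_capacity_ge:
  fixes K :: "'a::euclidean_space set"
  assumes d: "DIM('a) \<ge> 2" and K: "closed K" and L: "L > 0" and diam: "\<And>x y. x \<in> K \<Longrightarrow> y \<in> K \<Longrightarrow> norm (x - y) \<le> L"
    and c: "c > 0" and \<mu>: "borel_prob_on K \<mu>" and e: "kk_energy L \<mu> < ennreal (kr DIM('a) (c / L))"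
  shows "compact_capacity K \<ge> c"
proof -
  let ?d = "DIM('a)"
  have "energy \<mu> > ereal (- kr ?d c)" using e energy_gt_iff[OF \<mu> K L diam c] by simp
  moreover have "energy \<mu> \<le> max_energy K"
    unfolding max_energy_borel_prob_on using \<mu> by (intro SUP_upper) auto
  ultimately have 1: "max_energy K > ereal (- kr ?d c)" by simp
  \<comment> \<open>The diameter bound excludes the value \<infinity> and, for
    \<open>d \<ge> 3\<close>, makes \<open>- v\<close> positive, so that the power below is
    antitone.\<close>
  moreover note max_energy_le_diam[OF K L diam]
  ultimately obtain v where v: "max_energy K = ereal v" "- kr ?d c < v" "v \<le> - kr ?d L"
    by (cases "max_energy K") auto
  show ?thesis
  proof (cases "?d = 2")
    case True
    then have "exp (ln c) \<le> exp v" using v by (simp add: kr_def)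
    then show ?thesis using True v c by (simp add: compact_capacity_def)
  next
    case False
    then have 2: "- v \<le> 1 / c ^ (?d - 2)" "- v \<ge> 1 / L ^ (?d - 2)" using v by (simp_all add: kr_def)
    have "1 / L ^ (?d - 2) > 0" using L by simp
    then have "- v > 0" using 2 by linarith
    then have "(1 / c ^ (?d - 2)) powr (- (1 / (real ?d - 2))) \<le> (- v) powr (- (1 / (real ?d - 2)))"
      using c 2 d False by (intro powr_mono2') auto
    moreover have "(1 / c ^ (?d - 2)) powr (- (1 / (real ?d - 2))) = c"
      using False d c by (intro powr_minus_inverse_exponent) auto
    ultimately show ?thesis using False v by (simp add: compact_capacity_def)
  qed
qed

lemma capacity_ge:
  fixes A K :: "'a::euclidean_space set"
  assumes d: "DIM('a) \<ge> 2" and K: "compact K" "K \<subseteq> A" and A: "A \<subseteq> ball x r"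
    and c: "c > 0" and \<mu>: "borel_prob_on K \<mu>" and e: "kk_energy (2 * r) \<mu> < ennreal (kr DIM('a) (c / (2 * r)))"
  shows "capacity A \<ge> c"
proof -
  have "K \<noteq> {}" using \<mu> by (auto simp: borel_prob_on_def)
  then have r: "r > 0" using K A by (metis ball_eq_empty not_le order_trans subset_empty)
  have diam: "norm (y - z) \<le> 2 * r" if "y \<in> ball x r" "z \<in> ball x r" for y z
    using that norm_triangle_ineq4[of "y - x" "z - x"] by (simp add: dist_norm norm_minus_commute)
  have bdd: "bdd_above (compact_capacity ` {K. compact K \<and> K \<subseteq> A})"
  proof (rule bdd_aboveI2)
    fix K' :: "'a set" assume "K' \<in> {K. compact K \<and> K \<subseteq> A}"
    then show "compact_capacity K' \<le> 2 * r"
      using A r by (intro compact_capacity_le_diam[OF d]) (auto intro!: compact_imp_closed diam)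
  qed
  have "c \<le> compact_capacity K"
    by (rule compact_capacity_ge[OF d compact_imp_closed[OF K(1)] _ _ c \<mu> e]) (use r K A in \<open>auto intro!: diam\<close>)
  also have "\<dots> \<le> capacity A"
    unfolding capacity_def by (rule cSUP_upper[OF _ bdd]) (use K in auto)
  finally show ?thesis .
qed

text \<open>The estimate is given for all large \<open>L\<close> at once, so that measures from
  different cells can be used at one common scale.\<close>

lemma capacity_gt_imp:
  fixes A :: "'a::euclidean_space set"
  assumes d: "DIM('a) \<ge> 2" and c: "c > 0" and A: "A \<subseteq> ball x r" and cap: "capacity A > c"
  obtains K \<mu> where "compact K" "K \<subseteq> A" "borel_prob_on K \<mu>"
    "\<And>L. L \<ge> 2 * r \<Longrightarrow> kk_energy L \<mu> < ennreal (kr DIM('a) (c / L))"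
proof -
  let ?S = "compact_capacity ` {K. compact K \<and> K \<subseteq> A}"
  have "\<exists>K. compact K \<and> K \<subseteq> A \<and> compact_capacity K > c"
  proof (rule ccontr)
    assume *: "\<not> ?thesis"
    have "capacity A \<le> c"
      unfolding capacity_def by (rule cSUP_least) (use * in \<open>auto intro: exI[of _ "{}"] simp: not_less\<close>)
    then show False using cap by simp
  qed
  then obtain K where K: "compact K" "K \<subseteq> A" "compact_capacity K > c" by auto
  obtain \<mu> where \<mu>: "borel_prob_on K \<mu>" "energy \<mu> > ereal (- kr DIM('a) c)"
    by (rule compact_capacity_gt_imp[OF d c K(3)])
  have "K \<noteq> {}" using \<mu> by (auto simp: borel_prob_on_def)
  then have r: "r > 0" using K A by (metis ball_eq_empty not_le order_trans subset_empty)
  have diam: "norm (y - z) \<le> 2 * r" if "y \<in> ball x r" "z \<in> ball x r" for y z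
    using that norm_triangle_ineq4[of "y - x" "z - x"] by (simp add: dist_norm norm_minus_commute)
  have "kk_energy L \<mu> < ennreal (kr DIM('a) (c / L))" if L: "L \<ge> 2 * r" for L
  proof -
    have "norm (y - z) \<le> L" if "y \<in> K" "z \<in> K" for y z
      using diam[of y z] that K(2) A L by (meson order_trans subsetD)
    then show ?thesis
      using energy_gt_iff[OF \<mu>(1) compact_imp_closed[OF K(1)] _ _ c, of L] \<mu>(2) L r by auto
  qed
  then show ?thesis using that K \<mu> by blast
qed

section \<open>Decay of subharmonic functions near their zero sets\<close>

lemma kr_at_0:
  assumes d: "d \<ge> 2" shows "\<exists>s>0. kr d s > c"
proof (cases "d = 2")
  case True
  then show ?thesis by (intro exI[of _ "exp (- (\<bar>c\<bar> + 1))"]) (auto simp: kr_def)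
next
  case False
  define s where "s = 1 / (\<bar>c\<bar> + 1)"
  have s: "s > 0" "s \<le> 1" by (auto simp: s_def)
  have "s ^ (d - 2) \<le> s ^ 1" using s False d by (intro power_decreasing) auto
  then have "1 / s \<le> 1 / s ^ (d - 2)" using s by (intro divide_left_mono) auto
  then have "kr d s > c" using False by (simp add: kr_def s_def)
  then show ?thesis using s by blast
qed

lemma kr_isCont: "t > 0 \<Longrightarrow> isCont (kr d) t"
  unfolding kr_def by (cases "d = 2") (auto intro!: continuous_intros)

text \<open>The kernel is nonincreasing in the distance, so lower semicontinuity only needs one
  slightly larger distance with the same lower bound.\<close>

lemma kk_lower_semicontinuous:
  assumes d: "d \<ge> 2" and t: "t \<ge> 0" and c: "c < kk d t"
  shows "\<exists>s>t. c < kk d s"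
proof (cases "t = 0")
  case True
  have "c < \<top>" using c by (auto simp: less_top[symmetric])
  then obtain r where r: "c = ennreal r" "r \<ge> 0" by (cases c) auto
  obtain s where "s > 0" "kr d s > r" using kr_at_0[OF d] by blast
  then show ?thesis using True r by (intro exI[of _ s]) (auto simp: kk_pos ennreal_less_iff)
next
  case False
  then have t: "t > 0" using t by simp
  then obtain r where r: "c = ennreal r" "r \<ge> 0" "r < kr d t"
    using c by (cases c) (auto simp: kk_pos ennreal_less_iff)
  have "(kr d \<longlongrightarrow> kr d t) (at_right t)"
    using kr_isCont[OF t, of d] unfolding isCont_def by (rule tendsto_mono[rotated]) (simp add: at_le)
  then have "eventually (\<lambda>s. r < kr d s) (at_right t)" using r(3) by (rule order_tendstoD)
  moreover have "eventually (\<lambda>s. s > t) (at_right t)" by (simp add: eventually_at_right_less)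
  ultimately have "eventually (\<lambda>s. s > t \<and> r < kr d s) (at_right t)" by eventually_elim auto
  then obtain s where "s > t" "r < kr d s"
    using eventually_happens[of _ "at_right t"] trivial_limit_at_right_real by blast
  then show ?thesis using r t by (intro exI[of _ s]) (auto simp: kk_pos ennreal_less_iff)
qed

text \<open>By Fatou's lemma the potential inherits lower semicontinuity from the nonnegative
  kernel.\<close>

lemma closed_potential_sublevel:
  fixes \<mu> :: "'a::euclidean_space measure"
  assumes d: "d \<ge> 2" and L: "L > 0" and sets[measurable_cong]: "sets \<mu> = sets borel"
  shows "closed {y. (\<integral>\<^sup>+x. kk d (norm (x - y) / L) \<partial>\<mu>) \<le> c}"
  unfolding closed_sequential_limits
proof (intro allI impI, elim conjE)
  fix Y y assume Y: "\<forall>n. Y n \<in> {y. (\<integral>\<^sup>+x. kk d (norm (x - y) / L) \<partial>\<mu>) \<le> c}" and lim: "Y \<longlonglongrightarrow> y"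
  have "(\<integral>\<^sup>+x. kk d (norm (x - y) / L) \<partial>\<mu>) \<le> (\<integral>\<^sup>+x. liminf (\<lambda>n. kk d (norm (x - Y n) / L)) \<partial>\<mu>)"
  proof (rule nn_integral_mono)
    fix x
    show "kk d (norm (x - y) / L) \<le> liminf (\<lambda>n. kk d (norm (x - Y n) / L))"
      unfolding le_Liminf_iff
    proof (intro allI impI)
      fix a assume "a < kk d (norm (x - y) / L)"
      then obtain s where s: "s > norm (x - y) / L" "a < kk d s"
        using kk_lower_semicontinuous[OF d, of "norm (x - y) / L" a] L by auto
      have "(\<lambda>n. norm (x - Y n) / L) \<longlonglongrightarrow> norm (x - y) / L"
        by (intro tendsto_intros lim) (use L in auto)
      then have "eventually (\<lambda>n. norm (x - Y n) / L < s) sequentially" using s(1) by (rule order_tendstoD)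
      then show "eventually (\<lambda>n. a < kk d (norm (x - Y n) / L)) sequentially"
      proof eventually_elim
        case (elim n)
        then have "kk d s \<le> kk d (norm (x - Y n) / L)" using L by (intro kk_antimono) auto
        with s(2) show ?case by (rule less_le_trans)
      qed
    qed
  qed
  also have "\<dots> \<le> liminf (\<lambda>n. \<integral>\<^sup>+x. kk d (norm (x - Y n) / L) \<partial>\<mu>)"
    by (rule nn_integral_liminf) measurable
  also have "\<dots> \<le> liminf (\<lambda>n::nat. c)"
    using Y by (intro Liminf_mono) auto
  finally show "y \<in> {y. (\<integral>\<^sup>+x. kk d (norm (x - y) / L) \<partial>\<mu>) \<le> c}" by (simp add: Liminf_const)
qed

section \<open>Potentials of the truncated kernel\<close>

lemma prof_measurable [measurable]: "prof d \<in> borel_measurable borel"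
  unfolding prof_def kap_def by measurable

lemma abs_prof1_le:
  assumes "0 < s0" "s0 \<le> s" shows "\<bar>prof1 d s\<bar> \<le> s0 powr (- (real d / 2))"
proof -
  have "prof1 d s \<ge> - (s powr (- (real d / 2)))"
  proof (cases "s < 1")
    case True
    then have "real d / 2 * s \<le> real d / 2 * 1" by (intro mult_left_mono) auto
    then show ?thesis using True by (simp add: prof1_def)
  qed (simp add: prof1_def)
  moreover have "s powr (- (real d / 2)) \<le> s0 powr (- (real d / 2))" using assms by (intro powr_mono2') auto
  ultimately show ?thesis using prof1_nonpos[of s d] assms by auto
qed

text \<open>Subtracting \<open>\<kappa> * ((w - y) \<bullet> (w - y))\<close> keeps track of how
  positive the Laplacian is: the sub-mean-value inequality of the difference is one for the kernel
  with a surplus of \<kappa> times the integral of the squared distance.\<close>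

lemma truncated_kernel_C2:
  fixes y z :: "'a::euclidean_space"
  assumes d: "DIM('a) = d" "d \<ge> 2" and \<rho>: "\<rho> > 0" and \<kappa>: "\<kappa> \<ge> 0" and r': "r' > 0"
    and away: "\<And>w. w \<in> ball y r' \<Longrightarrow> norm (w - z) \<ge> r'"
    and lap: "\<And>w. w \<in> ball y r' \<Longrightarrow> (2 * real d + (real d)\<^sup>2) * max 0 (1 - ((w - z) \<bullet> (w - z)) / \<rho>\<^sup>2) / \<rho>\<^sup>2 \<ge> 2 * real d * \<kappa>"
  shows "\<exists>g H C. subharmonic_C2_ball (\<lambda>w. prof d (((w - z) \<bullet> (w - z)) / \<rho>\<^sup>2) - \<kappa> * ((w - y) \<bullet> (w - y))) g H y r' C"
proof -
  define p where "p s = prof d (s / \<rho>\<^sup>2)" for s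
  define p1 where "p1 s = prof1 d (s / \<rho>\<^sup>2) / \<rho>\<^sup>2" for s
  define p2 where "p2 s = prof2 d (s / \<rho>\<^sup>2) / \<rho>\<^sup>2 / \<rho>\<^sup>2" for s
  have \<rho>2: "\<rho>\<^sup>2 > 0" using \<rho> by simp
  have lin: "((\<lambda>s. s / \<rho>\<^sup>2) has_real_derivative 1 / \<rho>\<^sup>2) (at s)" for s
    by (rule DERIV_cdivide[OF DERIV_ident])
  have p: "(p has_real_derivative p1 s) (at s)" if "s > 0" for s
    using DERIV_chain2[OF prof_has_derivative[OF d(2)] lin, of s] that \<rho>2 by (simp add: p_def[abs_def] p1_def)
  have p1: "(p1 has_real_derivative p2 s) (at s)" if "s > 0" for s
    using DERIV_cdivide[OF DERIV_chain2[OF prof1_has_derivative lin, of s], of _ "\<rho>\<^sup>2"] that \<rho>2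
    by (simp add: p1_def[abs_def] p2_def)
  define S where "S w = (w - z) \<bullet> (w - z)" for w
  have Spos: "S w \<ge> r'\<^sup>2" "S w > 0" if "w \<in> ball y r'" for w
  proof -
    have "S w = (norm (w - z))\<^sup>2" by (simp add: S_def power2_norm_eq_inner)
    moreover have "r'\<^sup>2 \<le> (norm (w - z))\<^sup>2" using away[OF that] r' by (intro power_mono) auto
    ultimately show "S w \<ge> r'\<^sup>2" by simp
    then show "S w > 0" using r' by (smt (verit) zero_less_power)
  qed
  define g where "g w = (2 * p1 ((w - z) \<bullet> (w - z))) *\<^sub>R (w - z) - (2 * \<kappa>) *\<^sub>R (w - y)" for w
  define H where "H w v = ((4 * p2 (S w) * ((w - z) \<bullet> v)) *\<^sub>R (w - z) + (2 * p1 (S w)) *\<^sub>R v) - (2 * \<kappa>) *\<^sub>R v" for w v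
  define P where "P = ((r' / \<rho>)\<^sup>2) powr (- (real d / 2)) / \<rho>\<^sup>2"
  define C where "C = (2 * real d + (real d)\<^sup>2) / \<rho>\<^sup>2 + 2 * real d * P + 2 * P + 2 * \<kappa>"
  have trace_eq: "4 * p2 s * s + 2 * real d * p1 s = (2 * real d + (real d)\<^sup>2) * max 0 (1 - s / \<rho>\<^sup>2) / \<rho>\<^sup>2" if "s > 0" for s
  proof -
    have "4 * p2 s * s + 2 * real d * p1 s = (4 * prof2 d (s / \<rho>\<^sup>2) * (s / \<rho>\<^sup>2) + 2 * real d * prof1 d (s / \<rho>\<^sup>2)) / \<rho>\<^sup>2"
      by (simp add: p1_def p2_def add_divide_distrib)
    also have "\<dots> = (2 * real d + (real d)\<^sup>2) * max 0 (1 - s / \<rho>\<^sup>2) / \<rho>\<^sup>2"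
      using that \<rho>2 by (subst prof_laplacian) auto
    finally show ?thesis .
  qed
  have "subharmonic_C2_ball (\<lambda>w. p ((w - z) \<bullet> (w - z)) - \<kappa> * ((w - y) \<bullet> (w - y))) g H y r' C"
  proof
    fix w assume w: "w \<in> ball y r'"
    note Sw = Spos[OF w]
    have "((\<lambda>w. \<kappa> * ((w - y) \<bullet> (w - y))) has_derivative (\<lambda>v. ((2 * \<kappa>) *\<^sub>R (w - y)) \<bullet> v)) (at w)"
      by (auto intro!: derivative_eq_intros simp: inner_commute)
    from has_derivative_diff[OF radial_has_derivative[OF p[OF Sw(2), unfolded S_def]] this]
    show "((\<lambda>w. p ((w - z) \<bullet> (w - z)) - \<kappa> * ((w - y) \<bullet> (w - y))) has_derivative (\<lambda>v. g w \<bullet> v)) (at w)"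
      by (simp add: g_def inner_diff_left)
    have "((\<lambda>w. (2 * \<kappa>) *\<^sub>R (w - y)) has_derivative (\<lambda>v. (2 * \<kappa>) *\<^sub>R v)) (at w)"
      by (auto intro!: derivative_eq_intros)
    from has_derivative_diff[OF radial_gradient_has_derivative[OF p1[OF Sw(2), unfolded S_def]] this]
    show "(g has_derivative H w) (at w)"
      by (simp add: g_def[abs_def] H_def[abs_def] S_def)
    have P1: "\<bar>p1 (S w)\<bar> \<le> P"
    proof -
      have "\<bar>prof1 d (S w / \<rho>\<^sup>2)\<bar> \<le> ((r' / \<rho>)\<^sup>2) powr (- (real d / 2))"
        using Sw \<rho> r' by (intro abs_prof1_le) (auto simp: power_divide divide_right_mono)
      then show ?thesis using \<rho>2 by (simp add: p1_def P_def divide_right_mono)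
    qed
    have p2pos: "p2 (S w) \<ge> 0" using prof2_nonneg[of "S w / \<rho>\<^sup>2" d] Sw \<rho>2 by (simp add: p2_def)
    \<comment> \<open>The second-derivative term of the Hessian is not estimated directly;
      \<open>trace_eq\<close> expresses it through \<open>p1\<close> and the bounded
      Laplacian.\<close>
    have "max 0 (1 - S w / \<rho>\<^sup>2) \<le> 1" using Sw \<rho>2 by simp
    then have "(2 * real d + (real d)\<^sup>2) * max 0 (1 - S w / \<rho>\<^sup>2) / \<rho>\<^sup>2 \<le> (2 * real d + (real d)\<^sup>2) * 1 / \<rho>\<^sup>2"
      by (intro divide_right_mono mult_left_mono) auto
    then have "4 * p2 (S w) * S w + 2 * real d * p1 (S w) \<le> (2 * real d + (real d)\<^sup>2) / \<rho>\<^sup>2"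
      using trace_eq[OF Sw(2)] by simp
    moreover have "2 * real d * (- p1 (S w)) \<le> 2 * real d * P" using P1 by (intro mult_left_mono) auto
    ultimately have "4 * p2 (S w) * S w \<le> (2 * real d + (real d)\<^sup>2) / \<rho>\<^sup>2 + 2 * real d * P"
      by (simp only: mult_minus_right)
    moreover have "4 * \<bar>p2 (S w)\<bar> * S w = 4 * p2 (S w) * S w" using p2pos by simp
    ultimately have hb: "4 * \<bar>p2 (S w)\<bar> * S w + 2 * \<bar>p1 (S w)\<bar> + 2 * \<kappa> \<le> C"
      using P1 unfolding C_def by linarith
    show "norm (H w v) \<le> C * norm v" for v
    proof -
      have "norm (H w v) \<le> (4 * \<bar>p2 (S w)\<bar> * S w + 2 * \<bar>p1 (S w)\<bar>) * norm v + 2 * \<kappa> * norm v"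
        unfolding H_def S_def
        using norm_triangle_ineq4[of _ "(2 * \<kappa>) *\<^sub>R v"] radial_hessian_bound[of "p2 ((w - z) \<bullet> (w - z))" "w - z" v "p1 ((w - z) \<bullet> (w - z))"] \<kappa>
        by (smt (verit) norm_scaleR mult_nonneg_nonneg)
      also have "\<dots> = (4 * \<bar>p2 (S w)\<bar> * S w + 2 * \<bar>p1 (S w)\<bar> + 2 * \<kappa>) * norm v" by (simp add: distrib_right)
      also have "\<dots> \<le> C * norm v" using hb by (rule mult_right_mono) simp
      finally show ?thesis .
    qed
    have "(\<Sum>b\<in>Basis. H w b \<bullet> b) = (\<Sum>b\<in>Basis. ((4 * p2 (S w) * ((w - z) \<bullet> b)) *\<^sub>R (w - z) + (2 * p1 (S w)) *\<^sub>R b) \<bullet> b) - (\<Sum>b\<in>(Basis::'a set). 2 * \<kappa>)"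
      unfolding sum_subtractf[symmetric] by (rule sum.cong) (auto simp: H_def inner_diff_left)
    also have "\<dots> = 4 * p2 (S w) * S w + 2 * real d * p1 (S w) - 2 * real d * \<kappa>"
      unfolding radial_hessian_trace using d(1) by (simp add: S_def)
    finally show "(\<Sum>b\<in>Basis. H w b \<bullet> b) \<ge> 0"
      using trace_eq[OF Sw(2)] lap[OF w] by (simp add: S_def)
  qed (use r' in simp)
  then show ?thesis unfolding p_def by blast
qed

text \<open>The set \<open>A\<close> is the part of \<open>K\<close> where the potential of \<open>\<mu>\<close> is at most \<open>2 * I\<close>; by Markov's
  inequality it carries at least half of the mass, so the potential \<open>\<pi>\<close> of the restriction of \<open>\<mu>\<close> to
  \<open>A\<close> is bounded and still has a large Laplacian. The last inequality is a mean value form of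
  \<open>\<Delta> \<pi> \<ge> d / (32 * R\<^sup>2)\<close> on \<open>ball a R - A\<close> that avoids differentiating under the integral.\<close>

lemma cell_potential:
  fixes \<mu> :: "'a::euclidean_space measure"
  assumes d: "DIM('a) = d" "d \<ge> 2" and R: "R > 0" and K: "compact K" "K \<subseteq> ball a R"
    and \<mu>: "borel_prob_on K \<mu>" and I: "I > 0" and en: "kk_energy (8 * R) \<mu> < ennreal I"
  obtains A \<pi> where "compact A" "A \<subseteq> K"
    "\<And>y. y \<notin> A \<Longrightarrow> 0 \<le> \<pi> y \<and> \<pi> y \<le> 2 * ckap d * I"
    "\<And>y. norm (y - a) \<ge> 5 * R \<Longrightarrow> \<pi> y = 0"
    "\<And>y. y \<notin> A \<Longrightarrow> \<exists>r0>0. ball y r0 \<inter> A = {} \<and> continuous_on (ball y r0) \<pi> \<and>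
       (\<forall>r. 0 < r \<and> r < r0 \<longrightarrow> integrable lborel (\<lambda>w. indicator (ball y r) w * \<pi> w) \<and>
         \<pi> y * measure lborel (ball y r) + (if norm (y - a) < R then (\<integral>w. indicator (ball y r) w * ((w - y) \<bullet> (w - y)) \<partial>lborel) / (64 * R\<^sup>2) else 0)
          \<le> (\<integral>w. indicator (ball y r) w * \<pi> w \<partial>lborel))"
proof -
  interpret prob_space \<mu> using \<mu> by (simp add: borel_prob_on_def)
  have sets[measurable_cong, simp]: "sets \<mu> = sets borel" using \<mu> by (simp add: borel_prob_on_def)
  have sp[simp]: "space \<mu> = UNIV" using sets_eq_imp_space_eq[OF sets] by simp
  \<comment> \<open>With truncation radius \<open>4 * R\<close>, points within \<open>3 * R\<close>
    of the support still see at least 7/16 of the maximal Laplacian, and the potential vanishes at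
    distance \<open>5 * R\<close> from \<open>a\<close>.\<close>
  define \<rho> where "\<rho> = 4 * R"
  have \<rho>: "\<rho> > 0" using R by (simp add: \<rho>_def)
  define p where "p y = (\<integral>\<^sup>+x. kk d (norm (x - y) / (8 * R)) \<partial>\<mu>)" for y
  have pm[measurable]: "p \<in> borel_measurable borel" unfolding p_def by measurable
  define A where "A = K \<inter> {y. p y \<le> ennreal (2 * I)}"
  have clA: "closed {y. p y \<le> ennreal (2 * I)}"
    unfolding p_def using R by (intro closed_potential_sublevel d) auto
  have cA: "compact A" unfolding A_def using K(1) clA by (rule compact_Int_closed)
  have Am[measurable]: "A \<in> sets borel" using cA by (simp add: borel_compact)
  have AK: "A \<subseteq> K" by (auto simp: A_def)
  have mass: "measure \<mu> A \<ge> 1 / 2"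
  proof -
    have "emeasure \<mu> {x\<in>space \<mu>. 1 \<le> ennreal (1 / (2 * I)) * p x} \<le> ennreal (1 / (2 * I)) * (\<integral>\<^sup>+x. p x \<partial>\<mu>)"
      using nn_integral_Markov_inequality[of p UNIV \<mu> "ennreal (1 / (2 * I))"] by simp
    also have "(\<integral>\<^sup>+x. p x \<partial>\<mu>) = kk_energy (8 * R) \<mu>"
      unfolding kk_energy_def p_def d ..
    also have "ennreal (1 / (2 * I)) * kk_energy (8 * R) \<mu> \<le> ennreal (1 / (2 * I)) * ennreal I"
      using en by (intro mult_left_mono) auto
    also have "\<dots> = ennreal (1 / 2)" using I by (simp add: ennreal_mult[symmetric])
    finally have "emeasure \<mu> {x\<in>space \<mu>. 1 \<le> ennreal (1 / (2 * I)) * p x} \<le> ennreal (1 / 2)" .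
    then have 1: "prob {x. 1 \<le> ennreal (1 / (2 * I)) * p x} \<le> 1 / 2"
      unfolding emeasure_eq_measure by (simp add: ennreal_le_iff del: ennreal_half) 
    have "prob K = 1" using \<mu> by (simp add: borel_prob_on_def measure_def)
    have "K \<subseteq> A \<union> {x. 1 \<le> ennreal (1 / (2 * I)) * p x}"
    proof
      fix x assume x: "x \<in> K"
      show "x \<in> A \<union> {x. 1 \<le> ennreal (1 / (2 * I)) * p x}"
      proof (cases "p x \<le> ennreal (2 * I)")
        case False
        then have "ennreal (1 / (2 * I)) * ennreal (2 * I) \<le> ennreal (1 / (2 * I)) * p x"
          by (intro mult_left_mono) auto
        then show ?thesis using I by (simp add: ennreal_mult[symmetric])
      qed (use x in \<open>auto simp: A_def\<close>)
    qed
    then have "prob K \<le> prob (A \<union> {x. 1 \<le> ennreal (1 / (2 * I)) * p x})"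
      by (intro finite_measure_mono) auto
    also have "\<dots> \<le> prob A + prob {x. 1 \<le> ennreal (1 / (2 * I)) * p x}"
      by (intro measure_Un_le) auto
    finally show ?thesis using 1 \<open>prob K = 1\<close> by simp
  qed
  then have Ane: "A \<noteq> {}" by auto
  define f where "f z w = indicator A z * prof d (((w - z) \<bullet> (w - z)) / \<rho>\<^sup>2)" for z w :: 'a
  define \<pi> where "\<pi> w = (\<integral>z. f z w \<partial>\<mu>)" for w
  have fm[measurable]: "case_prod f \<in> borel_measurable (borel \<Otimes>\<^sub>M borel)"
    unfolding f_def by measurable
  have fm1[measurable]: "(\<lambda>z. f z w) \<in> borel_measurable \<mu>" for w
    unfolding f_def by measurable
  have fpos: "0 \<le> f z w" if "w \<notin> A" for z w
  proof (cases "z \<in> A")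
    case True
    then have "w - z \<noteq> 0" using that by auto
    then have "0 < ((w - z) \<bullet> (w - z)) / \<rho>\<^sup>2" using \<rho> by simp
    then show ?thesis using True prof_nonneg[OF d(2)] by (simp add: f_def)
  qed (simp add: f_def)
  have upper: "0 \<le> \<pi> y \<and> \<pi> y \<le> 2 * ckap d * I" if y: "y \<notin> A" for y
  proof
    show "0 \<le> \<pi> y" unfolding \<pi>_def by (intro integral_nonneg_AE AE_I2 fpos y)
    \<comment> \<open>A weak maximum principle. If \<open>y'\<close> is the point of
      \<open>A\<close> nearest to \<open>y\<close>, then
      \<open>norm (z - y') \<le> 2 * norm (y - z)\<close> for all \<open>z\<close> in
      \<open>A\<close>, so the potential at \<open>y\<close> is controlled by the one at
      \<open>y'\<close>, where it is bounded by the choice of \<open>A\<close>. This factor 2 is the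
      ratio of the energy scale \<open>8 * R\<close> to the truncation radius.\<close>
    obtain y' where y': "y' \<in> A" "\<And>z. z \<in> A \<Longrightarrow> dist y y' \<le> dist y z"
      using distance_attains_inf[of A y] cA Ane by (auto simp: compact_imp_closed)
    have "ennreal (f z y) \<le> ennreal (ckap d) * kk d (norm (z - y') / (8 * R))" for z
    proof (cases "z \<in> A")
      case True
      define T where "T = norm (y - z) / \<rho>"
      define t where "t = norm (z - y') / (8 * R)"
      have "norm (z - y') \<le> norm (y - z) + norm (y - y')"
        using norm_triangle_ineq4[of "y - y'" "y - z"] by (simp add: algebra_simps)
      also have "norm (y - y') \<le> norm (y - z)" using y'(2)[OF True] by (simp add: dist_norm)
      finally have tT: "t \<le> T" using R by (simp add: t_def T_def \<rho>_def field_simps)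
      have feq: "f z y = prof d (T\<^sup>2)" using True
        by (simp add: f_def T_def power_divide power2_norm_eq_inner)
      show ?thesis
      proof (cases "t = 0")
        case True
        then show ?thesis using ckap_pos[OF d(2)] by (simp add: t_def[symmetric] ennreal_mult_top)
      next
        case False
        then have t: "t > 0" using R by (simp add: t_def)
        show ?thesis
        proof (cases "T \<le> 1")
          case True
          have "f z y \<le> ckap d * kr d t" unfolding feq by (rule prof_le_kr[OF d(2) t tT True])
          then have "ennreal (f z y) \<le> ennreal (ckap d * kr d t)" by (rule ennreal_leI)
          also have "\<dots> = ennreal (ckap d) * kk d t" using t ckap_pos[OF d(2)] by (simp add: kk_pos ennreal_mult')
          finally show ?thesis by (simp add: t_def)
        next
          case False
          then have "T\<^sup>2 \<ge> 1" by (simp add: one_le_power)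
          then show ?thesis by (simp add: feq prof_def)
        qed
      qed
    qed (simp add: f_def)
    then have "(\<integral>\<^sup>+z. ennreal (f z y) \<partial>\<mu>) \<le> (\<integral>\<^sup>+z. ennreal (ckap d) * kk d (norm (z - y') / (8 * R)) \<partial>\<mu>)"
      by (intro nn_integral_mono) auto
    also have "\<dots> = ennreal (ckap d) * p y'" unfolding p_def by (rule nn_integral_cmult) measurable
    also have "\<dots> \<le> ennreal (ckap d) * ennreal (2 * I)" using y'(1) by (intro mult_left_mono) (auto simp: A_def)
    also have "\<dots> = ennreal (2 * ckap d * I)" using ckap_pos[OF d(2)] I by (simp add: ennreal_mult[symmetric] mult.commute mult.left_commute)
    finally have le: "(\<integral>\<^sup>+z. ennreal (f z y) \<partial>\<mu>) \<le> ennreal (2 * ckap d * I)" .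
    have "\<pi> y = enn2real (\<integral>\<^sup>+z. ennreal (f z y) \<partial>\<mu>)"
      unfolding \<pi>_def by (rule integral_eq_nn_integral) (use fpos[OF y] in auto)
    also have "\<dots> \<le> 2 * ckap d * I"
      using le ckap_pos[OF d(2)] I by (intro enn2real_leI) auto
    finally show "\<pi> y \<le> 2 * ckap d * I" .
  qed
  have zero: "\<pi> y = 0" if y: "norm (y - a) \<ge> 5 * R" for y
  proof -
    have "f z y = 0" for z
    proof (cases "z \<in> A")
      case True
      then have "norm (z - a) < R" using AK K by (auto simp: dist_norm norm_minus_commute)
      then have "norm (y - z) \<ge> \<rho>" using y norm_triangle_ineq[of "y - z" "z - a"] by (simp add: \<rho>_def)
      then have "(norm (y - z))\<^sup>2 \<ge> \<rho>\<^sup>2" using \<rho> by (intro power_mono) auto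
      then show ?thesis using \<rho> by (simp add: f_def prof_def power2_norm_eq_inner)
    qed (simp add: f_def)
    then show ?thesis by (simp add: \<pi>_def)
  qed
  have loc: "\<exists>r0>0. ball y r0 \<inter> A = {} \<and> continuous_on (ball y r0) \<pi> \<and>
       (\<forall>r. 0 < r \<and> r < r0 \<longrightarrow> integrable lborel (\<lambda>w. indicator (ball y r) w * \<pi> w) \<and>
         \<pi> y * measure lborel (ball y r) + (if norm (y - a) < R then (\<integral>w. indicator (ball y r) w * ((w - y) \<bullet> (w - y)) \<partial>lborel) / (64 * R\<^sup>2) else 0)
          \<le> (\<integral>w. indicator (ball y r) w * \<pi> w \<partial>lborel))" if y: "y \<notin> A" for y
  proof -
    have inf: "infdist y A > 0" using cA Ane y by (simp add: compact_imp_closed infdist_pos_not_in_closed)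
    \<comment> \<open>Half the distance to \<open>A\<close> keeps the kernels uniformly bounded on
      the ball; the cap \<open>R\<close> keeps the ball within \<open>3 * R\<close> of
      \<open>A\<close> when \<open>y\<close> lies in the cell.\<close>
    define r' where "r' = min R (infdist y A / 2)"
    have r': "r' > 0" "r' \<le> R" using inf R by (auto simp: r'_def)
    have away: "norm (w - z) \<ge> r'" if "w \<in> ball y r'" "z \<in> A" for w z
    proof -
      have "2 * r' \<le> infdist y A" by (simp add: r'_def)
      also have "\<dots> \<le> dist y z" by (rule infdist_le[OF that(2)])
      also have "\<dots> \<le> dist y w + dist w z" by (rule dist_triangle)
      finally show ?thesis using that(1) by (simp add: dist_norm)
    qed
    have notA: "w \<notin> A" if "w \<in> ball y r'" for w using away[OF that, of w] r' by auto
    define B where "B = prof d (r'\<^sup>2 / \<rho>\<^sup>2)"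
    have fB: "\<bar>f z w\<bar> \<le> B" if w: "w \<in> ball y r'" for z w
    proof (cases "z \<in> A")
      case True
      have "r'\<^sup>2 \<le> (norm (w - z))\<^sup>2" using away[OF w True] r' by (intro power_mono) auto
      then have "prof d (((w - z) \<bullet> (w - z)) / \<rho>\<^sup>2) \<le> B"
        unfolding B_def using r' \<rho> by (intro prof_antimono[OF d(2)]) (auto simp: power2_norm_eq_inner divide_right_mono)
      then show ?thesis using fpos[OF notA[OF w], of z] True by (simp add: f_def)
    next
      case False
      then show ?thesis using prof_nonneg[OF d(2), of "r'\<^sup>2 / \<rho>\<^sup>2"] r' \<rho> by (simp add: f_def B_def)
    qed
    have cont: "continuous_on (ball y r') \<pi>"
      unfolding continuous_on_sequentially
    proof (intro allI ballI impI, elim conjE)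
      fix X w assume w: "w \<in> ball y r'" and X: "\<forall>n. X n \<in> ball y r'" and lim: "X \<longlonglongrightarrow> w"
      have "(\<lambda>n. \<integral>z. f z (X n) \<partial>\<mu>) \<longlonglongrightarrow> (\<integral>z. f z w \<partial>\<mu>)"
      proof (rule integral_dominated_convergence[where w = "\<lambda>_. B"])
        show "AE z in \<mu>. (\<lambda>n. f z (X n)) \<longlonglongrightarrow> f z w"
        proof (rule AE_I2)
          fix z
          show "(\<lambda>n. f z (X n)) \<longlonglongrightarrow> f z w"
          proof (cases "z \<in> A")
            case True
            have "norm (w - z) > 0" using away[OF w True] r' by linarith
            then have "((w - z) \<bullet> (w - z)) / \<rho>\<^sup>2 > 0" using \<rho> by simp
            from DERIV_isCont[OF prof_has_derivative[OF d(2) this]]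
            have "isCont (prof d) (((w - z) \<bullet> (w - z)) / \<rho>\<^sup>2)" .
            moreover have "(\<lambda>n. ((X n - z) \<bullet> (X n - z)) / \<rho>\<^sup>2) \<longlonglongrightarrow> ((w - z) \<bullet> (w - z)) / \<rho>\<^sup>2"
              by (intro tendsto_intros lim) (use \<rho> in auto)
            ultimately have "(\<lambda>n. prof d (((X n - z) \<bullet> (X n - z)) / \<rho>\<^sup>2)) \<longlonglongrightarrow> prof d (((w - z) \<bullet> (w - z)) / \<rho>\<^sup>2)"
              by (rule isCont_tendsto_compose)
            then show ?thesis using True by (simp add: f_def)
          qed (simp add: f_def)
        qed
        show "AE z in \<mu>. norm (f z (X n)) \<le> B" for n using fB X by simp
      qed auto
      then show "(\<pi> \<circ> X) \<longlonglongrightarrow> \<pi> w" by (simp add: \<pi>_def o_def)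
    qed
    have mean: "integrable lborel (\<lambda>w. indicator (ball y r) w * \<pi> w) \<and>
         \<pi> y * measure lborel (ball y r) + (if norm (y - a) < R then (\<integral>w. indicator (ball y r) w * ((w - y) \<bullet> (w - y)) \<partial>lborel) / (64 * R\<^sup>2) else 0)
          \<le> (\<integral>w. indicator (ball y r) w * \<pi> w \<partial>lborel)" if r: "0 < r" "r < r'" for r
    proof -
      let ?V = "measure lborel (ball y r)"
      let ?D = "\<integral>w. indicator (ball y r) w * ((w - y) \<bullet> (w - y)) \<partial>lborel"
      note Dpos = mean_square_distance_pos[OF r(1), of y]
      \<comment> \<open>Twice the claimed surplus, because \<open>A\<close> may carry only half of
        the mass.\<close>
      define \<kappa> where "\<kappa> = (if norm (y - a) < R then 1 / (32 * R\<^sup>2) else 0)"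
      have \<kappa>: "\<kappa> \<ge> 0" by (simp add: \<kappa>_def)
      interpret P: pair_sigma_finite \<mu> "lborel :: 'a measure" ..
      define F where "F z w = f z w * indicator (ball y r) w" for z w
      have [measurable]: "ball y r \<in> sets borel" by simp
      have Fm[measurable]: "case_prod F \<in> borel_measurable (\<mu> \<Otimes>\<^sub>M lborel)"
        unfolding F_def f_def by measurable
      have Fint: "integrable (\<mu> \<Otimes>\<^sub>M lborel) (case_prod F)"
      proof (rule Bochner_Integration.integrable_bound[OF _ Fm])
        show "integrable (\<mu> \<Otimes>\<^sub>M lborel) (\<lambda>x. B * indicator (UNIV \<times> ball y r) x :: real)"
        proof (intro integrable_mult_right integrable_real_indicator)
          show "emeasure (\<mu> \<Otimes>\<^sub>M lborel) (UNIV \<times> ball y r) < \<infinity>"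
            using emeasure_space_1 emeasure_lborel_ball_finite[of y r]
            by (subst lborel.emeasure_pair_measure_Times) (auto simp: ennreal_mult_less_top)
        qed (auto intro!: pair_measureI)
        show "AE x in \<mu> \<Otimes>\<^sub>M lborel. norm (case_prod F x) \<le> norm (B * indicator (UNIV \<times> ball y r) x)"
        proof (rule AE_I2)
          fix x
          show "norm (case_prod F x) \<le> norm (B * indicator (UNIV \<times> ball y r) x)"
            using fB[of "snd x" "fst x"] r by (cases x) (auto simp: F_def indicator_def)
        qed
      qed
      have Fsnd: "(\<integral>z. F z w \<partial>\<mu>) = indicator (ball y r) w * \<pi> w" for w
        by (simp add: F_def \<pi>_def mult.commute)
      have int: "integrable lborel (\<lambda>w. indicator (ball y r) w * \<pi> w)"
        using P.integrable_snd[OF Fint] by (simp add: Fsnd)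
      have fub: "(\<integral>w. indicator (ball y r) w * \<pi> w \<partial>lborel) = (\<integral>z. \<integral>w. F z w \<partial>lborel \<partial>\<mu>)"
        using P.Fubini_integral[OF Fint] by (simp add: Fsnd)
      have iA: "integrable \<mu> (indicator A :: 'a \<Rightarrow> real)"
        by (intro integrable_real_indicator) (auto simp: less_top[symmetric])
      have "(\<integral>z. f z y * ?V + \<kappa> * ?D * indicator A z \<partial>\<mu>) \<le> (\<integral>z. \<integral>w. F z w \<partial>lborel \<partial>\<mu>)"
      proof (rule integral_mono)
        have "integrable \<mu> (\<lambda>z. f z y)"
          by (rule integrable_const_bound[of _ B]) (use fB[of y] r' in auto)
        then show "integrable \<mu> (\<lambda>z. f z y * ?V + \<kappa> * ?D * indicator A z)" using iA
          by (intro Bochner_Integration.integrable_add integrable_mult_left integrable_mult_right)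
        show "integrable \<mu> (\<lambda>z. \<integral>w. F z w \<partial>lborel)" by (rule P.integrable_fst[OF Fint])
        fix z
        show "f z y * ?V + \<kappa> * ?D * indicator A z \<le> (\<integral>w. F z w \<partial>lborel)"
        proof (cases "z \<in> A")
          case True
          have "\<exists>g H C. subharmonic_C2_ball (\<lambda>w. prof d (((w - z) \<bullet> (w - z)) / \<rho>\<^sup>2) - \<kappa> * ((w - y) \<bullet> (w - y))) g H y r' C"
          proof (rule truncated_kernel_C2[OF d \<rho> \<kappa> r'(1) away[OF _ True]])
            fix w assume w: "w \<in> ball y r'"
            show "2 * real d * \<kappa> \<le> (2 * real d + (real d)\<^sup>2) * max 0 (1 - ((w - z) \<bullet> (w - z)) / \<rho>\<^sup>2) / \<rho>\<^sup>2"
            proof (cases "norm (y - a) < R")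
              case True
              have "norm (z - a) < R" using \<open>z \<in> A\<close> AK K by (auto simp: dist_norm norm_minus_commute)
              then have "norm (w - z) \<le> 3 * R"
                using True w r'(2) norm_triangle_ineq[of "w - y" "y - a"] norm_triangle_ineq4[of "w - a" "z - a"]
                by (simp add: dist_norm norm_minus_commute)
              then have "(norm (w - z))\<^sup>2 \<le> (3 * R)\<^sup>2" by (intro power_mono) auto
              then have "((w - z) \<bullet> (w - z)) / \<rho>\<^sup>2 \<le> 9 / 16"
                using R by (simp add: power2_norm_eq_inner \<rho>_def power_mult_distrib divide_le_eq)
              then have "(2 * real d + (real d)\<^sup>2) * (7 / 16) / \<rho>\<^sup>2 \<le> (2 * real d + (real d)\<^sup>2) * max 0 (1 - ((w - z) \<bullet> (w - z)) / \<rho>\<^sup>2) / \<rho>\<^sup>2"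
                by (intro divide_right_mono mult_left_mono) (linarith | simp)+
              moreover have "2 * real d * \<kappa> \<le> (2 * real d + (real d)\<^sup>2) * (7 / 16) / \<rho>\<^sup>2"
              proof -
                have "real d * 2 \<le> (real d)\<^sup>2" using d(2) by (simp add: power2_eq_square mult_left_mono)
                then have "real d \<le> (2 * real d + (real d)\<^sup>2) * (7 / 16)" by simp
                then have "real d / \<rho>\<^sup>2 \<le> (2 * real d + (real d)\<^sup>2) * (7 / 16) / \<rho>\<^sup>2"
                  by (intro divide_right_mono) auto
                moreover have "2 * real d * \<kappa> = real d / \<rho>\<^sup>2" using True R by (simp add: \<kappa>_def \<rho>_def power_mult_distrib)
                ultimately show ?thesis by simp
              qed
              ultimately show ?thesis by simp
            qed (simp add: \<kappa>_def)
          qed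
          then obtain g H C where "subharmonic_C2_ball (\<lambda>w. prof d (((w - z) \<bullet> (w - z)) / \<rho>\<^sup>2) - \<kappa> * ((w - y) \<bullet> (w - y))) g H y r' C" by blast
          from subharmonic_C2_ball.sub_mean_value[OF this r]
          have sm: "prof d (((y - z) \<bullet> (y - z)) / \<rho>\<^sup>2) * ?V
            \<le> (\<integral>w. indicator (ball y r) w * (prof d (((w - z) \<bullet> (w - z)) / \<rho>\<^sup>2) - \<kappa> * ((w - y) \<bullet> (w - y))) \<partial>lborel)" by simp
          have Fz: "integrable lborel (F z)"
          proof (rule Bochner_Integration.integrable_bound)
            show "integrable lborel (\<lambda>w. B * indicator (ball y r) w :: real)"
              using emeasure_lborel_ball_finite[of y r] by (intro integrable_mult_right integrable_real_indicator) auto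
            show "F z \<in> borel_measurable lborel" unfolding F_def f_def by measurable
            show "AE w in lborel. norm (F z w) \<le> norm (B * indicator (ball y r) w)"
            proof (rule AE_I2)
              fix w show "norm (F z w) \<le> norm (B * indicator (ball y r) w)"
                using fB[of w z] r by (auto simp: F_def indicator_def)
            qed
          qed
          have "(\<integral>w. indicator (ball y r) w * (prof d (((w - z) \<bullet> (w - z)) / \<rho>\<^sup>2) - \<kappa> * ((w - y) \<bullet> (w - y))) \<partial>lborel)
             = (\<integral>w. F z w - \<kappa> * (indicator (ball y r) w * ((w - y) \<bullet> (w - y))) \<partial>lborel)"
            using True by (intro Bochner_Integration.integral_cong) (auto simp: F_def f_def algebra_simps)
          also have "\<dots> = (\<integral>w. F z w \<partial>lborel) - \<kappa> * ?D"
            using Fz Dpos(1) by (subst Bochner_Integration.integral_diff) auto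
          finally show ?thesis using sm True by (simp add: f_def)
        next
          case False
          then show ?thesis by (simp add: F_def f_def)
        qed
      qed
      also have "(\<integral>z. f z y * ?V + \<kappa> * ?D * indicator A z \<partial>\<mu>) = \<pi> y * ?V + \<kappa> * ?D * measure \<mu> A"
      proof -
        have "integrable \<mu> (\<lambda>z. f z y)"
          by (rule integrable_const_bound[of _ B]) (use fB[of y] r' in auto)
        then have "integrable \<mu> (\<lambda>z. f z y * ?V)" "integrable \<mu> (\<lambda>z. \<kappa> * ?D * indicator A z)"
          using iA by - (intro integrable_mult_left integrable_mult_right; assumption)+
        then show ?thesis by (subst Bochner_Integration.integral_add) (auto simp: \<pi>_def)
      qed
      finally have main: "\<pi> y * ?V + \<kappa> * ?D * measure \<mu> A \<le> (\<integral>w. indicator (ball y r) w * \<pi> w \<partial>lborel)"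
        by (simp add: fub)
      have "\<kappa> * ?D * measure \<mu> A \<ge> \<kappa> * ?D * (1 / 2)"
        using mass \<kappa> Dpos by (intro mult_left_mono) auto
      then have "\<pi> y * ?V + \<kappa> * ?D * (1 / 2) \<le> (\<integral>w. indicator (ball y r) w * \<pi> w \<partial>lborel)"
        using main by linarith
      moreover have "(if norm (y - a) < R then ?D / (64 * R\<^sup>2) else 0) = \<kappa> * ?D * (1 / 2)"
        by (simp add: \<kappa>_def)
      ultimately show ?thesis using int by (simp only:)
    qed
    show ?thesis using r' notA cont mean by (intro exI[of _ r']) auto
  qed
  show ?thesis by (rule that[OF cA AK upper zero loc])
qed

section \<open>Separated nets and the barrier built over them\<close>

lemma packing_bound:
  fixes S :: "'a::euclidean_space set"
  assumes "finite S" "R > 0" "a \<ge> 0" "S \<subseteq> cball y a" and sep: "\<And>p q. p \<in> S \<Longrightarrow> q \<in> S \<Longrightarrow> p \<noteq> q \<Longrightarrow> dist p q \<ge> R"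
  shows "real (card S) * (R / 2) ^ DIM('a) \<le> (a + R / 2) ^ DIM('a)"
proof -
  have disj: "disjoint_family_on (\<lambda>p. ball p (R / 2)) S"
    unfolding disjoint_family_on_def
  proof (intro ballI impI)
    fix p q assume pq: "p \<in> S" "q \<in> S" "p \<noteq> q"
    show "ball p (R / 2) \<inter> ball q (R / 2) = {}"
    proof (rule ccontr)
      assume "\<not> ?thesis"
      then obtain z where "dist p z < R / 2" "dist q z < R / 2" by auto
      then have "dist p q < R" using dist_triangle[of p q z] by (simp add: dist_commute)
      then show False using sep[OF pq] by simp
    qed
  qed
  have sub: "(\<Union>p\<in>S. ball p (R / 2)) \<subseteq> cball y (a + R / 2)"
  proof
    fix z assume "z \<in> (\<Union>p\<in>S. ball p (R / 2))"
    then obtain p where "p \<in> S" "dist p z < R / 2" by auto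
    then show "z \<in> cball y (a + R / 2)" using assms(4) dist_triangle[of y z p] by auto
  qed
  have fin: "emeasure lborel (ball p (R / 2)) \<noteq> \<infinity>" for p :: 'a
    using emeasure_lborel_ball_finite[of p "R / 2"] by simp
  let ?v = "unit_ball_vol (real DIM('a))"
  have "(\<Sum>p\<in>S. measure lborel (ball p (R / 2))) = measure lborel (\<Union>p\<in>S. ball p (R / 2))"
    using assms(1) disj fin by (intro measure_finite_Union[symmetric]) auto
  also have "\<dots> \<le> measure lborel (cball y (a + R / 2))"
    using emeasure_lborel_cball_finite[of y "a + R / 2"] by (intro measure_mono_fmeasurable sub) (auto simp: fmeasurable_def intro!: borel_open)
  also have "\<dots> = ?v * (a + R / 2) ^ DIM('a)" using assms by (simp add: content_cball)
  also have "(\<Sum>p\<in>S. measure lborel (ball p (R / 2))) = real (card S) * (?v * (R / 2) ^ DIM('a))"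
    using assms by (simp add: content_ball)
  finally have "?v * (real (card S) * (R / 2) ^ DIM('a)) \<le> ?v * (a + R / 2) ^ DIM('a)" by (simp add: mult.left_commute)
  moreover have "?v > 0" by simp
  ultimately show ?thesis by (simp only: mult_le_cancel_left_pos)
qed

lemma separated_net_exists:
  fixes x0 :: "'a::euclidean_space"
  assumes R: "R > 0" and s: "s \<ge> 0"
  obtains S where "finite S" "S \<subseteq> cball x0 s" "\<And>p q. p \<in> S \<Longrightarrow> q \<in> S \<Longrightarrow> p \<noteq> q \<Longrightarrow> dist p q \<ge> R"
    "\<And>y. y \<in> cball x0 s \<Longrightarrow> \<exists>p\<in>S. dist y p < R"
proof -
  define Q where "Q S \<longleftrightarrow> finite S \<and> S \<subseteq> cball x0 s \<and> (\<forall>p\<in>S. \<forall>q\<in>S. p \<noteq> q \<longrightarrow> dist p q \<ge> R)" for S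
  obtain N :: nat where N: "(s + R / 2) ^ DIM('a) / (R / 2) ^ DIM('a) < real N" using reals_Archimedean2 by blast
  have bd: "card S < N" if "Q S" for S
  proof -
    have "real (card S) * (R / 2) ^ DIM('a) \<le> (s + R / 2) ^ DIM('a)"
      using that by (intro packing_bound[of S R s x0] R s) (auto simp: Q_def)
    then have "real (card S) \<le> (s + R / 2) ^ DIM('a) / (R / 2) ^ DIM('a)"
      using R by (simp add: pos_le_divide_eq)
    then show ?thesis using N by linarith
  qed
  have "Q {}" by (simp add: Q_def)
  from ex_has_greatest_nat[of Q "{}" card N, OF this] bd
  obtain S where S: "Q S" "\<And>T. Q T \<Longrightarrow> card T \<le> card S" by (metis less_imp_le)
  have "\<exists>p\<in>S. dist y p < R" if y: "y \<in> cball x0 s" for y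
  proof (rule ccontr)
    assume *: "\<not> ?thesis"
    then have "y \<notin> S" using R by auto
    moreover have "Q (insert y S)"
      using S(1) y * unfolding Q_def by (auto simp: not_less dist_commute)
    ultimately show False using S(2)[of "insert y S"] S(1) by (simp add: Q_def)
  qed
  then show ?thesis using that[of S] S(1) by (auto simp: Q_def)
qed

text \<open>Each cell contributes a truncated potential of a measure on the zero set; its positive
  Laplacian away from the zero set pays for the negative Laplacian of the paraboloid.\<close>

lemma subharmonic_decay:
  fixes u :: "'a::euclidean_space \<Rightarrow> ereal"
  assumes dd: "DIM('a) = d" "d \<ge> 2" and u: "subharmonic u" and M: "M > 0" and R: "R > 0" and s': "s' > 0" and I: "I > 0"
    and uM: "\<And>x. x \<in> cball x0 (s' + 6 * R) \<Longrightarrow> u x \<le> ereal M"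
    and cells: "\<And>y. y \<in> cball x0 s' \<Longrightarrow> \<exists>K \<mu>. compact K \<and> K \<subseteq> ball y R \<and> (\<forall>z\<in>K. u z \<le> 0) \<and> borel_prob_on K \<mu> \<and> kk_energy (8 * R) \<mu> < ennreal I"
    and H_def: "H = 11 ^ d * (2 * ckap d * I)"
  shows "u x0 \<le> ereal (M * (1 - min (s'\<^sup>2 / (256 * R\<^sup>2 * H)) (1 / 4)))"
proof -
  \<comment> \<open>The potentials reach at most \<open>5 * R\<close> beyond a net point, so on the
    sphere of radius \<open>s\<close> they all vanish and the barrier equals
    \<open>M\<close>.\<close>
  define s where "s = s' + 6 * R"
  have s: "s > 0" "s' < s" using R s' by (auto simp: s_def)
  have H: "H > 0" using I ckap_pos[OF dd(2)] by (simp add: H_def)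
  obtain S where S: "finite S" "S \<subseteq> cball x0 s'" "\<And>p q. p \<in> S \<Longrightarrow> q \<in> S \<Longrightarrow> p \<noteq> q \<Longrightarrow> dist p q \<ge> R"
    "\<And>y. y \<in> cball x0 s' \<Longrightarrow> \<exists>p\<in>S. dist y p < R"
    using separated_net_exists[OF R less_imp_le[OF s'], of x0] by metis
  define cell where "cell a A \<pi> \<longleftrightarrow> compact A \<and> (\<forall>z\<in>A. u z \<le> 0) \<and>
    (\<forall>y. y \<notin> A \<longrightarrow> 0 \<le> \<pi> y \<and> \<pi> y \<le> 2 * ckap d * I) \<and>
    (\<forall>y. norm (y - a) \<ge> 5 * R \<longrightarrow> \<pi> y = 0) \<and>
    (\<forall>y. y \<notin> A \<longrightarrow> (\<exists>r0>0. ball y r0 \<inter> A = {} \<and> continuous_on (ball y r0) \<pi> \<and>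
       (\<forall>r. 0 < r \<and> r < r0 \<longrightarrow> integrable lborel (\<lambda>w. indicator (ball y r) w * \<pi> w) \<and>
         \<pi> y * measure lborel (ball y r) + (if norm (y - a) < R then (\<integral>w. indicator (ball y r) w * ((w - y) \<bullet> (w - y)) \<partial>lborel) / (64 * R\<^sup>2) else 0)
          \<le> (\<integral>w. indicator (ball y r) w * \<pi> w \<partial>lborel))))" for a :: 'a and A and \<pi> :: "'a \<Rightarrow> real"
  have "\<exists>A \<pi>. cell a A \<pi>" if a: "a \<in> S" for a
  proof -
    obtain K \<mu> where K: "compact K" "K \<subseteq> ball a R" "\<forall>z\<in>K. u z \<le> 0" "borel_prob_on K \<mu>" "kk_energy (8 * R) \<mu> < ennreal I"
      using cells[of a] a S(2) by blast
    obtain A \<pi> where A: "compact A" "A \<subseteq> K"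
      "\<And>y. y \<notin> A \<Longrightarrow> 0 \<le> \<pi> y \<and> \<pi> y \<le> 2 * ckap d * I"
      "\<And>y. norm (y - a) \<ge> 5 * R \<Longrightarrow> \<pi> y = 0"
      "\<And>y. y \<notin> A \<Longrightarrow> \<exists>r0>0. ball y r0 \<inter> A = {} \<and> continuous_on (ball y r0) \<pi> \<and>
       (\<forall>r. 0 < r \<and> r < r0 \<longrightarrow> integrable lborel (\<lambda>w. indicator (ball y r) w * \<pi> w) \<and>
         \<pi> y * measure lborel (ball y r) + (if norm (y - a) < R then (\<integral>w. indicator (ball y r) w * ((w - y) \<bullet> (w - y)) \<partial>lborel) / (64 * R\<^sup>2) else 0)
          \<le> (\<integral>w. indicator (ball y r) w * \<pi> w \<partial>lborel))"
      by (rule cell_potential[OF dd R K(1,2,4) I K(5)]) (auto simp: dd)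
    have "\<forall>z\<in>A. u z \<le> 0" using K(3) A(2) by blast
    then show ?thesis unfolding cell_def using A by blast
  qed
  then obtain A \<pi> where "\<forall>a\<in>S. cell a (A a) (\<pi> a)" by metis
  note cell = this[rule_format, unfolded cell_def]
  have cA: "\<And>a. a \<in> S \<Longrightarrow> compact (A a)" and A0: "\<And>a z. a \<in> S \<Longrightarrow> z \<in> A a \<Longrightarrow> u z \<le> 0"
    and \<pi>b: "\<And>a y. a \<in> S \<Longrightarrow> y \<notin> A a \<Longrightarrow> 0 \<le> \<pi> a y \<and> \<pi> a y \<le> 2 * ckap d * I"
    and \<pi>0: "\<And>a y. a \<in> S \<Longrightarrow> norm (y - a) \<ge> 5 * R \<Longrightarrow> \<pi> a y = 0"
    and \<pi>m: "\<And>a y. a \<in> S \<Longrightarrow> y \<notin> A a \<Longrightarrow> \<exists>r0>0. ball y r0 \<inter> A a = {} \<and> continuous_on (ball y r0) (\<pi> a) \<and>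
       (\<forall>r. 0 < r \<and> r < r0 \<longrightarrow> integrable lborel (\<lambda>w. indicator (ball y r) w * \<pi> a w) \<and>
         \<pi> a y * measure lborel (ball y r) + (if norm (y - a) < R then (\<integral>w. indicator (ball y r) w * ((w - y) \<bullet> (w - y)) \<partial>lborel) / (64 * R\<^sup>2) else 0)
          \<le> (\<integral>w. indicator (ball y r) w * \<pi> a w \<partial>lborel))"
    using cell by blast+
  define AA where "AA = (\<Union>a\<in>S. A a)"
  have AA0: "u z \<le> 0" if "z \<in> AA" for z using that A0 by (auto simp: AA_def)
  \<comment> \<open>The potentials and the paraboloid may each use \<open>M / 2\<close>, so that
    \<open>g \<le> M\<close>. The coefficient \<beta> is what the Laplacian of one cell potential of
    weight \<alpha> pays for. The last term, with \<eta>, gives strictness and takes away half of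
    the gain \<open>\<beta> * s'\<^sup>2\<close> at the centre.\<close>
  define \<alpha> where "\<alpha> = min (M / (2 * H)) (32 * M * R\<^sup>2 / s'\<^sup>2)"
  define \<beta> where "\<beta> = \<alpha> / (64 * R\<^sup>2)"
  define \<eta> where "\<eta> = \<beta> * s'\<^sup>2 / (2 * s\<^sup>2)"
  have \<alpha>: "\<alpha> > 0" using M H R s' by (simp add: \<alpha>_def)
  have \<beta>: "\<beta> > 0" using \<alpha> R by (simp add: \<beta>_def)
  have \<eta>: "\<eta> > 0" using \<beta> s' s by (simp add: \<eta>_def)
  have \<alpha>H: "\<alpha> * H \<le> M / 2"
  proof -
    have "\<alpha> * H \<le> M / (2 * H) * H" using H by (intro mult_right_mono) (auto simp: \<alpha>_def)
    then show ?thesis using H by simp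
  qed
  have \<beta>s: "\<beta> * s'\<^sup>2 \<le> M / 2"
  proof -
    have "\<alpha> * s'\<^sup>2 \<le> 32 * M * R\<^sup>2 / s'\<^sup>2 * s'\<^sup>2" by (intro mult_right_mono) (auto simp: \<alpha>_def)
    then show ?thesis using R s' by (simp add: \<beta>_def field_simps)
  qed
  \<comment> \<open>Beyond \<open>s'\<close> no net point pays for negative curvature, so the
    paraboloid is clipped there; taking the maximum with 0 only raises means.\<close>
  define Pb where "Pb y = max 0 (s'\<^sup>2 - (y - x0) \<bullet> (y - x0))" for y
  define g where "g y = \<beta> * Pb y + \<alpha> * (\<Sum>a\<in>S. \<pi> a y) + \<eta> * ((y - x0) \<bullet> (y - x0) - s\<^sup>2)" for y
  \<comment> \<open>On \<open>AA\<close> the barrier takes the value 0, an upper bound for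
    \<open>u\<close> there. Since \<open>M - g\<close> is nonnegative elsewhere, this downward jump
    is lower semicontinuous.\<close>
  define b where "b y = (if y \<in> AA then 0 else M - g y)" for y
  have sqn: "(y - x0) \<bullet> (y - x0) = (norm (y - x0))\<^sup>2" for y by (simp add: power2_norm_eq_inner)
  have gM: "g y \<le> M" if y: "y \<in> cball x0 s" "y \<notin> AA" for y
  proof -
    have "(\<Sum>a\<in>S. \<pi> a y) = (\<Sum>a\<in>{a\<in>S. norm (y - a) < 5 * R}. \<pi> a y)"
      using S(1) \<pi>0 by (intro sum.mono_neutral_right) (auto simp: not_less)
    also have "\<dots> \<le> real (card {a\<in>S. norm (y - a) < 5 * R}) * (2 * ckap d * I)"
      using \<pi>b y(2) by (intro sum_bounded_above) (auto simp: AA_def)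
    \<comment> \<open>Packing: \<open>5 * R + R / 2\<close> is 11 times \<open>R / 2\<close>, so at
      most \<open>11 ^ d\<close> cells act at one point.\<close>
    also have "\<dots> \<le> 11 ^ d * (2 * ckap d * I)"
    proof (rule mult_right_mono)
      have "real (card {a\<in>S. norm (y - a) < 5 * R}) * (R / 2) ^ d \<le> (5 * R + R / 2) ^ d"
        unfolding dd(1)[symmetric] using S(1,3) R by (intro packing_bound[of _ R "5 * R" y]) (auto simp: dist_norm)
      also have "(5 * R + R / 2) ^ d = 11 ^ d * (R / 2) ^ d" by (simp add: power_mult_distrib[symmetric])
      finally show "real (card {a\<in>S. norm (y - a) < 5 * R}) \<le> 11 ^ d" using R by (simp only: mult_le_cancel_right_pos zero_less_power half_gt_zero)
      show "0 \<le> 2 * ckap d * I" using ckap_pos[OF dd(2)] I by simp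
    qed
    finally have "\<alpha> * (\<Sum>a\<in>S. \<pi> a y) \<le> \<alpha> * H" unfolding H_def using \<alpha> by (intro mult_left_mono) auto
    moreover have "\<beta> * Pb y \<le> \<beta> * s'\<^sup>2" using \<beta> by (intro mult_left_mono) (auto simp: Pb_def)
    moreover have "\<eta> * ((y - x0) \<bullet> (y - x0) - s\<^sup>2) \<le> 0"
    proof -
      have "(norm (y - x0))\<^sup>2 \<le> s\<^sup>2" using y(1) by (intro power_mono) (auto simp: dist_norm norm_minus_commute)
      then show ?thesis using \<eta> unfolding sqn by (intro mult_nonneg_nonpos) auto
    qed
    ultimately show ?thesis using \<alpha>H \<beta>s unfolding g_def by linarith
  qed
  have small: "\<exists>r0>0. ball y r0 \<inter> AA = {} \<and> (\<forall>a\<in>S. continuous_on (ball y r0) (\<pi> a)) \<and>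
       (\<forall>r. 0 < r \<and> r < r0 \<longrightarrow> (\<forall>a\<in>S. integrable lborel (\<lambda>w. indicator (ball y r) w * \<pi> a w) \<and>
         \<pi> a y * measure lborel (ball y r) + (if norm (y - a) < R then (\<integral>w. indicator (ball y r) w * ((w - y) \<bullet> (w - y)) \<partial>lborel) / (64 * R\<^sup>2) else 0)
          \<le> (\<integral>w. indicator (ball y r) w * \<pi> a w \<partial>lborel)))" if y: "y \<notin> AA" for y
  proof -
    have "\<forall>a\<in>S. \<exists>r0>0. ball y r0 \<inter> A a = {} \<and> continuous_on (ball y r0) (\<pi> a) \<and>
       (\<forall>r. 0 < r \<and> r < r0 \<longrightarrow> integrable lborel (\<lambda>w. indicator (ball y r) w * \<pi> a w) \<and>
         \<pi> a y * measure lborel (ball y r) + (if norm (y - a) < R then (\<integral>w. indicator (ball y r) w * ((w - y) \<bullet> (w - y)) \<partial>lborel) / (64 * R\<^sup>2) else 0)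
          \<le> (\<integral>w. indicator (ball y r) w * \<pi> a w \<partial>lborel))"
      using \<pi>m y by (auto simp: AA_def)
    from bchoice[OF this] obtain \<rho> where \<rho>: "\<And>a. a \<in> S \<Longrightarrow> \<rho> a > 0" "\<And>a. a \<in> S \<Longrightarrow> ball y (\<rho> a) \<inter> A a = {}"
      "\<And>a. a \<in> S \<Longrightarrow> continuous_on (ball y (\<rho> a)) (\<pi> a)"
      "\<And>a r. a \<in> S \<Longrightarrow> 0 < r \<Longrightarrow> r < \<rho> a \<Longrightarrow> integrable lborel (\<lambda>w. indicator (ball y r) w * \<pi> a w) \<and>
         \<pi> a y * measure lborel (ball y r) + (if norm (y - a) < R then (\<integral>w. indicator (ball y r) w * ((w - y) \<bullet> (w - y)) \<partial>lborel) / (64 * R\<^sup>2) else 0)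
          \<le> (\<integral>w. indicator (ball y r) w * \<pi> a w \<partial>lborel)" by blast
    define r0 where "r0 = Min (insert 1 (\<rho> ` S))"
    have r0: "r0 > 0" "\<And>a. a \<in> S \<Longrightarrow> r0 \<le> \<rho> a" using S(1) \<rho>(1) by (auto simp: r0_def)
    have "ball y r0 \<inter> AA = {}" using \<rho>(2) r0(2) by (force simp: AA_def)
    moreover have "\<forall>a\<in>S. continuous_on (ball y r0) (\<pi> a)"
      using \<rho>(3) r0(2) by (meson continuous_on_subset subset_ball)
    moreover have "\<forall>r. 0 < r \<and> r < r0 \<longrightarrow> (\<forall>a\<in>S. integrable lborel (\<lambda>w. indicator (ball y r) w * \<pi> a w) \<and>
         \<pi> a y * measure lborel (ball y r) + (if norm (y - a) < R then (\<integral>w. indicator (ball y r) w * ((w - y) \<bullet> (w - y)) \<partial>lborel) / (64 * R\<^sup>2) else 0)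
          \<le> (\<integral>w. indicator (ball y r) w * \<pi> a w \<partial>lborel))"
    proof (intro allI impI ballI)
      fix r a assume "0 < r \<and> r < r0" and a: "a \<in> S"
      then have "0 < r" "r < \<rho> a" using r0(2)[OF a] by auto
      from \<rho>(4)[OF a this] show "integrable lborel (\<lambda>w. indicator (ball y r) w * \<pi> a w) \<and>
         \<pi> a y * measure lborel (ball y r) + (if norm (y - a) < R then (\<integral>w. indicator (ball y r) w * ((w - y) \<bullet> (w - y)) \<partial>lborel) / (64 * R\<^sup>2) else 0)
          \<le> (\<integral>w. indicator (ball y r) w * \<pi> a w \<partial>lborel)" .
    qed
    ultimately show ?thesis using r0(1) by blast
  qed
  have x0s: "x0 \<in> cball x0 s" using s by simp
  have "u x0 \<le> ereal (b x0)"
  proof (rule comparison_principle[OF u compact_cball _ _ x0s])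
    fix y c assume y: "y \<in> cball x0 s" and c: "c < b y"
    show "\<exists>U. open U \<and> y \<in> U \<and> (\<forall>z\<in>U \<inter> cball x0 s. c < b z)"
    proof (cases "y \<in> AA")
      case True
      then have "c < 0" using c by (simp add: b_def)
      moreover have "b z \<ge> 0" if "z \<in> cball x0 s" for z using gM[OF that] by (simp add: b_def)
      ultimately show ?thesis by (intro exI[of _ UNIV]) (auto intro: less_le_trans)
    next
      case False
      obtain r0 where r0: "r0 > 0" "ball y r0 \<inter> AA = {}" "\<forall>a\<in>S. continuous_on (ball y r0) (\<pi> a)"
        using small[OF False] by blast
      have "continuous_on (ball y r0) (\<lambda>z. M - g z)"
        unfolding g_def Pb_def using r0(3) by (intro continuous_intros) auto
      then have "continuous_on (ball y r0) b"
        by (rule continuous_on_eq) (use r0(2) in \<open>auto simp: b_def\<close>)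
      then have "open (b -` {c<..} \<inter> ball y r0)" by (intro continuous_on_open_vimage[THEN iffD1, rule_format]) auto
      then show ?thesis using c r0(1) by (intro exI[of _ "b -` {c<..} \<inter> ball y r0"]) auto
    qed
  next
    fix y assume y: "y \<in> cball x0 s" and uy: "ereal (b y) < u y"
    have yA: "y \<notin> AA" using uy AA0[of y] by (auto simp: b_def zero_ereal_def[symmetric])
    have ns: "norm (y - x0) < s"
    proof (rule ccontr)
      assume "\<not> ?thesis"
      then have n: "norm (y - x0) = s" using y by (simp add: dist_norm norm_minus_commute)
      have "\<pi> a y = 0" if a: "a \<in> S" for a
      proof -
        have "norm (a - x0) \<le> s'" using a S(2) by (auto simp: dist_norm norm_minus_commute)
        then have "norm (y - a) \<ge> 5 * R"
          using n R norm_triangle_ineq[of "y - a" "a - x0"] by (simp add: s_def)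
        then show ?thesis by (rule \<pi>0[OF a])
      qed
      moreover have "Pb y = 0" using n s s' by (simp add: Pb_def sqn power_mono)
      ultimately have "g y = 0" using n by (simp add: g_def sqn)
      then have "b y = M" using yA by (simp add: b_def)
      then show False using uM[of y] y uy by (simp add: s_def)
    qed
    obtain r0 where r0: "r0 > 0" "ball y r0 \<inter> AA = {}"
      "\<And>r a. 0 < r \<Longrightarrow> r < r0 \<Longrightarrow> a \<in> S \<Longrightarrow> integrable lborel (\<lambda>w. indicator (ball y r) w * \<pi> a w) \<and>
         \<pi> a y * measure lborel (ball y r) + (if norm (y - a) < R then (\<integral>w. indicator (ball y r) w * ((w - y) \<bullet> (w - y)) \<partial>lborel) / (64 * R\<^sup>2) else 0)
          \<le> (\<integral>w. indicator (ball y r) w * \<pi> a w \<partial>lborel)"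
      using small[OF yA] by blast
    define r where "r = min (r0 / 2) (s - norm (y - x0))"
    have r: "0 < r" "r < r0" "r \<le> s - norm (y - x0)" using r0(1) ns by (auto simp: r_def)
    note rr = r0(3)[OF r(1,2)]
    let ?B = "ball y r"
    let ?V = "measure lborel ?B"
    let ?D = "\<integral>w. indicator ?B w * ((w - y) \<bullet> (w - y)) \<partial>lborel"
    note D = mean_square_distance_pos[OF r(1), of y] and sq = mean_square_norm[OF r(1), of y x0]
    have sub: "?B \<subseteq> cball x0 s"
    proof
      fix w assume "w \<in> ?B"
      then show "w \<in> cball x0 s" using r(3) norm_triangle_ineq[of "w - y" "y - x0"]
        by (simp add: dist_norm norm_minus_commute)
    qed
    have ic: "integrable lborel (\<lambda>w. indicator ?B w * c)" for c :: real
      using emeasure_lborel_ball_finite[of y r] by (intro integrable_mult_left integrable_real_indicator) auto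
    have iP: "integrable lborel (\<lambda>w. indicator ?B w * Pb w)"
    proof (rule Bochner_Integration.integrable_bound[OF ic[of "s'\<^sup>2"]])
      show "(\<lambda>w. indicator ?B w * Pb w) \<in> borel_measurable lborel"
        using borel_measurable_indicator_times[of ?B Pb] unfolding Pb_def by (simp add: continuous_intros)
      show "AE w in lborel. norm (indicator ?B w * Pb w) \<le> norm (indicator ?B w * s'\<^sup>2)"
        by (rule AE_I2) (auto simp: Pb_def indicator_def)
    qed
    have i\<pi>: "integrable lborel (\<lambda>w. \<Sum>a\<in>S. indicator ?B w * \<pi> a w)" using rr by auto
    have geq: "indicator ?B w * g w = \<beta> * (indicator ?B w * Pb w) + \<alpha> * (\<Sum>a\<in>S. indicator ?B w * \<pi> a w)
        + \<eta> * (indicator ?B w * ((w - x0) \<bullet> (w - x0)) - indicator ?B w * s\<^sup>2)" for w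
      by (simp add: g_def algebra_simps sum_distrib_left)
    have ig: "integrable lborel (\<lambda>w. indicator ?B w * g w)"
      unfolding geq using iP i\<pi> sq(1) ic by (intro Bochner_Integration.integrable_add integrable_mult_right Bochner_Integration.integrable_diff)
    have "(\<integral>w. indicator ?B w * g w \<partial>lborel) = \<beta> * (\<integral>w. indicator ?B w * Pb w \<partial>lborel)
       + \<alpha> * (\<Sum>a\<in>S. \<integral>w. indicator ?B w * \<pi> a w \<partial>lborel)
       + \<eta> * ((\<integral>w. indicator ?B w * ((w - x0) \<bullet> (w - x0)) \<partial>lborel) - ?V * s\<^sup>2)"
    proof -
      have "(\<integral>w. indicator ?B w * g w \<partial>lborel) = (\<integral>w. \<beta> * (indicator ?B w * Pb w) \<partial>lborel) + (\<integral>w. \<alpha> * (\<Sum>a\<in>S. indicator ?B w * \<pi> a w) \<partial>lborel)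
        + (\<integral>w. \<eta> * (indicator ?B w * ((w - x0) \<bullet> (w - x0)) - indicator ?B w * s\<^sup>2) \<partial>lborel)"
      proof -
        have i1: "integrable lborel (\<lambda>w. \<beta> * (indicator ?B w * Pb w))" using iP by (rule integrable_mult_right)
        have i2: "integrable lborel (\<lambda>w. \<alpha> * (\<Sum>a\<in>S. indicator ?B w * \<pi> a w))" using i\<pi> by (rule integrable_mult_right)
        have i3: "integrable lborel (\<lambda>w. \<eta> * (indicator ?B w * ((w - x0) \<bullet> (w - x0)) - indicator ?B w * s\<^sup>2))"
          using sq(1) ic by (intro integrable_mult_right Bochner_Integration.integrable_diff)
        show ?thesis unfolding geq
          by (simp only: Bochner_Integration.integral_add[OF Bochner_Integration.integrable_add[OF i1 i2] i3] Bochner_Integration.integral_add[OF i1 i2])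
      qed
      also have "(\<integral>w. (\<Sum>a\<in>S. indicator ?B w * \<pi> a w) \<partial>lborel) = (\<Sum>a\<in>S. \<integral>w. indicator ?B w * \<pi> a w \<partial>lborel)"
        using rr by (intro Bochner_Integration.integral_sum) auto
      then have "(\<integral>w. \<alpha> * (\<Sum>a\<in>S. indicator ?B w * \<pi> a w) \<partial>lborel) = \<alpha> * (\<Sum>a\<in>S. \<integral>w. indicator ?B w * \<pi> a w \<partial>lborel)" by simp
      also have "(\<integral>w. \<eta> * (indicator ?B w * ((w - x0) \<bullet> (w - x0)) - indicator ?B w * s\<^sup>2) \<partial>lborel)
        = \<eta> * ((\<integral>w. indicator ?B w * ((w - x0) \<bullet> (w - x0)) \<partial>lborel) - ?V * s\<^sup>2)"
        using sq(1) ic by (simp add: Bochner_Integration.integral_diff)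
      finally show ?thesis by simp
    qed
    moreover have "(\<integral>w. indicator ?B w * Pb w \<partial>lborel) \<ge> ?V * Pb y - (if norm (y - x0) < s' then ?D else 0)"
    proof (cases "norm (y - x0) < s'")
      case True
      then have "(norm (y - x0))\<^sup>2 \<le> s'\<^sup>2" by (intro power_mono) auto
      then have "Pb y = s'\<^sup>2 - (y - x0) \<bullet> (y - x0)" by (simp add: Pb_def sqn)
      then have "?V * Pb y - ?D = ?V * s'\<^sup>2 - (((y - x0) \<bullet> (y - x0)) * ?V + ?D)"
        by (simp only: right_diff_distrib) (simp add: mult.commute)
      also have "\<dots> = (\<integral>w. indicator ?B w * s'\<^sup>2 \<partial>lborel) - (\<integral>w. indicator ?B w * ((w - x0) \<bullet> (w - x0)) \<partial>lborel)"
        unfolding sq(2) by simp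
      also have "\<dots> = (\<integral>w. indicator ?B w * s'\<^sup>2 - indicator ?B w * ((w - x0) \<bullet> (w - x0)) \<partial>lborel)"
        by (rule Bochner_Integration.integral_diff[OF ic sq(1), symmetric])
      also have "\<dots> \<le> (\<integral>w. indicator ?B w * Pb w \<partial>lborel)"
        using sq(1) ic iP by (intro integral_mono) (auto simp: Pb_def indicator_def)
      finally show ?thesis using True by simp
    next
      case False
      then have "s'\<^sup>2 \<le> (norm (y - x0))\<^sup>2" using s' by (intro power_mono) auto
      then have "Pb y = 0" by (simp add: Pb_def sqn)
      moreover have "(\<integral>w. indicator ?B w * Pb w \<partial>lborel) \<ge> 0"
        by (intro integral_nonneg_AE AE_I2) (simp add: Pb_def)
      ultimately show ?thesis using False by simp
    qed
    then have "\<beta> * (\<integral>w. indicator ?B w * Pb w \<partial>lborel) \<ge> \<beta> * (?V * Pb y - (if norm (y - x0) < s' then ?D else 0))"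
      using \<beta> by (intro mult_left_mono) auto
    moreover have "(\<Sum>a\<in>S. \<integral>w. indicator ?B w * \<pi> a w \<partial>lborel) \<ge> ?V * (\<Sum>a\<in>S. \<pi> a y) + (if norm (y - x0) < s' then ?D / (64 * R\<^sup>2) else 0)"
    proof -
      let ?e = "\<lambda>a. if norm (y - a) < R then ?D / (64 * R\<^sup>2) else 0"
      have "(\<Sum>a\<in>S. \<pi> a y * ?V + ?e a) \<le> (\<Sum>a\<in>S. \<integral>w. indicator ?B w * \<pi> a w \<partial>lborel)"
        using rr by (intro sum_mono) blast
      moreover have e0: "?e a \<ge> 0" for a using D(2) by auto
      \<comment> \<open>One net point within \<open>R\<close> of \<open>y\<close> pays for the whole
        paraboloid; the other potentials only need to be subharmonic.\<close>
      have "(if norm (y - x0) < s' then ?D / (64 * R\<^sup>2) else 0) \<le> (\<Sum>a\<in>S. ?e a)"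
      proof (cases "norm (y - x0) < s'")
        case True
        then obtain p where p: "p \<in> S" "norm (y - p) < R" using S(4)[of y] by (auto simp: dist_norm norm_minus_commute)
        have "?e p \<le> (\<Sum>a\<in>S. ?e a)" using S(1) p(1) e0 by (intro member_le_sum) auto
        then show ?thesis using True p by simp
      next
        case False
        then show ?thesis using e0 by (simp only: if_False) (rule sum_nonneg)
      qed
      ultimately show ?thesis by (simp add: sum.distrib sum_distrib_left mult.commute)
    qed
    then have "\<alpha> * (\<Sum>a\<in>S. \<integral>w. indicator ?B w * \<pi> a w \<partial>lborel) \<ge> \<alpha> * (?V * (\<Sum>a\<in>S. \<pi> a y) + (if norm (y - x0) < s' then ?D / (64 * R\<^sup>2) else 0))"
      using \<alpha> by (intro mult_left_mono) auto
    moreover have "\<alpha> * (if norm (y - x0) < s' then ?D / (64 * R\<^sup>2) else 0) = \<beta> * (if norm (y - x0) < s' then ?D else 0)"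
      by (simp add: \<beta>_def)
    ultimately have "(\<integral>w. indicator ?B w * g w \<partial>lborel) \<ge> ?V * g y + \<eta> * ?D"
      unfolding sq(2) g_def by (simp add: algebra_simps)
    moreover have "\<eta> * ?D > 0" using \<eta> D(2) by simp
    ultimately have gm: "(\<integral>w. indicator ?B w * g w \<partial>lborel) > ?V * g y" by linarith
    have beq: "indicator ?B w * b w = indicator ?B w * M - indicator ?B w * g w" for w
    proof (cases "w \<in> ?B")
      case True
      then have "w \<in> ball y r0" using r(2) by simp
      then have "w \<notin> AA" using r0(2) by blast
      then show ?thesis by (simp add: b_def right_diff_distrib)
    qed simp
    have "integrable lborel (\<lambda>w. indicator ?B w * b w)"
      unfolding beq using ic ig by (rule Bochner_Integration.integrable_diff)
    moreover have "(\<integral>w. indicator ?B w * b w \<partial>lborel) < b y * ?V"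
      unfolding beq Bochner_Integration.integral_diff[OF ic ig] using gm yA by (simp add: b_def algebra_simps)
    ultimately show "\<exists>r>0. ball y r \<subseteq> cball x0 s \<and> integrable lborel (\<lambda>z. indicator (ball y r) z * b z)
       \<and> (\<integral>z. indicator (ball y r) z * b z \<partial>lborel) < b y * measure lborel (ball y r)"
      using r(1) sub by blast
  qed
  also have "b x0 \<le> M * (1 - min (s'\<^sup>2 / (256 * R\<^sup>2 * H)) (1 / 4))"
  proof (cases "x0 \<in> AA")
    case True
    then show ?thesis using M by (simp add: b_def)
  next
    case False
    have "(\<Sum>a\<in>S. \<pi> a x0) \<ge> 0" using \<pi>b False by (intro sum_nonneg) (auto simp: AA_def)
    then have "g x0 \<ge> \<beta> * s'\<^sup>2 - \<eta> * s\<^sup>2" using \<alpha> by (simp add: g_def Pb_def)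
    also have "\<beta> * s'\<^sup>2 - \<eta> * s\<^sup>2 = \<beta> * s'\<^sup>2 / 2" using s by (simp add: \<eta>_def)
    also have "\<beta> * s'\<^sup>2 / 2 = M * min (s'\<^sup>2 / (256 * R\<^sup>2 * H)) (1 / 4)"
    proof -
      have "\<beta> * s'\<^sup>2 / 2 = (s'\<^sup>2 / (128 * R\<^sup>2)) * \<alpha>" by (simp add: \<beta>_def)
      also have "\<dots> = min ((s'\<^sup>2 / (128 * R\<^sup>2)) * (M / (2 * H))) ((s'\<^sup>2 / (128 * R\<^sup>2)) * (32 * M * R\<^sup>2 / s'\<^sup>2))"
        unfolding \<alpha>_def min_mult_distrib_left by (rule if_P) simp
      also have "(s'\<^sup>2 / (128 * R\<^sup>2)) * (M / (2 * H)) = M * (s'\<^sup>2 / (256 * R\<^sup>2 * H))" by (simp add: mult_ac)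
      also have "(s'\<^sup>2 / (128 * R\<^sup>2)) * (32 * M * R\<^sup>2 / s'\<^sup>2) = M * (1 / 4)" using R s' by (simp add: field_simps)
      also have "min (M * (s'\<^sup>2 / (256 * R\<^sup>2 * H))) (M * (1 / 4)) = M * min (s'\<^sup>2 / (256 * R\<^sup>2 * H)) (1 / 4)"
        using min_mult_distrib_left[of M] M by simp
      finally show ?thesis .
    qed
    finally show ?thesis using False by (simp add: b_def algebra_simps)
  qed
  finally show ?thesis by simp
qed

section \<open>Lower growth bound\<close>

lemma antimono_on_integrable:
  fixes f :: "real \<Rightarrow> real"
  assumes "\<And>s t. a \<le> s \<Longrightarrow> s \<le> t \<Longrightarrow> t \<le> b \<Longrightarrow> f t \<le> f s"
  shows "f integrable_on {a..b}"
proof -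
  have "mono_on {a..b} (\<lambda>t. - f t)" using assms by (auto simp: monotone_on_def)
  then have "(\<lambda>t. - f t) integrable_on {a..b}" by (rule integrable_on_mono_on)
  from integrable_neg[OF this] show ?thesis by simp
qed

text \<open>The potential \<open>f / \<delta> + log\<^sub>2 S\<close> gains at least \<open>1\<close> over every interval \<open>[a, a + 2 S a]\<close>:
  either \<open>S\<close> at most doubles on it and one step of the hypothesis fits in, or \<open>log\<^sub>2 S\<close> grows by \<open>1\<close>.\<close>

lemma growth_from_steps:
  fixes f S \<phi> :: "real \<Rightarrow> real"
  assumes r0: "r0 \<ge> 1" and \<delta>: "\<delta> > 0" and C1: "C1 > 0"
    and f_mono: "\<And>s t. r0 / 2 \<le> s \<Longrightarrow> s \<le> t \<Longrightarrow> f s \<le> f t"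
    and f_nonneg: "\<And>t. r0 / 2 \<le> t \<Longrightarrow> f t \<ge> 0"
    and S_mono: "\<And>s t. r0 \<le> s \<Longrightarrow> s \<le> t \<Longrightarrow> S s \<le> S t"
    and S_pos: "\<And>t. r0 \<le> t \<Longrightarrow> S t > 0"
    and S_le: "\<And>t. r0 \<le> t \<Longrightarrow> S t \<le> t / 2"
    and step: "\<And>r. r0 \<le> r \<Longrightarrow> f r \<ge> f (r - S r) + \<delta>"
    and \<phi>_anti: "\<And>s t. 1 \<le> s \<Longrightarrow> s \<le> t \<Longrightarrow> \<phi> t \<le> \<phi> s"
    and \<phi>_le: "\<And>t. r0 \<le> t \<Longrightarrow> \<phi> t \<le> C1 / S t"
  shows "\<exists>c>0. \<exists>\<rho>0. \<forall>\<rho>\<ge>\<rho>0. f \<rho> \<ge> c * integral {1..\<rho>} \<phi>"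
proof -
  have int: "\<phi> integrable_on {a..b}" if "1 \<le> a" for a b
    by (rule antimono_on_integrable) (use that \<phi>_anti in auto)
  define a where "a n = ((\<lambda>t. t + 2 * S t) ^^ n) r0" for n
  have a0: "a 0 = r0" and aS: "a (Suc n) = a n + 2 * S (a n)" for n by (simp_all add: a_def)
  have age: "a n \<ge> r0 + 2 * real n * S r0 \<and> a n \<ge> r0" for n
  proof (induction n)
    case (Suc n)
    have "S (a n) \<ge> S r0" using Suc by (intro S_mono) auto
    then show ?case using Suc S_pos[of r0] by (simp add: aS algebra_simps)
  qed (simp add: a0)
  have ar0: "a n \<ge> r0" for n using age by blast
  define \<Lambda> where "\<Lambda> t = f t / \<delta> + log 2 (S t)" for t
  have gain: "\<Lambda> (a (Suc n)) \<ge> \<Lambda> (a n) + 1" for n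
  proof (cases "S (a (Suc n)) \<le> 2 * S (a n)")
    case True
    have "a n \<le> a (Suc n) - S (a (Suc n))" using True by (simp add: aS)
    then have "f (a n) \<le> f (a (Suc n) - S (a (Suc n)))" using ar0[of n] r0 by (intro f_mono) auto
    then have "f (a (Suc n)) \<ge> f (a n) + \<delta>" using step[OF ar0[of "Suc n"]] by simp
    then have "f (a (Suc n)) / \<delta> \<ge> (f (a n) + \<delta>) / \<delta>" using \<delta> by (intro divide_right_mono) auto
    then have "f (a (Suc n)) / \<delta> \<ge> f (a n) / \<delta> + 1" using \<delta> by (simp add: add_divide_distrib)
    moreover have "log 2 (S (a n)) \<le> log 2 (S (a (Suc n)))"
      using S_pos[OF ar0[of n]] S_mono[OF ar0[of n], of "a (Suc n)"] aS[of n] by (subst log_le_cancel_iff) auto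
    ultimately show ?thesis by (simp add: \<Lambda>_def)
  next
    case False
    have "log 2 (2 * S (a n)) \<le> log 2 (S (a (Suc n)))"
      using S_pos[OF ar0] False by (subst log_le_cancel_iff) auto
    then have "log 2 (S (a n)) + 1 \<le> log 2 (S (a (Suc n)))"
      using S_pos[OF ar0[of n]] by (simp add: log_mult)
    moreover have "f (a n) \<le> f (a (Suc n))" using ar0[of n] r0 S_pos[OF ar0[of n]] by (intro f_mono) (auto simp: aS)
    then have "f (a n) / \<delta> \<le> f (a (Suc n)) / \<delta>" using \<delta> by (simp add: divide_right_mono)
    ultimately show ?thesis by (simp add: \<Lambda>_def)
  qed
  have total: "\<Lambda> (a n) \<ge> \<Lambda> r0 + real n" for n
  proof (induction n)
    case (Suc n) then show ?case using gain[of n] by simp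
  qed (simp add: a0)
  have piece: "integral {s..t} \<phi> \<le> 2 * C1" if "s \<ge> r0" "t \<le> s + 2 * S s" "s \<le> t" for s t
  proof -
    have "integral {s..t} \<phi> \<le> integral {s..t} (\<lambda>_. C1 / S s)"
      using that r0 \<phi>_anti[of s] \<phi>_le[of s]
      by (intro integral_le int) (auto intro: order_trans)
    also have "\<dots> = (C1 / S s) * (t - s)" using that by simp
    also have "\<dots> \<le> (C1 / S s) * (2 * S s)" using that C1 S_pos[of s] by (intro mult_left_mono) auto
    finally show ?thesis using S_pos[of s] that by simp
  qed
  have upto: "integral {r0..a n} \<phi> \<le> 2 * C1 * real n" for n
  proof (induction n)
    case (Suc n)
    have le: "a n \<le> a (Suc n)" using S_pos[OF ar0[of n]] by (simp add: aS)
    have "integral {r0..a (Suc n)} \<phi> = integral {r0..a n} \<phi> + integral {a n..a (Suc n)} \<phi>"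
      using ar0[of n] le int[of r0] r0 by (intro Henstock_Kurzweil_Integration.integral_combine[symmetric]) auto
    then show ?case using Suc piece[OF ar0[of n], of "a (Suc n)"] le by (simp add: aS algebra_simps)
  qed (simp add: a0)
  \<comment> \<open>As \<open>S \<rho> \<le> \<rho> / 2\<close>, each doubling of \<rho> contains a
    full step. The resulting logarithmic lower bound on \<open>f\<close> absorbs the
    \<open>log 2 (S _)\<close> part of \<Lambda>.\<close>
  have flog: "\<rho> \<ge> 2 ^ k * r0 \<Longrightarrow> f \<rho> \<ge> real k * \<delta>" for k \<rho>
  proof (induction k arbitrary: \<rho>)
    case 0 then show ?case using f_nonneg[of \<rho>] r0 by simp
  next
    case (Suc k)
    have "1 * r0 \<le> 2 ^ Suc k * r0" using r0 by (intro mult_right_mono one_le_power) auto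
    then have \<rho>: "\<rho> \<ge> r0" using Suc.prems by linarith
    have "f (\<rho> / 2) \<ge> real k * \<delta>" using Suc.prems by (intro Suc.IH) simp
    also have "f (\<rho> / 2) \<le> f (\<rho> - S \<rho>)" using S_le[OF \<rho>] \<rho> by (intro f_mono) auto
    finally show ?case using step[OF \<rho>] by (simp add: algebra_simps)
  qed
  define K where "K = \<bar>integral {1..r0} \<phi>\<bar> + 2 * C1 * (\<bar>log 2 r0\<bar> + \<bar>log 2 (S r0)\<bar> + 3)"
  have main: "integral {1..\<rho>} \<phi> \<le> K + 4 * C1 / \<delta> * f \<rho>" if \<rho>: "\<rho> \<ge> r0" for \<rho>
  proof -
    obtain N :: nat where N: "\<rho> / (2 * S r0) < real N" using reals_Archimedean2 by blast
    then have "\<rho> < a N" using age[of N] S_pos[of r0] r0 by (simp add: divide_less_eq algebra_simps)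
    then have ex: "\<exists>n. \<rho> < a n" by blast
    define m where "m = (LEAST n. \<rho> < a n)"
    have m: "\<rho> < a m" unfolding m_def by (rule LeastI_ex[OF ex])
    then have "m \<noteq> 0" using \<rho> a0 by (metis not_less)
    then obtain n where n: "m = Suc n" using not0_implies_Suc by blast
    then have an: "a n \<le> \<rho>" using not_less_Least[of n "\<lambda>n. \<rho> < a n"] m_def by auto
    have "integral {r0..\<rho>} \<phi> = integral {r0..a n} \<phi> + integral {a n..\<rho>} \<phi>"
      using ar0[of n] an int[of r0] r0 by (intro Henstock_Kurzweil_Integration.integral_combine[symmetric]) auto
    also have "\<dots> \<le> 2 * C1 * real n + 2 * C1"
      using upto[of n] piece[OF ar0[of n], of \<rho>] an m n by (intro add_mono) (auto simp: aS)
    finally have 1: "integral {r0..\<rho>} \<phi> \<le> 2 * C1 * (real n + 1)" by (simp add: algebra_simps)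
    have "real n \<le> \<Lambda> (a n) - \<Lambda> r0" using total[of n] by simp
    also have "\<dots> \<le> f \<rho> / \<delta> + log 2 \<rho> - log 2 (S r0)"
    proof -
      have "f (a n) / \<delta> \<le> f \<rho> / \<delta>" using an ar0[of n] r0 \<delta> by (intro divide_right_mono f_mono) auto
      moreover have "log 2 (S (a n)) \<le> log 2 \<rho>"
        using S_pos[OF ar0[of n]] S_le[OF ar0[of n]] an by (subst log_le_cancel_iff) auto
      moreover have "f r0 / \<delta> \<ge> 0" using f_nonneg[of r0] r0 \<delta> by simp
      ultimately show ?thesis by (simp add: \<Lambda>_def)
    qed
    finally have 2: "real n \<le> f \<rho> / \<delta> + log 2 \<rho> - log 2 (S r0)" .
    have 3: "log 2 \<rho> \<le> f \<rho> / \<delta> + 1 + log 2 r0"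
    proof -
      define k where "k = nat \<lfloor>log 2 (\<rho> / r0)\<rfloor>"
      have l0: "log 2 (\<rho> / r0) \<ge> 0" using \<rho> r0 by simp
      have k: "real k \<le> log 2 (\<rho> / r0)" "log 2 (\<rho> / r0) \<le> real k + 1" using l0 by (auto simp: k_def)
      have "2 powr real k \<le> \<rho> / r0" using k(1) \<rho> r0 by (simp add: le_log_iff)
      then have "\<rho> \<ge> 2 ^ k * r0" using r0 by (simp add: powr_realpow field_simps)
      from flog[OF this] have "real k \<le> f \<rho> / \<delta>" using \<delta> by (simp add: field_simps)
      then have "log 2 (\<rho> / r0) \<le> f \<rho> / \<delta> + 1" using k(2) by simp
      then show ?thesis using \<rho> r0 by (simp add: log_divide)
    qed
    have "real n + 1 \<le> 2 * (f \<rho> / \<delta>) + (\<bar>log 2 r0\<bar> + \<bar>log 2 (S r0)\<bar> + 3)" using 2 3 by linarith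
    then have "2 * C1 * (real n + 1) \<le> 2 * C1 * (2 * (f \<rho> / \<delta>) + (\<bar>log 2 r0\<bar> + \<bar>log 2 (S r0)\<bar> + 3))"
      using C1 by (intro mult_left_mono) auto
    then have 4: "integral {r0..\<rho>} \<phi> \<le> 4 * C1 / \<delta> * f \<rho> + 2 * C1 * (\<bar>log 2 r0\<bar> + \<bar>log 2 (S r0)\<bar> + 3)"
      using 1 by (simp add: distrib_left)
    have "integral {1..\<rho>} \<phi> = integral {1..r0} \<phi> + integral {r0..\<rho>} \<phi>"
      using r0 \<rho> int[of 1] by (intro Henstock_Kurzweil_Integration.integral_combine[symmetric]) auto
    then show ?thesis using 4 by (simp add: K_def)
  qed
  have K: "K \<ge> 0" using C1 by (simp add: K_def)
  \<comment> \<open>By \<open>flog\<close>, \<open>f\<close> eventually exceeds the additive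
    constant \<open>K\<close>, which is then absorbed into the factor.\<close>
  obtain k :: nat where k: "K / \<delta> < real k" using reals_Archimedean2 by blast
  define c where "c = 1 / (1 + 4 * C1 / \<delta>)"
  have cp: "1 + 4 * C1 / \<delta> > 0" using C1 \<delta> by (simp add: add_pos_pos)
  have "f \<rho> \<ge> c * integral {1..\<rho>} \<phi>" if \<rho>: "\<rho> \<ge> 2 ^ k * r0" for \<rho>
  proof -
    have "1 * r0 \<le> 2 ^ k * r0" using r0 by (intro mult_right_mono one_le_power) auto
    then have "integral {1..\<rho>} \<phi> \<le> K + 4 * C1 / \<delta> * f \<rho>" using \<rho> by (intro main) simp
    also have "K \<le> real k * \<delta>" using k \<delta> by (simp add: divide_less_eq less_imp_le)
    also have "\<dots> \<le> f \<rho>" using flog[OF \<rho>] .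
    finally have "integral {1..\<rho>} \<phi> \<le> (1 + 4 * C1 / \<delta>) * f \<rho>" by (simp add: distrib_right)
    then show ?thesis using cp by (simp add: c_def divide_le_eq mult.commute)
  qed
  moreover have "c > 0" using cp by (simp add: c_def)
  ultimately show ?thesis by blast
qed

section \<open>The rate functions and their regularity\<close>

locale recurrence_rate =
  fixes d :: nat and R \<epsilon> :: "real \<Rightarrow> real"
  assumes d: "d \<ge> 2"
    and R_pos: "\<And>t. t \<ge> 0 \<Longrightarrow> R t > 0"
    and R_mono: "\<And>s t. 0 \<le> s \<Longrightarrow> s \<le> t \<Longrightarrow> R s \<le> R t"
    and R_concave: "concave_on {0..} R"
    and eps: "\<And>t. t \<ge> 0 \<Longrightarrow> 0 < \<epsilon> t \<and> \<epsilon> t < 1"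
    and eps_anti: "\<And>s t. 0 \<le> s \<Longrightarrow> s \<le> t \<Longrightarrow> \<epsilon> t \<le> \<epsilon> s"
begin

definition "ke t = kr d (\<epsilon> t)"

text \<open>The reciprocal of \<open>phi\<close>, by \<open>phi_eq\<close>: the length over which
  \<open>log M\<close> gains about a constant.\<close>

definition "\<psi> t = R t * sqrt (ke t)"

lemma phi_eq: "t \<ge> 0 \<Longrightarrow> phi d \<epsilon> R t = 1 / \<psi> t"
  using eps[of t] by (simp add: phi_def \<psi>_def ke_def cap_kernel_eq)

lemma ke_pos: "t \<ge> 0 \<Longrightarrow> ke t > 0"
  using eps[of t] kr_pos[OF d, of "\<epsilon> t"] by (simp add: ke_def)

lemma ke_mono: "0 \<le> s \<Longrightarrow> s \<le> t \<Longrightarrow> ke s \<le> ke t"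
  unfolding ke_def using eps[of t] eps_anti[of s t] by (intro kr_antimono) auto

lemma \<psi>_pos: "t \<ge> 0 \<Longrightarrow> \<psi> t > 0"
  using R_pos[of t] ke_pos[of t] by (simp add: \<psi>_def)

lemma \<psi>_mono: "0 \<le> s \<Longrightarrow> s \<le> t \<Longrightarrow> \<psi> s \<le> \<psi> t"
  unfolding \<psi>_def using R_pos[of t] R_mono[of s t] ke_mono[of s t] ke_pos[of s] by (intro mult_mono) auto

lemma R_le_\<psi>: "t \<ge> 0 \<Longrightarrow> R t * sqrt (ke 0) \<le> \<psi> t"
  unfolding \<psi>_def using R_pos[of t] ke_mono[of 0 t] by (intro mult_left_mono) auto

lemma phi_pos: "t \<ge> 0 \<Longrightarrow> phi d \<epsilon> R t > 0"
  using \<psi>_pos by (simp add: phi_eq)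

lemma phi_antimono: "0 \<le> s \<Longrightarrow> s \<le> t \<Longrightarrow> phi d \<epsilon> R t \<le> phi d \<epsilon> R s"
  using \<psi>_pos[of s] \<psi>_mono[of s t] by (simp add: phi_eq frac_le)

lemma phi_integrable: "0 \<le> a \<Longrightarrow> phi d \<epsilon> R integrable_on {a..b}"
  by (rule antimono_on_integrable) (use phi_antimono in auto)

lemma integral_phi_ge:
  assumes "1 \<le> a" "a \<le> b" shows "integral {1..b} (phi d \<epsilon> R) \<ge> (a - 1) * phi d \<epsilon> R a"
proof -
  have "(a - 1) * phi d \<epsilon> R a = integral {1..a} (\<lambda>_. phi d \<epsilon> R a)" using assms by simp
  also have "\<dots> \<le> integral {1..a} (phi d \<epsilon> R)"
    using assms phi_antimono by (intro integral_le phi_integrable) auto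
  also have "\<dots> \<le> integral {1..b} (phi d \<epsilon> R)"
    using assms by (intro integral_subset_le phi_integrable) (auto intro!: less_imp_le[OF phi_pos])
  finally show ?thesis .
qed

text \<open>Concavity together with \<open>R 0 > 0\<close>. It makes \<open>R\<close> comparable at
  comparable radii.\<close>

lemma R_scale:
  assumes "0 \<le> k" "k \<le> 1" "t \<ge> 0" shows "k * R t \<le> R (k * t)"
proof -
  have "(1 - k) * R 0 + k * R t \<le> R ((1 - k) *\<^sub>R 0 + k *\<^sub>R t)"
    by (rule concave_onD[OF R_concave]) (use assms in auto)
  moreover have "(1 - k) * R 0 \<ge> 0" using assms R_pos[of 0] by simp
  ultimately show ?thesis by simp
qed

text \<open>In the plane, dividing the argument by \<open>N\<close> adds \<open>ln N\<close>; this
  is absorbed into a factor because \<open>ke\<close> stays above \<open>ke 0 > 0\<close>.\<close>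

lemma kr_scale_bound:
  assumes "N \<ge> 1"
  obtains C where "C > 0" "\<And>t. t \<ge> 0 \<Longrightarrow> kr d (\<epsilon> t / N) \<le> C * ke t"
proof -
  define C where "C = (if d = 2 then 1 + ln N / ke 0 else N ^ (d - 2))"
  have "C > 0" using assms ke_pos[of 0] by (auto simp: C_def intro!: add_pos_nonneg)
  moreover have "kr d (\<epsilon> t / N) \<le> C * ke t" if t: "t \<ge> 0" for t
  proof (cases "d = 2")
    case True
    have "ln N \<le> ln N / ke 0 * ke t"
      using ke_mono[of 0 t] ke_pos[of 0] assms t by (simp add: field_simps mult_left_mono)
    moreover have "kr d (\<epsilon> t / N) = ke t + ln N" using True assms eps[OF t] unfolding ke_def by (simp add: kr_def ln_div)
    ultimately show ?thesis using True by (simp add: C_def algebra_simps)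
  next
    case False
    then show ?thesis using assms by (simp add: kr_def ke_def C_def power_divide)
  qed
  ultimately show ?thesis using that by blast
qed

end

section \<open>Growth of \<open>M_u\<close> from repeated decay\<close>

lemma max_on_ball_real:
  fixes u :: "'a::euclidean_space \<Rightarrow> ereal"
  assumes u: "subharmonic u" and x0: "u x0 \<ge> 1" and \<rho>: "norm x0 \<le> \<rho>"
  shows "max_on_ball u \<rho> = ereal (real_of_ereal (max_on_ball u \<rho>))" "real_of_ereal (max_on_ball u \<rho>) \<ge> 1"
proof -
  obtain B where "\<And>x. x \<in> cball 0 \<rho> \<Longrightarrow> u x \<le> ereal B" by (rule subharmonic_bounded_above[OF u compact_cball[of 0 \<rho>]]) auto
  then have 1: "max_on_ball u \<rho> \<le> ereal B" unfolding max_on_ball_def by (intro SUP_least)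
  have "u x0 \<le> max_on_ball u \<rho>" unfolding max_on_ball_def by (rule SUP_upper) (use \<rho> in simp)
  then have 2: "1 \<le> max_on_ball u \<rho>" using x0 by (rule order_trans[rotated])
  show "max_on_ball u \<rho> = ereal (real_of_ereal (max_on_ball u \<rho>))" "real_of_ereal (max_on_ball u \<rho>) \<ge> 1"
    using 1 2 by (cases "max_on_ball u \<rho>"; auto)+
qed

lemma (in recurrence_rate) growth_lower_bound:
  fixes u :: "'a::euclidean_space \<Rightarrow> ereal"
  assumes dd: "DIM('a) = d" and lim: "Limsup at_top (\<lambda>t. ereal (1 / (t * phi d \<epsilon> R t))) < 1"
    and Ro: "R \<in> o[at_top](\<lambda>r. r)"
    and u: "subharmonic u" and rec: "recurrent \<epsilon> R (zero_set u)" and ux0: "u x\<^sub>0 \<ge> 1"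
  shows "Liminf at_top (\<lambda>\<rho>. ereal (growth_ratio \<epsilon> R u \<rho>)) > 0"
proof -
  define m where "m \<rho> = real_of_ereal (max_on_ball u \<rho>)" for \<rho>
  have mm: "max_on_ball u \<rho> = ereal (m \<rho>)" "m \<rho> \<ge> 1" if "\<rho> \<ge> norm x\<^sub>0" for \<rho>
    using max_on_ball_real[OF u ux0 that] by (auto simp: m_def)
  have um: "u x \<le> ereal (m \<rho>)" if "\<rho> \<ge> norm x\<^sub>0" "norm x \<le> \<rho>" for x \<rho>
    unfolding mm(1)[OF that(1), symmetric] max_on_ball_def by (rule SUP_upper) (use that in simp)
  have m_mono: "m s \<le> m t" if "norm x\<^sub>0 \<le> s" "s \<le> t" for s t
  proof -
    have "max_on_ball u s \<le> max_on_ball u t"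
      unfolding max_on_ball_def by (rule SUP_subset_mono) (use that in auto)
    then show ?thesis using mm(1)[of s] mm(1)[of t] that by simp
  qed
  define f where "f \<rho> = ln (m \<rho>)" for \<rho>
  \<comment> \<open>The paraboloid width \<open>\<psi> r / 4\<close> plus the margin
    \<open>6 * R r\<close> that \<open>subharmonic_decay\<close> needs.\<close>
  define S where "S r = \<psi> r / 4 + 6 * R r" for r
  define c0 where "c0 = sqrt (ke 0)"
  have c0: "c0 > 0" using ke_pos[of 0] by (simp add: c0_def)
  define C1 where "C1 = 1 / 4 + 6 / c0"
  have C1: "C1 > 0" using c0 by (simp add: C1_def add_pos_pos)
  have SC: "S r \<le> C1 * \<psi> r" if "r \<ge> 0" for r
  proof -
    have "R r \<le> \<psi> r / c0" using R_le_\<psi>[OF that] c0 by (simp add: c0_def field_simps)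
    then show ?thesis by (simp add: S_def C1_def algebra_simps)
  qed
  have Spos: "S r > 0" if "r \<ge> 0" for r using \<psi>_pos[OF that] R_pos[OF that] by (simp add: S_def)
  have Smono: "S s \<le> S t" if "0 \<le> s" "s \<le> t" for s t
    using \<psi>_mono[OF that] R_mono[OF that] by (simp add: S_def)
  have "eventually (\<lambda>t. ereal (1 / (t * phi d \<epsilon> R t)) < 1) at_top" by (rule Limsup_lessD[OF lim])
  \<comment> \<open>With \<open>6 * R r \<le> r / 8\<close>, and \<open>\<psi> r \<le> r\<close>
    from the limsup hypothesis, a step is at most \<open>r / 2\<close> long and all cells stay at
    norm at least \<open>r / 4\<close>, where \<open>R\<close> is comparable to
    \<open>R r\<close>.\<close>
  moreover have "eventually (\<lambda>r. norm (R r) \<le> 1 / 48 * norm r) at_top"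
    using landau_o.smallD[OF Ro, of "1 / 48"] by simp
  ultimately have "eventually (\<lambda>r. \<psi> r \<le> r \<and> R r \<le> r / 48 \<and> r \<ge> 2 * norm x\<^sub>0 + 2) at_top"
    using eventually_ge_at_top[of "2 * norm x\<^sub>0 + 2"]
  proof eventually_elim
    case (elim r)
    then have r: "r > 0" by (smt (verit) norm_ge_zero)
    then have "1 / (r * (1 / \<psi> r)) < 1" using elim(1) by (simp add: phi_eq one_ereal_def)
    then have "\<psi> r / r < 1" by simp
    then have "\<psi> r \<le> r" using r by (simp add: divide_less_eq)
    then show ?case using elim r by simp
  qed
  then obtain r0 where r0': "\<And>r. r \<ge> r0 \<Longrightarrow> \<psi> r \<le> r \<and> R r \<le> r / 48 \<and> r \<ge> 2 * norm x\<^sub>0 + 2"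
    unfolding eventually_at_top_linorder by blast
  have r0: "r0 \<ge> 2 * norm x\<^sub>0 + 2" using r0' by blast
  then have r01: "r0 \<ge> 1" "r0 / 2 \<ge> norm x\<^sub>0" using norm_ge_zero[of x\<^sub>0] by linarith+
  \<comment> \<open>Here 32 is 4 times 8: \<open>R\<close> may drop by the factor 4 inside the
    annulus, and energies are measured at the scale \<open>8 * R r\<close>.\<close>
  obtain C2 where C2: "C2 > 0" "\<And>t. t \<ge> 0 \<Longrightarrow> kr d (\<epsilon> t / 32) \<le> C2 * ke t" using kr_scale_bound[of 32] by auto
  \<comment> \<open>Inserting \<open>(\<psi> r)\<^sup>2 = (R r)\<^sup>2 * ke r\<close> into the gain
    of \<open>subharmonic_decay\<close>, with \<open>H\<close> at most a multiple of
    \<open>ke r\<close>, cancels \<open>ke r\<close>: the relative loss does not depend on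
    \<open>r\<close>. The factor 4096 is 16 times 256.\<close>
  define q where "q = 1 / (4096 * (11 ^ d * (2 * ckap d * C2)))"
  have q: "q > 0" using C2 ckap_pos[OF d] by (simp add: q_def)
  define \<delta>0 where "\<delta>0 = min q (1 / 4)"
  have \<delta>0: "0 < \<delta>0" "\<delta>0 < 1" using q by (auto simp: \<delta>0_def)
  define \<delta> where "\<delta> = - ln (1 - \<delta>0)"
  have \<delta>: "\<delta> > 0" using \<delta>0 by (simp add: \<delta>_def)
  have step: "f r \<ge> f (r - S r) + \<delta>" if r: "r \<ge> r0" for r
  proof -
    have rp: "r > 0" using r r01 by linarith
    have \<psi>r: "\<psi> r \<le> r" "\<psi> r > 0" and Rr: "R r \<le> r / 48" "R r > 0"
      using r0'[OF r] \<psi>_pos[of r] R_pos[of r] rp by auto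
    have Sr: "S r \<le> r / 2" using \<psi>r Rr unfolding S_def by linarith
    define \<rho>1 where "\<rho>1 = r - S r"
    have \<rho>1: "\<rho>1 > 0" "\<rho>1 \<ge> norm x\<^sub>0" "\<rho>1 \<le> r" "r \<ge> norm x\<^sub>0"
      using Sr rp Spos[of r] r r01 by (auto simp: \<rho>1_def)
    have m1: "m r \<ge> 1" using mm(2)[OF \<rho>1(4)] .
    define I where "I = kr d (\<epsilon> r / 32)"
    have er: "0 < \<epsilon> r" "\<epsilon> r < 1" using eps[of r] rp by auto
    have I: "I > 0" "I \<le> C2 * ke r" using er rp C2(2)[of r] by (auto simp: I_def intro!: kr_pos[OF d])
    define H where "H = 11 ^ d * (2 * ckap d * I)"
    have bound: "u x \<le> ereal (m r * (1 - \<delta>0))" if x: "norm x = \<rho>1" for x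
    proof -
      have "u x \<le> ereal (m r * (1 - min ((\<psi> r / 4)\<^sup>2 / (256 * (R r)\<^sup>2 * H)) (1 / 4)))"
      proof (rule subharmonic_decay[OF dd d u _ Rr(2) _ I(1) _ _ H_def])
        show "0 < m r" using m1 by simp
        show "0 < \<psi> r / 4" using \<psi>r by simp
        fix y assume "y \<in> cball x (\<psi> r / 4 + 6 * R r)"
        then have "norm (y - x) \<le> S r" by (simp add: S_def dist_norm norm_minus_commute)
        then have "norm y \<le> r" using x norm_triangle_ineq[of "y - x" x] by (simp add: \<rho>1_def)
        then show "u y \<le> ereal (m r)" by (rule um[OF \<rho>1(4)])
      next
        fix y assume "y \<in> cball x (\<psi> r / 4)"
        then have "norm (y - x) \<le> \<psi> r / 4" by (simp add: dist_norm norm_minus_commute)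
        then have yr: "norm y \<le> r" "norm y \<ge> r / 4"
          using x norm_triangle_ineq[of "y - x" x] norm_triangle_ineq2[of x "x - y"] \<psi>r Rr
          by (auto simp: \<rho>1_def S_def norm_minus_commute)
        have Ry: "R (norm y) \<ge> R r / 4" "R (norm y) \<le> R r"
          using R_scale[of "1 / 4" r] R_mono[of "r / 4" "norm y"] R_mono[of "norm y" r] yr rp by auto
        have ey: "\<epsilon> (norm y) \<ge> \<epsilon> r" using eps_anti[of "norm y" r] yr by simp
        define c where "c = R r / 4 * \<epsilon> r"
        have c: "c > 0" using Rr er by (simp add: c_def)
        have "c \<le> R (norm y) * \<epsilon> (norm y)" unfolding c_def using Ry ey Rr er by (intro mult_mono) auto
        also have "\<dots> < capacity (ball y (R (norm y)) \<inter> zero_set u)" using rec by (simp add: recurrent_def)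
        finally obtain K \<mu> where K: "compact K" "K \<subseteq> ball y (R (norm y)) \<inter> zero_set u" "borel_prob_on K \<mu>"
          "\<And>L. L \<ge> 2 * R (norm y) \<Longrightarrow> kk_energy L \<mu> < ennreal (kr DIM('a) (c / L))"
          by (rule capacity_gt_imp[of c _ y "R (norm y)", rotated 3]) (use d dd c in auto)
        have "kk_energy (8 * R r) \<mu> < ennreal (kr DIM('a) (c / (8 * R r)))" using Ry Rr by (intro K(4)) auto
        moreover have "c / (8 * R r) = \<epsilon> r / 32" using Rr by (simp add: c_def)
        ultimately have "kk_energy (8 * R r) \<mu> < ennreal I" by (simp add: I_def dd)
        moreover have "K \<subseteq> ball y (R r)" using K(2) Ry(2) by auto
        moreover have "\<forall>z\<in>K. u z \<le> 0" using K(2) by (auto simp: zero_set_def)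
        ultimately show "\<exists>K \<mu>. compact K \<and> K \<subseteq> ball y (R r) \<and> (\<forall>z\<in>K. u z \<le> 0) \<and> borel_prob_on K \<mu> \<and> kk_energy (8 * R r) \<mu> < ennreal I"
          using K(1,3) by blast
      qed
      also have "m r * (1 - min ((\<psi> r / 4)\<^sup>2 / (256 * (R r)\<^sup>2 * H)) (1 / 4)) \<le> m r * (1 - \<delta>0)"
      proof (intro mult_left_mono diff_left_mono)
        have ck: "ckap d > 0" by (rule ckap_pos[OF d])
        have "(\<psi> r)\<^sup>2 = (R r)\<^sup>2 * ke r" using ke_pos[of r] rp by (simp add: \<psi>_def power_mult_distrib)
        then have eq: "(\<psi> r / 4)\<^sup>2 / (256 * (R r)\<^sup>2 * H) = ke r / (4096 * H)"
          using Rr by (simp add: power_divide)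
        have "H \<le> 11 ^ d * (2 * ckap d * (C2 * ke r))"
          unfolding H_def using I ck by (intro mult_left_mono) auto
        then have "ke r / (4096 * (11 ^ d * (2 * ckap d * (C2 * ke r)))) \<le> ke r / (4096 * H)"
          using I ck ke_pos[of r] rp C2 by (intro divide_left_mono) (auto simp: H_def)
        also have "ke r / (4096 * (11 ^ d * (2 * ckap d * (C2 * ke r)))) = q"
          using ke_pos[of r] rp by (simp add: q_def)
        finally show "\<delta>0 \<le> min ((\<psi> r / 4)\<^sup>2 / (256 * (R r)\<^sup>2 * H)) (1 / 4)" unfolding eq \<delta>0_def by (intro min.mono) auto
      qed (use m1 in simp)
      finally show ?thesis by simp
    qed
    have "max_on_ball u \<rho>1 \<le> ereal (m r * (1 - \<delta>0))"
      unfolding max_on_ball_def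
    proof (rule SUP_least)
      fix x :: 'a assume "x \<in> cball 0 \<rho>1"
      then show "u x \<le> ereal (m r * (1 - \<delta>0))"
        using subharmonic_maximum_principle[OF u \<rho>1(1) bound, of x] by simp
    qed
    then have "m \<rho>1 \<le> m r * (1 - \<delta>0)" using mm(1)[OF \<rho>1(2)] by simp
    then have "ln (m \<rho>1) \<le> ln (m r * (1 - \<delta>0))" using mm(2)[OF \<rho>1(2)] by simp
    also have "\<dots> = ln (m r) + ln (1 - \<delta>0)" using m1 \<delta>0 by (simp add: ln_mult)
    finally show ?thesis by (simp add: f_def \<delta>_def \<rho>1_def)
  qed
  have "\<exists>c>0. \<exists>\<rho>0. \<forall>\<rho>\<ge>\<rho>0. f \<rho> \<ge> c * integral {1..\<rho>} (phi d \<epsilon> R)"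
  proof (rule growth_from_steps[OF r01(1) \<delta> C1, of f S])
    fix s t assume st: "r0 / 2 \<le> s" "s \<le> t"
    then show "f s \<le> f t" using m_mono[of s t] mm(2)[of s] r01 by (simp add: f_def)
  next
    fix t assume "r0 / 2 \<le> t"
    then show "0 \<le> f t" using mm(2)[of t] r01 by (simp add: f_def)
  next
    fix t assume t: "r0 \<le> t"
    show "S t \<le> t / 2" using r0'[OF t] t r01 unfolding S_def by linarith
    show "phi d \<epsilon> R t \<le> C1 / S t" using SC[of t] Spos[of t] \<psi>_pos[of t] t r01 by (simp add: phi_eq field_simps)
  qed (use Smono Spos step phi_antimono r01 in auto)
  then obtain c \<rho>0 where c: "c > 0" "\<And>\<rho>. \<rho> \<ge> \<rho>0 \<Longrightarrow> f \<rho> \<ge> c * integral {1..\<rho>} (phi d \<epsilon> R)" by blast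
  have "eventually (\<lambda>\<rho>. ereal c \<le> ereal (growth_ratio \<epsilon> R u \<rho>)) at_top"
    using eventually_ge_at_top[of "max \<rho>0 2"]
  proof eventually_elim
    case (elim \<rho>)
    have "integral {1..\<rho>} (phi d \<epsilon> R) > 0"
      using integral_phi_ge[of 2 \<rho>] phi_pos[of 2] elim by simp
    then show ?case using c(2)[of \<rho>] elim by (simp add: growth_ratio_def dd f_def m_def pos_le_divide_eq)
  qed
  then have "ereal c \<le> Liminf at_top (\<lambda>\<rho>. ereal (growth_ratio \<epsilon> R u \<rho>))" by (rule Liminf_bounded)
  then show ?thesis using c(1) by (metis ereal_less(2) less_le_trans zero_ereal_def)
qed

section \<open>Capacity of nearly full sets\<close>

text \<open>The kernel with pole \<open>y\<close> is harmonic near the smaller ball, so both signs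
  satisfy the sub-mean-value inequality. Halving the distance is the rescaling by the diameter of
  the unit ball.\<close>

lemma kr_half_mean_value:
  fixes y :: "'a::euclidean_space"
  assumes d: "DIM('a) = d" "d \<ge> 2" and t: "0 < t" "t < norm y"
  shows "(\<integral>x. indicator (ball 0 t) x * kr d (norm (x - y) / 2) \<partial>lborel) = kr d (norm y / 2) * measure lborel (ball (0::'a) t)"
    "integrable lborel (\<lambda>x. indicator (ball 0 t) x * kr d (norm (x - y) / 2))"
proof -
  define r' where "r' = (t + norm y) / 2"
  have r': "t < r'" "r' < norm y" "0 < r'" using t by (auto simp: r'_def)
  define \<eta> where "\<eta> = norm y - r'"
  have \<eta>: "\<eta> > 0" using r' by (simp add: \<eta>_def)
  have far: "norm (x - y) \<ge> \<eta>" if "x \<in> ball 0 r'" for x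
    using that norm_triangle_ineq2[of y x] by (simp add: \<eta>_def norm_minus_commute)
  \<comment> \<open>The kernel at half the distance is \<open>kap\<close> at a quarter of the
    squared distance.\<close>
  define p where "p s = kap d (s / 4)" for s
  define p1 where "p1 s = - ((s / 4) powr (- (real d / 2))) / 4" for s
  define p2 where "p2 s = (real d / 2) * (s / 4) powr (- (real d / 2) - 1) / 4 / 4" for s
  have lin: "((\<lambda>s. s / 4) has_real_derivative 1 / 4) (at s)" for s :: real by (rule DERIV_cdivide[OF DERIV_ident])
  have p: "(p has_real_derivative p1 s) (at s)" if "s > 0" for s
    using DERIV_chain2[OF kap_has_derivative[OF d(2)] lin, of s] that by (simp add: p_def[abs_def] p1_def)
  have p1: "(p1 has_real_derivative p2 s) (at s)" if "s > 0" for s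
    using DERIV_cdivide[OF DERIV_chain2[OF kap_deriv_has_derivative[of "s / 4" d] lin], of 4] that
    by (simp add: p1_def[abs_def] p2_def)
  have lap: "4 * p2 s * s + 2 * real d * p1 s = 0" if "s > 0" for s
  proof -
    have "4 * (X / 4 / 4) * s + 2 * real d * (- Y / 4) = 0" if "4 * X * (s / 4) + 2 * real d * (- Y) = 0" for X Y
      using that by (simp add: field_simps)
    from this[OF kap_laplacian] that show ?thesis by (simp add: p1_def p2_def)
  qed
  define S where "S x = (x - y) \<bullet> (x - y)" for x
  have Spos: "S x \<ge> \<eta>\<^sup>2" "S x > 0" if "x \<in> ball 0 r'" for x
  proof -
    have "\<eta>\<^sup>2 \<le> (norm (x - y))\<^sup>2" using far[OF that] \<eta> by (intro power_mono) auto
    then show "S x \<ge> \<eta>\<^sup>2" by (simp add: S_def power2_norm_eq_inner)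
    then show "S x > 0" using \<eta> by (smt (verit) zero_less_power)
  qed
  define P where "P = (\<eta>\<^sup>2 / 4) powr (- (real d / 2)) / 4"
  define g where "g c x = c *\<^sub>R ((2 * p1 ((x - y) \<bullet> (x - y))) *\<^sub>R (x - y))" for c x
  define H where "H c x v = c *\<^sub>R ((4 * p2 (S x) * ((x - y) \<bullet> v)) *\<^sub>R (x - y) + (2 * p1 (S x)) *\<^sub>R v)" for c x v
  have loc: "subharmonic_C2_ball (\<lambda>x. c * p ((x - y) \<bullet> (x - y))) (g c) (H c) 0 r' ((2 * real d + 2) * P)" if c: "\<bar>c\<bar> = 1" for c
  proof
    fix x :: 'a assume x: "x \<in> ball 0 r'"
    note Sx = Spos[OF x]
    show "((\<lambda>x. c * p ((x - y) \<bullet> (x - y))) has_derivative (\<lambda>v. g c x \<bullet> v)) (at x)"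
      using has_derivative_mult_right[OF radial_has_derivative[OF p[OF Sx(2), unfolded S_def]], of c] by (simp add: g_def mult.assoc)
    show "(g c has_derivative H c x) (at x)"
      using has_derivative_scaleR_right[OF radial_gradient_has_derivative[OF p1[OF Sx(2), unfolded S_def]], of c]
      by (simp add: g_def[abs_def] H_def[abs_def] S_def)
    have "(S x / 4) powr (- (real d / 2)) \<le> (\<eta>\<^sup>2 / 4) powr (- (real d / 2))" using Sx \<eta> by (intro powr_mono2') auto
    then have P1: "\<bar>p1 (S x)\<bar> \<le> P" by (simp add: p1_def P_def)
    have p2: "p2 (S x) \<ge> 0" by (simp add: p2_def)
    have "p1 (S x) \<le> 0" by (simp add: p1_def)
    then have "4 * \<bar>p2 (S x)\<bar> * S x + 2 * \<bar>p1 (S x)\<bar> = (2 * real d + 2) * \<bar>p1 (S x)\<bar>"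
      using lap[OF Sx(2)] p2 by (simp add: algebra_simps)
    also have "\<dots> \<le> (2 * real d + 2) * P" using P1 by (intro mult_left_mono) auto
    finally have hb: "4 * \<bar>p2 (S x)\<bar> * S x + 2 * \<bar>p1 (S x)\<bar> \<le> (2 * real d + 2) * P" .
    show "norm (H c x v) \<le> (2 * real d + 2) * P * norm v" for v
    proof -
      have "norm (H c x v) \<le> (4 * \<bar>p2 (S x)\<bar> * S x + 2 * \<bar>p1 (S x)\<bar>) * norm v"
        using radial_hessian_bound[of "p2 (S x)" "x - y" v "p1 (S x)"] c by (simp add: H_def S_def)
      also have "\<dots> \<le> (2 * real d + 2) * P * norm v" using hb by (rule mult_right_mono) simp
      finally show ?thesis .
    qed
    have "(\<Sum>b\<in>Basis. H c x b \<bullet> b) = c * (\<Sum>b\<in>Basis. ((4 * p2 (S x) * ((x - y) \<bullet> b)) *\<^sub>R (x - y) + (2 * p1 (S x)) *\<^sub>R b) \<bullet> b)"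
      by (simp add: H_def sum_distrib_left)
    also have "\<dots> = c * (4 * p2 (S x) * S x + 2 * real d * p1 (S x))"
      unfolding radial_hessian_trace using d(1) by (simp add: S_def)
    finally show "(\<Sum>b\<in>Basis. H c x b \<bullet> b) \<ge> 0" using lap[OF Sx(2)] by simp
  qed (use r' in simp)
  have pe: "p ((x - y) \<bullet> (x - y)) = ckap d * kr d (norm (x - y) / 2)" if "x \<noteq> y" for x
    using kap_power2[OF d(2), of "norm (x - y) / 2"] that by (simp add: p_def power_divide power2_norm_eq_inner)
  have ck: "ckap d > 0" by (rule ckap_pos[OF d(2)])
  have xy: "x \<noteq> y" if "x \<in> ball 0 t" for x using that t by auto
  have indp: "indicator (ball 0 t) x * p ((x - y) \<bullet> (x - y)) = ckap d * (indicator (ball 0 t) x * kr d (norm (x - y) / 2))" for x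
    using pe[of x] xy[of x] by (cases "x \<in> ball 0 t") auto
  have y0: "(0::'a) \<noteq> y" using t by auto
  have 1: "p (y \<bullet> y) * measure lborel (ball (0::'a) t) \<le> (\<integral>x. indicator (ball 0 t) x * p ((x - y) \<bullet> (x - y)) \<partial>lborel)"
    using subharmonic_C2_ball.sub_mean_value[OF loc[of 1], of t] t r' by simp
  have "- p (y \<bullet> y) * measure lborel (ball (0::'a) t) \<le> (\<integral>x. - (indicator (ball 0 t) x * p ((x - y) \<bullet> (x - y))) \<partial>lborel)"
    using subharmonic_C2_ball.sub_mean_value[OF loc[of "-1"], of t] t r' by simp
  with 1 have eq: "(\<integral>x. indicator (ball 0 t) x * p ((x - y) \<bullet> (x - y)) \<partial>lborel) = p (y \<bullet> y) * measure lborel (ball (0::'a) t)"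
    by simp
  have "p (y \<bullet> y) = ckap d * kr d (norm y / 2)" using pe[OF y0] by simp
  then show "(\<integral>x. indicator (ball 0 t) x * kr d (norm (x - y) / 2) \<partial>lborel) = kr d (norm y / 2) * measure lborel (ball (0::'a) t)"
    using eq ck unfolding indp by simp
  have "continuous_on (cball 0 t) (\<lambda>x. kr d (norm (x - y) / 2))"
  proof (rule continuous_at_imp_continuous_on, rule ballI)
    fix x :: 'a assume "x \<in> cball 0 t"
    then have "norm (x - y) / 2 > 0" using t by auto
    then show "isCont (\<lambda>x. kr d (norm (x - y) / 2)) x"
      by (intro isCont_o2[OF _ kr_isCont]) (auto intro!: continuous_intros)
  qed
  note c = this
  then obtain B where B: "\<And>x. x \<in> cball 0 t \<Longrightarrow> \<bar>kr d (norm (x - y) / 2)\<bar> \<le> B"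
    using compact_imp_bounded[OF compact_continuous_image[OF c compact_cball]] by (force simp: bounded_iff)
  show "integrable lborel (\<lambda>x. indicator (ball 0 t) x * kr d (norm (x - y) / 2))"
  proof (rule Bochner_Integration.integrable_bound)
    show "integrable lborel (\<lambda>x. indicator (ball (0::'a) t) x * B)"
      using emeasure_lborel_ball_finite[of "0::'a" t] by (intro integrable_mult_left integrable_real_indicator) auto
    show "(\<lambda>x. indicator (ball 0 t) x * kr d (norm (x - y) / 2)) \<in> borel_measurable lborel"
      using borel_measurable_indicator_times[of "ball 0 t"] continuous_on_subset[OF c, of "ball 0 t"] by auto
    show "AE x in lborel. norm (indicator (ball 0 t) x * kr d (norm (x - y) / 2)) \<le> norm (indicator (ball 0 t) x * B)"
    proof (rule AE_I2)
      fix x show "norm (indicator (ball 0 t) x * kr d (norm (x - y) / 2)) \<le> norm (indicator (ball 0 t) x * B)"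
        using B[of x] by (cases "x \<in> ball 0 t") auto
    qed
  qed
qed

text \<open>As \<open>norm y \<le> 1\<close>, the rescaled distances stay within (0, 1], where
  clipping in \<open>kk\<close> loses nothing.\<close>

lemma kk_half_mean_value:
  fixes y :: "'a::euclidean_space"
  assumes d: "DIM('a) = d" "d \<ge> 2" and t: "0 < t" "t < norm y" and y: "norm y \<le> 1"
  shows "(\<integral>\<^sup>+x. kk d (norm (x - y) / 2) * indicator (ball 0 t) x \<partial>lborel) = ennreal (kr d (norm y / 2)) * emeasure lborel (ball (0::'a) t)"
proof -
  note m = kr_half_mean_value[OF d t]
  have eq: "kk d (norm (x - y) / 2) * indicator (ball 0 t) x = ennreal (indicator (ball 0 t) x * kr d (norm (x - y) / 2))"
    and nn: "0 \<le> indicator (ball 0 t) x * kr d (norm (x - y) / 2)" for x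
  proof -
    have "norm (x - y) > 0 \<and> norm (x - y) / 2 \<le> 1" if "norm x < t"
      using that t y norm_triangle_ineq4[of x y] by auto
    then show "kk d (norm (x - y) / 2) * indicator (ball 0 t) x = ennreal (indicator (ball 0 t) x * kr d (norm (x - y) / 2))"
      "0 \<le> indicator (ball 0 t) x * kr d (norm (x - y) / 2)"
      by (cases "x \<in> ball 0 t"; auto simp: kk_pos kr_nonneg)+
  qed
  have "(\<integral>\<^sup>+x. kk d (norm (x - y) / 2) * indicator (ball 0 t) x \<partial>lborel) = ennreal (kr d (norm y / 2) * measure lborel (ball (0::'a) t))"
    unfolding eq m(1)[symmetric] by (rule nn_integral_eq_integral[OF m(2)]) (simp add: nn)
  also have "\<dots> = ennreal (kr d (norm y / 2)) * emeasure lborel (ball (0::'a) t)"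
  proof -
    have "0 \<le> kr d (norm y / 2)" using t y by (intro kr_nonneg) auto
    moreover have "emeasure lborel (ball (0::'a) t) = ennreal (measure lborel (ball (0::'a) t))"
      using emeasure_lborel_ball_finite[of "0::'a" t] by (intro emeasure_eq_ennreal_measure) auto
    ultimately show ?thesis by (simp only: ennreal_mult measure_nonneg)
  qed
  finally show ?thesis .
qed

text \<open>Newton's theorem: seen from \<open>y\<close>, the part of a shell inside the sphere
  through \<open>y\<close> acts as if its mass sat at the origin. The mean value identity for the
  inner ball is subtracted from that for the ball of radius \<open>norm y\<close>; the pole lies on
  the boundary of the latter, so it is exhausted by smaller balls.\<close>

lemma shell_potential:
  fixes y :: "'a::euclidean_space"
  assumes d: "DIM('a) = d" "d \<ge> 2" and a: "0 < a" "a < norm y" and y: "norm y \<le> 1"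
  shows "(\<integral>\<^sup>+x. kk d (norm (x - y) / 2) * indicator {x. a \<le> norm x \<and> norm x < norm y} x \<partial>lborel)
     \<le> ennreal (kr d (a / 2)) * emeasure lborel {x::'a. a \<le> norm x \<and> norm x < norm y}"
proof -
  let ?k = "\<lambda>x. kk d (norm (x - y) / 2)"
  define t where "t n = norm y * (1 - 1 / real (n + 2))" for n
  have y0: "norm y > 0" using a by linarith
  have t: "0 < t n" "t n < norm y" for n using y0 by (auto simp: t_def intro!: mult_pos_pos)
  have inc: "incseq t"
    unfolding t_def incseq_def using y0 by (auto intro!: mult_left_mono divide_left_mono)
  have tl: "t \<longlonglongrightarrow> norm y"
  proof -
    have "(\<lambda>n. 1 / real (n + 2)) \<longlonglongrightarrow> 0" using LIMSEQ_ignore_initial_segment[OF lim_1_over_n, of 2] by simp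
    then have "(\<lambda>n. norm y * (1 - 1 / real (n + 2))) \<longlonglongrightarrow> norm y * (1 - 0)" by (intro tendsto_intros)
    then show ?thesis by (simp add: t_def[abs_def])
  qed
  have Un: "(\<Union>n. ball (0::'a) (t n)) = ball 0 (norm y)"
  proof
    show "(\<Union>n. ball (0::'a) (t n)) \<subseteq> ball 0 (norm y)"
    proof
      fix x :: 'a assume "x \<in> (\<Union>n. ball 0 (t n))"
      then obtain n where "norm x < t n" by auto
      then show "x \<in> ball 0 (norm y)" using t(2)[of n] by simp
    qed
    show "ball 0 (norm y) \<subseteq> (\<Union>n. ball (0::'a) (t n))"
    proof
      fix x :: 'a assume "x \<in> ball 0 (norm y)"
      then have "norm x < norm y" by simp
      then have "eventually (\<lambda>n. norm x < t n) sequentially" using tl by (rule order_tendstoD(1)[rotated])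
      then show "x \<in> (\<Union>n. ball 0 (t n))" by (auto simp: eventually_sequentially)
    qed
  qed
  let ?C = "ennreal (kr d (norm y / 2))"
  have full: "(\<integral>\<^sup>+x. ?k x * indicator (ball 0 (norm y)) x \<partial>lborel) \<le> ?C * emeasure lborel (ball (0::'a) (norm y))"
  proof -
    define \<nu> where "\<nu> = density lborel ?k"
    have \<nu>: "emeasure \<nu> A = (\<integral>\<^sup>+x. ?k x * indicator A x \<partial>lborel)" if "A \<in> sets borel" for A
      unfolding \<nu>_def using that by (subst emeasure_density) auto
    have "emeasure \<nu> (\<Union>n. ball (0::'a) (t n)) = (SUP n. emeasure \<nu> (ball (0::'a) (t n)))"
    proof (rule SUP_emeasure_incseq[symmetric])
      show "incseq (\<lambda>n. ball (0::'a) (t n))"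
        using inc unfolding incseq_def by (intro allI impI subset_ball) auto
    qed (auto simp: \<nu>_def)
    also have "\<dots> \<le> ?C * emeasure lborel (ball (0::'a) (norm y))"
    proof (rule SUP_least)
      fix n
      have "emeasure \<nu> (ball (0::'a) (t n)) = ?C * emeasure lborel (ball (0::'a) (t n))"
        using kk_half_mean_value[OF d t y] by (simp add: \<nu>)
      also have "\<dots> \<le> ?C * emeasure lborel (ball (0::'a) (norm y))"
        using t[of n] by (intro mult_left_mono emeasure_mono) auto
      finally show "emeasure \<nu> (ball (0::'a) (t n)) \<le> ?C * emeasure lborel (ball (0::'a) (norm y))" .
    qed
    finally show ?thesis unfolding Un by (simp add: \<nu>)
  qed
  let ?A = "{x::'a. a \<le> norm x \<and> norm x < norm y}"
  have Am[measurable]: "?A \<in> sets borel" by measurable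
  have bm[measurable]: "ball (0::'a) s \<in> sets borel" for s by simp
  have split: "indicator (ball 0 (norm y)) x = indicator (ball (0::'a) a) x + (indicator ?A x :: ennreal)" for x :: 'a
    using a by (auto simp: indicator_def)
  have km: "?k \<in> borel_measurable borel" by measurable
  have ia: "(\<integral>\<^sup>+x. ?k x * indicator (ball 0 a) x \<partial>lborel) = ?C * emeasure lborel (ball (0::'a) a)"
    by (rule kk_half_mean_value[OF d a y])
  have "emeasure lborel (ball (0::'a) (norm y)) = (\<integral>\<^sup>+x. indicator (ball (0::'a) a) x + indicator ?A x \<partial>lborel)"
    unfolding split[symmetric] by simp
  also have "\<dots> = (\<integral>\<^sup>+x. indicator (ball (0::'a) a) x \<partial>lborel) + (\<integral>\<^sup>+x. indicator ?A x \<partial>lborel)"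
    by (rule nn_integral_add) (simp_all add: borel_measurable_indicator)
  also have "\<dots> = emeasure lborel (ball (0::'a) a) + emeasure lborel ?A" by simp
  finally have em: "emeasure lborel (ball (0::'a) (norm y)) = emeasure lborel (ball (0::'a) a) + emeasure lborel ?A" .
  have "(\<integral>\<^sup>+x. ?k x * indicator (ball 0 a) x \<partial>lborel) + (\<integral>\<^sup>+x. ?k x * indicator ?A x \<partial>lborel)
     = (\<integral>\<^sup>+x. ?k x * indicator (ball 0 (norm y)) x \<partial>lborel)"
    unfolding split distrib_left
    by (rule nn_integral_add[symmetric]) (intro borel_measurable_times_ennreal borel_measurable_indicator; use km in simp)+
  also have "\<dots> \<le> ?C * emeasure lborel (ball (0::'a) a) + ?C * emeasure lborel ?A"
    using full unfolding em by (simp add: distrib_left)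
  finally have "?C * emeasure lborel (ball (0::'a) a) + (\<integral>\<^sup>+x. ?k x * indicator ?A x \<partial>lborel)
    \<le> ?C * emeasure lborel (ball (0::'a) a) + ?C * emeasure lborel ?A" unfolding ia .
  \<comment> \<open>Cancelling the contribution of the inner ball in \<open>ennreal\<close> requires
    it to be finite.\<close>
  moreover have "?C * emeasure lborel (ball (0::'a) a) < \<top>"
    using emeasure_lborel_ball_finite[of "0::'a" a] by (simp add: ennreal_mult_less_top)
  ultimately have "(\<integral>\<^sup>+x. ?k x * indicator ?A x \<partial>lborel) \<le> ?C * emeasure lborel ?A"
    unfolding ennreal_add_left_cancel_le by auto
  also have "\<dots> \<le> ennreal (kr d (a / 2)) * emeasure lborel ?A"
    using a by (intro mult_right_mono ennreal_leI kr_antimono) auto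
  finally show ?thesis .
qed

text \<open>By symmetry only pairs with \<open>norm x < norm y\<close> matter, and there the mean value property makes
  the inner integral explicit.\<close>

lemma shell_kk_energy:
  assumes d: "DIM('a::euclidean_space) = d" "d \<ge> 2" and ab: "0 < a" "a < b" "b \<le> 1"
  defines "A \<equiv> {x::'a. a \<le> norm x \<and> norm x < b}"
  shows "borel_prob_on (cball 0 b) (uniform_measure lborel A)" "AE x in uniform_measure lborel A. x \<in> cball 0 b"
    "kk_energy 2 (uniform_measure lborel A) \<le> ennreal (kr d (a / 2))"
proof -
  have Am[measurable]: "A \<in> sets borel" unfolding A_def by measurable
  have AB: "A \<subseteq> ball 0 b" by (auto simp: A_def)
  have finA: "emeasure lborel A < \<infinity>"
    using emeasure_mono[OF AB, of lborel] emeasure_lborel_ball_finite[of "0::'a" b] by (auto intro: order_le_less_trans)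
  have posA: "emeasure lborel A > 0"
  proof -
    define c where "c = (a + b) / 2"
    obtain i :: 'a where i: "i \<in> Basis" using nonempty_Basis by blast
    have "ball (c *\<^sub>R i) ((b - a) / 2) \<subseteq> A"
    proof
      fix x assume "x \<in> ball (c *\<^sub>R i) ((b - a) / 2)"
      then have "norm (c *\<^sub>R i - x) < (b - a) / 2" by (simp add: dist_norm)
      moreover have "norm (c *\<^sub>R i) = c" using i ab by (simp add: c_def)
      ultimately have "\<bar>c - norm x\<bar> < (b - a) / 2" using norm_triangle_ineq3[of "c *\<^sub>R i" x] by simp
      then show "x \<in> A" by (auto simp: A_def c_def abs_less_iff field_simps)
    qed
    then have "emeasure lborel (ball (c *\<^sub>R i) ((b - a) / 2)) \<le> emeasure lborel A" by (intro emeasure_mono) auto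
    moreover have "emeasure lborel (ball (c *\<^sub>R i) ((b - a) / 2)) > 0"
      using ab by (simp add: emeasure_ball)
    ultimately show ?thesis by (rule less_le_trans[rotated])
  qed
  let ?\<omega> = "uniform_measure lborel A"
  have P: "prob_space ?\<omega>" using posA finA by (intro prob_space_uniform_measure) auto
  have "emeasure ?\<omega> (cball 0 b) = 1"
  proof -
    have "A \<inter> cball 0 b = A" using AB by auto
    then show ?thesis using posA finA by (subst emeasure_uniform_measure) (auto simp: ennreal_divide_self)
  qed
  then show bp: "borel_prob_on (cball 0 b) ?\<omega>" using P by (simp add: borel_prob_on_def)
  then show "AE x in ?\<omega>. x \<in> cball 0 b" by (rule borel_prob_on_AE) simp
  define V where "V = emeasure lborel A"
  define F where "F x y = kk d (norm (x - y) / 2) * indicator A x * indicator A y" for x y :: 'a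
  define L where "L x y = (indicator {p::'a\<times>'a. norm (fst p) < norm (snd p)} (x, y) :: ennreal)" for x y :: 'a
  have Lm[measurable]: "{p::'a\<times>'a. norm (fst p) < norm (snd p)} \<in> sets (borel \<Otimes>\<^sub>M borel)"
  proof -
    have "{p \<in> space (borel \<Otimes>\<^sub>M borel :: ('a \<times> 'a) measure). norm (fst p) < norm (snd p)} \<in> sets (borel \<Otimes>\<^sub>M borel)"
      by measurable
    then show ?thesis by (simp add: space_pair_measure)
  qed
  have Fm[measurable]: "case_prod F \<in> borel_measurable (borel \<Otimes>\<^sub>M borel)" unfolding F_def by measurable
  have LLm[measurable]: "case_prod L \<in> borel_measurable (borel \<Otimes>\<^sub>M borel)" unfolding L_def by measurable
  have "AE x in lborel. L x y + L y x = 1" for y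
  proof -
    have "AE x in lborel. x \<notin> sphere (0::'a) (norm y)"
      using negligible_sphere[of "0::'a" "norm y"]
      by (intro AE_not_in) (simp add: negligible_iff_null_sets null_sets_completion_iff)
    then show ?thesis by eventually_elim (auto simp: L_def indicator_def)
  qed
  note LAE = this
  have sym: "(\<integral>\<^sup>+y. \<integral>\<^sup>+x. G x y * L y x \<partial>lborel \<partial>lborel) = (\<integral>\<^sup>+y. \<integral>\<^sup>+x. G x y * L x y \<partial>lborel \<partial>lborel)"
    if [measurable]: "case_prod G \<in> borel_measurable (borel \<Otimes>\<^sub>M borel)" and s: "\<And>x y. G x y = G y x" for G
  proof -
    have "(\<integral>\<^sup>+y. \<integral>\<^sup>+x. G x y * L y x \<partial>lborel \<partial>lborel) = (\<integral>\<^sup>+x. \<integral>\<^sup>+y. G x y * L y x \<partial>lborel \<partial>lborel)"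
      by (rule lborel_pair.Fubini') measurable
    also have "\<dots> = (\<integral>\<^sup>+x. \<integral>\<^sup>+y. G y x * L y x \<partial>lborel \<partial>lborel)"
      using s by (intro nn_integral_cong arg_cong2[where f = "(*)"] refl)
    finally show ?thesis .
  qed
  have dbl: "(\<integral>\<^sup>+y. \<integral>\<^sup>+x. G x y \<partial>lborel \<partial>lborel) = 2 * (\<integral>\<^sup>+y. \<integral>\<^sup>+x. G x y * L x y \<partial>lborel \<partial>lborel)"
    if Gm[measurable]: "case_prod G \<in> borel_measurable (borel \<Otimes>\<^sub>M borel)" and s: "\<And>x y. G x y = G y x" for G
  proof -
    have "(\<integral>\<^sup>+x. G x y \<partial>lborel) = (\<integral>\<^sup>+x. G x y * L x y \<partial>lborel) + (\<integral>\<^sup>+x. G x y * L y x \<partial>lborel)" for y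
    proof -
      have "(\<integral>\<^sup>+x. G x y \<partial>lborel) = (\<integral>\<^sup>+x. G x y * (L x y + L y x) \<partial>lborel)"
        by (rule nn_integral_cong_AE, use LAE[of y] in eventually_elim) simp
      also have "\<dots> = (\<integral>\<^sup>+x. G x y * L x y \<partial>lborel) + (\<integral>\<^sup>+x. G x y * L y x \<partial>lborel)"
        unfolding distrib_left by (rule nn_integral_add) measurable
      finally show ?thesis .
    qed
    then have "(\<integral>\<^sup>+y. \<integral>\<^sup>+x. G x y \<partial>lborel \<partial>lborel)
      = (\<integral>\<^sup>+y. \<integral>\<^sup>+x. G x y * L x y \<partial>lborel \<partial>lborel) + (\<integral>\<^sup>+y. \<integral>\<^sup>+x. G x y * L y x \<partial>lborel \<partial>lborel)"
      by (simp add: nn_integral_add)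
    also have "\<dots> = 2 * (\<integral>\<^sup>+y. \<integral>\<^sup>+x. G x y * L x y \<partial>lborel \<partial>lborel)"
      unfolding sym[OF Gm s] by (simp add: mult_2)
    finally show ?thesis .
  qed
  let ?C = "ennreal (kr d (a / 2))"
  define G1 where "G1 x y = (indicator A x * indicator A y :: ennreal)" for x y
  have G1m[measurable]: "case_prod G1 \<in> borel_measurable (borel \<Otimes>\<^sub>M borel)" unfolding G1_def by measurable
  have inner: "(\<integral>\<^sup>+x. F x y * L x y \<partial>lborel) \<le> ?C * (\<integral>\<^sup>+x. G1 x y * L x y \<partial>lborel)" for y
  proof (cases "y \<in> A \<and> a < norm y")
    case True
    let ?S = "{x::'a. a \<le> norm x \<and> norm x < norm y}"
    have e: "indicator A x * L x y = indicator ?S x" for x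
      using True by (auto simp: A_def L_def indicator_def)
    have "(\<integral>\<^sup>+x. F x y * L x y \<partial>lborel) = (\<integral>\<^sup>+x. kk d (norm (x - y) / 2) * indicator ?S x \<partial>lborel)"
      using True by (intro nn_integral_cong) (simp add: F_def e[symmetric] mult.assoc)
    also have "\<dots> \<le> ?C * emeasure lborel ?S"
      using True ab by (intro shell_potential d) (auto simp: A_def)
    also have "emeasure lborel ?S = (\<integral>\<^sup>+x. G1 x y * L x y \<partial>lborel)"
    proof -
      have "G1 x y * L x y = indicator ?S x" for x using True by (simp add: G1_def e[symmetric])
      then show ?thesis by simp
    qed
    finally show ?thesis .
  next
    \<comment> \<open>If \<open>norm y = a\<close>, no point of \<open>A\<close> has smaller norm;
      \<open>shell_potential\<close> needs \<open>a < norm y\<close>.\<close>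
    case False
    then have "F x y * L x y = 0" for x by (auto simp: F_def A_def L_def indicator_def)
    then have "(\<integral>\<^sup>+x. F x y * L x y \<partial>lborel) = (\<integral>\<^sup>+(x::'a). 0 \<partial>lborel)"
      by (intro nn_integral_cong) blast
    then show ?thesis by simp
  qed
  have "(\<integral>\<^sup>+y. \<integral>\<^sup>+x. F x y \<partial>lborel \<partial>lborel) = 2 * (\<integral>\<^sup>+y. \<integral>\<^sup>+x. F x y * L x y \<partial>lborel \<partial>lborel)"
    by (rule dbl[OF Fm]) (simp add: F_def norm_minus_commute mult_ac)
  also have "\<dots> \<le> 2 * (\<integral>\<^sup>+y. ?C * (\<integral>\<^sup>+x. G1 x y * L x y \<partial>lborel) \<partial>lborel)"
    by (intro mult_left_mono nn_integral_mono inner) auto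
  also have "\<dots> = 2 * (?C * (\<integral>\<^sup>+y. (\<integral>\<^sup>+x. G1 x y * L x y \<partial>lborel) \<partial>lborel))"
    by (subst nn_integral_cmult) auto
  also have "\<dots> = ?C * (2 * (\<integral>\<^sup>+y. (\<integral>\<^sup>+x. G1 x y * L x y \<partial>lborel) \<partial>lborel))"
    by (rule mult.left_commute)
  also have "2 * (\<integral>\<^sup>+y. (\<integral>\<^sup>+x. G1 x y * L x y \<partial>lborel) \<partial>lborel) = (\<integral>\<^sup>+y. \<integral>\<^sup>+x. G1 x y \<partial>lborel \<partial>lborel)"
    by (rule dbl[OF G1m, symmetric]) (simp add: G1_def mult.commute)
  also have "(\<integral>\<^sup>+y. \<integral>\<^sup>+x. G1 x y \<partial>lborel \<partial>lborel) = V * V"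
    unfolding G1_def V_def by (simp add: nn_integral_multc nn_integral_cmult)
  finally have main: "(\<integral>\<^sup>+y. \<integral>\<^sup>+x. F x y \<partial>lborel \<partial>lborel) \<le> ?C * (V * V)" .
  have "kk_energy 2 ?\<omega> = (\<integral>\<^sup>+y. ((\<integral>\<^sup>+x. kk d (norm (x - y) / 2) * indicator A x \<partial>lborel) / V) * indicator A y \<partial>lborel) / V"
    unfolding kk_energy_def V_def d(1) by (subst nn_integral_uniform_measure, measurable)+
  also have "\<dots> = (\<integral>\<^sup>+y. \<integral>\<^sup>+x. F x y \<partial>lborel \<partial>lborel) / V / V"
  proof -
    have "((\<integral>\<^sup>+x. kk d (norm (x - y) / 2) * indicator A x \<partial>lborel) / V) * indicator A y = (\<integral>\<^sup>+x. F x y \<partial>lborel) / V" for y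
      unfolding F_def by (subst nn_integral_multc) (auto simp: indicator_def)
    then show ?thesis by (simp add: nn_integral_divide)
  qed
  also have "\<dots> \<le> ?C * (V * V) / V / V" using main by (intro divide_right_mono_ennreal)
  also have "\<dots> = ?C"
    using posA finA by (simp add: V_def mult_divide_eq_ennreal mult.assoc[symmetric])
  finally show "kk_energy 2 ?\<omega> \<le> ?C" .
qed

section \<open>From the shell to nearly full subsets of a ball\<close>

lemma capacity_mono:
  fixes A B :: "'a::euclidean_space set"
  assumes d: "DIM('a) \<ge> 2" and AB: "A \<subseteq> B" and B: "B \<subseteq> ball x r" and r: "r > 0"
  shows "capacity A \<le> capacity B"
  unfolding capacity_def
proof (rule cSUP_subset_mono)
  have diam: "norm (y - z) \<le> 2 * r" if "y \<in> ball x r" "z \<in> ball x r" for y z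
    using that norm_triangle_ineq4[of "y - x" "z - x"] by (simp add: dist_norm norm_minus_commute)
  show "bdd_above (compact_capacity ` {K. compact K \<and> K \<subseteq> B})"
  proof (rule bdd_aboveI2)
    fix K' :: "'a set" assume "K' \<in> {K. compact K \<and> K \<subseteq> B}"
    then show "compact_capacity K' \<le> 2 * r"
      using B r by (intro compact_capacity_le_diam[OF d]) (auto intro!: compact_imp_closed diam)
  qed
qed (use AB in \<open>auto intro: exI[of _ "{}"]\<close>)

text \<open>A contraction changes the kernel at most affinely, so a finite energy remains finite.
  This provides the integrable majorant in \<open>near_full_capacity\<close>.\<close>

lemma kk_contract:
  assumes "0 < \<theta>" "\<theta> \<le> 1" "t \<ge> 0"
  shows "kk d (\<theta> * t) \<le> ennreal (scB d (1 / \<theta>)) * (ennreal (scA d (1 / \<theta>)) + kk d t)"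
proof -
  have A: "scA d (1 / \<theta>) \<ge> 0" using assms by (simp add: scA_def)
  have "kk d (\<theta> * t) = kk d (t / (1 / \<theta>))" by (simp add: mult.commute)
  also have "\<dots> = ennreal (scB d (1 / \<theta>)) * e2ennreal (ereal (scA d (1 / \<theta>)) - cap_kernel d t)"
    using assms by (intro kk_scale) auto
  also have "\<dots> \<le> ennreal (scB d (1 / \<theta>)) * (ennreal (scA d (1 / \<theta>)) + kk d t)"
  proof (rule mult_left_mono)
    show "e2ennreal (ereal (scA d (1 / \<theta>)) - cap_kernel d t) \<le> ennreal (scA d (1 / \<theta>)) + kk d t"
    proof (cases "t = 0")
      case False
      then have t: "t > 0" using assms by simp
      have *: "ennreal a = ennreal (max 0 a)" for a by (simp add: max_def ennreal_neg)
      have "ennreal (scA d (1 / \<theta>) + kr d t) \<le> ennreal (scA d (1 / \<theta>) + max 0 (kr d t))" by (intro ennreal_leI) auto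
      also have "\<dots> = ennreal (scA d (1 / \<theta>)) + ennreal (kr d t)" using A *[of "kr d t"] by simp
      finally show ?thesis using t by (simp add: cap_kernel_eq kk_pos)
    qed simp
  qed simp
  finally show ?thesis .
qed

text \<open>The map \<open>T\<close> pushes a nearly optimal measure of the ball into \<open>K\<close>. Far from the diagonal it hardly
  changes distances, and near the diagonal the energy is controlled by the contraction factor \<open>\<theta>\<close>.\<close>

lemma near_full_capacity:
  assumes dd: "DIM('a::euclidean_space) = d" "d \<ge> 2" and e1: "0 < e1" "e1 < 1" and \<theta>: "0 < \<theta>" "\<theta> \<le> 1"
  obtains b \<sigma>0 where "0 < b" "b < 1" "\<sigma>0 > 0"
    "\<And>(x::'a) r \<sigma> T K E. r > 0 \<Longrightarrow> \<sigma> \<le> \<sigma>0 \<Longrightarrow> T \<in> borel_measurable borel \<Longrightarrow> compact K \<Longrightarrow> K \<subseteq> ball x r \<inter> E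
      \<Longrightarrow> (\<And>z. z \<in> cball x (b * r) \<Longrightarrow> T z \<in> K)
      \<Longrightarrow> (\<And>z w. z \<in> cball x (b * r) \<Longrightarrow> w \<in> cball x (b * r) \<Longrightarrow> norm (T z - T w) \<ge> \<theta> * norm (z - w) \<and> norm (T z - T w) \<ge> norm (z - w) - 16 * \<sigma> * r)
      \<Longrightarrow> capacity (ball x r \<inter> E) \<ge> e1 * r"
proof -
  \<comment> \<open>The interval from \<open>e1\<close> to 1 is cut into thirds: the shell between
    \<open>a\<close> and \<open>b\<close> lies strictly inside the unit ball and has energy at most
    \<open>kr d (a / 2)\<close>, strictly below the value \<open>kr d (e1 / 2)\<close> that capacity
    \<open>e1\<close> requires.\<close>
  define a where "a = e1 + (1 - e1) / 3"
  define b where "b = e1 + 2 * (1 - e1) / 3"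
  have ab: "e1 < a" "0 < a" "a < b" "b < 1" "b \<le> 1" "0 < b" using e1 by (auto simp: a_def b_def field_simps)
  define \<omega> where "\<omega> = uniform_measure lborel {x::'a. a \<le> norm x \<and> norm x < b}"
  note sh = shell_kk_energy[OF dd ab(2,3,5), folded \<omega>_def]
  interpret prob_space \<omega> using sh(1) by (simp add: borel_prob_on_def)
  have sets[measurable_cong, simp]: "sets \<omega> = sets borel" using sh(1) by (simp add: borel_prob_on_def)
  have sp[simp]: "space \<omega> = UNIV" using sets_eq_imp_space_eq[OF sets] by simp
  interpret P: pair_prob_space \<omega> \<omega> ..
  define t where "t p = norm (snd p - fst p)" for p :: "'a \<times> 'a"
  have tm[measurable]: "t \<in> borel_measurable (\<omega> \<Otimes>\<^sub>M \<omega>)" unfolding t_def by measurable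
  have t0: "t p \<ge> 0" for p by (simp add: t_def)
  \<comment> \<open>Combines both lower bounds on the distances after applying \<open>T\<close>,
    with \<sigma> at most \<open>1 / Suc n\<close>. As \<open>n\<close> grows these kernels tend to
    the undistorted one, under the majorant with factor \<theta>, so the strict energy inequality
    survives for some \<open>n\<close>.\<close>
  define u where "u n p = kk d (max (\<theta> * t p) (t p - 16 / real (Suc n)) / 2)" for n p
  have um[measurable]: "u n \<in> borel_measurable (\<omega> \<Otimes>\<^sub>M \<omega>)" for n unfolding u_def by measurable
  have E0: "(\<integral>\<^sup>+p. kk d (t p / 2) \<partial>(\<omega> \<Otimes>\<^sub>M \<omega>)) = kk_energy 2 \<omega>"
    unfolding kk_energy_def dd(1) t_def by (subst nn_integral_fst[symmetric]) auto
  have fin: "(\<integral>\<^sup>+p. kk d (\<theta> * t p / 2) \<partial>(\<omega> \<Otimes>\<^sub>M \<omega>)) < \<infinity>"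
  proof -
    have "(\<integral>\<^sup>+p. kk d (\<theta> * t p / 2) \<partial>(\<omega> \<Otimes>\<^sub>M \<omega>)) \<le> (\<integral>\<^sup>+p. ennreal (scB d (1 / \<theta>)) * (ennreal (scA d (1 / \<theta>)) + kk d (t p / 2)) \<partial>(\<omega> \<Otimes>\<^sub>M \<omega>))"
      using kk_contract[OF \<theta>, of "t _ / 2"] t0 by (intro nn_integral_mono) simp
    also have "\<dots> = ennreal (scB d (1 / \<theta>)) * (ennreal (scA d (1 / \<theta>)) + kk_energy 2 \<omega>)"
      by (simp add: nn_integral_cmult nn_integral_add E0 P.emeasure_space_1)
    also have "\<dots> < \<infinity>" using sh(3) by (auto simp: ennreal_mult_less_top intro: order_le_less_trans)
    finally show ?thesis .
  qed
  have lim: "(\<lambda>n. integral\<^sup>N (\<omega> \<Otimes>\<^sub>M \<omega>) (u n)) \<longlonglongrightarrow> (\<integral>\<^sup>+p. kk d (t p / 2) \<partial>(\<omega> \<Otimes>\<^sub>M \<omega>))"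
  proof (rule nn_integral_dominated_convergence[where w = "\<lambda>p. kk d (\<theta> * t p / 2)"])
    show "AE p in \<omega> \<Otimes>\<^sub>M \<omega>. u n p \<le> kk d (\<theta> * t p / 2)" for n
      unfolding u_def using \<theta> t0 by (intro AE_I2 kk_antimono) auto
    show "AE p in \<omega> \<Otimes>\<^sub>M \<omega>. (\<lambda>n. u n p) \<longlonglongrightarrow> kk d (t p / 2)"
    proof (rule AE_I2)
      fix p
      show "(\<lambda>n. u n p) \<longlonglongrightarrow> kk d (t p / 2)"
      proof (cases "t p = 0")
        case True
        then show ?thesis by (simp add: u_def max_def)
      next
        case False
        then have tp: "t p > 0" using t0[of p] by simp
        have "(\<lambda>n. 1 / real (Suc n)) \<longlonglongrightarrow> 0" using LIMSEQ_Suc[OF lim_1_over_n] by simp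
        then have "(\<lambda>n. max (\<theta> * t p) (t p - 16 * (1 / real (Suc n))) / 2) \<longlonglongrightarrow> max (\<theta> * t p) (t p - 16 * 0) / 2"
          by (intro tendsto_intros) auto
        moreover have "max (\<theta> * t p) (t p - 16 * 0) / 2 = t p / 2" using \<theta> tp by (simp add: max_def mult_left_le_one_le)
        ultimately have "(\<lambda>n. max (\<theta> * t p) (t p - 16 / real (Suc n)) / 2) \<longlonglongrightarrow> t p / 2" by simp
        then have "(\<lambda>n. kr d (max (\<theta> * t p) (t p - 16 / real (Suc n)) / 2)) \<longlonglongrightarrow> kr d (t p / 2)"
          by (rule isCont_tendsto_compose[OF kr_isCont, rotated]) (use tp in simp)
        then have "(\<lambda>n. ennreal (kr d (max (\<theta> * t p) (t p - 16 / real (Suc n)) / 2))) \<longlonglongrightarrow> ennreal (kr d (t p / 2))"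
          by (rule tendsto_ennrealI)
        moreover have "max (\<theta> * t p) (t p - 16 / real (Suc n)) > 0" for n using \<theta> tp by (simp add: less_max_iff_disj)
        ultimately show ?thesis using tp by (simp add: u_def kk_pos)
      qed
    qed
  qed (use fin in auto)
  have "kk_energy 2 \<omega> < ennreal (kr d (e1 / 2))"
  proof -
    have "kr d (a / 2) < kr d (e1 / 2)" using ab e1 by (intro kr_strict_antimono dd) auto
    moreover have "kr d (a / 2) \<ge> 0" using ab by (intro kr_nonneg) auto
    ultimately have "ennreal (kr d (a / 2)) < ennreal (kr d (e1 / 2))" by (simp add: ennreal_less_iff)
    then show ?thesis using sh(3) by (rule le_less_trans[rotated])
  qed
  then have "eventually (\<lambda>n. integral\<^sup>N (\<omega> \<Otimes>\<^sub>M \<omega>) (u n) < ennreal (kr d (e1 / 2))) sequentially"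
    using lim unfolding E0 by (intro order_tendstoD(2))
  then obtain n where n: "integral\<^sup>N (\<omega> \<Otimes>\<^sub>M \<omega>) (u n) < ennreal (kr d (e1 / 2))"
    by (auto simp: eventually_sequentially)
  show ?thesis
  proof (rule that[of b "1 / real (Suc n)"])
    fix x :: 'a and r \<sigma> :: real and T :: "'a \<Rightarrow> 'a" and K E :: "'a set"
    assume r: "r > 0" and \<sigma>: "\<sigma> \<le> 1 / real (Suc n)" and Tm[measurable]: "T \<in> borel_measurable borel"
      and K: "compact K" "K \<subseteq> ball x r \<inter> E" and TK: "\<And>z. z \<in> cball x (b * r) \<Longrightarrow> T z \<in> K"
      and TT: "\<And>z w. z \<in> cball x (b * r) \<Longrightarrow> w \<in> cball x (b * r) \<Longrightarrow> norm (T z - T w) \<ge> \<theta> * norm (z - w) \<and> norm (T z - T w) \<ge> norm (z - w) - 16 * \<sigma> * r"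
    define T' where "T' z = T (x + r *\<^sub>R z)" for z
    have T'm[measurable]: "T' \<in> borel_measurable borel" unfolding T'_def by measurable
    have in_ball: "x + r *\<^sub>R z \<in> cball x (b * r)" if "z \<in> cball 0 b" for z
      using that r by (simp add: dist_norm mult.commute)
    define \<mu> where "\<mu> = distr \<omega> borel T'"
    have K': "K \<in> sets borel" using K(1) by (rule borel_compact)
    have AEb: "AE z in \<omega>. z \<in> cball 0 b" by (rule sh(2))
    have \<mu>: "borel_prob_on K \<mu>"
      unfolding borel_prob_on_def
    proof (intro conjI)
      show "prob_space \<mu>" unfolding \<mu>_def by (rule prob_space_distr) measurable
      have "emeasure \<mu> K = emeasure \<omega> (T' -` K \<inter> space \<omega>)"
        unfolding \<mu>_def using K' by (intro emeasure_distr) auto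
      also have "\<dots> = 1"
      proof (rule emeasure_eq_1_AE)
        show "T' -` K \<inter> space \<omega> \<in> events" using K' by measurable
        show "AE z in \<omega>. z \<in> T' -` K \<inter> space \<omega>"
          using AEb by eventually_elim (use TK[OF in_ball] in \<open>auto simp: T'_def\<close>)
      qed
      finally show "emeasure \<mu> K = 1" .
    qed (simp add: \<mu>_def)
    have "kk_energy (2 * r) \<mu> = (\<integral>\<^sup>+y. \<integral>\<^sup>+z. kk d (norm (T' z - T' y) / (2 * r)) \<partial>\<omega> \<partial>\<omega>)"
      unfolding kk_energy_def \<mu>_def dd(1) by (simp add: nn_integral_distr)
    also have "\<dots> \<le> (\<integral>\<^sup>+y. \<integral>\<^sup>+z. u n (y, z) \<partial>\<omega> \<partial>\<omega>)"
    proof (rule nn_integral_mono_AE, use AEb in eventually_elim)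
      fix y :: 'a assume y: "y \<in> cball 0 b"
      show "(\<integral>\<^sup>+z. kk d (norm (T' z - T' y) / (2 * r)) \<partial>\<omega>) \<le> (\<integral>\<^sup>+z. u n (y, z) \<partial>\<omega>)"
      proof (rule nn_integral_mono_AE, use AEb in eventually_elim)
        fix z :: 'a assume z: "z \<in> cball 0 b"
        have nz: "norm (x + r *\<^sub>R z - (x + r *\<^sub>R y)) = r * norm (z - y)"
          using r by (simp add: scaleR_diff_right[symmetric])
        have "16 * \<sigma> * r \<le> 16 * (1 / real (Suc n)) * r" using r \<sigma> by (intro mult_right_mono mult_left_mono) auto
        then have "r * (\<theta> * norm (z - y)) \<le> norm (T' z - T' y)" "r * (norm (z - y) - 16 / real (Suc n)) \<le> norm (T' z - T' y)"
          using TT[OF in_ball[OF z] in_ball[OF y]] unfolding nz T'_def by (auto simp: algebra_simps)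
        then have rm: "r * max (\<theta> * norm (z - y)) (norm (z - y) - 16 / real (Suc n)) \<le> norm (T' z - T' y)"
          by (simp add: max_def)
        have "max (\<theta> * norm (z - y)) (norm (z - y) - 16 / real (Suc n)) / 2 \<le> norm (T' z - T' y) / (2 * r)"
        proof -
          have "m / 2 \<le> N / (2 * r)" if "r * m \<le> N" for m N using that r by (simp add: field_simps)
          then show ?thesis using rm by blast
        qed
        then show "kk d (norm (T' z - T' y) / (2 * r)) \<le> u n (y, z)"
          unfolding u_def t_def using \<theta> by (intro kk_antimono) (auto simp: le_max_iff_disj)
      qed
    qed
    also have "\<dots> = integral\<^sup>N (\<omega> \<Otimes>\<^sub>M \<omega>) (u n)" by (rule nn_integral_fst) measurable
    also note n
    finally have en: "kk_energy (2 * r) \<mu> < ennreal (kr DIM('a) (e1 * r / (2 * r)))" using r by (simp add: dd(1))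
    show "e1 * r \<le> capacity (ball x r \<inter> E)"
      by (rule capacity_ge[OF _ K _ _ \<mu> en]) (use dd e1 r in auto)
  qed (use ab in auto)
qed

text \<open>The identity serves as \<open>T\<close>, with a concentric closed ball as
  \<open>K\<close>. Half of the true value is enough for isolated holes, whose radius matters only
  up to constants.\<close>

lemma ball_capacity:
  fixes p :: "'a::euclidean_space"
  assumes dd: "DIM('a) = d" "d \<ge> 2" and \<rho>: "\<rho> > 0"
  shows "capacity (ball p \<rho>) \<ge> \<rho> / 2"
proof (rule near_full_capacity[OF dd, of "1/2" 1])
  fix b \<sigma>0 :: real
  assume b: "0 < b" "b < 1" "\<sigma>0 > 0"
    and *: "\<And>(x::'a) r \<sigma> T K E. r > 0 \<Longrightarrow> \<sigma> \<le> \<sigma>0 \<Longrightarrow> T \<in> borel_measurable borel \<Longrightarrow> compact K \<Longrightarrow> K \<subseteq> ball x r \<inter> E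
      \<Longrightarrow> (\<And>z. z \<in> cball x (b * r) \<Longrightarrow> T z \<in> K)
      \<Longrightarrow> (\<And>z w. z \<in> cball x (b * r) \<Longrightarrow> w \<in> cball x (b * r) \<Longrightarrow> norm (T z - T w) \<ge> 1 * norm (z - w) \<and> norm (T z - T w) \<ge> norm (z - w) - 16 * \<sigma> * r)
      \<Longrightarrow> (1/2) * r \<le> capacity (ball x r \<inter> E)"
  have "(1/2) * \<rho> \<le> capacity (ball p \<rho> \<inter> UNIV)"
  proof (rule *[of \<rho> 0 "\<lambda>z. z" "cball p (b * \<rho>)"])
    have "b * \<rho> < 1 * \<rho>" using b \<rho> by (intro mult_strict_right_mono) auto
    then show "cball p (b * \<rho>) \<subseteq> ball p \<rho> \<inter> UNIV" by auto
  qed (use b \<rho> in auto)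
  then show ?thesis by simp
qed simp_all

section \<open>Subharmonic functions with holes\<close>

text \<open>Made for \<open>h\<close> minus a truncated kernel: the summands are radial about
  different centres, the second has negative Laplacian, and only the sum of the two traces has a
  sign.\<close>

lemma subharmonic_C2_ball_radial_pair:
  fixes z x :: "'a::euclidean_space"
  assumes dd: "DIM('a) = d" and r: "r > 0"
    and p: "\<And>y. y \<in> ball x r \<Longrightarrow> (p has_real_derivative p1 (y \<bullet> y)) (at (y \<bullet> y))"
    and p': "\<And>y. y \<in> ball x r \<Longrightarrow> (p1 has_real_derivative p2 (y \<bullet> y)) (at (y \<bullet> y))"
    and q: "\<And>y. y \<in> ball x r \<Longrightarrow> (q has_real_derivative q1 ((y - z) \<bullet> (y - z))) (at ((y - z) \<bullet> (y - z)))"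
    and q': "\<And>y. y \<in> ball x r \<Longrightarrow> (q1 has_real_derivative q2 ((y - z) \<bullet> (y - z))) (at ((y - z) \<bullet> (y - z)))"
    and B: "\<And>y. y \<in> ball x r \<Longrightarrow> \<bar>p1 (y \<bullet> y)\<bar> \<le> B" "\<And>y. y \<in> ball x r \<Longrightarrow> \<bar>p2 (y \<bullet> y)\<bar> * (y \<bullet> y) \<le> B"
      "\<And>y. y \<in> ball x r \<Longrightarrow> \<bar>q1 ((y - z) \<bullet> (y - z))\<bar> \<le> B" "\<And>y. y \<in> ball x r \<Longrightarrow> \<bar>q2 ((y - z) \<bullet> (y - z))\<bar> * ((y - z) \<bullet> (y - z)) \<le> B"
    and tr: "\<And>y. y \<in> ball x r \<Longrightarrow> (4 * p2 (y \<bullet> y) * (y \<bullet> y) + 2 * real d * p1 (y \<bullet> y))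
       + (4 * q2 ((y - z) \<bullet> (y - z)) * ((y - z) \<bullet> (y - z)) + 2 * real d * q1 ((y - z) \<bullet> (y - z))) \<ge> 0"
  shows "\<exists>g H C. subharmonic_C2_ball (\<lambda>y. p (y \<bullet> y) + q ((y - z) \<bullet> (y - z))) g H x r C"
proof -
  define H1 where "H1 y v = (4 * p2 (y \<bullet> y) * (y \<bullet> v)) *\<^sub>R y + (2 * p1 (y \<bullet> y)) *\<^sub>R v" for y v :: 'a
  define H2 where "H2 y v = (4 * q2 ((y - z) \<bullet> (y - z)) * ((y - z) \<bullet> v)) *\<^sub>R (y - z) + (2 * q1 ((y - z) \<bullet> (y - z))) *\<^sub>R v" for y v
  have "subharmonic_C2_ball (\<lambda>y. p (y \<bullet> y) + q ((y - z) \<bullet> (y - z)))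
     (\<lambda>y. (2 * p1 (y \<bullet> y)) *\<^sub>R y + (2 * q1 ((y - z) \<bullet> (y - z))) *\<^sub>R (y - z)) (\<lambda>y v. H1 y v + H2 y v) x r (12 * B)"
  proof
    fix y :: 'a assume y: "y \<in> ball x r"
    show "((\<lambda>y. p (y \<bullet> y) + q ((y - z) \<bullet> (y - z))) has_derivative
       (\<lambda>v. ((2 * p1 (y \<bullet> y)) *\<^sub>R y + (2 * q1 ((y - z) \<bullet> (y - z))) *\<^sub>R (y - z)) \<bullet> v)) (at y)"
      unfolding inner_add_left
      using has_derivative_add[OF radial_has_derivative[of p _ y 0] radial_has_derivative[OF q[OF y]]] p[OF y] by simp
    show "((\<lambda>y. (2 * p1 (y \<bullet> y)) *\<^sub>R y + (2 * q1 ((y - z) \<bullet> (y - z))) *\<^sub>R (y - z)) has_derivative (\<lambda>v. H1 y v + H2 y v)) (at y)"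
      unfolding H1_def H2_def
      using has_derivative_add[OF radial_gradient_has_derivative[of p1 _ y 0] radial_gradient_has_derivative[OF q'[OF y]]] p'[OF y] by simp
    have "norm (H1 y v) \<le> 6 * B * norm v" for v
    proof -
      have "norm (H1 y v) \<le> (4 * \<bar>p2 (y \<bullet> y)\<bar> * (y \<bullet> y) + 2 * \<bar>p1 (y \<bullet> y)\<bar>) * norm v" unfolding H1_def by (rule radial_hessian_bound)
      also have "\<dots> \<le> 6 * B * norm v" using B(1,2)[OF y] by (intro mult_right_mono) auto
      finally show ?thesis .
    qed
    moreover have "norm (H2 y v) \<le> 6 * B * norm v" for v
    proof -
      have "norm (H2 y v) \<le> (4 * \<bar>q2 ((y - z) \<bullet> (y - z))\<bar> * ((y - z) \<bullet> (y - z)) + 2 * \<bar>q1 ((y - z) \<bullet> (y - z))\<bar>) * norm v" unfolding H2_def by (rule radial_hessian_bound)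
      also have "\<dots> \<le> 6 * B * norm v" using B(3,4)[OF y] by (intro mult_right_mono) auto
      finally show ?thesis .
    qed
    ultimately show "norm (H1 y v + H2 y v) \<le> 12 * B * norm v" for v
      using norm_triangle_ineq[of "H1 y v" "H2 y v"] by (smt (verit) distrib_right)
    have "(\<Sum>b\<in>Basis. (H1 y b + H2 y b) \<bullet> b) = (\<Sum>b\<in>Basis. H1 y b \<bullet> b) + (\<Sum>b\<in>Basis. H2 y b \<bullet> b)"
      by (simp add: inner_add_left sum.distrib)
    also have "\<dots> \<ge> 0"
      unfolding H1_def H2_def radial_hessian_trace using tr[OF y] by (simp add: dd)
    finally show "(\<Sum>b\<in>Basis. (H1 y b + H2 y b) \<bullet> b) \<ge> 0" .
  qed (rule r)
  then show ?thesis by blast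
qed

lemma has_real_derivative_max0_power:
  assumes "n \<ge> 1"
  shows "((\<lambda>s::real. (max s 0) ^ Suc n) has_real_derivative real (Suc n) * (max s 0) ^ n) (at s)"
proof -
  have e: "((\<lambda>s::real. s ^ Suc n) has_real_derivative real (Suc n) * s ^ n) (at s)" for s
    by (rule derivative_eq_intros refl | simp)+
  consider "s > 0" | "s = 0" | "s < 0" by linarith
  then show ?thesis
  proof cases
    case 1
    have "((\<lambda>s::real. (max s 0) ^ Suc n) has_real_derivative real (Suc n) * s ^ n) (at s)"
      by (rule has_field_derivative_transform_within_open[OF e, of "{0<..}"]) (use 1 in auto)
    then show ?thesis using 1 by simp
  next
    case 2
    have "((\<lambda>s::real. (max s 0) ^ Suc n) has_real_derivative 0) (at 0)"
    proof (rule has_real_derivative_0_dominated[of "\<lambda>s. s ^ Suc n"])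
      show "((\<lambda>s::real. s ^ Suc n) has_real_derivative 0) (at 0)" using e[of 0] assms by (simp add: power_0_left)
      show "\<bar>(max s 0) ^ Suc n\<bar> \<le> \<bar>s ^ Suc n\<bar>" for s :: real
        by (cases "s \<le> 0") auto
    qed auto
    then show ?thesis using 2 assms by (simp add: power_0_left)
  next
    case 3
    have "((\<lambda>_. 0::real) has_real_derivative 0) (at s)" by simp
    then have "((\<lambda>s::real. (max s 0) ^ Suc n) has_real_derivative 0) (at s)"
      by (rule has_field_derivative_transform_within_open[of _ _ _ "{..<0}"]) (use 3 in auto)
    then show ?thesis using 3 assms by (simp add: power_0_left)
  qed
qed

text \<open>Cubing makes the positive part \<open>C\<^sup>2\<close> and, being convex and nondecreasing, preserves subharmonicity.\<close>

lemma subharmonic_C2_ball_cube: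
  assumes "subharmonic_C2_ball f g H x r C"
  shows "\<exists>g H C. subharmonic_C2_ball (\<lambda>y. (max (f y) 0) ^ 3) g H x r C"
proof -
  interpret subharmonic_C2_ball f g H x r C by fact
  define F where "F = \<bar>f x\<bar> + G * r"
  have Fb: "0 \<le> max (f y) 0" "max (f y) 0 \<le> F" if "y \<in> ball x r" for y
  proof -
    have "\<bar>f y - f x\<bar> \<le> G * norm (y - x)" using that r'_pos by (intro f_lipschitz) auto
    also have "\<dots> \<le> G * r" using that G_nonneg by (intro mult_left_mono) (auto simp: dist_norm norm_minus_commute)
    finally show "max (f y) 0 \<le> F" using G_nonneg r'_pos by (auto simp: F_def)
  qed simp
  define g' where "g' y = (3 * (max (f y) 0)\<^sup>2) *\<^sub>R g y" for y
  define H' where "H' y v = (6 * max (f y) 0 * (g y \<bullet> v)) *\<^sub>R g y + (3 * (max (f y) 0)\<^sup>2) *\<^sub>R H y v" for y v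
  have "subharmonic_C2_ball (\<lambda>y. (max (f y) 0) ^ 3) g' H' x r (6 * F * G * G + 3 * F\<^sup>2 * C)"
  proof
    fix y assume y: "y \<in> ball x r"
    note Fy = Fb[OF y]
    have "((\<lambda>y. (max (f y) 0) ^ Suc 2) has_derivative (\<lambda>v. (real (Suc 2) * (max (f y) 0) ^ 2) * (g y \<bullet> v))) (at y)"
      by (rule has_derivative_compose[OF grad[OF y] has_real_derivative_max0_power[of 2, unfolded has_field_derivative_def]]) simp
    then show "((\<lambda>y. (max (f y) 0) ^ 3) has_derivative (\<lambda>v. g' y \<bullet> v)) (at y)"
      by (simp add: g'_def numeral_3_eq_3 numeral_2_eq_2)
    have "((\<lambda>y. (max (f y) 0) ^ Suc 1) has_derivative (\<lambda>v. (real (Suc 1) * (max (f y) 0) ^ 1) * (g y \<bullet> v))) (at y)"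
      by (rule has_derivative_compose[OF grad[OF y] has_real_derivative_max0_power[of 1, unfolded has_field_derivative_def]]) simp
    then have "((\<lambda>y. 3 * (max (f y) 0)\<^sup>2) has_derivative (\<lambda>v. 3 * (2 * max (f y) 0 * (g y \<bullet> v)))) (at y)"
      by (intro has_derivative_mult_right) (simp add: numeral_2_eq_2)
    from has_derivative_scaleR[OF this hess[OF y]]
    show "(g' has_derivative H' y) (at y)"
      by (simp add: g'_def[abs_def] H'_def[abs_def] add.commute mult.assoc)
    show "norm (H' y v) \<le> (6 * F * G * G + 3 * F\<^sup>2 * C) * norm v" for v
    proof -
      have "norm (H' y v) \<le> norm ((6 * max (f y) 0 * (g y \<bullet> v)) *\<^sub>R g y) + norm ((3 * (max (f y) 0)\<^sup>2) *\<^sub>R H y v)"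
        unfolding H'_def by (rule norm_triangle_ineq)
      also have "norm ((6 * max (f y) 0 * (g y \<bullet> v)) *\<^sub>R g y) = 6 * max (f y) 0 * \<bar>g y \<bullet> v\<bar> * norm (g y)"
        by (simp add: abs_mult)
      also have "\<dots> \<le> 6 * F * (G * norm v) * G"
      proof (intro mult_mono)
        have "\<bar>g y \<bullet> v\<bar> \<le> norm (g y) * norm v" by (rule Cauchy_Schwarz_ineq2)
        also have "\<dots> \<le> G * norm v" using grad_bound[OF y] by (intro mult_right_mono) auto
        finally show "\<bar>g y \<bullet> v\<bar> \<le> G * norm v" .
      qed (use Fy G_nonneg grad_bound[OF y] in auto)
      also have "norm ((3 * (max (f y) 0)\<^sup>2) *\<^sub>R H y v) = 3 * (max (f y) 0)\<^sup>2 * norm (H y v)" by simp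
      also have "\<dots> \<le> 3 * F\<^sup>2 * (C * norm v)"
        using Fy bound[OF y] C_nonneg by (intro mult_mono power_mono) auto
      finally show ?thesis by (simp add: algebra_simps)
    qed
    have "(\<Sum>b\<in>Basis. H' y b \<bullet> b) = 6 * max (f y) 0 * (\<Sum>b\<in>Basis. (g y \<bullet> b) * (g y \<bullet> b)) + 3 * (max (f y) 0)\<^sup>2 * (\<Sum>b\<in>Basis. H y b \<bullet> b)"
      by (simp add: H'_def inner_add_left sum.distrib sum_distrib_left mult.assoc)
    also have "\<dots> \<ge> 0"
    proof -
      have "0 \<le> (\<Sum>b\<in>Basis. (g y \<bullet> b) * (g y \<bullet> b))" by (intro sum_nonneg) simp
      then show ?thesis using Fy trace[OF y] by (intro add_nonneg_nonneg mult_nonneg_nonneg) simp_all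
    qed
    finally show "(\<Sum>b\<in>Basis. H' y b \<bullet> b) \<ge> 0" .
  qed (rule r'_pos)
  then show ?thesis by blast
qed

lemma subharmonic_C2_ball_cong:
  assumes "subharmonic_C2_ball f g H x r C" "0 < r2" "r2 \<le> r" and eq: "\<And>y. y \<in> ball x r2 \<Longrightarrow> f y = f' y"
  shows "subharmonic_C2_ball f' g H x r2 C"
proof -
  interpret subharmonic_C2_ball f g H x r C by fact
  show ?thesis
  proof
    fix y assume y: "y \<in> ball x r2"
    then have y': "y \<in> ball x r" using assms(3) by auto
    show "(f' has_derivative (\<lambda>v. g y \<bullet> v)) (at y)"
      by (rule has_derivative_transform_within_open[OF grad[OF y'] open_ball y eq])
    show "(g has_derivative H y) (at y)" "norm (H y v) \<le> C * norm v" "(\<Sum>b\<in>Basis. H y b \<bullet> b) \<ge> 0" for v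
      using hess bound trace y' by auto
  qed (rule assms(2))
qed

text \<open>The argument is \<open>(4 * \<delta>)\<^sup>2\<close> because a hole of radius
  \<open>\<delta> * ell\<close> sits in a kernel of radius \<open>ell / 4\<close>.\<close>

lemma prof_at_0:
  assumes d: "d \<ge> 2"
  shows "\<exists>\<delta>>0. \<delta> \<le> 1 / 8 \<and> prof d (16 * \<delta>\<^sup>2) \<ge> K"
proof -
  define K' where "K' = (\<bar>K\<bar> + \<bar>kap d 1\<bar> + 1 + real d / 2) / ckap d"
  obtain s where s: "s > 0" "kr d s > K'" using kr_at_0[OF d] by blast
  define \<delta> where "\<delta> = min (1/8) (s / 4)"
  have \<delta>: "\<delta> > 0" "\<delta> \<le> 1 / 8" "4 * \<delta> \<le> s" using s by (auto simp: \<delta>_def)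
  have ck: "ckap d > 0" by (rule ckap_pos[OF d])
  have "kr d (4 * \<delta>) > K'" using kr_antimono[of "4 * \<delta>" s d] \<delta> s by simp
  then have "ckap d * K' \<le> kap d ((4 * \<delta>)\<^sup>2)" using \<delta> ck by (subst kap_power2[OF d]) auto
  then have 1: "\<bar>K\<bar> + \<bar>kap d 1\<bar> + 1 + real d / 2 \<le> kap d ((4 * \<delta>)\<^sup>2)" using ck by (simp add: K'_def)
  have "(4 * \<delta>)\<^sup>2 < 1\<^sup>2" using \<delta> by (intro power_strict_mono) auto
  then have "(4 * \<delta>)\<^sup>2 < 1" by simp
  then have "prof d ((4 * \<delta>)\<^sup>2) \<ge> kap d ((4 * \<delta>)\<^sup>2) - kap d 1 - (1 + real d / 2)" using \<delta> by (intro prof_ge_kap) auto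
  then have "prof d (16 * \<delta>\<^sup>2) \<ge> K" using 1 by (simp add: power_mult_distrib)
  then show ?thesis using \<delta> by blast
qed

text \<open>The net may be infinite and its mesh \<open>w\<close> varies, so maximality comes from
  Zorn's lemma; the maximum of both weights makes separation symmetric.\<close>

lemma maximal_separated_set:
  fixes w :: "'a::metric_space \<Rightarrow> real" and D :: "'a set"
  obtains J where "J \<subseteq> D" "\<And>p q. p \<in> J \<Longrightarrow> q \<in> J \<Longrightarrow> p \<noteq> q \<Longrightarrow> dist p q \<ge> max (w p) (w q)"
    "\<And>y. y \<in> D \<Longrightarrow> y \<in> J \<or> (\<exists>p\<in>J. dist y p < max (w y) (w p))"
proof -
  define Q where "Q = {J. J \<subseteq> D \<and> (\<forall>p\<in>J. \<forall>q\<in>J. p \<noteq> q \<longrightarrow> dist p q \<ge> max (w p) (w q))}"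
  have "\<exists>M\<in>Q. \<forall>X\<in>Q. M \<subseteq> X \<longrightarrow> X = M"
  proof (rule subset_Zorn')
    fix C assume C: "subset.chain Q C"
    then have CQ: "C \<subseteq> Q" and ch: "\<And>A B. A \<in> C \<Longrightarrow> B \<in> C \<Longrightarrow> A \<subseteq> B \<or> B \<subseteq> A" by (auto simp: subset_chain_def)
    show "\<Union>C \<in> Q"
      unfolding Q_def
    proof (intro CollectI conjI ballI impI)
      show "\<Union>C \<subseteq> D" using CQ by (auto simp: Q_def)
      fix p q assume "p \<in> \<Union>C" "q \<in> \<Union>C" and pq: "p \<noteq> q"
      then obtain A B where A: "A \<in> C" "p \<in> A" "B \<in> C" "q \<in> B" by auto
      then obtain E where "E \<in> C" "p \<in> E" "q \<in> E" using ch[of A B] by blast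
      then show "max (w p) (w q) \<le> dist p q" using CQ pq by (auto simp: Q_def)
    qed
  qed
  then obtain J where J: "J \<in> Q" "\<And>X. X \<in> Q \<Longrightarrow> J \<subseteq> X \<Longrightarrow> X = J" by blast
  show ?thesis
  proof (rule that[of J])
    fix y assume y: "y \<in> D"
    show "y \<in> J \<or> (\<exists>p\<in>J. dist y p < max (w y) (w p))"
    proof (rule ccontr)
      assume *: "\<not> ?thesis"
      then have "insert y J \<in> Q" using J(1) y by (auto simp: Q_def not_less dist_commute max.commute)
      then have "insert y J = J" using J(2) by blast
      then show False using * by blast
    qed
  qed (use J(1) in \<open>auto simp: Q_def\<close>)
qed

text \<open>The growth of \<open>u\<close> is that of \<open>h\<^sup>3\<close>, where \<open>h = exp \<integral> 1 / g\<close> is radial. Around each point \<open>p\<close> of the net \<open>J\<close> a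
  truncated kernel of size \<open>lam p * h p\<close> and radius \<open>ell (norm p) / 4\<close> is subtracted from \<open>h\<close>; the weight
  \<open>lam p\<close> is about \<open>(ell / g)\<^sup>2\<close>, the most that the Laplacian \<open>h / g\<^sup>2\<close> of \<open>h\<close> can pay for.\<close>

locale perforation =
  fixes ell g g' :: "real \<Rightarrow> real" and d :: nat and J :: "'a::euclidean_space set"
  assumes dd: "DIM('a) = d" "d \<ge> 2"
    and ell_pos: "\<And>t. t \<ge> 0 \<Longrightarrow> ell t > 0"
    and ell_mono: "\<And>s t. 0 \<le> s \<Longrightarrow> s \<le> t \<Longrightarrow> ell s \<le> ell t"
    and ell_lip: "\<And>s t. 0 \<le> s \<Longrightarrow> s \<le> t \<Longrightarrow> ell t \<le> ell s + (t - s) / 100"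
    and g_deriv: "\<And>t. t > 0 \<Longrightarrow> (g has_real_derivative g' t) (at t)"
    and g'_le: "\<And>t. t > 0 \<Longrightarrow> \<bar>g' t\<bar> \<le> 1 / 4"
    and g_ge: "\<And>t. t > 0 \<Longrightarrow> g t \<ge> ell t"
    and J_far: "\<And>p. p \<in> J \<Longrightarrow> norm p \<ge> ell 0"
    and J_sep: "\<And>p q. p \<in> J \<Longrightarrow> q \<in> J \<Longrightarrow> p \<noteq> q \<Longrightarrow> dist p q \<ge> max (ell (norm p)) (ell (norm q))"
    and J_max: "\<And>y. norm y \<ge> ell 0 \<Longrightarrow> y \<in> J \<or> (\<exists>p\<in>J. dist y p < max (ell (norm y)) (ell (norm p)))"
begin

definition "s0 = ell 0 / 2"
text \<open>The lower limit lies strictly below \<open>s0\<close>, the least value of \<tau>, so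
  that \<Phi> is differentiable wherever it is used.\<close>

definition "\<Phi> t = integral {s0 / 2..t} (\<lambda>t. 1 / g t)"
text \<open>The norm is replaced by \<open>sqrt (s0\<^sup>2 + s)\<close>, with \<open>s\<close> the
  squared norm: this is smooth at the origin and stays in the range where \<open>g\<close> is
  differentiable.\<close>

definition "hs s = exp (\<Phi> (sqrt (s0\<^sup>2 + s)))"
definition "hs1 s = hs s / (2 * sqrt (s0\<^sup>2 + s) * g (sqrt (s0\<^sup>2 + s)))"
definition "hs2 s = hs s / (4 * (s0\<^sup>2 + s) * (g (sqrt (s0\<^sup>2 + s)))\<^sup>2) * (1 - g (sqrt (s0\<^sup>2 + s)) / sqrt (s0\<^sup>2 + s) - g' (sqrt (s0\<^sup>2 + s)))"
definition "\<tau> x = sqrt (s0\<^sup>2 + x \<bullet> x)" for x :: 'a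
definition "h x = hs (x \<bullet> x)" for x :: 'a
text \<open>The constant makes the two Laplacians in \<open>cell_C2\<close> match: 256 is 16 from
  \<open>rad p = ell (norm p) / 4\<close>, squared, times 16 from
  \<open>4 * (2 * g)\<^sup>2\<close>; \<open>exp 1\<close> bounds the oscillation of
  \<open>h\<close> over a cell, and \<open>2 * d + d\<^sup>2\<close> comes from
  \<open>prof_laplacian\<close>.\<close>

definition "lam p = (ell (norm p))\<^sup>2 / (256 * exp 1 * (2 * real d + (real d)\<^sup>2) * (g (\<tau> p))\<^sup>2)" for p :: 'a
definition "rad p = ell (norm p) / 4" for p :: 'a
text \<open>At its pole the true kernel is infinite, whereas \<open>prof d 0\<close> is a finite
  default value; hence the separate clause for \<open>y = p\<close>.\<close>

definition "cell_fun p y = (if y = p then 0 else (max (h y - h p * lam p * prof d (((y - p) \<bullet> (y - p)) / (rad p)\<^sup>2)) 0) ^ 3)" for p y :: 'a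
definition "u y = (if \<exists>p\<in>J. dist y p < rad p then cell_fun (THE p. p \<in> J \<and> dist y p < rad p) y else (h y) ^ 3)"

section \<open>The radial function \<open>h\<close> and its Laplacian\<close>

lemma s0: "s0 > 0" using ell_pos[of 0] by (simp add: s0_def)

lemma g_pos: "t > 0 \<Longrightarrow> g t > 0" using ell_pos[of t] g_ge[of t] by simp

lemma g_cont: "continuous_on {0<..} g"
  using g_deriv by (intro continuous_at_imp_continuous_on) (auto intro: DERIV_isCont)

lemma inv_g_cont:
  assumes "0 < a" shows "continuous_on {a..b} (\<lambda>t. 1 / g t)"
proof (intro continuous_on_divide continuous_on_const ballI)
  show "continuous_on {a..b} g" by (rule continuous_on_subset[OF g_cont]) (use assms in auto)
  show "g t \<noteq> 0" if "t \<in> {a..b}" for t using g_pos[of t] that assms by simp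
qed

lemma inv_g_integrable: "0 < a \<Longrightarrow> (\<lambda>t. 1 / g t) integrable_on {a..b}"
  by (intro integrable_continuous_real inv_g_cont)

lemma Phi_deriv:
  assumes "t > s0 / 2" shows "(\<Phi> has_real_derivative 1 / g t) (at t)"
proof -
  have "((\<lambda>u. integral {s0 / 2..u} (\<lambda>t. 1 / g t)) has_vector_derivative 1 / g t) (at t within {s0 / 2..t + 1})"
    by (rule integral_has_vector_derivative[OF inv_g_cont]) (use assms s0 in auto)
  moreover have "at t within {s0 / 2..t + 1} = at t" using assms by (intro at_within_interior) auto
  ultimately show ?thesis by (simp add: \<Phi>_def[abs_def] has_real_derivative_iff_has_vector_derivative)
qed

lemma sigma: 
  assumes "s \<ge> 0" shows "sqrt (s0\<^sup>2 + s) \<ge> s0" "sqrt (s0\<^sup>2 + s) > 0" "(sqrt (s0\<^sup>2 + s))\<^sup>2 = s0\<^sup>2 + s" "s0\<^sup>2 + s > 0"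
proof -
  show "s0\<^sup>2 + s > 0" using s0 assms by (simp add: add_pos_nonneg)
  then show "sqrt (s0\<^sup>2 + s) > 0" "(sqrt (s0\<^sup>2 + s))\<^sup>2 = s0\<^sup>2 + s" by simp_all
  show "sqrt (s0\<^sup>2 + s) \<ge> s0" using s0 assms by (intro real_le_rsqrt) simp
qed

lemma sqrt_deriv: "s \<ge> 0 \<Longrightarrow> ((\<lambda>s. sqrt (s0\<^sup>2 + s)) has_real_derivative 1 / (2 * sqrt (s0\<^sup>2 + s))) (at s)"
  using sigma(4)[of s] by (auto intro!: derivative_eq_intros simp: field_simps)

lemma hs_deriv:
  assumes "s \<ge> 0" shows "(hs has_real_derivative hs1 s) (at s)"
proof -
  let ?\<sigma> = "sqrt (s0\<^sup>2 + s)"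
  have "?\<sigma> > s0 / 2" using sigma(1)[OF assms] s0 by linarith
  from DERIV_chain2[OF DERIV_exp DERIV_chain2[OF Phi_deriv[OF this] sqrt_deriv[OF assms]]]
  show ?thesis by (simp add: hs_def[abs_def] hs1_def mult.commute)
qed

lemma hs1_deriv:
  assumes "s \<ge> 0" shows "(hs1 has_real_derivative hs2 s) (at s)"
proof -
  let ?\<sigma> = "sqrt (s0\<^sup>2 + s)"
  note sg = sigma[OF assms]
  have g0: "g ?\<sigma> > 0" using g_pos sg by simp
  have dg: "((\<lambda>s. g (sqrt (s0\<^sup>2 + s))) has_real_derivative g' ?\<sigma> * (1 / (2 * ?\<sigma>))) (at s)"
    by (rule DERIV_chain2[OF g_deriv[OF sg(2)] sqrt_deriv[OF assms]])
  have den: "((\<lambda>s. 2 * sqrt (s0\<^sup>2 + s) * g (sqrt (s0\<^sup>2 + s))) has_real_derivative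
     (2 * (1 / (2 * ?\<sigma>))) * g ?\<sigma> + (g' ?\<sigma> * (1 / (2 * ?\<sigma>))) * (2 * ?\<sigma>)) (at s)"
    by (rule DERIV_mult[OF DERIV_cmult[OF sqrt_deriv[OF assms]] dg])
  have ne: "2 * ?\<sigma> * g ?\<sigma> \<noteq> 0" using sg g0 by simp
  have "(hs1 has_real_derivative (hs1 s * (2 * ?\<sigma> * g ?\<sigma>) - hs s * ((2 * (1 / (2 * ?\<sigma>))) * g ?\<sigma> + (g' ?\<sigma> * (1 / (2 * ?\<sigma>))) * (2 * ?\<sigma>))) / ((2 * ?\<sigma> * g ?\<sigma>) * (2 * ?\<sigma> * g ?\<sigma>))) (at s)"
    unfolding hs1_def[abs_def] using DERIV_divide[OF hs_deriv[OF assms] den ne] unfolding hs1_def .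
  moreover have "hs1 s * (2 * ?\<sigma> * g ?\<sigma>) = hs s" using ne by (simp add: hs1_def)
  moreover have "(hs s - hs s * ((2 * (1 / (2 * ?\<sigma>))) * g ?\<sigma> + (g' ?\<sigma> * (1 / (2 * ?\<sigma>))) * (2 * ?\<sigma>))) / ((2 * ?\<sigma> * g ?\<sigma>) * (2 * ?\<sigma> * g ?\<sigma>)) = hs2 s"
  proof -
    have "(2 * a * c) * (2 * a * c) = 4 * a\<^sup>2 * c\<^sup>2" for a c :: real by (simp add: power2_eq_square)
    from this[of ?\<sigma> "g ?\<sigma>", unfolded sg(3)]
    have "(2 * ?\<sigma> * g ?\<sigma>) * (2 * ?\<sigma> * g ?\<sigma>) = 4 * (s0\<^sup>2 + s) * (g ?\<sigma>)\<^sup>2" .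
    moreover have "(2 * (1 / (2 * ?\<sigma>))) * g ?\<sigma> + (g' ?\<sigma> * (1 / (2 * ?\<sigma>))) * (2 * ?\<sigma>) = g ?\<sigma> / ?\<sigma> + g' ?\<sigma>"
      using sg(2) by simp
    moreover have "(a - a * (b + e)) / k = a / k * (1 - b - e)" for a b e k :: real
      by (simp add: algebra_simps diff_divide_distrib add_divide_distrib)
    ultimately show ?thesis unfolding hs2_def by (simp only:)
  qed
  ultimately show ?thesis by simp
qed

text \<open>This is the Laplacian of \<open>exp (\<Phi> \<tau>)\<close>: the squared gradient of
  \<tau> is \<open>s / (s0\<^sup>2 + s)\<close>, and its Laplacian is \<open>d\<close> minus that
  quotient, divided by \<tau>.\<close>

lemma hs_laplacian_eq:
  assumes "s \<ge> 0"
  shows "4 * hs2 s * s + 2 * real d * hs1 s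
    = hs s * (s / (s0\<^sup>2 + s) * (1 - g' (sqrt (s0\<^sup>2 + s))) / (g (sqrt (s0\<^sup>2 + s)))\<^sup>2
        + (real d - s / (s0\<^sup>2 + s)) / (sqrt (s0\<^sup>2 + s) * g (sqrt (s0\<^sup>2 + s))))"
proof -
  let ?\<sigma> = "sqrt (s0\<^sup>2 + s)"
  note sg = sigma[OF assms]
  have g0: "g ?\<sigma> > 0" using g_pos sg by simp
  define \<sigma> \<gamma> D where "\<sigma> = ?\<sigma>" and "\<gamma> = g ?\<sigma>" and "D = s0\<^sup>2 + s"
  have pos: "\<sigma> > 0" "\<gamma> > 0" "D > 0" using sg g0 by (auto simp: \<sigma>_def \<gamma>_def D_def)
  have "4 * hs2 s * s + 2 * real d * hs1 s = hs s * (s / (D * \<gamma>\<^sup>2) * (1 - \<gamma> / \<sigma> - g' \<sigma>) + real d / (\<sigma> * \<gamma>))"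
  proof -
    have "hs2 s = hs s / (4 * D * \<gamma>\<^sup>2) * (1 - \<gamma> / \<sigma> - g' \<sigma>)" "hs1 s = hs s / (2 * \<sigma> * \<gamma>)"
      by (simp_all add: hs2_def hs1_def \<sigma>_def \<gamma>_def D_def)
    moreover have "4 * (a / (4 * D * \<gamma>\<^sup>2) * c) * s + 2 * real d * (a / (2 * \<sigma> * \<gamma>)) = a * (s / (D * \<gamma>\<^sup>2) * c + real d / (\<sigma> * \<gamma>))" for a c
      using pos by (simp add: field_simps)
    ultimately show ?thesis by simp
  qed
  also have "s / (D * \<gamma>\<^sup>2) * (1 - \<gamma> / \<sigma> - g' \<sigma>) + real d / (\<sigma> * \<gamma>) = s / D * (1 - g' \<sigma>) / \<gamma>\<^sup>2 + (real d - s / D) / (\<sigma> * \<gamma>)"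
    using pos by (simp add: field_simps power2_eq_square)
  finally show ?thesis unfolding \<sigma>_def \<gamma>_def D_def .
qed

lemma hs_pos: "hs s > 0" by (simp add: hs_def)

lemma hs_laplacian_nonneg:
  assumes "s \<ge> 0" shows "4 * hs2 s * s + 2 * real d * hs1 s \<ge> 0"
  unfolding hs_laplacian_eq[OF assms]
proof (intro mult_nonneg_nonneg add_nonneg_nonneg divide_nonneg_nonneg)
  note sg = sigma[OF assms]
  show "0 \<le> 1 - g' (sqrt (s0\<^sup>2 + s))" using g'_le[OF sg(2)] by simp
  show "0 \<le> g (sqrt (s0\<^sup>2 + s))" using g_pos[OF sg(2)] by simp
  have "s / (s0\<^sup>2 + s) \<le> 1" using sg(4) s0 by simp
  then show "0 \<le> real d - s / (s0\<^sup>2 + s)" using dd(2) by linarith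
qed (use assms sigma[OF assms] hs_pos[of s] in auto)

text \<open>From radius \<open>s0\<close> on, the squared gradient of \<tau> is at least 1/2, and so
  is \<open>1 - g'\<close>.\<close>

lemma hs_laplacian_ge:
  assumes "s \<ge> s0\<^sup>2" shows "4 * hs2 s * s + 2 * real d * hs1 s \<ge> hs s / (4 * (g (sqrt (s0\<^sup>2 + s)))\<^sup>2)"
proof -
  have s: "s \<ge> 0" using assms s0 by (smt (verit) zero_le_power2)
  note sg = sigma[OF s]
  define \<gamma> where "\<gamma> = g (sqrt (s0\<^sup>2 + s))"
  have g0: "\<gamma> > 0" using g_pos sg by (simp add: \<gamma>_def)
  have "s / (s0\<^sup>2 + s) \<ge> 1 / 2" using assms sg(4) by (simp add: le_divide_eq)
  moreover have "1 - g' (sqrt (s0\<^sup>2 + s)) \<ge> 1 / 2" using g'_le[OF sg(2)] by linarith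
  ultimately have "(1/2) * (1/2) \<le> s / (s0\<^sup>2 + s) * (1 - g' (sqrt (s0\<^sup>2 + s)))" by (intro mult_mono) linarith+
  then have "(1/4) / \<gamma>\<^sup>2 \<le> s / (s0\<^sup>2 + s) * (1 - g' (sqrt (s0\<^sup>2 + s))) / \<gamma>\<^sup>2" by (intro divide_right_mono) auto
  moreover have "(real d - s / (s0\<^sup>2 + s)) / (sqrt (s0\<^sup>2 + s) * \<gamma>) \<ge> 0"
  proof (intro divide_nonneg_nonneg mult_nonneg_nonneg)
    have "s / (s0\<^sup>2 + s) \<le> 1" using sg(4) s0 by simp
    then show "0 \<le> real d - s / (s0\<^sup>2 + s)" using dd(2) by linarith
  qed (use sg g0 in auto)
  ultimately have "(1/4) / \<gamma>\<^sup>2 \<le> s / (s0\<^sup>2 + s) * (1 - g' (sqrt (s0\<^sup>2 + s))) / \<gamma>\<^sup>2 + (real d - s / (s0\<^sup>2 + s)) / (sqrt (s0\<^sup>2 + s) * \<gamma>)" by linarith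
  then have "hs s * ((1/4) / \<gamma>\<^sup>2) \<le> 4 * hs2 s * s + 2 * real d * hs1 s"
    unfolding hs_laplacian_eq[OF s] \<gamma>_def[symmetric] using hs_pos[of s] by (intro mult_left_mono) auto
  then show ?thesis by (simp add: \<gamma>_def)
qed

lemma Phi_mono:
  assumes "s0 / 2 < a" "a \<le> b" shows "\<Phi> a \<le> \<Phi> b"
proof (rule DERIV_nonneg_imp_nondecreasing[OF assms(2)])
  fix t assume "a \<le> t"
  then have t: "t > s0 / 2" "t > 0" using assms s0 by linarith+
  then show "\<exists>y. (\<Phi> has_real_derivative y) (at t) \<and> 0 \<le> y"
    using Phi_deriv[OF t(1)] g_pos[OF t(2)] by (intro exI[of _ "1 / g t"]) simp
qed

lemma hs_mono:
  assumes "0 \<le> s" "s \<le> t" shows "hs s \<le> hs t"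
proof -
  have "sqrt (s0\<^sup>2 + s) > s0 / 2" using sigma(1)[OF assms(1)] s0 by linarith
  then show ?thesis unfolding hs_def using assms by (simp add: Phi_mono)
qed

lemma hs_bounds:
  assumes "T \<ge> 0"
  obtains B where "\<And>s. 0 \<le> s \<Longrightarrow> s \<le> T \<Longrightarrow> \<bar>hs1 s\<bar> \<le> B" "\<And>s. 0 \<le> s \<Longrightarrow> s \<le> T \<Longrightarrow> \<bar>hs2 s\<bar> * s \<le> B"
proof
  define E where "E = ell 0"
  have E: "E > 0" using ell_pos[of 0] by (simp add: E_def)
  fix s assume s: "0 \<le> s" "s \<le> T"
  note sg = sigma[OF s(1)]
  let ?\<sigma> = "sqrt (s0\<^sup>2 + s)"
  have gE: "g ?\<sigma> \<ge> E" using g_ge[OF sg(2)] ell_mono[of 0 ?\<sigma>] sg(2) by (simp add: E_def)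
  have hT: "hs s \<le> hs T" by (rule hs_mono[OF s])
  have "\<bar>hs1 s\<bar> = hs s / (2 * ?\<sigma> * g ?\<sigma>)" using sg gE E hs_pos[of s] by (simp add: hs1_def)
  also have "\<dots> \<le> hs T / (2 * s0 * E)"
    using hT sg gE E s0 hs_pos[of s] by (intro frac_le mult_mono) auto
  finally have 1: "\<bar>hs1 s\<bar> \<le> hs T / (2 * s0 * E)" .
  have D: "s0\<^sup>2 \<le> s0\<^sup>2 + s" using s by simp
  have a: "\<bar>hs s / (4 * (s0\<^sup>2 + s) * (g ?\<sigma>)\<^sup>2)\<bar> \<le> hs T / (4 * s0\<^sup>2 * E\<^sup>2)"
  proof -
    have "\<bar>hs s / (4 * (s0\<^sup>2 + s) * (g ?\<sigma>)\<^sup>2)\<bar> = hs s / (4 * (s0\<^sup>2 + s) * (g ?\<sigma>)\<^sup>2)" using sg hs_pos[of s] by simp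
    also have "\<dots> \<le> hs T / (4 * s0\<^sup>2 * E\<^sup>2)"
      using hT sg gE E s0 hs_pos[of s] D by (intro frac_le mult_mono power_mono) auto
    finally show ?thesis .
  qed
  have gs: "g ?\<sigma> \<le> g s0 + (?\<sigma> - s0)"
  proof -
    have "g ?\<sigma> - ?\<sigma> \<le> g s0 - s0"
    proof (rule DERIV_nonpos_imp_nonincreasing[OF sg(1), of "\<lambda>t. g t - t"])
      fix t assume t: "s0 \<le> t"
      then have "((\<lambda>t. g t - t) has_real_derivative g' t - 1) (at t)" "g' t - 1 \<le> 0"
        using g_deriv[of t] g'_le[of t] s0 by (auto intro!: derivative_eq_intros)
      then show "\<exists>y. ((\<lambda>t. g t - t) has_real_derivative y) (at t) \<and> y \<le> 0" by blast
    qed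
    then show ?thesis by simp
  qed
  have gr: "g ?\<sigma> / ?\<sigma> \<le> g s0 / s0 + 1"
  proof -
    have gs0: "g s0 > 0" using g_pos[OF s0] .
    have "g ?\<sigma> / ?\<sigma> \<le> (g s0 + ?\<sigma>) / ?\<sigma>" using gs sg(2) s0 by (intro divide_right_mono) auto
    also have "\<dots> = g s0 / ?\<sigma> + 1" using sg(2) by (simp add: add_divide_distrib)
    also have "g s0 / ?\<sigma> \<le> g s0 / s0" using gs0 sg s0 by (intro divide_left_mono) auto
    finally show ?thesis by simp
  qed
  have gpos: "g ?\<sigma> / ?\<sigma> \<ge> 0" using gE E sg by simp
  have b: "\<bar>1 - g ?\<sigma> / ?\<sigma> - g' ?\<sigma>\<bar> \<le> g s0 / s0 + 3"
    using gr gpos g'_le[OF sg(2)] by linarith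
  have "\<bar>hs2 s\<bar> \<le> hs T / (4 * s0\<^sup>2 * E\<^sup>2) * (g s0 / s0 + 3)"
    unfolding hs2_def abs_mult using a b hs_pos[of T] by (intro mult_mono) simp_all
  then have "\<bar>hs2 s\<bar> * s \<le> hs T / (4 * s0\<^sup>2 * E\<^sup>2) * (g s0 / s0 + 3) * T"
    using s by (intro mult_mono) (auto intro: order_trans[OF abs_ge_zero])
  then show "\<bar>hs2 s\<bar> * s \<le> max (hs T / (2 * s0 * E)) (hs T / (4 * s0\<^sup>2 * E\<^sup>2) * (g s0 / s0 + 3) * T)" by simp
  show "\<bar>hs1 s\<bar> \<le> max (hs T / (2 * s0 * E)) (hs T / (4 * s0\<^sup>2 * E\<^sup>2) * (g s0 / s0 + 3) * T)" using 1 by simp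
qed

section \<open>Cells: oscillation of \<open>h\<close>, and subtraction of kernels\<close>

lemma ell_p: "ell (norm p) > 0" using ell_pos by simp

lemma rad_pos: "rad p > 0" using ell_p by (simp add: rad_def)

lemma tau_ge: "\<tau> x \<ge> norm x" "\<tau> x \<ge> s0" "\<tau> x > 0" "\<tau> x \<le> norm x + s0"
proof -
  show "\<tau> x \<ge> s0" "\<tau> x > 0" using sigma[of "x \<bullet> x"] by (auto simp: \<tau>_def)
  show "\<tau> x \<ge> norm x" unfolding \<tau>_def norm_eq_sqrt_inner using s0 by (intro real_sqrt_le_mono) auto
  show "\<tau> x \<le> norm x + s0"
    unfolding \<tau>_def using s0
    by (intro real_le_lsqrt) (auto simp: power2_sum power2_norm_eq_inner)
qed

lemma tau_lipschitz: "\<bar>\<tau> x - \<tau> p\<bar> \<le> norm (x - p)"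
proof -
  have "(\<tau> x - \<tau> p) * (\<tau> x + \<tau> p) = (\<tau> x)\<^sup>2 - (\<tau> p)\<^sup>2" by (simp add: power2_eq_square algebra_simps)
  also have "\<dots> = (norm x)\<^sup>2 - (norm p)\<^sup>2" using sigma(3)[of "x \<bullet> x"] sigma(3)[of "p \<bullet> p"] by (simp add: \<tau>_def power2_norm_eq_inner)
  also have "\<dots> = (norm x - norm p) * (norm x + norm p)" by (simp add: power2_eq_square algebra_simps)
  finally have "\<bar>\<tau> x - \<tau> p\<bar> * (\<tau> x + \<tau> p) = \<bar>norm x - norm p\<bar> * (norm x + norm p)"
    using tau_ge(3)[of x] tau_ge(3)[of p] by (metis abs_mult abs_of_nonneg add_nonneg_nonneg less_imp_le norm_ge_zero)
  also have "\<dots> \<le> norm (x - p) * (\<tau> x + \<tau> p)"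
    using tau_ge(1)[of x] tau_ge(1)[of p] by (intro mult_mono norm_triangle_ineq3 add_mono) auto
  finally show ?thesis using tau_ge(3)[of x] tau_ge(3)[of p] by simp
qed

text \<open>\<open>ell\<close> is 1/100-Lipschitz, so it stays above half of its central value
  across a cell; since \<open>g \<ge> ell\<close>, \<Phi> varies by at most 1/2 over a length
  \<open>rad p\<close>.\<close>

lemma near_center:
  assumes xp: "norm (x - p) \<le> rad p"
  shows "h x \<le> exp 1 * h p" "h p \<le> exp 1 * h x" "g (\<tau> x) \<le> 2 * g (\<tau> p)"
proof -
  have ell2: "ell t \<ge> ell (norm p) / 2" if t: "t \<ge> min (\<tau> x) (\<tau> p)" for t
  proof -
    have "norm x \<ge> norm p - rad p" using xp norm_triangle_ineq2[of p "p - x"] by (simp add: norm_minus_commute)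
    then have tt: "t \<ge> norm p - rad p" using t tau_ge(1)[of x] tau_ge(1)[of p] rad_pos[of p] by linarith
    have t0: "t \<ge> 0" using t tau_ge(3)[of x] tau_ge(3)[of p] by linarith
    show ?thesis
    proof (cases "t \<ge> norm p")
      case True then show ?thesis using ell_mono[of "norm p" t] ell_p[of p] by simp
    next
      case False
      then have "ell (norm p) \<le> ell t + (norm p - t) / 100" using ell_lip[OF t0, of "norm p"] by simp
      moreover have "(norm p - t) / 100 \<le> (ell (norm p) / 4) / 100"
        using tt by (intro divide_right_mono) (auto simp: rad_def)
      moreover have "e / 2 \<le> l" if "e \<le> l + k" "k \<le> e / 4 / 100" "0 < e" for e l k :: real
        using that by linarith
      ultimately show ?thesis using ell_p[of p] by blast
    qed
  qed
  have pos: "t > s0 / 2" "t > 0" if "t \<ge> min (\<tau> x) (\<tau> p)" for t using that tau_ge(2)[of x] tau_ge(2)[of p] s0 by linarith+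
  have Phi1: "\<Phi> b \<le> \<Phi> a + 1" if ab: "min (\<tau> x) (\<tau> p) \<le> a" "a \<le> b" "b - a \<le> rad p" for a b
  proof -
    have "\<Phi> b - (2 / ell (norm p)) * b \<le> \<Phi> a - (2 / ell (norm p)) * a"
    proof (rule DERIV_nonpos_imp_nonincreasing[OF ab(2), of "\<lambda>t. \<Phi> t - (2 / ell (norm p)) * t"])
      fix t assume "a \<le> t"
      then have t: "t \<ge> min (\<tau> x) (\<tau> p)" using ab by linarith
      have "((\<lambda>t. \<Phi> t - (2 / ell (norm p)) * t) has_real_derivative 1 / g t - (2 / ell (norm p)) * 1) (at t)"
        by (intro DERIV_diff Phi_deriv DERIV_cmult DERIV_ident pos t)
      moreover have "1 / g t \<le> 1 / (ell (norm p) / 2)"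
        using ell2[OF t] g_ge[OF pos(2)[OF t]] ell_p[of p] by (intro divide_left_mono) auto
      ultimately show "\<exists>y. ((\<lambda>t. \<Phi> t - (2 / ell (norm p)) * t) has_real_derivative y) (at t) \<and> y \<le> 0" by fastforce
    qed
    then have "\<Phi> b - \<Phi> a \<le> (2 / ell (norm p)) * (b - a)" unfolding right_diff_distrib by linarith
    also have "\<dots> \<le> (2 / ell (norm p)) * rad p" using ab ell_p[of p] by (intro mult_left_mono) auto
    also have "\<dots> = 1 / 2" using ell_p[of p] by (simp add: rad_def)
    finally show ?thesis by simp
  qed
  have lip: "\<bar>\<tau> x - \<tau> p\<bar> \<le> rad p" using tau_lipschitz[of x p] xp by linarith
  have mono: "\<Phi> a \<le> \<Phi> b" if "min (\<tau> x) (\<tau> p) \<le> a" "a \<le> b" for a b using that by (intro Phi_mono pos)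
  have "\<Phi> (\<tau> x) \<le> \<Phi> (\<tau> p) + 1 \<and> \<Phi> (\<tau> p) \<le> \<Phi> (\<tau> x) + 1"
    using lip Phi1[of "\<tau> x" "\<tau> p"] Phi1[of "\<tau> p" "\<tau> x"] mono[of "\<tau> x" "\<tau> p"] mono[of "\<tau> p" "\<tau> x"] by linarith
  then have e: "exp (\<Phi> (\<tau> x)) \<le> exp (1 + \<Phi> (\<tau> p))" "exp (\<Phi> (\<tau> p)) \<le> exp (1 + \<Phi> (\<tau> x))" by simp_all
  then show "h x \<le> exp 1 * h p" "h p \<le> exp 1 * h x" unfolding exp_add by (simp_all add: h_def hs_def \<tau>_def)
  have "\<bar>g (\<tau> x) - g (\<tau> p)\<bar> \<le> (1 / 4) * \<bar>\<tau> x - \<tau> p\<bar>"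
  proof -
    have "norm (g (\<tau> x) - g (\<tau> p)) \<le> (1 / 4) * norm (\<tau> x - \<tau> p)"
    proof (rule field_differentiable_bound[of "{0<..}"])
      fix t :: real assume t: "t \<in> {0<..}"
      then show "(g has_field_derivative g' t) (at t within {0<..})" using g_deriv[of t] by (auto intro: has_field_derivative_at_within)
      show "norm (g' t) \<le> 1 / 4" using g'_le[of t] t by simp
    qed (use tau_ge(3) in auto)
    then show ?thesis by simp
  qed
  also have "\<dots> \<le> (1 / 4) * rad p" using lip by simp
  finally have "g (\<tau> x) - g (\<tau> p) \<le> (1 / 4) * rad p" by (rule order_trans[OF abs_ge_self])
  then have "g (\<tau> x) \<le> g (\<tau> p) + (1 / 4) * rad p" by (simp only: diff_le_eq add.commute)
  then have 1: "g (\<tau> x) \<le> g (\<tau> p) + ell (norm p) / 16" by (simp add: rad_def)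
  moreover have "ell (norm p) \<le> g (\<tau> p)"
    using ell_mono[of "norm p" "\<tau> p"] tau_ge(1)[of p] g_ge[OF tau_ge(3)[of p]] by simp
  moreover have "a \<le> 2 * c" if "a \<le> c + e / 16" "e \<le> c" "e > 0" for a c e :: real using that by linarith
  ultimately show "g (\<tau> x) \<le> 2 * g (\<tau> p)" using 1 ell_p[of p] by blast
qed

lemma lam_pos: "lam p > 0"
proof -
  have "2 * real d + (real d)\<^sup>2 > 0" using dd(2) by (simp add: add_pos_pos)
  then show ?thesis using ell_p[of p] g_pos[OF tau_ge(3)[of p]] by (simp add: lam_def)
qed

lemma h_pos: "h x > 0" by (simp add: h_def hs_pos)

lemma cell_C2:
  assumes p: "p \<in> J" and x: "x \<noteq> p"
  obtains r gg H C where "r > 0" "subharmonic_C2_ball (\<lambda>y. h y - h p * lam p * prof d (((y - p) \<bullet> (y - p)) / (rad p)\<^sup>2)) gg H x r C"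
proof -
  define r where "r = norm (x - p) / 2"
  have r: "r > 0" using x by (simp add: r_def)
  define c where "c = h p * lam p"
  have c: "c > 0" using h_pos lam_pos by (simp add: c_def)
  define \<rho> where "\<rho> = rad p"
  have \<rho>: "\<rho> > 0" "\<rho>\<^sup>2 > 0" using rad_pos[of p] by (simp_all add: \<rho>_def)
  define q where "q s = - (c * prof d (s / \<rho>\<^sup>2))" for s
  define q1 where "q1 s = - (c * (prof1 d (s / \<rho>\<^sup>2) / \<rho>\<^sup>2))" for s
  define q2 where "q2 s = - (c * (prof2 d (s / \<rho>\<^sup>2) / \<rho>\<^sup>2 / \<rho>\<^sup>2))" for s
  have lin: "((\<lambda>s. s / \<rho>\<^sup>2) has_real_derivative 1 / \<rho>\<^sup>2) (at s)" for s by (rule DERIV_cdivide[OF DERIV_ident])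
  have q: "(q has_real_derivative q1 s) (at s)" if "s > 0" for s
    using DERIV_minus[OF DERIV_cmult[OF DERIV_chain2[OF prof_has_derivative[OF dd(2)] lin, of s], of c]] that \<rho>
    by (simp add: q_def[abs_def] q1_def)
  have q1: "(q1 has_real_derivative q2 s) (at s)" if "s > 0" for s
    using DERIV_minus[OF DERIV_cmult[OF DERIV_cdivide[OF DERIV_chain2[OF prof1_has_derivative lin, of s], of _ "\<rho>\<^sup>2"], of c]] that \<rho>
    by (simp add: q1_def[abs_def] q2_def)
  define S where "S y = (y - p) \<bullet> (y - p)" for y
  have Sp: "S y \<ge> r\<^sup>2" "S y > 0" if "y \<in> ball x r" for y
  proof -
    have "norm (y - p) \<ge> r" using that norm_triangle_ineq2[of "x - p" "x - y"] by (simp add: r_def dist_norm)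
    then have "r\<^sup>2 \<le> (norm (y - p))\<^sup>2" using r by (intro power_mono) auto
    then show "S y \<ge> r\<^sup>2" by (simp add: S_def power2_norm_eq_inner)
    then show "S y > 0" using r by (smt (verit) zero_less_power)
  qed
  have lapq: "4 * q2 s * s + 2 * real d * q1 s = - (c * ((2 * real d + (real d)\<^sup>2) * max 0 (1 - s / \<rho>\<^sup>2) / \<rho>\<^sup>2))" if "s > 0" for s
  proof -
    have "4 * q2 s * s + 2 * real d * q1 s = - (c * ((4 * prof2 d (s / \<rho>\<^sup>2) * (s / \<rho>\<^sup>2) + 2 * real d * prof1 d (s / \<rho>\<^sup>2)) / \<rho>\<^sup>2))"
      by (simp add: q1_def q2_def add_divide_distrib algebra_simps)
    also have "4 * prof2 d (s / \<rho>\<^sup>2) * (s / \<rho>\<^sup>2) + 2 * real d * prof1 d (s / \<rho>\<^sup>2) = (2 * real d + (real d)\<^sup>2) * max 0 (1 - s / \<rho>\<^sup>2)"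
      using that \<rho> by (intro prof_laplacian divide_pos_pos)
    finally show ?thesis .
  qed
  obtain B1 where B1: "\<And>s. 0 \<le> s \<Longrightarrow> s \<le> (norm x + r)\<^sup>2 \<Longrightarrow> \<bar>hs1 s\<bar> \<le> B1" "\<And>s. 0 \<le> s \<Longrightarrow> s \<le> (norm x + r)\<^sup>2 \<Longrightarrow> \<bar>hs2 s\<bar> * s \<le> B1"
    using hs_bounds[of "(norm x + r)\<^sup>2"] by auto
  have yb: "y \<bullet> y \<le> (norm x + r)\<^sup>2" if "y \<in> ball x r" for y
  proof -
    have "norm y \<le> norm x + r" using that norm_triangle_ineq2[of y x] by (simp add: dist_norm norm_minus_commute)
    then have "(norm y)\<^sup>2 \<le> (norm x + r)\<^sup>2" by (intro power_mono) auto
    then show ?thesis by (simp add: power2_norm_eq_inner)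
  qed
  define P where "P = c * (((r\<^sup>2 / \<rho>\<^sup>2) powr (- (real d / 2))) / \<rho>\<^sup>2)"
  define P2 where "P2 = c * ((2 * real d + (real d)\<^sup>2) * 1 / \<rho>\<^sup>2)"
  have P2: "P2 \<ge> 0" using c by (simp add: P2_def)
  have qb: "\<bar>q1 (S y)\<bar> \<le> P" if "y \<in> ball x r" for y
  proof -
    have "\<bar>prof1 d (S y / \<rho>\<^sup>2)\<bar> \<le> (r\<^sup>2 / \<rho>\<^sup>2) powr (- (real d / 2))"
      using Sp[OF that] \<rho> r by (intro abs_prof1_le) (auto simp: divide_right_mono)
    then have "c * (\<bar>prof1 d (S y / \<rho>\<^sup>2)\<bar> / \<rho>\<^sup>2) \<le> P" unfolding P_def using c by (intro mult_left_mono divide_right_mono) auto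
    then show ?thesis using c by (simp add: q1_def abs_mult)
  qed
  \<comment> \<open>The second-derivative term is again estimated through the Laplacian, which is
    bounded.\<close>
  have qb2: "\<bar>q2 (S y)\<bar> * S y \<le> real d * P + P2" if "y \<in> ball x r" for y
  proof -
    note s = Sp[OF that]
    have "q2 (S y) \<le> 0" using prof2_nonneg[of "S y / \<rho>\<^sup>2" d] s \<rho> c by (simp add: q2_def)
    then have "4 * (\<bar>q2 (S y)\<bar> * S y) = - (4 * q2 (S y) * S y)" by simp
    also have "\<dots> = 2 * real d * q1 (S y) + c * ((2 * real d + (real d)\<^sup>2) * max 0 (1 - S y / \<rho>\<^sup>2) / \<rho>\<^sup>2)"
      using lapq[OF s(2)] by simp
    also have "\<dots> \<le> 2 * real d * P + P2"
    proof (rule add_mono)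
      show "2 * real d * q1 (S y) \<le> 2 * real d * P" using qb[OF that] by (intro mult_left_mono) auto
      show "c * ((2 * real d + (real d)\<^sup>2) * max 0 (1 - S y / \<rho>\<^sup>2) / \<rho>\<^sup>2) \<le> P2"
        unfolding P2_def using s \<rho> c by (intro mult_left_mono divide_right_mono) auto
    qed
    finally have "4 * (\<bar>q2 (S y)\<bar> * S y) \<le> 2 * real d * P + P2" .
    moreover have "real d * P \<ge> 0" using c by (simp add: P_def)
    ultimately show ?thesis using P2 by linarith
  qed
  define B where "B = max (max B1 P) (real d * P + P2)"
  have "\<exists>g H C. subharmonic_C2_ball (\<lambda>y. hs (y \<bullet> y) + q ((y - p) \<bullet> (y - p))) g H x r C"
  proof (rule subharmonic_C2_ball_radial_pair[OF dd(1) r])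
    fix y assume y: "y \<in> ball x r"
    show "(hs has_real_derivative hs1 (y \<bullet> y)) (at (y \<bullet> y))" "(hs1 has_real_derivative hs2 (y \<bullet> y)) (at (y \<bullet> y))"
      by (simp_all add: hs_deriv hs1_deriv)
    show "(q has_real_derivative q1 ((y - p) \<bullet> (y - p))) (at ((y - p) \<bullet> (y - p)))"
      "(q1 has_real_derivative q2 ((y - p) \<bullet> (y - p))) (at ((y - p) \<bullet> (y - p)))"
      using q q1 Sp(2)[OF y] by (auto simp: S_def)
    show "\<bar>hs1 (y \<bullet> y)\<bar> \<le> B" using B1(1)[OF _ yb[OF y]] by (simp add: B_def)
    show "\<bar>hs2 (y \<bullet> y)\<bar> * (y \<bullet> y) \<le> B" using B1(2)[OF _ yb[OF y]] by (simp add: B_def)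
    show "\<bar>q1 ((y - p) \<bullet> (y - p))\<bar> \<le> B" using qb[OF y] by (simp add: B_def S_def)
    show "\<bar>q2 ((y - p) \<bullet> (y - p))\<bar> * ((y - p) \<bullet> (y - p)) \<le> B" using qb2[OF y] by (simp add: B_def S_def)
    have "(4 * hs2 (y \<bullet> y) * (y \<bullet> y) + 2 * real d * hs1 (y \<bullet> y)) + (4 * q2 (S y) * S y + 2 * real d * q1 (S y)) \<ge> 0"
    proof (cases "norm (y - p) < \<rho>")
      case False
      then have "\<rho>\<^sup>2 \<le> S y" using \<rho> unfolding S_def power2_norm_eq_inner[symmetric] by (intro power_mono) auto
      then have "4 * q2 (S y) * S y + 2 * real d * q1 (S y) = 0" using lapq[OF Sp(2)[OF y]] \<rho> by simp
      then show ?thesis using hs_laplacian_nonneg[of "y \<bullet> y"] by simp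
    next
      case True
      then have yp: "norm (y - p) \<le> rad p" by (simp add: \<rho>_def)
      \<comment> \<open>The cell stays away from the origin: \<open>rad p \<le> norm p / 2\<close>
        and \<open>norm p \<ge> ell 0\<close> give \<open>norm y \<ge> s0\<close>, the range of
        \<open>hs_laplacian_ge\<close>.\<close>
      have pe: "norm p \<ge> ell 0" by (rule J_far[OF p])
      have "ell (norm p) \<le> ell 0 + norm p / 100" using ell_lip[of 0 "norm p"] by simp
      then have "rad p \<le> norm p / 2" using pe ell_pos[of 0] unfolding rad_def by linarith
      moreover have "norm y \<ge> norm p - rad p" using yp norm_triangle_ineq2[of p "p - y"] by (simp add: norm_minus_commute)
      ultimately have "norm y \<ge> s0" using pe by (simp add: s0_def)
      then have "y \<bullet> y \<ge> s0\<^sup>2" unfolding power2_norm_eq_inner[symmetric] using s0 by (intro power_mono) auto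
      then have 1: "4 * hs2 (y \<bullet> y) * (y \<bullet> y) + 2 * real d * hs1 (y \<bullet> y) \<ge> h y / (4 * (g (\<tau> y))\<^sup>2)"
        using hs_laplacian_ge by (simp add: h_def \<tau>_def)
      note nc = near_center[OF yp]
      have gp: "g (\<tau> p) > 0" "g (\<tau> y) > 0" using g_pos tau_ge(3) by auto
      have "(g (\<tau> y))\<^sup>2 \<le> (2 * g (\<tau> p))\<^sup>2" using nc(3) gp by (intro power_mono) auto
      then have "(h p / exp 1) / (4 * (2 * g (\<tau> p))\<^sup>2) \<le> h y / (4 * (g (\<tau> y))\<^sup>2)"
        using nc(2) gp h_pos[of y] h_pos[of p] by (intro frac_le) (auto simp: divide_le_eq mult.commute)
      moreover have "c * ((2 * real d + (real d)\<^sup>2) * max 0 (1 - S y / \<rho>\<^sup>2) / \<rho>\<^sup>2) \<le> P2"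
        unfolding P2_def using Sp[OF y] \<rho> c by (intro mult_left_mono divide_right_mono) auto
      moreover have "P2 = (h p / exp 1) / (4 * (2 * g (\<tau> p))\<^sup>2)"
      proof -
        have N: "2 * real d + (real d)\<^sup>2 > 0" using dd(2) by (simp add: add_pos_pos)
        define N where "N = 2 * real d + (real d)\<^sup>2"
        show ?thesis
          unfolding P2_def c_def \<rho>_def rad_def lam_def N_def[symmetric]
          using N[folded N_def] ell_p[of p] gp by (simp add: field_simps power2_eq_square)
      qed
      ultimately show ?thesis using 1 lapq[OF Sp(2)[OF y]] by linarith
    qed
    then show "(4 * hs2 (y \<bullet> y) * (y \<bullet> y) + 2 * real d * hs1 (y \<bullet> y))
      + (4 * q2 ((y - p) \<bullet> (y - p)) * ((y - p) \<bullet> (y - p)) + 2 * real d * q1 ((y - p) \<bullet> (y - p))) \<ge> 0" by (simp add: S_def)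
  qed
  then obtain gg H C where "subharmonic_C2_ball (\<lambda>y. hs (y \<bullet> y) + q ((y - p) \<bullet> (y - p))) gg H x r C" by blast
  then have "subharmonic_C2_ball (\<lambda>y. h y - h p * lam p * prof d (((y - p) \<bullet> (y - p)) / (rad p)\<^sup>2)) gg H x r C"
    by (simp add: h_def q_def c_def \<rho>_def)
  then show ?thesis using that r by blast
qed

text \<open>Two cells enlarged by \<open>ell 0 / 8\<close> that nearly touch would put their centres
  within 7/8 of the separation. The margin makes the choice of the cell in \<open>u\<close> locally
  constant.\<close>

lemma cell_unique:
  assumes "p \<in> J" "q \<in> J" "dist y p < rad p + ell 0 / 8" "dist z q < rad q + ell 0 / 8" "dist y z < ell 0 / 8"
  shows "p = q"
proof (rule ccontr)
  assume "p \<noteq> q"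
  then have sep: "dist p q \<ge> max (ell (norm p)) (ell (norm q))" using J_sep assms by blast
  have "dist p q \<le> dist y p + dist y z + dist z q"
    using dist_triangle[of p q y] dist_triangle[of y q z] by (simp add: dist_commute)
  then have "dist p q < rad p + rad q + 3 * (ell 0 / 8)" using assms by linarith
  moreover have "ell 0 \<le> ell (norm p)" "ell (norm p) > 0" using ell_mono[of 0 "norm p"] ell_p[of p] by simp_all
  moreover have "ell (norm p) \<le> dist p q" "ell (norm q) \<le> dist p q" using sep by simp_all
  ultimately show False unfolding rad_def by linarith
qed

text \<open>In the margin beyond \<open>rad p\<close> the kernel has already vanished, so
  \<open>cell_fun p\<close> agrees with the cube of \<open>h\<close> there and one formula describes
  \<open>u\<close> on a neighbourhood of the closed cell.\<close>

lemma u_cell: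
  assumes p: "p \<in> J" and y: "dist y p < rad p + ell 0 / 8"
  shows "u y = cell_fun p y"
proof (cases "dist y p < rad p")
  case True
  have "(THE p. p \<in> J \<and> dist y p < rad p) = p"
  proof (rule the_equality)
    fix q assume q: "q \<in> J \<and> dist y q < rad q"
    show "q = p" by (rule cell_unique[of q p y y]) (use q p True ell_pos[of 0] in auto)
  qed (use p True in blast)
  moreover have "\<exists>p\<in>J. dist y p < rad p" using True p by blast
  ultimately show ?thesis by (simp only: u_def if_True)
next
  case False
  have no: "\<not> (\<exists>q\<in>J. dist y q < rad q)"
  proof
    assume "\<exists>q\<in>J. dist y q < rad q"
    then obtain q where q: "q \<in> J" "dist y q < rad q" by blast
    have "p = q" by (rule cell_unique[of p q y y]) (use q p y ell_pos[of 0] in auto)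
    then show False using q False by simp
  qed
  have "(rad p)\<^sup>2 \<le> (norm (y - p))\<^sup>2" using False rad_pos[of p] by (intro power_mono) (auto simp: dist_norm)
  then have "prof d (((y - p) \<bullet> (y - p)) / (rad p)\<^sup>2) = 0" using rad_pos[of p] by (simp add: prof_def power2_norm_eq_inner)
  moreover have "y \<noteq> p" using False rad_pos[of p] by auto
  ultimately show ?thesis using no h_pos[of y] by (simp add: u_def cell_fun_def max_def)
qed

lemma u_far:
  assumes "\<And>p. p \<in> J \<Longrightarrow> dist y p \<ge> rad p" shows "u y = (h y) ^ 3"
  using assms by (auto simp: u_def not_less[symmetric])

lemma u_bounds: "0 \<le> u y" "u y \<le> (h y) ^ 3"
proof -
  have "0 \<le> u y \<and> u y \<le> (h y) ^ 3"
  proof (cases "\<exists>p\<in>J. dist y p < rad p")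
    case True
    then obtain p where p: "p \<in> J" "dist y p < rad p" by blast
    then have uy: "u y = cell_fun p y" using ell_pos[of 0] by (intro u_cell) auto
    show ?thesis
    proof (cases "y = p")
      case False
      then have "((y - p) \<bullet> (y - p)) / (rad p)\<^sup>2 > 0" using rad_pos[of p] by simp
      then have "prof d (((y - p) \<bullet> (y - p)) / (rad p)\<^sup>2) \<ge> 0" by (intro prof_nonneg dd)
      then have "h y - h p * lam p * prof d (((y - p) \<bullet> (y - p)) / (rad p)\<^sup>2) \<le> h y"
        using h_pos[of p] lam_pos[of p] by simp
      then have "max (h y - h p * lam p * prof d (((y - p) \<bullet> (y - p)) / (rad p)\<^sup>2)) 0 \<le> h y" using h_pos[of y] by simp
      then show ?thesis unfolding uy cell_fun_def using False by (simp add: power_mono)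
    qed (use h_pos[of y] uy in \<open>simp add: cell_fun_def\<close>)
  next
    case False
    then show ?thesis using u_far[of y] h_pos[of y] by (force simp: not_less)
  qed
  then show "0 \<le> u y" "u y \<le> (h y) ^ 3" by auto
qed

text \<open>On a cell \<open>h\<close> exceeds its central value at most by the factor
  \<open>exp 1\<close>, so where \<open>lam p\<close> times the kernel reaches \<open>exp 1\<close>
  the positive part is zero.\<close>

lemma hole:
  assumes p: "p \<in> J" and \<delta>: "0 < \<delta>" "\<delta> \<le> 1 / 8" and big: "lam p * prof d (16 * \<delta>\<^sup>2) \<ge> exp 1"
    and y: "y \<in> cball p (\<delta> * ell (norm p))"
  shows "u y = 0"
proof -
  have n: "norm (y - p) \<le> \<delta> * ell (norm p)" using y by (simp add: dist_norm norm_minus_commute)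
  also have le: "\<delta> * ell (norm p) \<le> (1 / 8) * ell (norm p)" using \<delta> ell_p[of p] by (intro mult_right_mono) auto
  finally have nr: "norm (y - p) \<le> rad p" using ell_p[of p] by (simp add: rad_def)
  have uy: "u y = cell_fun p y" using p nr ell_pos[of 0] by (intro u_cell) (auto simp: dist_norm)
  show ?thesis
  proof (cases "y = p")
    case False
    have "(norm (y - p))\<^sup>2 \<le> (\<delta> * ell (norm p))\<^sup>2" using n by (intro power_mono) auto
    then have "((y - p) \<bullet> (y - p)) / (rad p)\<^sup>2 \<le> 16 * \<delta>\<^sup>2"
      using ell_p[of p] by (simp add: rad_def power2_norm_eq_inner power_divide power_mult_distrib divide_le_eq)
    moreover have "((y - p) \<bullet> (y - p)) / (rad p)\<^sup>2 > 0" using False rad_pos[of p] by simp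
    ultimately have "prof d (16 * \<delta>\<^sup>2) \<le> prof d (((y - p) \<bullet> (y - p)) / (rad p)\<^sup>2)" by (intro prof_antimono dd)
    then have "exp 1 \<le> lam p * prof d (((y - p) \<bullet> (y - p)) / (rad p)\<^sup>2)"
      using big lam_pos[of p] by (meson less_imp_le mult_left_mono order_trans)
    then have "h p * exp 1 \<le> h p * (lam p * prof d (((y - p) \<bullet> (y - p)) / (rad p)\<^sup>2))"
      using h_pos[of p] by (intro mult_left_mono) auto
    then have "h y - h p * lam p * prof d (((y - p) \<bullet> (y - p)) / (rad p)\<^sup>2) \<le> 0"
      using near_center(1)[OF nr] by (simp add: mult.assoc mult.commute[of "exp 1"])
    then show ?thesis unfolding uy cell_fun_def using False by simp
  next
    case True
    then show ?thesis using uy by (simp add: cell_fun_def)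
  qed
qed

lemma u_local_C2: "\<exists>r>0. \<exists>g H C. subharmonic_C2_ball u g H x r C"
\<comment> \<open>Half of the margin of \<open>u_cell\<close>: a ball of radius
  \<open>ell 0 / 16\<close> about \<open>x\<close> stays inside the enlarged cell or misses all
  cells.\<close>
proof (cases "\<exists>p\<in>J. dist x p < rad p + ell 0 / 16")
  case True
  then obtain p where p: "p \<in> J" "dist x p < rad p + ell 0 / 16" by blast
  have near: "dist y p < rad p + ell 0 / 8" if "y \<in> ball x (ell 0 / 16)" for y
    using that p(2) dist_triangle[of y p x] by (simp add: dist_commute)
  have E: "ell 0 > 0" using ell_pos[of 0] by simp
  show ?thesis
  proof (cases "x = p")
    case True
    \<comment> \<open>The kernel is unbounded at its pole, so however small \<open>lam p\<close> is,
      \<open>u\<close> vanishes on some ball about \<open>p\<close>.\<close>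
    obtain \<delta> where \<delta>: "\<delta> > 0" "\<delta> \<le> 1 / 8" "prof d (16 * \<delta>\<^sup>2) \<ge> exp 1 / lam p" using prof_at_0[OF dd(2)] by blast
    then have big: "lam p * prof d (16 * \<delta>\<^sup>2) \<ge> exp 1" using lam_pos[of p] by (simp add: divide_le_eq mult.commute)
    define r where "r = \<delta> * ell (norm p)"
    have r: "r > 0" using \<delta> ell_p[of p] by (simp add: r_def)
    have "subharmonic_C2_ball (\<lambda>_. 0) (\<lambda>_. 0) (\<lambda>_ _. 0) x r 0" by unfold_locales (use r in auto)
    from this have "subharmonic_C2_ball u (\<lambda>_. 0) (\<lambda>_ _. 0) x r 0"
    proof (rule subharmonic_C2_ball_cong)
      fix y assume "y \<in> ball x r"
      then have "y \<in> cball p (\<delta> * ell (norm p))" using True by (auto simp: r_def)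
      then show "0 = u y" using hole[OF p(1) \<delta>(1,2) big] by simp
    qed (use r in auto)
    then show ?thesis using r by blast
  next
    case False
    obtain r g H C where r: "r > 0" "subharmonic_C2_ball (\<lambda>y. h y - h p * lam p * prof d (((y - p) \<bullet> (y - p)) / (rad p)\<^sup>2)) g H x r C"
      by (rule cell_C2[OF p(1) False])
    from subharmonic_C2_ball_cube[OF r(2)] obtain g H C where
      C: "subharmonic_C2_ball (\<lambda>y. (max (h y - h p * lam p * prof d (((y - p) \<bullet> (y - p)) / (rad p)\<^sup>2)) 0) ^ 3) g H x r C" by blast
    \<comment> \<open>The ball avoids the pole, where \<open>cell_fun\<close> has its own clause,
      and stays in the region where \<open>u\<close> is \<open>cell_fun p\<close>.\<close>
    define r2 where "r2 = min (min r (ell 0 / 16)) (dist x p)"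
    have r2: "0 < r2" "r2 \<le> r" using r E False by (auto simp: r2_def)
    have "subharmonic_C2_ball u g H x r2 C"
    proof (rule subharmonic_C2_ball_cong[OF C r2])
      fix y assume y: "y \<in> ball x r2"
      then have "y \<noteq> p" by (auto simp: r2_def)
      moreover have "u y = cell_fun p y" using y by (intro u_cell p near) (auto simp: r2_def)
      ultimately show "(max (h y - h p * lam p * prof d (((y - p) \<bullet> (y - p)) / (rad p)\<^sup>2)) 0) ^ 3 = u y" by (simp add: cell_fun_def)
    qed
    then show ?thesis using r2 by blast
  qed
next
  case False
  have E: "ell 0 > 0" using ell_pos[of 0] by simp
  obtain B1 where B1: "\<And>s. 0 \<le> s \<Longrightarrow> s \<le> (norm x + 1)\<^sup>2 \<Longrightarrow> \<bar>hs1 s\<bar> \<le> B1" "\<And>s. 0 \<le> s \<Longrightarrow> s \<le> (norm x + 1)\<^sup>2 \<Longrightarrow> \<bar>hs2 s\<bar> * s \<le> B1"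
    using hs_bounds[of "(norm x + 1)\<^sup>2"] by auto
  have yb: "y \<bullet> y \<le> (norm x + 1)\<^sup>2" if "y \<in> ball x 1" for y
  proof -
    have "norm y \<le> norm x + 1" using that norm_triangle_ineq2[of y x] by (simp add: dist_norm norm_minus_commute)
    then have "(norm y)\<^sup>2 \<le> (norm x + 1)\<^sup>2" by (intro power_mono) auto
    then show ?thesis by (simp add: power2_norm_eq_inner)
  qed
  have B0: "B1 \<ge> 0" using B1(1)[of 0] by (auto intro: order_trans[OF abs_ge_zero])
  have "\<exists>g H C. subharmonic_C2_ball (\<lambda>y. hs (y \<bullet> y) + (\<lambda>_. 0) ((y - 0) \<bullet> (y - 0))) g H x 1 C"
    by (rule subharmonic_C2_ball_radial_pair[OF dd(1), where q = "\<lambda>_. 0" and ?q1.0 = "\<lambda>_. 0" and ?q2.0 = "\<lambda>_. 0" and B = B1 and ?p1.0 = hs1 and ?p2.0 = hs2])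
       (use hs_deriv hs1_deriv B0 B1 yb hs_laplacian_nonneg in auto)
  then obtain g H C where "subharmonic_C2_ball h g H x 1 C" by (auto simp: h_def[abs_def])
  from subharmonic_C2_ball_cube[OF this] obtain g H C where
    C: "subharmonic_C2_ball (\<lambda>y. (max (h y) 0) ^ 3) g H x 1 C" by blast
  define r2 where "r2 = min 1 (ell 0 / 16)"
  have "subharmonic_C2_ball u g H x r2 C"
  proof (rule subharmonic_C2_ball_cong[OF C])
    fix y assume y: "y \<in> ball x r2"
    have "dist y p \<ge> rad p" if "p \<in> J" for p
    proof -
      have "dist x p \<ge> rad p + ell 0 / 16" using False that by (auto simp: not_less)
      then show ?thesis using y dist_triangle[of x p y] by (simp add: r2_def dist_commute)
    qed
    then show "(max (h y) 0) ^ 3 = u y" using u_far[of y] h_pos[of y] by simp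
  qed (use E in \<open>auto simp: r2_def\<close>)
  then show ?thesis using E by (intro exI[of _ r2]) (auto simp: r2_def)
qed

lemma u_subharmonic: "subharmonic (\<lambda>x. ereal (u x))"
  by (rule subharmonic_local_C2) (rule u_local_C2)

lemma u_continuous: "continuous_on UNIV u"
  unfolding continuous_on_eq_continuous_within
proof
  fix x
  obtain r g H C where "r > 0" "subharmonic_C2_ball u g H x r C" using u_local_C2[of x] by blast
  then show "isCont u x" using subharmonic_C2_ball.grad[of u g H x r C x] has_derivative_continuous by auto
qed

lemma closed_zero_set_u: "closed (zero_set (\<lambda>x. ereal (u x)))"
proof -
  have "zero_set (\<lambda>x. ereal (u x)) = u -` {..0}" by (auto simp: zero_set_def)
  then show ?thesis using continuous_closed_vimage[of "{..0}" u] u_continuous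
    by (simp add: continuous_on_eq_continuous_at)
qed

lemma u_0: "u 0 \<ge> 1"
proof -
  have "dist 0 p \<ge> rad p" if p: "p \<in> J" for p
  proof -
    have "ell (norm p) \<le> ell 0 + norm p / 100" using ell_lip[of 0 "norm p"] by simp
    then show ?thesis using J_far[OF p] ell_pos[of 0] unfolding rad_def by simp
  qed
  then have "u 0 = (h 0) ^ 3" by (rule u_far)
  moreover have "h 0 \<ge> 1"
  proof -
    have "0 \<le> integral {s0 / 2..s0} (\<lambda>t. 1 / g t)"
      using s0 g_pos by (intro integral_nonneg inv_g_integrable) (auto simp: less_imp_le)
    then show ?thesis using s0 by (simp add: h_def hs_def \<Phi>_def)
  qed
  ultimately show ?thesis by (simp add: one_le_power)
qed

lemma u_growth:
  assumes "norm x \<le> \<rho>" shows "u x \<le> exp (3 * \<Phi> (\<rho> + s0))"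
proof -
  have "\<tau> x \<le> \<rho> + s0" using tau_ge(4)[of x] assms by linarith
  moreover have "\<tau> x > s0 / 2" using tau_ge(2)[of x] s0 by linarith
  ultimately have "h x \<le> exp (\<Phi> (\<rho> + s0))" by (simp add: h_def hs_def \<tau>_def Phi_mono)
  then have "(h x) ^ 3 \<le> (exp (\<Phi> (\<rho> + s0))) ^ 3" using h_pos[of x] by (intro power_mono) auto
  also have "\<dots> = exp (3 * \<Phi> (\<rho> + s0))" by (simp add: exp_of_nat_mult[symmetric])
  finally show ?thesis using u_bounds(2)[of x] by linarith
qed

text \<open>Maximality bounds the distance by the larger mesh, and the slow variation of
  \<open>ell\<close> converts this to the mesh at \<open>y\<close>. Points with norm below
  \<open>ell 0\<close>, where the net has none, are first moved out to the sphere of radius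
  \<open>ell 0\<close>.\<close>

lemma coverage: "\<exists>p\<in>J. dist y p \<le> 4 * ell (norm y)"
proof -
  have main: "\<exists>p\<in>J. dist y p \<le> 2 * ell (norm y)" if y: "norm y \<ge> ell 0" for y
  proof (cases "y \<in> J")
    case True then show ?thesis using ell_p[of y] by (intro bexI[of _ y]) auto
  next
    case False
    then obtain p where p: "p \<in> J" "dist y p < max (ell (norm y)) (ell (norm p))" using J_max[OF y] by blast
    have "ell (norm p) \<le> ell (norm y) + dist y p / 100"
    proof (cases "norm y \<le> norm p")
      case True
      have "norm p - norm y \<le> dist y p" using norm_triangle_ineq2[of p y] by (simp add: dist_norm norm_minus_commute)
      then have "(norm p - norm y) / 100 \<le> dist y p / 100" by (rule divide_right_mono) simp
      then show ?thesis using ell_lip[OF norm_ge_zero True] by linarith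
    next
      case False
      then have "ell (norm p) \<le> ell (norm y)" by (intro ell_mono) auto
      then show ?thesis by (simp add: add_increasing2)
    qed
    then have "dist y p \<le> 2 * ell (norm y)" using p(2) ell_p[of y] by linarith
    then show ?thesis using p(1) by blast
  qed
  show ?thesis
  proof (cases "norm y \<ge> ell 0")
    case True
    then obtain p where "p \<in> J" "dist y p \<le> 2 * ell (norm y)" using main by blast
    then show ?thesis using ell_p[of y] by (intro bexI[of _ p]) auto
  next
    case False
    have E: "ell 0 > 0" using ell_pos[of 0] by simp
    obtain i :: 'a where i: "i \<in> Basis" using nonempty_Basis by blast
    define y' where "y' = (if y = 0 then ell 0 *\<^sub>R i else (ell 0 / norm y) *\<^sub>R y)"
    have ny': "norm y' = ell 0" using E i by (simp add: y'_def)
    have dy': "dist y y' \<le> ell 0"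
    proof (cases "y = 0")
      case True then show ?thesis using ny' by simp
    next
      case False
      then have "y' - y = (ell 0 / norm y - 1) *\<^sub>R y" by (simp add: y'_def scaleR_diff_left)
      then have "dist y y' = \<bar>ell 0 / norm y - 1\<bar> * norm y" by (metis dist_commute dist_norm norm_scaleR)
      also have "\<dots> = \<bar>(ell 0 / norm y - 1) * norm y\<bar>" by (simp add: abs_mult)
      also have "(ell 0 / norm y - 1) * norm y = ell 0 - norm y" using False by (simp add: algebra_simps)
      finally show ?thesis using \<open>\<not> ell 0 \<le> norm y\<close> norm_ge_zero[of y] by linarith
    qed
    obtain p where p: "p \<in> J" "dist y' p \<le> 2 * ell (norm y')" using main[of y'] ny' by auto
    have "ell (norm y') \<le> ell (norm y) + (norm y' - norm y) / 100" using False ny' by (intro ell_lip) auto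
    moreover have "ell 0 \<le> ell (norm y)" using ell_mono[of 0 "norm y"] by simp
    ultimately have "dist y p \<le> 4 * ell (norm y)" using p(2) dy' dist_triangle[of y p y'] ny' norm_ge_zero[of y] ell_p[of y]
      unfolding diff_divide_distrib by linarith
    then show ?thesis using p(1) by blast
  qed
qed

end

section \<open>Upper growth bound\<close>

lemma separated_bounded_finite:
  fixes S :: "'a::euclidean_space set"
  assumes R: "R > 0" and S: "S \<subseteq> cball y a" and sep: "\<And>p q. p \<in> S \<Longrightarrow> q \<in> S \<Longrightarrow> p \<noteq> q \<Longrightarrow> dist p q \<ge> R"
  shows "finite S"
proof (rule ccontr)
  assume inf: "infinite S"
  then have a: "a \<ge> 0" using S by (metis cball_eq_empty finite.emptyI not_le subset_empty)
  obtain N :: nat where N: "(a + R / 2) ^ DIM('a) / (R / 2) ^ DIM('a) < real N" using reals_Archimedean2 by blast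
  obtain T where T: "finite T" "card T = N" "T \<subseteq> S" using infinite_arbitrarily_large[OF inf] by blast
  have "real (card T) * (R / 2) ^ DIM('a) \<le> (a + R / 2) ^ DIM('a)"
  proof (rule packing_bound[OF T(1) R a])
    show "T \<subseteq> cball y a" using T(3) S by blast
    show "dist p q \<ge> R" if "p \<in> T" "q \<in> T" "p \<noteq> q" for p q using that T(3) sep by blast
  qed
  then have "real N \<le> (a + R / 2) ^ DIM('a) / (R / 2) ^ DIM('a)" using R T by (simp add: pos_le_divide_eq)
  then show False using N by simp
qed

text \<open>First-fit choice over a finite set. It makes the assignment of points to net points
  Borel, and with it the map handed to \<open>near_full_capacity\<close>.\<close>

lemma measurable_selector:
  fixes C :: "'a::euclidean_space \<Rightarrow> 'a set"
  assumes "finite S" "\<And>p. p \<in> S \<Longrightarrow> C p \<in> sets borel"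
  shows "\<exists>c \<in> borel_measurable borel. \<forall>z\<in>(\<Union>p\<in>S. C p). c z \<in> S \<and> z \<in> C (c z)"
  using assms
proof (induction S)
  case empty
  show ?case by (intro bexI[of _ "\<lambda>_. 0"]) auto
next
  case (insert a S)
  then obtain c where c[measurable]: "c \<in> borel_measurable borel" and cS: "\<forall>z\<in>(\<Union>p\<in>S. C p). c z \<in> S \<and> z \<in> C (c z)" by auto
  have [measurable]: "C a \<in> sets borel" using insert by simp
  have "(\<lambda>z. if z \<in> C a then a else c z) \<in> borel_measurable borel" by measurable
  moreover have "\<forall>z\<in>(\<Union>p\<in>insert a S. C p). (if z \<in> C a then a else c z) \<in> insert a S \<and> z \<in> C (if z \<in> C a then a else c z)"
    using cS by auto
  ultimately show ?case by (intro bexI[of _ "\<lambda>z. if z \<in> C a then a else c z"]) simp_all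
qed

text \<open>At relative radius \<open>4 * N * e\<close> the kernel is still of order
  \<open>kr d e\<close>: rescaling and truncation change it by bounded terms and a factor, and the
  bounded terms are absorbed once \<open>kr d e\<close> is large.\<close>

lemma prof_small_radius:
  assumes d: "d \<ge> 2" and N: "N \<ge> 1"
  obtains c B where "c > 0" "\<And>e. e > 0 \<Longrightarrow> kr d e \<ge> B \<Longrightarrow> N * e \<le> 1 / 8 \<and> prof d (16 * (N * e)\<^sup>2) \<ge> c * kr d e"
proof -
  define L where "L = 1 / (4 * N)"
  have L: "L > 0" using N by (simp add: L_def)
  define a where "a = ckap d * scB d L"
  have a: "a > 0" using ckap_pos[OF d] scB_pos[OF L, of d] by (simp add: a_def)
  define K where "K = a * \<bar>scA d L\<bar> + \<bar>kap d 1\<bar> + 1 + real d / 2"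
  define B where "B = max (2 * K / a) (kr d (1 / (64 * N)))"
  have "N * e \<le> 1 / 8 \<and> prof d (16 * (N * e)\<^sup>2) \<ge> (a / 2) * kr d e" if e: "e > 0" "kr d e \<ge> B" for e
  proof -
    have "e \<le> 1 / (64 * N)"
    proof (rule ccontr)
      assume "\<not> ?thesis"
      then have "kr d e < kr d (1 / (64 * N))" using N by (intro kr_strict_antimono d) auto
      then show False using e(2) by (simp add: B_def)
    qed
    then have Ne: "N * e \<le> 1 / 64" using N by (simp add: field_simps)
    have t: "0 < 4 * (N * e)" "4 * (N * e) < 1" using Ne e N by auto
    have "(4 * (N * e))\<^sup>2 < 1\<^sup>2" using t by (intro power_strict_mono) auto
    then have "prof d ((4 * (N * e))\<^sup>2) \<ge> kap d ((4 * (N * e))\<^sup>2) - kap d 1 - (1 + real d / 2)"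
      using t e N by (intro prof_ge_kap) auto
    also have "kap d ((4 * (N * e))\<^sup>2) = ckap d * kr d (e / L)" using kap_power2[OF d t(1)] N by (simp add: L_def mult_ac)
    also have "kr d (e / L) = scB d L * (scA d L + kr d e)" by (rule kr_scale[OF L e(1)])
    also have "ckap d * (scB d L * (scA d L + kr d e)) = a * scA d L + a * kr d e" by (simp add: a_def algebra_simps)
    finally have 1: "a * scA d L + a * kr d e - kap d 1 - (1 + real d / 2) \<le> prof d (16 * (N * e)\<^sup>2)"
      by (simp add: power_mult_distrib)
    have "- (a * \<bar>scA d L\<bar>) \<le> a * scA d L" using a by (simp add: abs_if)
    then have 2: "a * kr d e - K \<le> prof d (16 * (N * e)\<^sup>2)" using 1 unfolding K_def by linarith
    have "2 * K / a \<le> kr d e" using e(2) by (simp add: B_def)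
    then have "2 * K \<le> a * kr d e" using a by (simp add: divide_le_eq mult.commute)
    then have "(a / 2) * kr d e \<le> prof d (16 * (N * e)\<^sup>2)" using 2 by linarith
    then show ?thesis using Ne by simp
  qed
  then show ?thesis using that[of "a / 2" B] a by auto
qed

context recurrence_rate
begin

text \<open>Both \<open>s\<close> and \<open>t\<close> are convex combinations of 0 and
  \<open>t + s\<close>, with complementary weights; the two concavity inequalities are
  added.\<close>

lemma R_increment:
  assumes "s \<ge> 0" "t \<ge> 0" shows "R (t + s) - R t \<le> R s - R 0"
proof (cases "t + s = 0")
  case True
  then have "t = 0" "s = 0" using assms by auto
  then show ?thesis by simp
next
  case False
  then have ts: "t + s > 0" using assms by simp
  define k where "k = t / (t + s)"
  have k: "0 \<le> k" "k \<le> 1" "k * (t + s) = t" "(1 - k) * (t + s) = s" using ts assms by (auto simp: k_def field_simps)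
  have "(1 - k) * R 0 + k * R (t + s) \<le> R ((1 - k) *\<^sub>R 0 + k *\<^sub>R (t + s))"
    by (rule concave_onD[OF R_concave]) (use k ts in auto)
  moreover have "(1 - (1 - k)) * R 0 + (1 - k) * R (t + s) \<le> R ((1 - (1 - k)) *\<^sub>R 0 + (1 - k) *\<^sub>R (t + s))"
    by (rule concave_onD[OF R_concave]) (use k ts in auto)
  ultimately have "(1 - k) * R 0 + k * R (t + s) \<le> R t" "k * R 0 + (1 - k) * R (t + s) \<le> R s" using k by simp_all
  then have "((1 - k) * R 0 + k * R (t + s)) + (k * R 0 + (1 - k) * R (t + s)) \<le> R t + R s" by (rule add_mono)
  then show ?thesis by (simp add: algebra_simps)
qed

lemma R_continuous: "continuous_on {0<..} R"
proof -
  have "convex_on {0..} (\<lambda>t. - R t)" using R_concave by (simp add: concave_on_def)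
  then have "convex_on {0<..} (\<lambda>t. - R t)" by (rule convex_on_subset) auto
  then have "continuous_on {0<..} (\<lambda>t. - R t)" by (intro convex_on_continuous) auto
  from continuous_on_minus[OF this] show ?thesis by simp
qed

text \<open>Averaging over \<open>[t + 1, t + 2]\<close> replaces \<open>R\<close> by a comparable \<open>C\<^sup>1\<close> function; near \<open>0\<close> the
  slope of \<open>R\<close> may be unbounded.\<close>

lemma smooth_scale:
  obtains L L' :: "real \<Rightarrow> real" and \<kappa> where "0 < \<kappa>" "\<kappa> \<le> 1" "\<And>t. t \<ge> 0 \<Longrightarrow> (L has_real_derivative L' t) (at t)"
    "\<And>t. t \<ge> 0 \<Longrightarrow> 0 \<le> L' t \<and> L' t \<le> 1" "\<And>t. t \<ge> 0 \<Longrightarrow> \<kappa> * R t \<le> L t" "\<And>t. t \<ge> 0 \<Longrightarrow> L t \<le> R t"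
proof -
  define F where "F t = integral {1/2..t} R" for t
  \<comment> \<open>Two demands: \<open>\<kappa> * R 2 \<le> 1\<close> bounds the derivative of
    \<open>L\<close>, and \<open>\<kappa> * R 2 \<le> R 0\<close> keeps \<open>L\<close> below
    \<open>R\<close> although averaging looks ahead by up to 2.\<close>
  define \<kappa> where "\<kappa> = min (R 0) 1 / R 2"
  have R0: "R 0 > 0" "R 2 > 0" "R 0 \<le> R 2" using R_pos R_mono[of 0 2] by auto
  have \<kappa>: "0 < \<kappa>" "\<kappa> \<le> 1" "\<kappa> * R 2 \<le> R 0" "\<kappa> * R 2 \<le> 1"
    using R0 by (auto simp: \<kappa>_def divide_le_eq)
  have F: "(F has_real_derivative R t) (at t)" if "t > 1/2" for t
  proof -
    have "((\<lambda>u. integral {1/2..u} R) has_vector_derivative R t) (at t within {1/2..t + 1})"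
      by (rule integral_has_vector_derivative) (use that in \<open>auto intro: continuous_on_subset[OF R_continuous]\<close>)
    moreover have "at t within {1/2..t + 1} = at t" using that by (intro at_within_interior) auto
    ultimately show ?thesis by (simp add: F_def[abs_def] has_real_derivative_iff_has_vector_derivative)
  qed
  define L where "L t = \<kappa> * (F (t + 2) - F (t + 1))" for t
  define L' where "L' t = \<kappa> * (R (t + 2) - R (t + 1))" for t
  have L: "(L has_real_derivative L' t) (at t)" if t: "t \<ge> 0" for t
  proof -
    have "((\<lambda>t. F (t + a)) has_real_derivative R (t + a) * 1) (at t)" if "a \<ge> 1" for a
      by (rule DERIV_chain2[OF F]) (use t that in \<open>auto intro!: derivative_eq_intros\<close>)
    from DERIV_cmult[OF DERIV_diff[OF this[of 2] this[of 1]], of \<kappa>] show ?thesis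
      by (simp add: L_def[abs_def] L'_def)
  qed
  have mv: "\<exists>z. t + 1 < z \<and> z < t + 2 \<and> F (t + 2) - F (t + 1) = R z" if t: "t \<ge> 0" for t
  proof -
    have "\<exists>z>t + 1. z < t + 2 \<and> F (t + 2) - F (t + 1) = (t + 2 - (t + 1)) * R z"
      by (rule MVT2) (use t F in auto)
    then show ?thesis by auto
  qed
  show ?thesis
  proof (rule that[OF \<kappa>(1,2) L])
    fix t :: real assume t: "t \<ge> 0"
    have "R (t + 2) - R (t + 1) \<le> R 1 - R 0" using R_increment[of 1 "t + 1"] t by (simp add: add_ac)
    also have "\<dots> \<le> R 2" using R_mono[of 1 2] R0 by simp
    finally have "\<kappa> * (R (t + 2) - R (t + 1)) \<le> \<kappa> * R 2" using \<kappa> by (intro mult_left_mono) auto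
    then have "\<kappa> * (R (t + 2) - R (t + 1)) \<le> 1" using \<kappa>(4) by linarith
    then show "0 \<le> L' t \<and> L' t \<le> 1" using \<kappa> R_mono[of "t + 1" "t + 2"] t by (simp add: L'_def)
    obtain z where z: "t + 1 < z" "z < t + 2" "F (t + 2) - F (t + 1) = R z" using mv[OF t] by blast
    have "R t \<le> R z" "R z \<le> R (t + 2)" using z t by (auto intro: R_mono)
    then show "\<kappa> * R t \<le> L t" using \<kappa> z by (simp add: L_def)
    have Rt: "R t \<ge> R 0" using R_mono[of 0 t] t by simp
    have "L t \<le> \<kappa> * R (t + 2)" using \<open>R z \<le> R (t + 2)\<close> \<kappa> z by (simp add: L_def)
    also have "R (t + 2) \<le> R t + (R 2 - R 0)" using R_increment[of 2 t] t by simp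
    then have "\<kappa> * R (t + 2) \<le> \<kappa> * (R t + (R 2 - R 0))" using \<kappa> by (intro mult_left_mono) auto
    also have "\<dots> = \<kappa> * (R t - R 0) + \<kappa> * R 2" by (simp add: algebra_simps)
    also have "\<kappa> * (R t - R 0) \<le> 1 * (R t - R 0)" using \<kappa> Rt by (intro mult_right_mono) auto
    finally show "L t \<le> R t" using \<kappa>(3) by simp
  qed auto
qed

lemma growth_upper_bound:
  fixes C :: real
  assumes dd: "DIM('a::euclidean_space) = d"
    and D: "\<forall>t>0. \<exists>D. ((\<lambda>s. 1 / phi d \<epsilon> R s) has_real_derivative D) (at t) \<and> \<bar>D\<bar> \<le> C"
  shows "\<exists>u :: 'a \<Rightarrow> ereal. subharmonic u \<and> recurrent \<epsilon> R (zero_set u) \<and> u 0 \<ge> 1 \<and>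
              Limsup at_top (\<lambda>\<rho>. ereal (growth_ratio \<epsilon> R u \<rho>)) < \<infinity>"
proof -
  have "\<forall>t>0. \<exists>D. (\<psi> has_real_derivative D) (at t) \<and> \<bar>D\<bar> \<le> C"
  proof (intro allI impI)
    fix t :: real assume t: "t > 0"
    then obtain D where D': "((\<lambda>s. 1 / phi d \<epsilon> R s) has_real_derivative D) (at t)" "\<bar>D\<bar> \<le> C" using D by blast
    have "(\<psi> has_real_derivative D) (at t)"
      by (rule has_field_derivative_transform_within_open[OF D'(1), of "{0<..}"]) (use t in \<open>auto simp: phi_eq\<close>)
    then show "\<exists>D. (\<psi> has_real_derivative D) (at t) \<and> \<bar>D\<bar> \<le> C" using D'(2) by blast
  qed
  then obtain \<psi>' where \<psi>': "\<And>t. t > 0 \<Longrightarrow> (\<psi> has_real_derivative \<psi>' t) (at t)" "\<And>t. t > 0 \<Longrightarrow> \<bar>\<psi>' t\<bar> \<le> C" by metis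
  have C: "C \<ge> 0" using \<psi>'(2)[of 1] by simp
  have \<psi>lip: "\<psi> t \<le> \<psi> s + C * (t - s)" if "0 < s" "s \<le> t" for s t
  proof -
    have "\<psi> t - C * t \<le> \<psi> s - C * s"
    proof (rule DERIV_nonpos_imp_nonincreasing[OF that(2), of "\<lambda>t. \<psi> t - C * t"])
      fix x assume "s \<le> x"
      then have x: "x > 0" using that by simp
      have "((\<lambda>t. \<psi> t - C * t) has_real_derivative \<psi>' x - C * 1) (at x)"
        by (intro DERIV_diff DERIV_cmult DERIV_ident \<psi>' x)
      then show "\<exists>y. ((\<lambda>t. \<psi> t - C * t) has_real_derivative y) (at x) \<and> y \<le> 0" using \<psi>'(2)[OF x] by force
    qed
    then show ?thesis by (simp add: algebra_simps)
  qed
  \<comment> \<open>The derivative bound holds only at positive arguments; the additive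
    \<open>\<psi> 1\<close> covers \<open>t = 0\<close>.\<close>
  have \<psi>inc: "\<psi> (t + s) \<le> \<psi> t + C * s + \<psi> 1" if t: "t \<ge> 0" and s: "s \<ge> 0" for t s
  proof (cases "t > 0")
    case True
    then show ?thesis using \<psi>lip[of t "t + s"] s \<psi>_pos[of 1] by simp
  next
    case False
    then have "t = 0" using t by simp
    moreover have "\<psi> s \<le> C * s + \<psi> 1"
    proof (cases "s \<le> 1")
      case True then show ?thesis using \<psi>_mono[of s 1] s C by (simp add: add_increasing)
    next
      case False
      then have "\<psi> s \<le> \<psi> 1 + C * (s - 1)" by (intro \<psi>lip) auto
      then show ?thesis using C by (simp add: algebra_simps)
    qed
    ultimately show ?thesis using \<psi>_pos[of 0] by simp
  qed
  obtain L L' :: "real \<Rightarrow> real" and \<kappa> where \<kappa>: "0 < \<kappa>" "\<kappa> \<le> 1" and L: "\<And>t. t \<ge> 0 \<Longrightarrow> (L has_real_derivative L' t) (at t)"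
    and L': "\<And>t. t \<ge> 0 \<Longrightarrow> 0 \<le> L' t \<and> L' t \<le> 1" and LR: "\<And>t. t \<ge> 0 \<Longrightarrow> \<kappa> * R t \<le> L t" "\<And>t. t \<ge> 0 \<Longrightarrow> L t \<le> R t"
    using smooth_scale by metis
  \<comment> \<open>Chosen so that \<open>g \<le> 4 * m * ell\<close> forces
    \<open>lam p \<ge> exp 1 / (K1 * m\<^sup>2)\<close>: a kernel value of
    \<open>K1 * m\<^sup>2\<close> then makes a hole.\<close>
  define K1 where "K1 = 4096 * (exp 1)\<^sup>2 * (2 * real d + (real d)\<^sup>2)"
  have dpos: "2 * real d + (real d)\<^sup>2 > 0" using d by (simp add: add_pos_pos)
  have K1: "K1 > 0" using dpos by (simp add: K1_def)
  obtain \<delta>1 where \<delta>1: "\<delta>1 > 0" "\<delta>1 \<le> 1 / 8" "prof d (16 * \<delta>1\<^sup>2) \<ge> K1" using prof_at_0[OF d] by blast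
  \<comment> \<open>Points lie within \<open>5 * ell\<close> of their assigned net point, so
    contraction by \<theta> puts them into its hole of radius
    \<open>\<delta>1 * ell\<close>.\<close>
  define \<theta> where "\<theta> = \<delta>1 / 5"
  have \<theta>: "0 < \<theta>" "\<theta> \<le> 1" "\<theta> \<le> 1 / 40" using \<delta>1 by (auto simp: \<theta>_def)
  \<comment> \<open>The midpoint between \<open>\<epsilon> 0\<close> and 1 exceeds every value of
    \<epsilon> and is still a fraction that nearly full sets attain.\<close>
  define e1 where "e1 = (1 + \<epsilon> 0) / 2"
  have e1: "0 < e1" "e1 < 1" "\<epsilon> 0 < e1" using eps[of 0] by (auto simp: e1_def)
  show ?thesis
  proof (rule near_full_capacity[OF dd d e1(1,2) \<theta>(1,2)])
  fix b \<sigma>0 :: real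
  assume b: "0 < b" "b < 1" and \<sigma>0: "\<sigma>0 > 0"
    and near_full: "\<And>(x::'a) r \<sigma> T K E. r > 0 \<Longrightarrow> \<sigma> \<le> \<sigma>0 \<Longrightarrow> T \<in> borel_measurable borel \<Longrightarrow> compact K \<Longrightarrow> K \<subseteq> ball x r \<inter> E
      \<Longrightarrow> (\<And>z. z \<in> cball x (b * r) \<Longrightarrow> T z \<in> K)
      \<Longrightarrow> (\<And>z w. z \<in> cball x (b * r) \<Longrightarrow> w \<in> cball x (b * r) \<Longrightarrow> norm (T z - T w) \<ge> \<theta> * norm (z - w) \<and> norm (T z - T w) \<ge> norm (z - w) - 16 * \<sigma> * r)
      \<Longrightarrow> e1 * r \<le> capacity (ball x r \<inter> E)"
  \<comment> \<open>The mesh fraction: \<sigma>0 for \<open>near_full_capacity\<close>,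
    \<open>(1 - b) / 16\<close> so that displacements of \<open>8 * \<sigma> * r\<close> stay inside
    the ball, and 1/100 for the slow variation of \<open>ell\<close>.\<close>
  define \<sigma> where "\<sigma> = min (min \<sigma>0 ((1 - b) / 16)) (1 / 100)"
  have \<sigma>: "\<sigma> > 0" "\<sigma> \<le> \<sigma>0" "\<sigma> \<le> (1 - b) / 16" "\<sigma> \<le> 1 / 100"
    unfolding \<sigma>_def using \<sigma>0 b by (simp_all only: min_less_iff_conj min.cobounded2 min.cobounded1 min.coboundedI1) auto
  define ell where "ell t = \<sigma> * L t" for t
  have ellR: "ell t \<le> \<sigma> * R t" "\<sigma> * \<kappa> * R t \<le> ell t" "ell t > 0" if "t \<ge> 0" for t
  proof -
    show "ell t \<le> \<sigma> * R t" "\<sigma> * \<kappa> * R t \<le> ell t" using LR[OF that] \<sigma>(1) by (auto simp: ell_def)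
    moreover have "\<sigma> * \<kappa> * R t > 0" using \<sigma> \<kappa> R_pos[OF that] by simp
    ultimately show "ell t > 0" by linarith
  qed
  have ell_mono: "ell s \<le> ell t" if "0 \<le> s" "s \<le> t" for s t
  proof -
    have "L s \<le> L t"
    proof (rule DERIV_nonneg_imp_nondecreasing[OF that(2)])
      fix x assume "s \<le> x"
      then have "x \<ge> 0" using that by simp
      then show "\<exists>y. (L has_real_derivative y) (at x) \<and> 0 \<le> y" using L L' by blast
    qed
    then show ?thesis using \<sigma> by (simp add: ell_def)
  qed
  have ell_lip\<sigma>: "ell t \<le> ell s + \<sigma> * (t - s)" if "0 \<le> s" "s \<le> t" for s t
  proof -
    have "L t - t \<le> L s - s"
    proof (rule DERIV_nonpos_imp_nonincreasing[OF that(2), of "\<lambda>t. L t - t"])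
      fix x assume "s \<le> x"
      then have x: "x \<ge> 0" using that by simp
      have "((\<lambda>t. L t - t) has_real_derivative L' x - 1) (at x)" by (intro DERIV_diff L x DERIV_ident)
      then show "\<exists>y. ((\<lambda>t. L t - t) has_real_derivative y) (at x) \<and> y \<le> 0" using L'[OF x] by force
    qed
    then have "\<sigma> * (L t - L s) \<le> \<sigma> * (t - s)" using \<sigma> by (intro mult_left_mono) auto
    then show ?thesis by (simp add: ell_def algebra_simps)
  qed
  have ell_lip: "ell t \<le> ell s + (t - s) / 100" if "0 \<le> s" "s \<le> t" for s t
  proof -
    have "\<sigma> * (t - s) \<le> (1 / 100) * (t - s)" using \<sigma> that by (intro mult_right_mono) auto
    then show ?thesis using ell_lip\<sigma>[OF that] by linarith
  qed
  \<comment> \<open>A hole of radius \<open>\<epsilon> * N * ell\<close> must have capacity above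
    \<open>\<epsilon> * r\<close>; halving once for \<open>R (norm p)\<close> and once in
    \<open>ball_capacity\<close> leaves the factor 5/4.\<close>
  define N where "N = 5 / (\<sigma> * \<kappa>)"
  have \<sigma>\<kappa>: "0 < \<sigma> * \<kappa>" "\<sigma> * \<kappa> \<le> 1" using \<sigma> \<kappa> by (auto intro!: mult_le_one)
  have N: "N \<ge> 1" using \<sigma>\<kappa> by (simp add: N_def le_divide_eq)
  obtain cN B00 where cN: "cN > 0" "\<And>e. e > 0 \<Longrightarrow> kr d e \<ge> B00 \<Longrightarrow> N * e \<le> 1 / 8 \<and> prof d (16 * (N * e)\<^sup>2) \<ge> cN * kr d e"
    using prof_small_radius[OF d N] by metis
  \<comment> \<open>Above this threshold \<epsilon> counts as small: \<open>B00\<close> is for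
    \<open>prof_small_radius\<close>, \<open>ke (100 * ell 0)\<close> forces
    \<open>norm x > 100 * ell 0\<close>, and the last value makes one hole of relative size
    \<delta>1 sufficient.\<close>
  define B0 where "B0 = max (max 0 B00) (max (ke (100 * ell 0)) (kr d (\<delta>1 * \<sigma> * \<kappa> / 8)))"
  \<comment> \<open>A bound for \<open>sqrt (ke t)\<close> at all net points near some
    \<open>x\<close> with \<open>ke (norm x) \<le> B0\<close>; it is proved under
    \<open>reg\<close>.\<close>
  define b1 where "b1 = sqrt B0 + 2 * C + \<psi> 1 / R 0"
  have b1: "b1 > 0" "sqrt B0 \<le> b1" using C \<psi>_pos[of 1] R_pos[of 0] by (auto simp: b1_def B0_def intro!: add_nonneg_pos)
  \<comment> \<open>The first bound keeps the slope of \<open>g\<close> within 1/4, the second makes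
    the mesh term dominate \<open>g\<close> in the regime of large \<epsilon>, and the third lets
    the kernel weight produce holes of radius \<open>N * \<epsilon> * ell\<close>.\<close>
  define \<zeta> where "\<zeta> = min (min (1 / (8 * (C + 1))) (1 / (b1 + 1))) (sqrt (cN / K1))"
  have \<zeta>: "\<zeta> > 0" "\<zeta> \<le> 1 / (8 * (C + 1))" "\<zeta> \<le> 1 / (b1 + 1)" "\<zeta> \<le> sqrt (cN / K1)"
    using C b1 cN K1 by (auto simp: \<zeta>_def)
  define c2 where "c2 = \<zeta> * \<sigma> * \<kappa>"
  have c2: "c2 > 0" using \<zeta> \<sigma> \<kappa> by (simp add: c2_def)
  have c2C: "c2 * C \<le> 1 / 8"
  proof -
    have "c2 \<le> \<zeta> * 1" unfolding c2_def mult.assoc using \<zeta> \<sigma>\<kappa> by (intro mult_left_mono) auto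
    then have "c2 \<le> 1 / (8 * (C + 1))" using \<zeta> by simp
    then have "c2 * (C + 1) \<le> 1 / 8" using C by (simp add: field_simps)
    then show ?thesis using c2 by (simp add: algebra_simps)
  qed
  define g where "g t = ell t + c2 * \<psi> t" for t
  define g' where "g' t = \<sigma> * L' t + c2 * \<psi>' t" for t
  obtain J :: "'a set" where J: "J \<subseteq> {y. norm y \<ge> ell 0}"
    "\<And>p q. p \<in> J \<Longrightarrow> q \<in> J \<Longrightarrow> p \<noteq> q \<Longrightarrow> dist p q \<ge> max (ell (norm p)) (ell (norm q))"
    "\<And>y. y \<in> {y. norm y \<ge> ell 0} \<Longrightarrow> y \<in> J \<or> (\<exists>p\<in>J. dist y p < max (ell (norm y)) (ell (norm p)))"
    using maximal_separated_set[of "{y. norm y \<ge> ell 0}" "\<lambda>p. ell (norm p)"] by metis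
  interpret P: perforation ell g g' d J
  proof
    fix t :: real assume t: "t > 0"
    show "(g has_real_derivative g' t) (at t)"
      unfolding g_def[abs_def] g'_def ell_def by (intro DERIV_add DERIV_cmult L \<psi>') (use t in auto)
    have "\<bar>\<sigma> * L' t\<bar> \<le> (1 / 8) * 1"
      unfolding abs_mult using \<sigma> L'[of t] t by (intro mult_mono) auto
    moreover have "\<bar>c2 * \<psi>' t\<bar> \<le> c2 * C" unfolding abs_mult using c2 \<psi>'(2)[OF t] by (intro mult_mono) auto
    ultimately show "\<bar>g' t\<bar> \<le> 1 / 4" using c2C unfolding g'_def by linarith
    show "g t \<ge> ell t" using c2 \<psi>_pos[of t] t by (simp add: g_def)
  qed (use dd d ellR(3) ell_mono ell_lip J in auto)
  let ?u = "\<lambda>x. ereal (P.u x)"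
  define E where "E = zero_set ?u"
  have ell0: "ell 0 > 0" using ellR(3)[of 0] by simp
  have s0: "P.s0 = ell 0 / 2" by (simp add: P.s0_def)
  have ell\<tau>: "ell (P.\<tau> p) \<le> 2 * ell (norm p)" for p
  proof -
    have "ell (P.\<tau> p) \<le> ell (norm p) + (P.\<tau> p - norm p) / 100" by (rule ell_lip) (use P.tau_ge(1) in auto)
    also have "(P.\<tau> p - norm p) / 100 \<le> (ell 0 / 2) / 100" using P.tau_ge(4)[of p] s0 by (intro divide_right_mono) auto
    finally show ?thesis using ell_mono[of 0 "norm p"] ell0 by simp
  qed
  have lam_ge: "P.lam p \<ge> exp 1 / (K1 * m\<^sup>2)" if m: "g (P.\<tau> p) \<le> 4 * m * ell (norm p)" "m > 0" for p m
  proof -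
    have gp: "g (P.\<tau> p) > 0" by (rule P.g_pos[OF P.tau_ge(3)])
    have ep: "ell (norm p) > 0" using ellR(3) by simp
    have "(g (P.\<tau> p))\<^sup>2 \<le> (4 * m * ell (norm p))\<^sup>2" using m(1) gp by (intro power_mono) auto
    then have "(ell (norm p))\<^sup>2 / (256 * exp 1 * (2 * real d + (real d)\<^sup>2) * (4 * m * ell (norm p))\<^sup>2) \<le> P.lam p"
      unfolding P.lam_def using dpos gp ep m(2) by (intro divide_left_mono mult_left_mono mult_pos_pos) auto
    moreover have "(ell (norm p))\<^sup>2 / (256 * exp 1 * (2 * real d + (real d)\<^sup>2) * (4 * m * ell (norm p))\<^sup>2) = exp 1 / (K1 * m\<^sup>2)"
    proof -
      define n where "n = 2 * real d + (real d)\<^sup>2"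
      have "n > 0" using dpos by (simp add: n_def)
      then show ?thesis unfolding K1_def n_def[symmetric] using ep m(2) by (simp add: field_simps power2_eq_square)
    qed
    ultimately show ?thesis by simp
  qed
  have u0: "x \<in> E \<longleftrightarrow> P.u x = 0" for x
    using P.u_bounds(1)[of x] by (auto simp: E_def zero_set_def)
  have hole1: "cball p (\<delta>1 * ell (norm p)) \<subseteq> E" if p: "p \<in> J" and reg: "c2 * \<psi> (P.\<tau> p) \<le> ell (P.\<tau> p)" for p
  proof
    fix y assume y: "y \<in> cball p (\<delta>1 * ell (norm p))"
    have "g (P.\<tau> p) \<le> 4 * 1 * ell (norm p)" using reg ell\<tau>[of p] by (simp add: g_def)
    then have "exp 1 / (K1 * 1\<^sup>2) \<le> P.lam p" by (rule lam_ge) simp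
    then have "exp 1 / K1 * K1 \<le> P.lam p * prof d (16 * \<delta>1\<^sup>2)"
      using \<delta>1(3) K1 by (intro mult_mono) (auto intro: less_imp_le P.lam_pos)
    then have "exp 1 \<le> P.lam p * prof d (16 * \<delta>1\<^sup>2)" using K1 by simp
    then show "y \<in> E" unfolding u0 by (rule P.hole[OF p \<delta>1(1,2) _ y])
  qed
  \<comment> \<open>Here the \<psi> term dominates \<open>g\<close>, so \<open>lam p\<close> is of
    order \<open>1 / ke\<close>, while the kernel at relative radius of order \<epsilon> is of order
    \<open>ke\<close>. The inequality also forces \<open>ke\<close> beyond
    \<open>B00\<close>.\<close>
  have hole2: "\<epsilon> (P.\<tau> p) * N \<le> 1 / 8 \<and> cball p (\<epsilon> (P.\<tau> p) * N * ell (norm p)) \<subseteq> E"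
    if p: "p \<in> J" and reg: "c2 * \<psi> (P.\<tau> p) > ell (P.\<tau> p)" for p
  proof -
    define t where "t = P.\<tau> p"
    have t: "t > 0" using P.tau_ge(3) by (simp add: t_def)
    have k: "ke t > 0" using ke_pos[of t] t by simp
    have Rt: "R t > 0" using R_pos t by simp
    have "\<sigma> * \<kappa> * R t < \<zeta> * \<sigma> * \<kappa> * (R t * sqrt (ke t))"
      using reg ellR(2)[of t] t unfolding t_def[symmetric] c2_def \<psi>_def by simp
    then have "(\<sigma> * \<kappa> * R t) * 1 < (\<sigma> * \<kappa> * R t) * (\<zeta> * sqrt (ke t))" by (simp add: mult_ac)
    then have \<zeta>k: "1 < \<zeta> * sqrt (ke t)" using \<sigma>\<kappa> Rt by (simp only: mult_less_cancel_left_pos mult_pos_pos)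
    have "\<zeta> * sqrt (ke t) \<le> (1 / (b1 + 1)) * sqrt (ke t)" using \<zeta> k by (intro mult_right_mono) auto
    then have "1 < sqrt (ke t) / (b1 + 1)" using \<zeta>k by simp
    then have "b1 + 1 < sqrt (ke t)" using b1 by (simp add: less_divide_eq)
    then have "sqrt B0 < sqrt (ke t)" using b1 by linarith
    then have "B00 \<le> ke t" by (simp add: B0_def)
    then have pr: "N * \<epsilon> t \<le> 1 / 8" "prof d (16 * (N * \<epsilon> t)\<^sup>2) \<ge> cN * ke t"
      using cN(2)[of "\<epsilon> t"] eps[of t] t by (auto simp: ke_def)
    have "g t \<le> 2 * (c2 * \<psi> t)" using reg by (simp add: g_def t_def)
    also have "\<dots> = 2 * (\<zeta> * sqrt (ke t)) * (\<sigma> * \<kappa> * R t)" by (simp add: c2_def \<psi>_def mult_ac)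
    also have "\<dots> \<le> 2 * (\<zeta> * sqrt (ke t)) * (2 * ell (norm p))"
      using ellR(2)[of t] ell\<tau>[of p] t \<zeta>k by (intro mult_left_mono) (auto simp: t_def)
    finally have "g (P.\<tau> p) \<le> 4 * (\<zeta> * sqrt (ke t)) * ell (norm p)" by (simp add: t_def)
    then have "exp 1 / (K1 * (\<zeta> * sqrt (ke t))\<^sup>2) \<le> P.lam p" by (rule lam_ge) (use \<zeta>k in linarith)
    then have "exp 1 / (K1 * (\<zeta> * sqrt (ke t))\<^sup>2) * (cN * ke t) \<le> P.lam p * prof d (16 * (N * \<epsilon> t)\<^sup>2)"
      using pr(2) cN k K1 by (intro mult_mono) (auto intro: less_imp_le P.lam_pos)
    moreover have "exp 1 \<le> exp 1 / (K1 * (\<zeta> * sqrt (ke t))\<^sup>2) * (cN * ke t)"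
    proof -
      have "\<zeta>\<^sup>2 \<le> (sqrt (cN / K1))\<^sup>2" using \<zeta> by (intro power_mono) auto
      then have "\<zeta>\<^sup>2 \<le> cN / K1" using cN K1 by simp
      then have "K1 * \<zeta>\<^sup>2 \<le> cN" using K1 by (simp add: field_simps)
      then have "1 \<le> cN / (K1 * \<zeta>\<^sup>2)" using K1 \<zeta> by (simp add: le_divide_eq)
      moreover have "exp 1 / (K1 * (\<zeta> * sqrt (ke t))\<^sup>2) * (cN * ke t) = exp 1 * (cN / (K1 * \<zeta>\<^sup>2))"
        using k by (simp add: power_mult_distrib)
      moreover have "exp 1 * 1 \<le> exp 1 * x" if "1 \<le> x" for x :: real using that by (intro mult_left_mono) auto
      ultimately show ?thesis by (metis mult.right_neutral)
    qed
    ultimately have big: "exp 1 \<le> P.lam p * prof d (16 * (N * \<epsilon> t)\<^sup>2)" by linarith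
    have pos: "0 < N * \<epsilon> t" using N eps[of t] t by simp
    have "cball p (N * \<epsilon> t * ell (norm p)) \<subseteq> E"
    proof
      fix y assume "y \<in> cball p (N * \<epsilon> t * ell (norm p))"
      then show "y \<in> E" unfolding u0 by (rule P.hole[OF p pos pr(1) big])
    qed
    then show ?thesis using pr(1) by (simp add: t_def mult.commute)
  qed
  have cap: "capacity (ball x (R (norm x)) \<inter> E) > R (norm x) * \<epsilon> (norm x)" for x :: 'a
  proof -
    define r where "r = R (norm x)"
    have r: "r > 0" "r \<ge> R 0" using R_pos R_mono[of 0 "norm x"] by (auto simp: r_def)
    have ex: "0 < \<epsilon> (norm x)" using eps by simp
    have ellx: "ell (norm x) \<le> \<sigma> * r" using ellR(1)[of "norm x"] by (simp add: r_def)
    show ?thesis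
    proof (cases "ke (norm x) \<le> B0")
      case False
      have x100: "norm x > 100 * ell 0"
      proof (rule ccontr)
        assume "\<not> ?thesis"
        then have "ke (norm x) \<le> ke (100 * ell 0)" by (intro ke_mono) auto
        then show False using False by (simp add: B0_def)
      qed
      define lx where "lx = ell (norm x)"
      have lx: "lx > 0" "lx \<ge> ell 0" using ellR(3)[of "norm x"] ell_mono[of 0 "norm x"] by (auto simp: lx_def)
      have "lx \<le> ell 0 + (norm x - 0) / 100" unfolding lx_def by (rule ell_lip) auto
      then have lx2: "50 * lx \<le> norm x" using x100 by simp
      have nx: "norm x > 0" using x100 ell0 by linarith
      \<comment> \<open>Moving inward by \<open>6 * lx\<close> before choosing a net point within
        \<open>4 * lx\<close> ensures \<open>\<tau> p \<le> norm x\<close>, so that \<epsilon> at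
        \<open>p\<close> is at least its value at \<open>x\<close>.\<close>
      define y where "y = (1 - 6 * lx / norm x) *\<^sub>R x"
      have "0 \<le> 1 - 6 * lx / norm x" using lx2 lx nx by (simp add: divide_le_eq)
      then have ny: "norm y = norm x - 6 * lx" using nx by (simp add: y_def left_diff_distrib)
      have "x - y = (6 * lx / norm x) *\<^sub>R x" by (simp add: y_def scaleR_diff_left)
      then have dxy: "dist x y = 6 * lx" using nx lx by (simp add: dist_norm)
      obtain p where p: "p \<in> J" "dist y p \<le> 4 * ell (norm y)" using P.coverage by blast
      have "ell (norm y) \<le> lx" unfolding lx_def by (intro ell_mono norm_ge_zero) (use ny lx in linarith)
      then have dyp: "dist y p \<le> 4 * lx" using p(2) by linarith
      have np: "norm p \<le> norm x - 2 * lx" "norm p \<ge> norm x - 10 * lx"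
        using dyp ny norm_triangle_ineq2[of p y] norm_triangle_ineq2[of y p] by (auto simp: dist_norm norm_minus_commute)
      have dxp: "dist x p \<le> 10 * lx" using dxy dyp dist_triangle[of x p y] by linarith
      have \<tau>p: "P.\<tau> p \<le> norm x" using P.tau_ge(4)[of p] np s0 lx by linarith
      have e\<tau>: "\<epsilon> (P.\<tau> p) \<ge> \<epsilon> (norm x)" using \<tau>p P.tau_ge(3)[of p] by (intro eps_anti) auto
      have lp: "ell (norm p) \<le> lx" "ell (norm p) > 0" unfolding lx_def using np lx ellR(3) by (auto intro!: ell_mono)
      have "(1/2) * R (norm x) \<le> R ((1/2) * norm x)" by (rule R_scale) auto
      also have "\<dots> \<le> R (norm p)" using np lx2 lx by (intro R_mono) auto
      finally have Rp: "R (norm p) \<ge> r / 2" by (simp add: r_def)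
      have "\<sigma> * \<kappa> * (r / 2) \<le> \<sigma> * \<kappa> * R (norm p)" using \<sigma>\<kappa> Rp by (intro mult_left_mono) auto
      then have lp2: "ell (norm p) \<ge> \<sigma> * \<kappa> * (r / 2)" using ellR(2)[of "norm p"] by simp
      have fin: "capacity (ball x r \<inter> E) > r * \<epsilon> (norm x)"
        if \<delta>: "0 < \<delta>" "\<delta> \<le> 1 / 8" "cball p (\<delta> * ell (norm p)) \<subseteq> E" "\<delta> * (\<sigma> * \<kappa>) / 4 > \<epsilon> (norm x)" for \<delta>
      proof -
        define \<rho> where "\<rho> = \<delta> * ell (norm p)"
        have \<rho>: "\<rho> > 0" using \<delta> lp by (simp add: \<rho>_def)
        have "\<rho> \<le> (1 / 8) * lx" unfolding \<rho>_def using \<delta> lp by (intro mult_mono) auto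
        then have \<rho>lx: "\<rho> \<le> lx" using lx by simp
        have "11 * lx \<le> 11 * (\<sigma> * r)" using ellx by (simp add: lx_def)
        also have "\<dots> \<le> 11 * ((1 / 100) * r)" using \<sigma> r by (intro mult_left_mono mult_right_mono) auto
        finally have 11: "11 * lx < r" using r by linarith
        have "ball p \<rho> \<subseteq> ball x r"
        proof
          fix z assume "z \<in> ball p \<rho>"
          then show "z \<in> ball x r" using dxp \<rho>lx 11 dist_triangle[of x z p] by simp
        qed
        moreover have "ball p \<rho> \<subseteq> E" using \<delta>(3) by (auto simp: \<rho>_def)
        ultimately have "capacity (ball p \<rho>) \<le> capacity (ball x r \<inter> E)" using r dd d by (intro capacity_mono[of _ _ x r]) auto
        moreover have "\<rho> / 2 \<le> capacity (ball p \<rho>)" by (rule ball_capacity[OF dd d \<rho>])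
        moreover have "\<rho> / 2 \<ge> r * (\<delta> * (\<sigma> * \<kappa>) / 4)"
        proof -
          have "\<delta> * (\<sigma> * \<kappa> * (r / 2)) \<le> \<rho>" unfolding \<rho>_def using \<delta> lp2 by (intro mult_left_mono) auto
          then show ?thesis by (simp add: mult_ac)
        qed
        moreover have "r * (\<delta> * (\<sigma> * \<kappa>) / 4) > r * \<epsilon> (norm x)" using \<delta>(4) r by (intro mult_strict_left_mono) auto
        ultimately show ?thesis by linarith
      qed
      show ?thesis
      proof (cases "c2 * \<psi> (P.\<tau> p) \<le> ell (P.\<tau> p)")
        case True
        have "\<epsilon> (norm x) < \<delta>1 * \<sigma> * \<kappa> / 8"
        proof (rule ccontr)
          assume "\<not> ?thesis"
          then have "kr d (\<epsilon> (norm x)) \<le> kr d (\<delta>1 * \<sigma> * \<kappa> / 8)" using \<delta>1 \<sigma> \<kappa> by (intro kr_antimono) auto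
          then show False using False by (simp add: B0_def ke_def)
        qed
        moreover have "\<delta>1 * \<sigma> * \<kappa> / 8 \<le> \<delta>1 * (\<sigma> * \<kappa>) / 4" using \<delta>1 \<sigma> \<kappa> by simp
        ultimately have "\<epsilon> (norm x) < \<delta>1 * (\<sigma> * \<kappa>) / 4" by linarith
        from fin[OF \<delta>1(1,2) hole1[OF p(1) True] this] show ?thesis by (simp add: r_def)
      next
        case F2: False
        define e where "e = \<epsilon> (P.\<tau> p)"
        have e: "e > 0" "e \<ge> \<epsilon> (norm x)" using e\<tau> ex by (auto simp: e_def)
        have 1: "0 < e * N" using e N by simp
        have "e * N * (\<sigma> * \<kappa>) / 4 = e * (5 / 4)" using \<sigma> \<kappa> by (simp add: N_def)
        then have 2: "e * N * (\<sigma> * \<kappa>) / 4 > \<epsilon> (norm x)" using e by linarith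
        have "c2 * \<psi> (P.\<tau> p) > ell (P.\<tau> p)" using F2 by simp
        from hole2[OF p(1) this, folded e_def] have "r * \<epsilon> (norm x) < capacity (ball x r \<inter> E)" by (intro fin[OF 1 _ _ 2]) simp_all
        then show ?thesis by (simp add: r_def)
      qed
    next
      case True
      define S where "S = J \<inter> cball x r"
      have finS: "finite S"
      proof (rule separated_bounded_finite[OF ell0, of S x r])
        fix p q assume "p \<in> S" "q \<in> S" "p \<noteq> q"
        then have "dist p q \<ge> max (ell (norm p)) (ell (norm q))" using J(2) by (auto simp: S_def)
        then show "dist p q \<ge> ell 0" using ell_mono[of 0 "norm p"] by simp
      qed (auto simp: S_def)
      \<comment> \<open>The mesh term dominates \<open>g\<close> at every net point of the ball.
        Farther out than \<open>x\<close>, \<epsilon> could be much smaller, but the bounded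
        derivative of \<open>1 / phi\<close> lets \<psi> grow by at most a multiple of
        \<open>r + 1\<close>.\<close>
      have reg: "c2 * \<psi> (P.\<tau> p) \<le> ell (P.\<tau> p)" if p: "p \<in> S" for p
      proof -
        define t where "t = P.\<tau> p"
        have t: "t > 0" using P.tau_ge(3) by (simp add: t_def)
        have "norm p \<le> norm x + r" using p norm_triangle_ineq2[of p x] by (auto simp: S_def dist_norm norm_minus_commute)
        moreover have "P.s0 \<le> r"
        proof -
          have "ell 0 \<le> \<sigma> * R 0" by (rule ellR(1)) simp
          also have "\<dots> \<le> 1 * R 0" using \<sigma> R_pos[of 0] by (intro mult_right_mono) auto
          finally show ?thesis using s0 r ell0 by linarith
        qed
        ultimately have tb: "t \<le> norm x + 2 * r" using P.tau_ge(4)[of p] by (simp add: t_def)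
        have "sqrt (ke t) \<le> b1"
        proof (cases "t \<le> norm x")
          case True
          then have "ke t \<le> ke (norm x)" using t by (intro ke_mono) auto
          then have "sqrt (ke t) \<le> sqrt B0" using \<open>ke (norm x) \<le> B0\<close> by simp
          then show ?thesis using b1 by linarith
        next
          case False
          have "\<psi> t \<le> \<psi> (norm x + 2 * r)" using tb t by (intro \<psi>_mono) auto
          also have "\<dots> \<le> \<psi> (norm x) + C * (2 * r) + \<psi> 1" using r by (intro \<psi>inc) auto
          also have "\<psi> (norm x) \<le> r * sqrt B0" using \<open>ke (norm x) \<le> B0\<close> r by (simp add: \<psi>_def r_def)
          also have "\<psi> 1 \<le> r * (\<psi> 1 / R 0)"
          proof -
            have "R 0 * (\<psi> 1 / R 0) \<le> r * (\<psi> 1 / R 0)" using r \<psi>_pos[of 1] R_pos[of 0] by (intro mult_right_mono) auto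
            then show ?thesis using R_pos[of 0] by simp
          qed
          finally have "\<psi> t \<le> r * b1" by (simp add: b1_def algebra_simps)
          also have "r \<le> R t" unfolding r_def using False by (intro R_mono) auto
          then have "r * b1 \<le> R t * b1" using b1 by (intro mult_right_mono) auto
          finally have "R t * sqrt (ke t) \<le> R t * b1" by (simp add: \<psi>_def)
          then show ?thesis using R_pos[of t] t by simp
        qed
        moreover have "\<zeta> * (b1 + 1) \<le> 1" using \<zeta>(3) b1 by (simp add: field_simps)
        ultimately have "\<zeta> * sqrt (ke t) \<le> 1"
          using \<zeta>(1) by (smt (verit) mult_left_mono)
        then have "(\<sigma> * \<kappa> * R t) * (\<zeta> * sqrt (ke t)) \<le> (\<sigma> * \<kappa> * R t) * 1"
          using \<sigma>\<kappa> R_pos[of t] t by (intro mult_left_mono) auto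
        then have "c2 * \<psi> t \<le> \<sigma> * \<kappa> * R t" by (simp add: c2_def \<psi>_def mult_ac)
        then show ?thesis using ellR(2)[of t] t unfolding t_def by linarith
      qed
      have ellcont: "continuous_on UNIV (\<lambda>z::'a. ell (norm z))"
      proof (rule continuous_on_compose2[of "{0..}" ell])
        show "continuous_on {0..} ell"
          unfolding ell_def using L by (intro continuous_intros continuous_at_imp_continuous_on) (auto intro: DERIV_isCont)
      qed (auto intro: continuous_intros)
      \<comment> \<open>The points that \<open>coverage\<close> allows to be assigned to
        \<open>p\<close>; \<open>ell\<close> is continuous, so this set is closed and hence
        Borel.\<close>
      define Cl where "Cl p = {z. dist z p \<le> 4 * ell (norm z)}" for p :: 'a
      have "closed (Cl p)" for p
        unfolding Cl_def by (intro closed_Collect_le continuous_intros ellcont)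
      then have "\<exists>c \<in> borel_measurable borel. \<forall>z\<in>(\<Union>p\<in>S. Cl p). c z \<in> S \<and> z \<in> Cl (c z)"
        using finS by (intro measurable_selector) (auto intro: borel_closed)
      then obtain c where cm[measurable]: "c \<in> borel_measurable borel" and c: "\<And>z. z \<in> (\<Union>p\<in>S. Cl p) \<Longrightarrow> c z \<in> S \<and> z \<in> Cl (c z)" by blast
      have br: "b * r + 8 * \<sigma> * r < r"
      proof -
        have "(b + 8 * \<sigma>) * r < 1 * r" using \<sigma>(3) b r by (intro mult_strict_right_mono) auto
        then show ?thesis by (simp add: algebra_simps)
      qed
      have cz: "c z \<in> S" "dist z (c z) \<le> 8 * \<sigma> * r" "dist z (c z) \<le> 5 * ell (norm (c z))"
        if z: "z \<in> cball x (b * r)" for z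
      proof -
        have "norm z \<le> norm x + b * r" using z norm_triangle_ineq2[of z x] by (auto simp: dist_norm norm_minus_commute)
        also have "b * r \<le> r" using b r by (simp add: mult_left_le_one_le)
        finally have nz: "norm z \<le> norm x + r" by simp
        have ez: "ell (norm z) \<le> 2 * \<sigma> * r"
        proof -
          have "ell (norm z) \<le> ell (norm x + r)" using nz by (intro ell_mono) auto
          also have "\<dots> \<le> ell (norm x) + \<sigma> * (norm x + r - norm x)" using r by (intro ell_lip\<sigma>) auto
          finally show ?thesis using ellx by simp
        qed
        obtain p where p: "p \<in> J" "dist z p \<le> 4 * ell (norm z)" using P.coverage by blast
        have "dist x p \<le> b * r + 8 * \<sigma> * r" using z p(2) ez dist_triangle[of x p z] by simp
        then have "p \<in> S" using p(1) br by (simp add: S_def)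
        then have *: "c z \<in> S" "dist z (c z) \<le> 4 * ell (norm z)" using c[of z] p(2) by (auto simp: Cl_def)
        then show "c z \<in> S" "dist z (c z) \<le> 8 * \<sigma> * r" using ez by auto
        have "ell (norm z) \<le> ell (norm (c z)) + dist z (c z) / 100"
        proof (cases "norm (c z) \<le> norm z")
          case True
          have "norm z - norm (c z) \<le> dist z (c z)" using norm_triangle_ineq2[of z "c z"] by (simp add: dist_norm)
          then have "(norm z - norm (c z)) / 100 \<le> dist z (c z) / 100" by (rule divide_right_mono) simp
          then show ?thesis using ell_lip[OF norm_ge_zero True] by linarith
        next
          case False
          then have "ell (norm z) \<le> ell (norm (c z))" by (intro ell_mono) auto
          then show ?thesis by (simp add: add_increasing2)
        qed
        then show "dist z (c z) \<le> 5 * ell (norm (c z))" using *(2) ellR(3)[OF norm_ge_zero, of "c z"] by linarith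
      qed
      \<comment> \<open>Each group of points is contracted towards its net point, into the hole
        there. Within a group distances shrink exactly by \<theta>; between groups the separation of
        the net takes over.\<close>
      define T where "T z = c z + \<theta> *\<^sub>R (z - c z)" for z
      have Tm: "T \<in> borel_measurable borel" unfolding T_def by measurable
      have Tc: "dist (T z) (c z) = \<theta> * dist z (c z)" for z using \<theta> by (simp add: T_def dist_norm)
      have Tz: "dist z (T z) \<le> dist z (c z)" for z
      proof -
        have "z - T z = (1 - \<theta>) *\<^sub>R (z - c z)" by (simp add: T_def algebra_simps)
        then have "dist z (T z) = (1 - \<theta>) * dist z (c z)" using \<theta> by (simp add: dist_norm)
        then show ?thesis using \<theta> by (simp add: mult_left_le_one_le)
      qed
      have Thole: "dist (T z) (c z) \<le> \<delta>1 * ell (norm (c z))" if "z \<in> cball x (b * r)" for z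
      proof -
        have "\<theta> * dist z (c z) \<le> \<theta> * (5 * ell (norm (c z)))" using cz(3)[OF that] \<theta> by (intro mult_left_mono) auto
        then show ?thesis by (simp add: Tc \<theta>_def)
      qed
      define K where "K = cball x (b * r + 8 * \<sigma> * r) \<inter> (\<Union>p\<in>S. cball p (\<delta>1 * ell (norm p)))"
      have "e1 * r \<le> capacity (ball x r \<inter> E)"
      proof (rule near_full[OF r(1) \<sigma>(2) Tm])
        show "compact K" unfolding K_def using finS by (intro compact_Int compact_cball compact_UN) auto
        show "K \<subseteq> ball x r \<inter> E"
        proof
          fix z assume "z \<in> K"
          then obtain p where p: "p \<in> S" "z \<in> cball p (\<delta>1 * ell (norm p))" "dist x z \<le> b * r + 8 * \<sigma> * r" by (auto simp: K_def)
          have "p \<in> J" using p(1) by (simp add: S_def)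
          then have "z \<in> E" using hole1[OF _ reg[OF p(1)]] p(2) by blast
          then show "z \<in> ball x r \<inter> E" using p(3) br by simp
        qed
        fix z assume z: "z \<in> cball x (b * r)"
        have "dist x (T z) \<le> b * r + 8 * \<sigma> * r"
          using z Tz[of z] cz(2)[OF z] dist_triangle[of x "T z" z] by simp
        moreover have "T z \<in> cball (c z) (\<delta>1 * ell (norm (c z)))" using Thole[OF z] by (simp add: dist_commute)
        ultimately show "T z \<in> K" using cz(1)[OF z] unfolding K_def by auto
        fix w assume w: "w \<in> cball x (b * r)"
        have 2: "norm (T z - T w) \<ge> norm (z - w) - 16 * \<sigma> * r"
        proof -
          have "dist z w \<le> dist z (T z) + dist (T z) (T w) + dist (T w) w"
            using dist_triangle[of z w "T z"] dist_triangle[of "T z" w "T w"] by linarith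
          then show ?thesis using Tz[of z] Tz[of w] cz(2)[OF z] cz(2)[OF w] by (simp add: dist_norm norm_minus_commute)
        qed
        have "norm (T z - T w) \<ge> \<theta> * norm (z - w)"
        proof (cases "c z = c w")
          case True
          then have "T z - T w = \<theta> *\<^sub>R (z - w)" by (simp add: T_def algebra_simps)
          then show ?thesis using \<theta> by simp
        next
          \<comment> \<open>Images lie within \<open>D / 8\<close> of their centres, hence at least
            \<open>3 / 4 * D\<close> apart, whereas \<open>z\<close> and \<open>w\<close> are at
            most \<open>11 * D\<close> apart; \<theta> at most 1/40 reconciles the two.\<close>
          case False
          define D where "D = dist (c z) (c w)"
          have sep: "ell (norm (c z)) \<le> D" "ell (norm (c w)) \<le> D"
            using J(2)[of "c z" "c w"] cz(1)[OF z] cz(1)[OF w] False by (auto simp: S_def D_def)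
          have D0: "D \<ge> 0" by (simp add: D_def)
          have tz: "dist (T z) (c z) \<le> D / 8" "dist (T w) (c w) \<le> D / 8"
          proof -
            have "\<delta>1 * ell (norm (c z)) \<le> (1 / 8) * D" "\<delta>1 * ell (norm (c w)) \<le> (1 / 8) * D"
              using \<delta>1 sep ellR(3) by (intro mult_mono; simp add: less_imp_le)+
            then show "dist (T z) (c z) \<le> D / 8" "dist (T w) (c w) \<le> D / 8" using Thole[OF z] Thole[OF w] by linarith+
          qed
          have "D \<le> dist (T z) (c z) + dist (T z) (T w) + dist (T w) (c w)"
            unfolding D_def using dist_triangle[of "c z" "c w" "T z"] dist_triangle[of "T z" "c w" "T w"] by (simp add: dist_commute)
          then have lo: "dist (T z) (T w) \<ge> 3 / 4 * D" using tz by linarith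
          have "dist z w \<le> dist z (c z) + D + dist w (c w)"
            unfolding D_def using dist_triangle[of z w "c z"] dist_triangle[of "c z" w "c w"] by (simp add: dist_commute)
          then have hi: "dist z w \<le> 11 * D" using cz(3)[OF z] cz(3)[OF w] sep by linarith
          have "\<theta> * dist z w \<le> (1 / 40) * (11 * D)" using \<theta> hi by (intro mult_mono) auto
          then have "\<theta> * dist z w \<le> dist (T z) (T w)" using lo D0 by linarith
          then show ?thesis by (simp add: dist_norm)
        qed
        then show "\<theta> * norm (z - w) \<le> norm (T z - T w) \<and> norm (z - w) - 16 * \<sigma> * r \<le> norm (T z - T w)" using 2 by blast
      qed
      moreover have "r * \<epsilon> (norm x) < e1 * r"
      proof -
        have "\<epsilon> (norm x) \<le> \<epsilon> 0" by (intro eps_anti) auto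
        then have "\<epsilon> (norm x) < e1" using e1(3) by linarith
        then have "r * \<epsilon> (norm x) < r * e1" using r(1) by (rule mult_strict_left_mono)
        then show ?thesis by (simp add: mult.commute)
      qed
      ultimately show ?thesis unfolding r_def by linarith
    qed
  qed
  have rec: "recurrent \<epsilon> R (zero_set ?u)"
    unfolding recurrent_def using cap P.closed_zero_set_u by (auto simp: E_def)
  have u00: "?u 0 \<ge> 1" using P.u_0 by (simp add: one_ereal_def)
  \<comment> \<open>Collects the parts of the integral outside \<open>{1..\<rho>}\<close>: the
    stretch before 1, and the stretch of length \<open>s0\<close> after \<rho> that comes from
    smoothing the norm.\<close>
  define Q where "Q = integral {0..1} (phi d \<epsilon> R) + P.s0 * phi d \<epsilon> R 0"
  have s0p: "P.s0 > 0" by (rule P.s0)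
  have Phi_le: "P.\<Phi> (\<rho> + P.s0) \<le> (1 / c2) * (Q + integral {1..\<rho>} (phi d \<epsilon> R))" if \<rho>: "\<rho> \<ge> 1" for \<rho>
  proof -
    have "P.\<Phi> (\<rho> + P.s0) \<le> integral {P.s0 / 2..\<rho> + P.s0} (\<lambda>t. (1 / c2) * phi d \<epsilon> R t)"
      unfolding P.\<Phi>_def
    proof (rule integral_le)
      show "(\<lambda>t. 1 / g t) integrable_on {P.s0 / 2..\<rho> + P.s0}" using s0p by (intro P.inv_g_integrable) simp
      show "(\<lambda>t. (1 / c2) * phi d \<epsilon> R t) integrable_on {P.s0 / 2..\<rho> + P.s0}"
        using s0p by (intro integrable_on_mult_right phi_integrable) simp
      fix t assume "t \<in> {P.s0 / 2..\<rho> + P.s0}"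
      then have t: "t > 0" using s0p by auto
      have "1 / g t \<le> 1 / (c2 * \<psi> t)"
        using ellR(3)[of t] t c2 \<psi>_pos[of t] by (intro divide_left_mono) (auto simp: g_def intro!: mult_pos_pos add_pos_pos)
      then show "1 / g t \<le> (1 / c2) * phi d \<epsilon> R t" using t by (simp add: phi_eq)
    qed
    also have "\<dots> = (1 / c2) * integral {P.s0 / 2..\<rho> + P.s0} (phi d \<epsilon> R)" by simp
    also have "integral {P.s0 / 2..\<rho> + P.s0} (phi d \<epsilon> R) \<le> integral {0..\<rho> + P.s0} (phi d \<epsilon> R)"
      using s0p by (intro integral_subset_le phi_integrable) (auto intro!: less_imp_le[OF phi_pos])
    also have "integral {0..\<rho> + P.s0} (phi d \<epsilon> R) = integral {0..1} (phi d \<epsilon> R) + integral {1..\<rho> + P.s0} (phi d \<epsilon> R)"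
      using \<rho> s0p by (intro Henstock_Kurzweil_Integration.integral_combine[symmetric] phi_integrable) auto
    also have "integral {1..\<rho> + P.s0} (phi d \<epsilon> R) = integral {1..\<rho>} (phi d \<epsilon> R) + integral {\<rho>..\<rho> + P.s0} (phi d \<epsilon> R)"
      using \<rho> s0p by (intro Henstock_Kurzweil_Integration.integral_combine[symmetric] phi_integrable) auto
    also have "integral {\<rho>..\<rho> + P.s0} (phi d \<epsilon> R) \<le> integral {\<rho>..\<rho> + P.s0} (\<lambda>_. phi d \<epsilon> R 0)"
      using \<rho> s0p by (intro integral_le phi_integrable) (auto intro: phi_antimono)
    also have "\<dots> = P.s0 * phi d \<epsilon> R 0" using s0p by simp
    finally show ?thesis using c2 by (simp add: Q_def divide_right_mono algebra_simps)
  qed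
  \<comment> \<open>A positive lower bound for the integral from \<open>\<rho> = 2\<close> on, so
    that the constant \<open>Q\<close> stays bounded relative to it.\<close>
  define m where "m = phi d \<epsilon> R 2"
  have m: "m > 0" unfolding m_def by (rule phi_pos) simp
  have Q: "Q \<ge> 0" unfolding Q_def using s0p
    by (intro add_nonneg_nonneg mult_nonneg_nonneg integral_nonneg phi_integrable) (auto intro!: less_imp_le[OF phi_pos])
  have "eventually (\<lambda>\<rho>. ereal (growth_ratio \<epsilon> R ?u \<rho>) \<le> ereal (3 / c2 * (Q / m + 1))) at_top"
    using eventually_ge_at_top[of 2]
  proof eventually_elim
    case (elim \<rho>)
    define I where "I = integral {1..\<rho>} (phi d \<epsilon> R)"
    have I: "I \<ge> m" using integral_phi_ge[of 2 \<rho>] elim by (simp add: I_def m_def)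
    have mb: "max_on_ball ?u \<rho> = ereal (real_of_ereal (max_on_ball ?u \<rho>))" "real_of_ereal (max_on_ball ?u \<rho>) \<ge> 1"
      using max_on_ball_real[OF P.u_subharmonic u00, of \<rho>] elim by auto
    have "max_on_ball ?u \<rho> \<le> ereal (exp (3 * P.\<Phi> (\<rho> + P.s0)))"
      unfolding max_on_ball_def by (rule SUP_least) (use P.u_growth in auto)
    then have "real_of_ereal (max_on_ball ?u \<rho>) \<le> exp (3 * P.\<Phi> (\<rho> + P.s0))" using mb(1) by (metis ereal_less_eq(3))
    then have "ln (real_of_ereal (max_on_ball ?u \<rho>)) \<le> ln (exp (3 * P.\<Phi> (\<rho> + P.s0)))"
      using mb(2) by (subst ln_le_cancel_iff) auto
    also have "\<dots> = 3 * P.\<Phi> (\<rho> + P.s0)" by simp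
    also have "\<dots> \<le> 3 * ((1 / c2) * (Q + I))"
      unfolding I_def by (intro mult_left_mono Phi_le) (use elim in auto)
    finally have "ln (real_of_ereal (max_on_ball ?u \<rho>)) / I \<le> 3 * ((1 / c2) * (Q + I)) / I"
      using I m by (intro divide_right_mono) auto
    also have "\<dots> = 3 / c2 * (Q / I + 1)" using I m by (simp add: field_simps)
    also have "\<dots> \<le> 3 / c2 * (Q / m + 1)"
      using I m Q c2 by (intro mult_left_mono add_mono divide_left_mono) auto
    finally show ?case by (simp add: growth_ratio_def dd I_def)
  qed
  then have "Limsup at_top (\<lambda>\<rho>. ereal (growth_ratio \<epsilon> R ?u \<rho>)) \<le> ereal (3 / c2 * (Q / m + 1))" by (rule Limsup_bounded)
  also have "\<dots> < \<infinity>" by simp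
  finally show "\<exists>u :: 'a \<Rightarrow> ereal. subharmonic u \<and> recurrent \<epsilon> R (zero_set u) \<and> u 0 \<ge> 1 \<and>
              Limsup at_top (\<lambda>\<rho>. ereal (growth_ratio \<epsilon> R u \<rho>)) < \<infinity>"
    using P.u_subharmonic rec u00 by blast
  qed
qed

end

theorem mainTheorem1:
  fixes R \<epsilon> :: "real \<Rightarrow> real"
  assumes "DIM('a::euclidean_space) \<ge> 2"
    and "\<And>t. t \<ge> 0 \<Longrightarrow> R t > 0"
    and "mono_on {0..} R"
    and "concave_on {0..} R"
    and "R \<in> o[at_top](\<lambda>r. r)"
    and "\<And>t. t \<ge> 0 \<Longrightarrow> 0 < \<epsilon> t \<and> \<epsilon> t < 1"
    and "antimono_on {0..} \<epsilon>"
  shows "(Limsup at_top (\<lambda>t. ereal (1 / (t * phi DIM('a) \<epsilon> R t))) < 1 \<longrightarrow>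
           (\<forall>u :: 'a \<Rightarrow> ereal.
              subharmonic u \<and> recurrent \<epsilon> R (zero_set u) \<and> (\<exists>x\<^sub>0. u x\<^sub>0 \<ge> 1) \<longrightarrow>
              Liminf at_top (\<lambda>\<rho>. ereal (growth_ratio \<epsilon> R u \<rho>)) > 0))
       \<and> ((\<exists>C. \<forall>t>0. \<exists>D. ((\<lambda>s. 1 / phi DIM('a) \<epsilon> R s) has_real_derivative D) (at t) \<and> \<bar>D\<bar> \<le> C) \<longrightarrow>
           (\<exists>u :: 'a \<Rightarrow> ereal.
              subharmonic u \<and> recurrent \<epsilon> R (zero_set u) \<and> u 0 \<ge> 1 \<and>
              Limsup at_top (\<lambda>\<rho>. ereal (growth_ratio \<epsilon> R u \<rho>)) < \<infinity>))"
proof -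
  interpret recurrence_rate "DIM('a)" R \<epsilon>
    using assms by unfold_locales (auto simp: monotone_on_def)
  show ?thesis
    using growth_lower_bound[OF refl] growth_upper_bound[OF refl] assms(5) by blast
qed

end
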